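(* Let $m>0$ and let $V=(V_{ij})_{i,j=1}^2$ be a $2\times 2$ matrix-valued function on $\mathbb{R}$ (not assumed Hermitian) with $V_{ij}\in L^p(\mathbb{R})$ for $i,j=1,2$ and some $p\in[2,\infty)$. Let $H=H_0+V$ be the Dirac operator with potential $V$. If $$\|V\|_p:=\left(\int_{\mathbb{R}}\|V(x)\|^p\,dx\right)^{1/p}<\left(\frac{mp}{2(p-1)}\right)^{(p-1)/p},$$ then $H$ is similar to a block-diagonal operator: there exist a bounded and boundedly invertible operator $S$ on $L^2(\mathbb{R})\otimes\mathbb{C}^2=L^2(\mathbb{R})\oplus L^2(\mathbb{R})$ and operators $H_\pm$ in $L^2(\mathbb{R})$ such that $$SHS^{-1}=\begin{pmatrix}H_+&0\\0&H_-\end{pmatrix},\qquad \sigma(H_\pm)=\sigma(H)\cap\{z\in\mathbb{C}:\pm\operatorname{Re}z>0\}.$$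
   Context: Units are chosen so that $\hbar=c=1$. The Hilbert space is $\mathcal{H}=L^2(\mathbb{R})\otimes\mathbb{C}^2=L^2(\mathbb{R};\mathbb{C}^2)$. The free Dirac operator is the selfadjoint operator $H_0=-i\frac{d}{dx}\sigma_1+m\sigma_3$ with domain $H^1(\mathbb{R};\mathbb{C}^2)$, where $\sigma_1=\begin{pmatrix}0&1\\1&0\end{pmatrix}$, $\sigma_3=\begin{pmatrix}1&0\\0&-1\end{pmatrix}$. $\|V(x)\|$ is the operator norm of the matrix $V(x)$ on $\mathbb{C}^2$ with Euclidean norm; $V$ is identified with the closed maximal multiplication operator in $\mathcal{H}$. For $V_{ij}\in L^p(\mathbb{R})$ with $p\in[2,\infty)$, $V$ is $H_0$-bounded with relative bound less than one, and $H=H_0+V$ is closed on the domain of $H_0$. *)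

theory Defs
  imports "HOL-Analysis.Analysis"
begin

section \<open>Complex normed vector spaces\<close>

class complex_normed_vector = real_normed_vector +
  fixes scaleC :: "complex \<Rightarrow> 'a \<Rightarrow> 'a" (infixr \<open>*\<^sub>C\<close> 75)
  assumes scaleC_add_right: "c *\<^sub>C (x + y) = c *\<^sub>C x + c *\<^sub>C y"
    and scaleC_add_left: "(c + d) *\<^sub>C x = c *\<^sub>C x + d *\<^sub>C x"
    and scaleC_scaleC: "c *\<^sub>C d *\<^sub>C x = (c * d) *\<^sub>C x"
    and scaleR_scaleC: "r *\<^sub>R x = complex_of_real r *\<^sub>C x"
    and norm_scaleC: "norm (c *\<^sub>C x) = cmod c * norm x"

lemma scaleC_one: "1 *\<^sub>C x = (x :: 'a :: complex_normed_vector)"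
  using scaleR_scaleC[of 1 x] by simp

instantiation complex :: complex_normed_vector
begin

definition scaleC_complex :: "complex \<Rightarrow> complex \<Rightarrow> complex" where
  "scaleC_complex c x = c * x"

instance
  by standard (simp_all add: scaleC_complex_def algebra_simps scaleR_conv_of_real norm_mult)

end

instantiation vec :: (complex_normed_vector, finite) complex_normed_vector
begin

definition scaleC_vec :: "complex \<Rightarrow> 'a ^ 'b \<Rightarrow> 'a ^ 'b" where
  "scaleC_vec c v = (\<chi> i. c *\<^sub>C (v $ i))"

instance
proof
  fix c d :: complex and x y :: "'a ^ 'b" and r :: real
  show "c *\<^sub>C (x + y) = c *\<^sub>C x + c *\<^sub>C y"
    by (simp add: scaleC_vec_def vec_eq_iff scaleC_add_right)
  show "(c + d) *\<^sub>C x = c *\<^sub>C x + d *\<^sub>C x"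
    by (simp add: scaleC_vec_def vec_eq_iff scaleC_add_left)
  show "c *\<^sub>C d *\<^sub>C x = (c * d) *\<^sub>C x"
    by (simp add: scaleC_vec_def vec_eq_iff scaleC_scaleC)
  show "r *\<^sub>R x = complex_of_real r *\<^sub>C x"
    by (simp add: scaleC_vec_def vec_eq_iff scaleR_scaleC)
  show "norm (c *\<^sub>C x) = cmod c * norm x"
    by (simp add: scaleC_vec_def norm_vec_def norm_scaleC L2_set_right_distrib)
qed

end

lemma bounded_linear_scaleC: "bounded_linear (\<lambda>x :: 'a :: complex_normed_vector. c *\<^sub>C x)"
proof (rule bounded_linear_intro[where K = "cmod c"])
  show "c *\<^sub>C (r *\<^sub>R x) = r *\<^sub>R (c *\<^sub>C x)" for r and x :: 'a
    by (simp add: scaleR_scaleC scaleC_scaleC mult.commute)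
qed (simp_all add: scaleC_add_right norm_scaleC)


section \<open>The Hilbert space of square-integrable functions on the line\<close>

definition sq_integrable :: "(real \<Rightarrow> 'a :: real_normed_vector) \<Rightarrow> bool" where
  "sq_integrable f \<longleftrightarrow>
     f \<in> borel_measurable lebesgue \<and> integrable lebesgue (\<lambda>x. (norm (f x))\<^sup>2)"

definition l2_rel :: "(real \<Rightarrow> 'a :: real_normed_vector) \<Rightarrow> (real \<Rightarrow> 'a) \<Rightarrow> bool" where
  "l2_rel f g \<longleftrightarrow> sq_integrable f \<and> sq_integrable g \<and> (AE x in lebesgue. f x = g x)"

definition l2_norm :: "(real \<Rightarrow> 'a :: real_normed_vector) \<Rightarrow> real" where
  "l2_norm f = sqrt (LINT x|lebesgue. (norm (f x))\<^sup>2)"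

lemma sq_integrable_zero: "sq_integrable (\<lambda>_. 0)"
  by (simp add: sq_integrable_def)

lemma norm_add_sq_le:
  fixes a b :: "'a :: real_normed_vector"
  assumes "t > 0"
  shows "(norm (a + b))\<^sup>2 \<le> (1 + t) * (norm a)\<^sup>2 + (1 + 1 / t) * (norm b)\<^sup>2"
proof -
  have "(norm (a + b))\<^sup>2 \<le> (norm a + norm b)\<^sup>2"
    by (simp add: norm_triangle_ineq power_mono)
  also have "0 \<le> (t * norm a - norm b)\<^sup>2 / t"
    using assms by simp
  then have "(norm a + norm b)\<^sup>2 \<le> (1 + t) * (norm a)\<^sup>2 + (1 + 1 / t) * (norm b)\<^sup>2"
    using assms by (simp add: field_simps power2_eq_square)
  finally show ?thesis .
qed

lemma sq_integrable_add:
  fixes f g :: "real \<Rightarrow> 'a :: {real_normed_vector, second_countable_topology}"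
  assumes "sq_integrable f" "sq_integrable g"
  shows "sq_integrable (\<lambda>x. f x + g x)"
proof -
  have [measurable]: "f \<in> borel_measurable lebesgue" "g \<in> borel_measurable lebesgue"
    using assms by (auto simp: sq_integrable_def)
  have "integrable lebesgue (\<lambda>x. (norm (f x + g x))\<^sup>2)"
  proof (rule Bochner_Integration.integrable_bound)
    show "integrable lebesgue (\<lambda>x. (1 + 1) * (norm (f x))\<^sup>2 + (1 + 1 / 1) * (norm (g x))\<^sup>2 :: real)"
      using assms unfolding sq_integrable_def
      by (intro Bochner_Integration.integrable_add integrable_mult_right) auto
    show "AE x in lebesgue. norm ((norm (f x + g x))\<^sup>2)
            \<le> norm ((1 + 1) * (norm (f x))\<^sup>2 + (1 + 1 / 1) * (norm (g x))\<^sup>2 :: real)"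
      using norm_add_sq_le[of 1] by (intro AE_I2) (simp add: abs_of_nonneg)
  qed measurable
  then show ?thesis by (simp add: sq_integrable_def)
qed

lemma sq_integrable_bounded_linear:
  assumes "bounded_linear T" "sq_integrable f"
  shows "sq_integrable (\<lambda>x. T (f x))"
proof -
  interpret T: bounded_linear T by fact
  obtain K where K: "\<And>x. norm (T x) \<le> norm x * K" using T.bounded by blast
  have meas [measurable]: "(\<lambda>x. T (f x)) \<in> borel_measurable lebesgue"
    using assms(2) borel_measurable_continuous_onI[OF T.continuous_on[OF continuous_on_id]]
      measurable_compose[of f lebesgue borel T borel]
    by (auto simp: sq_integrable_def)
  have "integrable lebesgue (\<lambda>x. (norm (T (f x)))\<^sup>2)"
  proof (rule Bochner_Integration.integrable_bound)
    show "integrable lebesgue (\<lambda>x. K\<^sup>2 * (norm (f x))\<^sup>2)"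
      using assms(2) by (simp add: sq_integrable_def)
    show "AE x in lebesgue. norm ((norm (T (f x)))\<^sup>2) \<le> norm (K\<^sup>2 * (norm (f x))\<^sup>2)"
    proof (intro AE_I2)
      fix x
      have "(norm (T (f x)))\<^sup>2 \<le> (norm (f x) * K)\<^sup>2"
        using K by (simp add: power_mono)
      then show "norm ((norm (T (f x)))\<^sup>2) \<le> norm (K\<^sup>2 * (norm (f x))\<^sup>2)"
        by (simp add: power_mult_distrib mult.commute)
    qed
  qed measurable
  then show ?thesis using meas by (simp add: sq_integrable_def)
qed

lemma l2_norm_sq: "(l2_norm f)\<^sup>2 = (LINT x|lebesgue. (norm (f x))\<^sup>2)"
  by (simp add: l2_norm_def)

lemma l2_norm_nonneg: "l2_norm f \<ge> 0"
  by (simp add: l2_norm_def)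

lemma l2_norm_eq_0_iff:
  assumes "sq_integrable f"
  shows "l2_norm f = 0 \<longleftrightarrow> (AE x in lebesgue. f x = 0)"
  using assms integral_nonneg_eq_0_iff_AE[of lebesgue "\<lambda>x. (norm (f x))\<^sup>2"]
  by (simp add: l2_norm_def sq_integrable_def)

lemma l2_norm_triangle:
  fixes f g :: "real \<Rightarrow> 'a :: {real_normed_vector, second_countable_topology}"
  assumes f: "sq_integrable f" and g: "sq_integrable g"
  shows "l2_norm (\<lambda>x. f x + g x) \<le> l2_norm f + l2_norm g"
proof -
  have *: "(l2_norm (\<lambda>x. f x + g x))\<^sup>2 \<le> (1 + t) * (l2_norm f)\<^sup>2 + (1 + 1 / t) * (l2_norm g)\<^sup>2"
    if "t > 0" for t
  proof -
    have if1: "integrable lebesgue (\<lambda>x. (1 + t) * (norm (f x))\<^sup>2)"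
      and ig1: "integrable lebesgue (\<lambda>x. (1 + 1 / t) * (norm (g x))\<^sup>2)"
      using f g by (simp_all only: sq_integrable_def integrable_mult_right)
    have "(l2_norm (\<lambda>x. f x + g x))\<^sup>2
        \<le> (LINT x|lebesgue. (1 + t) * (norm (f x))\<^sup>2 + (1 + 1 / t) * (norm (g x))\<^sup>2)"
      unfolding l2_norm_sq
      by (rule integral_mono)
        (use sq_integrable_add[OF f g] if1 ig1 norm_add_sq_le[OF that] in
          \<open>simp_all only: sq_integrable_def Bochner_Integration.integrable_add\<close>)
    also have "\<dots> = (1 + t) * (l2_norm f)\<^sup>2 + (1 + 1 / t) * (l2_norm g)\<^sup>2"
      unfolding l2_norm_sq Bochner_Integration.integral_add[OF if1 ig1] by simp
    finally show ?thesis .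
  qed
  consider "l2_norm f = 0" | "l2_norm g = 0" | "l2_norm f > 0" "l2_norm g > 0"
    using l2_norm_nonneg[of f] l2_norm_nonneg[of g] by linarith
  then show ?thesis
  proof cases
    case 1
    then have "AE x in lebesgue. f x = 0" using l2_norm_eq_0_iff[OF f] by simp
    then have "(LINT x|lebesgue. (norm (f x + g x))\<^sup>2) = (LINT x|lebesgue. (norm (g x))\<^sup>2)"
      using sq_integrable_add[OF f g] g
      by (intro integral_cong_AE) (auto simp: sq_integrable_def borel_measurable_integrable)
    then show ?thesis using 1 by (simp add: l2_norm_def)
  next
    case 2
    then have "AE x in lebesgue. g x = 0" using l2_norm_eq_0_iff[OF g] by simp
    then have "(LINT x|lebesgue. (norm (f x + g x))\<^sup>2) = (LINT x|lebesgue. (norm (f x))\<^sup>2)"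
      using sq_integrable_add[OF f g] f
      by (intro integral_cong_AE) (auto simp: sq_integrable_def borel_measurable_integrable)
    then show ?thesis using 2 by (simp add: l2_norm_def)
  next
    case 3
    then have "(l2_norm (\<lambda>x. f x + g x))\<^sup>2
        \<le> (1 + l2_norm g / l2_norm f) * (l2_norm f)\<^sup>2
          + (1 + 1 / (l2_norm g / l2_norm f)) * (l2_norm g)\<^sup>2"
      by (intro *) simp
    also have "\<dots> = (l2_norm f + l2_norm g)\<^sup>2"
      using 3 by (simp add: field_simps power2_eq_square)
    finally show ?thesis
      by (rule power2_le_imp_le) (simp add: l2_norm_nonneg)
  qed
qed

text \<open>\<open>'a l2\<close> is \<open>L\<^sup>2(\<real>; 'a)\<close>: square-integrable functions modulo equality almost everywhere.
  The quotient map provides \<open>rep_l2\<close>, which selects a representative.\<close>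

quotient_type (overloaded) 'a l2 = "real \<Rightarrow> 'a :: {complex_normed_vector, euclidean_space}" / partial: l2_rel
proof (rule part_equivpI)
  show "\<exists>f :: real \<Rightarrow> 'a. l2_rel f f"
    by (rule exI[of _ "\<lambda>_. 0"]) (simp add: l2_rel_def sq_integrable_zero)
  show "symp (l2_rel :: (real \<Rightarrow> 'a) \<Rightarrow> _)"
    by (auto intro!: sympI simp: l2_rel_def eq_commute)
  show "transp (l2_rel :: (real \<Rightarrow> 'a) \<Rightarrow> _)"
  proof (rule transpI)
    fix f g h :: "real \<Rightarrow> 'a"
    assume fg: "l2_rel f g" and gh: "l2_rel g h"
    have "AE x in lebesgue. f x = g x" "AE x in lebesgue. g x = h x"
      using fg gh by (auto simp: l2_rel_def)
    then have "AE x in lebesgue. f x = h x" by eventually_elim simp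
    then show "l2_rel f h" using fg gh by (simp add: l2_rel_def)
  qed
qed

lemma sq_integrable_rep_l2: "sq_integrable (rep_l2 f)"
  using Quotient3_rep_reflp[OF Quotient3_l2, of f] by (simp add: l2_rel_def)

lemma AE_rep_l2_eq_iff: "(AE x in lebesgue. rep_l2 f x = rep_l2 g x) \<longleftrightarrow> f = g"
  using Quotient3_rel_rep[OF Quotient3_l2, of f g] sq_integrable_rep_l2[of f] sq_integrable_rep_l2[of g]
  by (simp add: l2_rel_def)

lemma l2_norm_cong_rel: "l2_rel f g \<Longrightarrow> l2_norm f = l2_norm g"
  unfolding l2_norm_def l2_rel_def
  by (intro arg_cong[where f = sqrt] integral_cong_AE)
    (auto simp: sq_integrable_def borel_measurable_integrable)

instantiation l2 :: ("{complex_normed_vector, euclidean_space}") real_normed_vector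
begin

lift_definition zero_l2 :: "'a l2" is "\<lambda>_. 0"
  by (simp add: l2_rel_def sq_integrable_zero)

lift_definition plus_l2 :: "'a l2 \<Rightarrow> 'a l2 \<Rightarrow> 'a l2" is "\<lambda>f g x. f x + g x"
  by (auto simp: l2_rel_def sq_integrable_add)

lift_definition scaleR_l2 :: "real \<Rightarrow> 'a l2 \<Rightarrow> 'a l2" is "\<lambda>r f x. r *\<^sub>R f x"
  by (auto simp: l2_rel_def sq_integrable_bounded_linear[OF bounded_linear_scaleR_right])

lift_definition norm_l2 :: "'a l2 \<Rightarrow> real" is l2_norm
  by (rule l2_norm_cong_rel)

definition uminus_l2 :: "'a l2 \<Rightarrow> 'a l2" where
  "- f = (-1) *\<^sub>R f" for f :: "'a l2"

definition minus_l2 :: "'a l2 \<Rightarrow> 'a l2 \<Rightarrow> 'a l2" where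
  "f - g = f + - g" for f g :: "'a l2"

definition sgn_l2 :: "'a l2 \<Rightarrow> 'a l2" where
  "sgn_l2 f = inverse (norm f) *\<^sub>R f"

definition dist_l2 :: "'a l2 \<Rightarrow> 'a l2 \<Rightarrow> real" where
  "dist_l2 f g = norm (f - g)"

definition uniformity_l2 :: "('a l2 \<times> 'a l2) filter" where
  "uniformity_l2 = (INF e\<in>{0<..}. principal {(f, g). dist f g < e})"

definition open_l2 :: "'a l2 set \<Rightarrow> bool" where
  "open_l2 U = (\<forall>f\<in>U. \<forall>\<^sub>F (f', g) in uniformity. f' = f \<longrightarrow> g \<in> U)"

instance
proof
  fix f g h :: "'a l2" and r s :: real
  show "f + g + h = f + (g + h)"
    by transfer (auto simp: l2_rel_def add.assoc intro!: sq_integrable_add)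
  show "f + g = g + f"
    by transfer (auto simp: l2_rel_def add.commute intro!: sq_integrable_add)
  show "0 + f = f"
    by transfer (auto simp: l2_rel_def)
  show "- f + f = 0"
    unfolding uminus_l2_def
    by transfer (auto simp: l2_rel_def sq_integrable_zero)
  show "f - g = f + - g" by (simp add: minus_l2_def)
  show "r *\<^sub>R (f + g) = r *\<^sub>R f + r *\<^sub>R g"
    by transfer (auto simp: l2_rel_def scaleR_add_right
      intro!: sq_integrable_add sq_integrable_bounded_linear[OF bounded_linear_scaleR_right])
  show "(r + s) *\<^sub>R f = r *\<^sub>R f + s *\<^sub>R f"
    by transfer (auto simp: l2_rel_def scaleR_add_left
      intro!: sq_integrable_add sq_integrable_bounded_linear[OF bounded_linear_scaleR_right])
  show "r *\<^sub>R s *\<^sub>R f = (r * s) *\<^sub>R f"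
    by transfer (auto simp: l2_rel_def
      intro!: sq_integrable_bounded_linear[OF bounded_linear_scaleR_right])
  show "1 *\<^sub>R f = f"
    by transfer (auto simp: l2_rel_def)
  show "dist f g = norm (f - g)" by (simp add: dist_l2_def)
  show "sgn f = inverse (norm f) *\<^sub>R f" by (simp add: sgn_l2_def)
  show "uniformity = (INF e\<in>{0<..}. principal {(f :: 'a l2, g). dist f g < e})"
    by (simp add: uniformity_l2_def)
  show "open U = (\<forall>f\<in>U. \<forall>\<^sub>F (f', g) in uniformity. f' = f \<longrightarrow> g \<in> U)" for U :: "'a l2 set"
    by (simp add: open_l2_def)
  show "norm f = 0 \<longleftrightarrow> f = 0"
    by transfer (auto simp: l2_rel_def l2_norm_eq_0_iff sq_integrable_zero)
  show "norm (f + g) \<le> norm f + norm g"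
    by transfer (auto simp: l2_rel_def intro!: l2_norm_triangle)
  show "norm (r *\<^sub>R f) = \<bar>r\<bar> * norm f"
    by transfer (simp add: l2_norm_def power_mult_distrib real_sqrt_mult)
qed

end

instantiation l2 :: ("{complex_normed_vector, euclidean_space}") complex_normed_vector
begin

lift_definition scaleC_l2 :: "complex \<Rightarrow> 'a l2 \<Rightarrow> 'a l2" is "\<lambda>c f x. c *\<^sub>C f x"
  by (auto simp: l2_rel_def sq_integrable_bounded_linear[OF bounded_linear_scaleC])

instance
proof
  fix f g :: "'a l2" and c d :: complex and r :: real
  show "c *\<^sub>C (f + g) = c *\<^sub>C f + c *\<^sub>C g"
    by transfer (auto simp: l2_rel_def scaleC_add_right
      intro!: sq_integrable_add sq_integrable_bounded_linear[OF bounded_linear_scaleC])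
  show "(c + d) *\<^sub>C f = c *\<^sub>C f + d *\<^sub>C f"
    by transfer (auto simp: l2_rel_def scaleC_add_left
      intro!: sq_integrable_add sq_integrable_bounded_linear[OF bounded_linear_scaleC])
  show "c *\<^sub>C d *\<^sub>C f = (c * d) *\<^sub>C f"
    by transfer (auto simp: l2_rel_def scaleC_scaleC
      intro!: sq_integrable_bounded_linear[OF bounded_linear_scaleC])
  show "r *\<^sub>R f = complex_of_real r *\<^sub>C f"
    by transfer (auto simp: l2_rel_def scaleR_scaleC
      intro!: sq_integrable_bounded_linear[OF bounded_linear_scaleC])
  show "norm (c *\<^sub>C f) = cmod c * norm f"
    by transfer (simp add: l2_norm_def norm_scaleC power_mult_distrib real_sqrt_mult)
qed

end

text \<open>The components of an element of \<open>L\<^sup>2(\<real>; \<complex>\<^sup>2)\<close>; they give the identification of this space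
  with \<open>L\<^sup>2(\<real>) \<oplus> L\<^sup>2(\<real>)\<close>.\<close>

lift_definition l2_component :: "2 \<Rightarrow> (complex ^ 2) l2 \<Rightarrow> complex l2" is "\<lambda>i f x. f x $ i"
  by (auto simp: l2_rel_def sq_integrable_bounded_linear[OF bounded_linear_vec_nth])


section \<open>Operators\<close>

text \<open>A not necessarily everywhere defined operator from \<open>'a\<close> to \<open>'b\<close> is represented by its graph;
  its domain is the \<^const>\<open>Domain\<close> of this relation.\<close>

definition linear_operator ::
    "('a :: complex_normed_vector \<times> 'b :: complex_normed_vector) set \<Rightarrow> bool" where
  "linear_operator T \<longleftrightarrow>
     single_valued T \<and> (0, 0) \<in> T \<and>
     (\<forall>f g f' g'. (f, g) \<in> T \<longrightarrow> (f', g') \<in> T \<longrightarrow> (f + f', g + g') \<in> T) \<and>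
     (\<forall>c f g. (f, g) \<in> T \<longrightarrow> (c *\<^sub>C f, c *\<^sub>C g) \<in> T)"

definition operator_sum :: "('a \<times> 'b :: plus) set \<Rightarrow> ('a \<times> 'b) set \<Rightarrow> ('a \<times> 'b) set" where
  "operator_sum A B = {(f, g + h) | f g h. (f, g) \<in> A \<and> (f, h) \<in> B}"

definition operator_shift ::
    "('a :: complex_normed_vector \<times> 'a) set \<Rightarrow> complex \<Rightarrow> ('a \<times> 'a) set" where
  "operator_shift T z = {(f, g - z *\<^sub>C f) | f g. (f, g) \<in> T}"

definition bounded_clinear ::
    "('a :: complex_normed_vector \<Rightarrow> 'b :: complex_normed_vector) \<Rightarrow> bool" where
  "bounded_clinear S \<longleftrightarrow> bounded_linear S \<and> (\<forall>c f. S (c *\<^sub>C f) = c *\<^sub>C S f)"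

definition boundedly_invertible ::
    "('a :: complex_normed_vector \<Rightarrow> 'b :: complex_normed_vector) \<Rightarrow> bool" where
  "boundedly_invertible S \<longleftrightarrow> bij S \<and> bounded_clinear (inv S)"

text \<open>The point \<open>z\<close> is in the resolvent set iff \<open>T - z\<close> is a bijection from the domain of \<open>T\<close>
  onto the whole space with bounded inverse, that is, iff the inverse relation of \<open>T - z\<close> is
  the graph of an everywhere defined bounded operator.\<close>

definition resolvent_set :: "('a :: complex_normed_vector \<times> 'a) set \<Rightarrow> complex set" where
  "resolvent_set T = {z. \<exists>R. bounded_clinear R \<and> (operator_shift T z)\<inverse> = {(h, R h) | h. True}}"

definition spectrum :: "('a :: complex_normed_vector \<times> 'a) set \<Rightarrow> complex set" where
  "spectrum T = - resolvent_set T"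

text \<open>The operator \<open>S T S\<^sup>-\<^sup>1\<close>, on the domain of those \<open>u\<close> with \<open>S\<^sup>-\<^sup>1 u\<close> in the domain of \<open>T\<close>.\<close>

definition operator_conj :: "('a \<Rightarrow> 'b) \<Rightarrow> ('a \<times> 'a) set \<Rightarrow> ('b \<times> 'b) set" where
  "operator_conj S T = {(u, S g) | u g. (inv S u, g) \<in> T}"

definition block_diag ::
    "(complex l2 \<times> complex l2) set \<Rightarrow> (complex l2 \<times> complex l2) set
      \<Rightarrow> ((complex ^ 2) l2 \<times> (complex ^ 2) l2) set" where
  "block_diag A B =
     {(f, g). (l2_component 1 f, l2_component 1 g) \<in> A \<and> (l2_component 2 f, l2_component 2 g) \<in> B}"


section \<open>Dirac operators\<close>

text \<open>\<open>weak_derivative f g\<close> states that \<open>g\<close> is the weak derivative of \<open>f\<close>, tested against compactly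
  supported \<open>C\<^sup>1\<close> functions. As both \<open>f\<close> and \<open>g\<close> are in \<open>L\<^sup>2\<close>, the Sobolev space \<open>H\<^sup>1\<close> consists of
  those \<open>f\<close> that have a weak derivative in this sense.\<close>

definition weak_derivative ::
    "'a :: {complex_normed_vector, euclidean_space} l2 \<Rightarrow> 'a l2 \<Rightarrow> bool" where
  "weak_derivative f g \<longleftrightarrow>
     (\<forall>\<phi> \<phi>' :: real \<Rightarrow> real.
        (\<forall>x. (\<phi> has_real_derivative \<phi>' x) (at x)) \<longrightarrow> continuous_on UNIV \<phi>' \<longrightarrow>
        compact (closure {x. \<phi> x \<noteq> 0}) \<longrightarrow>
        (LINT x|lebesgue. \<phi>' x *\<^sub>R rep_l2 f x) = - (LINT x|lebesgue. \<phi> x *\<^sub>R rep_l2 g x))"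

definition \<sigma>\<^sub>1 :: "complex ^ 2 ^ 2" where
  "\<sigma>\<^sub>1 = vector [vector [0, 1], vector [1, 0]]"

definition \<sigma>\<^sub>3 :: "complex ^ 2 ^ 2" where
  "\<sigma>\<^sub>3 = vector [vector [1, 0], vector [0, -1]]"

definition free_dirac :: "real \<Rightarrow> ((complex ^ 2) l2 \<times> (complex ^ 2) l2) set" where
  "free_dirac m = {(f, g). \<exists>f'. weak_derivative f f' \<and>
     (AE x in lebesgue.
        rep_l2 g x = - \<i> *\<^sub>C (\<sigma>\<^sub>1 *v rep_l2 f' x) + complex_of_real m *\<^sub>C (\<sigma>\<^sub>3 *v rep_l2 f x))}"

text \<open>The maximal operator of multiplication by \<open>V\<close>: its domain is the set of \<open>f\<close> in \<open>L\<^sup>2\<close> for which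
  \<open>V f\<close> is in \<open>L\<^sup>2\<close>.\<close>

definition multiplication_operator ::
    "(real \<Rightarrow> complex ^ 2 ^ 2) \<Rightarrow> ((complex ^ 2) l2 \<times> (complex ^ 2) l2) set" where
  "multiplication_operator V = {(f, g). AE x in lebesgue. rep_l2 g x = V x *v rep_l2 f x}"

definition dirac :: "real \<Rightarrow> (real \<Rightarrow> complex ^ 2 ^ 2) \<Rightarrow> ((complex ^ 2) l2 \<times> (complex ^ 2) l2) set" where
  "dirac m V = operator_sum (free_dirac m) (multiplication_operator V)"

definition Lp_function :: "real \<Rightarrow> (real \<Rightarrow> complex) \<Rightarrow> bool" where
  "Lp_function p f \<longleftrightarrow>
     f \<in> borel_measurable lebesgue \<and> integrable lebesgue (\<lambda>x. norm (f x) powr p)"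

text \<open>The \<open>L\<^sup>p\<close> norm of a matrix-valued function, \<^term>\<open>onorm ((*v) A)\<close> being the operator norm of the
  matrix \<open>A\<close> with respect to the Euclidean norm.\<close>

definition Lp_matrix_norm :: "real \<Rightarrow> (real \<Rightarrow> complex ^ 2 ^ 2) \<Rightarrow> real" where
  "Lp_matrix_norm p V = (LINT x|lebesgue. onorm ((*v) (V x)) powr p) powr (1 / p)"

end

theory Submission
  imports Defs
begin

text \<open>The operator \<open>H\<close> is the graph \<open>{(A f, f)}\<close> of the inverse of the bounded injective operator
  \<open>A = A\<^sub>0 (1 + V A\<^sub>0)\<^sup>-\<^sup>1\<close>, \<open>A\<^sub>0 = H\<^sub>0\<^sup>-\<^sup>1\<close>. The Green matrix of \<open>H\<^sub>0 - \<i>t\<close> is bounded by \<open>exp (-\<kappa> |x - y|)\<close> with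
  \<open>\<kappa>\<^sup>2 = m\<^sup>2 + t\<^sup>2\<close>, and the hypothesis on \<open>V\<close> is what Schur's test needs to make
  \<open>V (H\<^sub>0 - \<i>t)\<^sup>-\<^sup>1\<close> a contraction, uniformly in \<open>t\<close> and with norm \<open>O(|t|\<^sup>-\<^sup>1\<^sup>/\<^sup>2)\<close>. Hence the imaginary axis is in the
  resolvent set of \<open>H + (\<tau> - 1) V\<close> for all \<open>\<tau> \<in> [0, 1]\<close>, and the sign \<open>B\<^sub>\<tau> = A\<^sub>\<tau>\<^sup>-\<^sup>1 L\<^sub>\<tau>\<close>, with
  \<open>L\<^sub>\<tau> = 2/\<pi> \<integral> (H\<^sub>\<tau> - \<i>t)\<^sup>-\<^sup>1 (H\<^sub>\<tau> + \<i>t)\<^sup>-\<^sup>1 dt\<close> over the half line, is a Lipschitz path of involutions in \<open>\<tau>\<close>.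
  Nearby involutions are similar, so \<open>B\<^sub>1\<close> is similar to \<open>B\<^sub>0\<close>; and \<open>B\<^sub>0\<close> is similar to \<open>\<sigma>\<^sub>3\<close> as
  \<open>\<sigma>\<^sub>3 H\<^sub>0 + H\<^sub>0 \<sigma>\<^sub>3 = 2m\<close>. The similarity that takes \<open>B\<^sub>1\<close> to \<open>\<sigma>\<^sub>3\<close> makes \<open>A\<close> block-diagonal, and a contour
  integral over the imaginary axis gives the resolvents of the blocks in the opposite half planes.\<close>

section \<open>Complex Banach algebras and bounded operators\<close>

text \<open>The constant in the hypothesis is the reciprocal of the L^r norm of exp (- m |x|), r = p
  / (p - 1): what is assumed is ||V||_p ||exp (- m |x|)||_r < 1, the norm bound for V times a Green
  kernel dominated by that exponential. At the point it the bound gains a factor (m / \<kappa>)^((p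
  - 1) / p), and p \<ge> 2 makes this O(|t|^(-1/2)). Two obstacles shape the proof. H need not be
  normal, so there is no functional calculus: that L is a square root of A^2 comes from a conserved
  quantity in a spectral shift \<kappa>. And the integral of (H - it)^(-1) + (H + it)^(-1), which
  formally gives \<pi> sign H, does not converge in norm, its integrand being only O(1/t). The
  difference of two such integrands on the path from H_0 to H is O(t^(-3/2)); so the sign of H_0 is
  built by Hilbert space means, and that of H by adding a norm-convergent correction. Unbounded
  operators stay out of the algebra: statements about H - z become identities between bounded
  operators, from which factors A are cancelled by injectivity.\<close>

class complex_banach_algebra_1 = complex_normed_vector + real_normed_algebra_1 + banach +
  assumes scaleC_mult_left [simp]: "(c *\<^sub>C x) * y = c *\<^sub>C (x * y)"
    and scaleC_mult_right [simp]: "x * (c *\<^sub>C y) = c *\<^sub>C (x * y)"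

lemma scaleC_zero_left [simp]: "0 *\<^sub>C x = (0 :: 'a :: complex_normed_vector)"
  by (metis add_cancel_right_right scaleC_add_left)

lemma scaleC_zero_right [simp]: "c *\<^sub>C 0 = (0 :: 'a :: complex_normed_vector)"
  using bounded_linear.linear[OF bounded_linear_scaleC] by (rule linear_0)

lemma scaleC_minus_right [simp]: "c *\<^sub>C (- x) = - (c *\<^sub>C x :: 'a :: complex_normed_vector)"
  using bounded_linear.linear[OF bounded_linear_scaleC] by (rule linear_neg)

lemma scaleC_diff_right: "c *\<^sub>C (x - y) = c *\<^sub>C x - (c *\<^sub>C y :: 'a :: complex_normed_vector)"
  using bounded_linear.linear[OF bounded_linear_scaleC] by (rule linear_diff)

lemma scaleC_minus_left [simp]: "(- c) *\<^sub>C x = - (c *\<^sub>C x :: 'a :: complex_normed_vector)"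
  by (metis add.right_inverse add_eq_0_iff scaleC_add_left scaleC_zero_left)

lemma scaleC_diff_left: "(c - d) *\<^sub>C x = c *\<^sub>C x - (d *\<^sub>C x :: 'a :: complex_normed_vector)"
  by (metis add_uminus_conv_diff scaleC_add_left scaleC_minus_left)

lemma scaleC_left_cancel [simp]:
  "c *\<^sub>C x = c *\<^sub>C y \<longleftrightarrow> c = 0 \<or> x = (y :: 'a :: complex_normed_vector)"
proof -
  have "c *\<^sub>C x = c *\<^sub>C y \<longleftrightarrow> norm (c *\<^sub>C (x - y)) = 0"
    by (simp add: scaleC_diff_right)
  then show ?thesis by (simp add: norm_scaleC)
qed

lemmas scaleC_distribs =
  scaleC_add_left scaleC_add_right scaleC_diff_left scaleC_diff_right scaleC_scaleC

lemma scaleR_scaleC_commute: "r *\<^sub>R (c *\<^sub>C x) = c *\<^sub>C (r *\<^sub>R x :: 'a :: complex_normed_vector)"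
  by (simp add: scaleR_scaleC scaleC_scaleC mult.commute)

lemma bounded_bilinear_scaleC:
  "bounded_bilinear ((*\<^sub>C) :: complex \<Rightarrow> 'a \<Rightarrow> 'a :: complex_normed_vector)"
  by (rule bounded_bilinear.intro)
    (auto simp: scaleC_distribs norm_scaleC scaleR_conv_of_real scaleR_scaleC[where ?'a = 'a]
      scaleC_scaleC mult_ac intro!: exI[of _ 1])

lemmas continuous_on_scaleC [continuous_intros] =
  bounded_bilinear.continuous_on[OF bounded_bilinear_scaleC]

lemmas tendsto_scaleC [tendsto_intros] = bounded_bilinear.tendsto[OF bounded_bilinear_scaleC]

text \<open>A type of its own for the complex linear operators makes them an instance of the
  abstract Banach algebra, in which all resolvent computations take place.\<close>

typedef (overloaded) 'a cop = "{f :: 'a :: complex_normed_vector \<Rightarrow>\<^sub>L 'a. \<forall>c x. f (c *\<^sub>C x) = c *\<^sub>C f x}"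
  by (rule exI[of _ 0]) simp

setup_lifting type_definition_cop

lift_definition cop_apply :: "'a :: complex_normed_vector cop \<Rightarrow> 'a \<Rightarrow> 'a" (infixl \<open>\<bullet>\<^sub>o\<close> 74)
  is blinfun_apply .

lemma cop_eqI: "(\<And>x. f \<bullet>\<^sub>o x = g \<bullet>\<^sub>o x) \<Longrightarrow> f = g"
  by transfer (simp add: blinfun_eqI)

text \<open>The value 0 on functions that are not bounded and complex linear makes the constructor
  total.\<close>

lift_definition cop_of :: "('a \<Rightarrow> 'a) \<Rightarrow> 'a :: complex_normed_vector cop"
  is "\<lambda>f. if bounded_clinear f then Blinfun f else 0"
  by (auto simp: bounded_clinear_def bounded_linear_Blinfun_apply)

lemma cop_of_apply [simp]: "bounded_clinear f \<Longrightarrow> cop_of f \<bullet>\<^sub>o x = f x"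
  by transfer (simp add: bounded_clinear_def bounded_linear_Blinfun_apply)

lemma bounded_clinear_cop: "bounded_clinear ((\<bullet>\<^sub>o) f)"
  unfolding bounded_clinear_def by transfer (auto simp: blinfun.bounded_linear_right)

lemma bounded_linear_cop: "bounded_linear ((\<bullet>\<^sub>o) f)"
  using bounded_clinear_cop bounded_clinear_def by blast

lemma cop_scaleC: "f \<bullet>\<^sub>o (c *\<^sub>C x) = c *\<^sub>C (f \<bullet>\<^sub>o x)"
  by transfer auto

lemmas cop_add = linear_add[OF bounded_linear.linear[OF bounded_linear_cop]]
lemmas cop_diff = linear_diff[OF bounded_linear.linear[OF bounded_linear_cop]]
lemmas cop_zero = linear_0[OF bounded_linear.linear[OF bounded_linear_cop]]
lemmas cop_neg = linear_neg[OF bounded_linear.linear[OF bounded_linear_cop]]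
lemmas cop_scaleR = linear_scale[OF bounded_linear.linear[OF bounded_linear_cop]]

lemma bounded_clinearI:
  assumes "\<And>x y. f (x + y) = f x + f y" "\<And>c x. f (c *\<^sub>C x) = c *\<^sub>C f x" "\<And>x. norm (f x) \<le> K * norm x"
  shows "bounded_clinear f"
  unfolding bounded_clinear_def
  using assms by (auto intro!: bounded_linear_intro[where K = K] simp: scaleR_scaleC mult.commute)

instantiation cop :: ("{complex_normed_vector, perfect_space}") complex_normed_vector
begin

lift_definition zero_cop :: "'a cop" is "0 :: 'a \<Rightarrow>\<^sub>L 'a" by simp
lift_definition plus_cop :: "'a cop \<Rightarrow> 'a cop \<Rightarrow> 'a cop" is "(+) :: ('a \<Rightarrow>\<^sub>L 'a) \<Rightarrow> _"
  by (simp add: blinfun.add_left scaleC_add_right)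
lift_definition minus_cop :: "'a cop \<Rightarrow> 'a cop \<Rightarrow> 'a cop" is "(-) :: ('a \<Rightarrow>\<^sub>L 'a) \<Rightarrow> _"
  by (simp add: blinfun.diff_left scaleC_diff_right)
lift_definition uminus_cop :: "'a cop \<Rightarrow> 'a cop" is "uminus :: ('a \<Rightarrow>\<^sub>L 'a) \<Rightarrow> _"
  by (simp add: blinfun.minus_left)
lift_definition scaleR_cop :: "real \<Rightarrow> 'a cop \<Rightarrow> 'a cop" is "(*\<^sub>R) :: real \<Rightarrow> ('a \<Rightarrow>\<^sub>L 'a) \<Rightarrow> _"
  by (simp add: blinfun.scaleR_left scaleR_scaleC_commute)
lift_definition scaleC_cop :: "complex \<Rightarrow> 'a cop \<Rightarrow> 'a cop" is "\<lambda>c f. Blinfun (\<lambda>x. c *\<^sub>C blinfun_apply f x)"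
  by (simp add: bounded_linear_Blinfun_apply bounded_linear_compose[OF bounded_linear_scaleC]
      blinfun.bounded_linear_right scaleC_scaleC mult.commute)
lift_definition norm_cop :: "'a cop \<Rightarrow> real" is "norm :: ('a \<Rightarrow>\<^sub>L 'a) \<Rightarrow> _" .

lemma cop_apply_simps [simp]:
  fixes f g :: "'a cop"
  shows "(f + g) \<bullet>\<^sub>o x = f \<bullet>\<^sub>o x + g \<bullet>\<^sub>o x" "(f - g) \<bullet>\<^sub>o x = f \<bullet>\<^sub>o x - g \<bullet>\<^sub>o x" "(- f) \<bullet>\<^sub>o x = - (f \<bullet>\<^sub>o x)"
    "0 \<bullet>\<^sub>o x = 0" "(r *\<^sub>R f) \<bullet>\<^sub>o x = r *\<^sub>R (f \<bullet>\<^sub>o x)"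
  by (transfer, simp add: blinfun.bilinear_simps)+

lemma cop_apply_scaleC [simp]: "(c *\<^sub>C f) \<bullet>\<^sub>o x = c *\<^sub>C (f \<bullet>\<^sub>o (x :: 'a))"
  by transfer (subst bounded_linear_Blinfun_apply,
    auto intro: bounded_linear_compose[OF bounded_linear_scaleC] blinfun.bounded_linear_right)

lemma norm_cop_apply: "norm (f \<bullet>\<^sub>o x) \<le> norm f * norm (x :: 'a)"
  by transfer (rule norm_blinfun)

lemma norm_cop_bound:
  "0 \<le> b \<Longrightarrow> (\<And>x :: 'a. norm (f \<bullet>\<^sub>o x) \<le> b * norm x) \<Longrightarrow> norm f \<le> b"
  by transfer (rule norm_blinfun_bound)

definition "sgn_cop (f :: 'a cop) = inverse (norm f) *\<^sub>R f"
definition "dist_cop (f :: 'a cop) g = norm (f - g)"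
definition "uniformity_cop = (INF e\<in>{0<..}. principal {(f :: 'a cop, g). dist f g < e})"
definition "open_cop U = (\<forall>f\<in>U. \<forall>\<^sub>F (f', g :: 'a cop) in uniformity. f' = f \<longrightarrow> g \<in> U)"

instance
proof
  fix f g h :: "'a cop" and r s :: real and c d :: complex
  show "f + g + h = f + (g + h)" by transfer simp
  show "f + g = g + f" by transfer simp
  show "0 + f = f" by transfer simp
  show "- f + f = 0" by transfer simp
  show "f - g = f + - g" by transfer simp
  show "r *\<^sub>R (f + g) = r *\<^sub>R f + r *\<^sub>R g" by transfer (simp add: scaleR_add_right)
  show "(r + s) *\<^sub>R f = r *\<^sub>R f + s *\<^sub>R f" by transfer (simp add: scaleR_add_left)
  show "r *\<^sub>R s *\<^sub>R f = (r * s) *\<^sub>R f" by transfer simp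
  show "1 *\<^sub>R f = f" by transfer simp
  show "dist f g = norm (f - g)" by (simp add: dist_cop_def)
  show "sgn f = inverse (norm f) *\<^sub>R f" by (simp add: sgn_cop_def)
  show "uniformity = (INF e\<in>{0<..}. principal {(f :: 'a cop, g). dist f g < e})"
    by (simp add: uniformity_cop_def)
  show "open U = (\<forall>f\<in>U. \<forall>\<^sub>F (f', g :: 'a cop) in uniformity. f' = f \<longrightarrow> g \<in> U)" for U
    by (simp add: open_cop_def)
  show "norm f = 0 \<longleftrightarrow> f = 0" by transfer simp
  show "norm (f + g) \<le> norm f + norm g" by transfer (rule norm_triangle_ineq)
  show "norm (r *\<^sub>R f) = \<bar>r\<bar> * norm f" by transfer simp
  show "c *\<^sub>C (f + g) = c *\<^sub>C f + c *\<^sub>C g"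
    by (rule cop_eqI) (simp add: scaleC_add_right)
  show "(c + d) *\<^sub>C f = c *\<^sub>C f + d *\<^sub>C f"
    by (rule cop_eqI) (simp add: scaleC_add_left)
  show "c *\<^sub>C d *\<^sub>C f = (c * d) *\<^sub>C f"
    by (rule cop_eqI) (simp add: scaleC_scaleC)
  show "r *\<^sub>R f = complex_of_real r *\<^sub>C f"
    by (rule cop_eqI) (simp add: scaleR_scaleC)
  show "norm (c *\<^sub>C f) = cmod c * norm f"
  proof -
    \<comment> \<open>Equality follows by applying this inequality to the inverse scalar as
      well.\<close>
    have le: "norm (c *\<^sub>C f) \<le> cmod c * norm f" for c and f :: "'a cop"
    proof (rule norm_cop_bound)
      show "0 \<le> cmod c * norm f" by (simp add: norm_cop.rep_eq)
    qed (simp add: norm_scaleC mult.assoc mult_left_mono norm_cop_apply)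
    show ?thesis
    proof (cases "c = 0")
      case True
      then have "c *\<^sub>C f = 0" by (intro cop_eqI) simp
      then show ?thesis using True by (simp add: norm_cop.rep_eq zero_cop.rep_eq)
    next
      case False
      have "f = inverse c *\<^sub>C c *\<^sub>C f"
        using False by (intro cop_eqI) (simp add: scaleC_scaleC scaleC_one)
      then have "norm f \<le> cmod (inverse c) * norm (c *\<^sub>C f)" using le by metis
      then have "cmod c * norm f \<le> norm (c *\<^sub>C f)" using False by (simp only: norm_inverse) (simp add: divide_simps mult.commute)
      then show ?thesis using le[of c f] by simp
    qed
  qed
qed

end

lemma dist_Rep_cop: "dist (Rep_cop f) (Rep_cop g) = dist f g"
  by (simp add: dist_norm norm_cop.rep_eq minus_cop.rep_eq)

instance cop :: ("{complex_normed_vector, perfect_space, banach}") banach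
proof
  fix X :: "nat \<Rightarrow> 'a cop"
  assume "Cauchy X"
  then have "Cauchy (\<lambda>n. Rep_cop (X n))"
    unfolding Cauchy_def by (simp add: dist_Rep_cop)
  then obtain l where l: "(\<lambda>n. Rep_cop (X n)) \<longlonglongrightarrow> l"
    using Cauchy_convergent_iff convergent_def by blast
  \<comment> \<open>Complex linearity passes to the limit pointwise, so the subtype is
    closed.\<close>
  have "blinfun_apply l (c *\<^sub>C x) = c *\<^sub>C blinfun_apply l x" for c x
  proof (rule LIMSEQ_unique)
    show "(\<lambda>n. Rep_cop (X n) (c *\<^sub>C x)) \<longlonglongrightarrow> l (c *\<^sub>C x)"
      by (intro tendsto_intros l)
    have "(\<lambda>n. c *\<^sub>C Rep_cop (X n) x) \<longlonglongrightarrow> c *\<^sub>C l x"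
      by (intro tendsto_intros l)
    moreover have "Rep_cop (X n) (c *\<^sub>C x) = c *\<^sub>C Rep_cop (X n) x" for n
      using Rep_cop[of "X n"] by simp
    ultimately show "(\<lambda>n. Rep_cop (X n) (c *\<^sub>C x)) \<longlonglongrightarrow> c *\<^sub>C l x"
      by simp
  qed
  then have "Rep_cop (Abs_cop l) = l" by (intro Abs_cop_inverse) auto
  then have "X \<longlonglongrightarrow> Abs_cop l"
    using l unfolding LIMSEQ_def by (metis dist_Rep_cop)
  then show "convergent X" by (auto simp: convergent_def)
qed

instantiation cop :: ("{complex_normed_vector, perfect_space, banach}") complex_banach_algebra_1
begin

lift_definition one_cop :: "'a cop" is id_blinfun by simp
lift_definition times_cop :: "'a cop \<Rightarrow> 'a cop \<Rightarrow> 'a cop" is "(o\<^sub>L)" by simp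

instance
proof
  fix f g h :: "'a cop" and r :: real and c :: complex
  show "f * g * h = f * (g * h)" by transfer (auto intro!: blinfun_eqI)
  show "1 * f = f" by transfer (auto intro!: blinfun_eqI)
  show "f * 1 = f" by transfer (auto intro!: blinfun_eqI)
  show "(f + g) * h = f * h + g * h" by transfer (auto intro!: blinfun_eqI simp: blinfun.add_left)
  show "f * (g + h) = f * g + f * h"
    by transfer (auto intro!: blinfun_eqI simp: blinfun.add_left blinfun.add_right)
  show "r *\<^sub>R f * g = r *\<^sub>R (f * g)" by transfer (auto intro!: blinfun_eqI simp: blinfun.scaleR_left)
  show "f * r *\<^sub>R g = r *\<^sub>R (f * g)"
    by transfer (auto intro!: blinfun_eqI simp: blinfun.scaleR_left blinfun.scaleR_right)
  \<comment> \<open>Here \<open>perfect_space\<close> enters: it makes the underlying space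
    nonzero.\<close>
  show "norm (1 :: 'a cop) = 1" by transfer simp
  then show "(0 :: 'a cop) \<noteq> 1" by (metis norm_zero zero_neq_one)
  show "norm (f * g) \<le> norm f * norm g" by transfer (rule norm_blinfun_compose)
  have mult: "(f * g) \<bullet>\<^sub>o x = f \<bullet>\<^sub>o (g \<bullet>\<^sub>o x)" for f g :: "'a cop" and x
    by transfer simp
  show "(c *\<^sub>C f) * g = c *\<^sub>C (f * g)"
    by (rule cop_eqI) (simp add: mult)
  show "f * (c *\<^sub>C g) = c *\<^sub>C (f * g)"
    by (rule cop_eqI) (simp add: mult cop_scaleC)
qed

end

lemma cop_apply_mult [simp]:
  fixes f g :: "'a :: {complex_normed_vector, perfect_space, banach} cop"
  shows "(f * g) \<bullet>\<^sub>o x = f \<bullet>\<^sub>o (g \<bullet>\<^sub>o x)" "1 \<bullet>\<^sub>o x = x"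
  by (transfer, simp)+

lemma bounded_linear_cop_left:
  "bounded_linear (\<lambda>f. f \<bullet>\<^sub>o (x :: 'a :: {complex_normed_vector, perfect_space}))"
  by (rule bounded_linear_intro[where K = "norm x"]) (auto simp: norm_cop_apply)

section \<open>Improper integrals\<close>

text \<open>Operator algebras are not separable, so integrals over bounded intervals are taken in
  the Henstock-Kurzweil sense, where continuity of the integrand suffices; integer endpoints are
  enough for integrands with decay.\<close>

definition impint :: "(real \<Rightarrow> 'a :: banach) \<Rightarrow> 'a" where
  "impint f = lim (\<lambda>n. integral {0..real n} f)"

text \<open>The exponent 3/2 is the sum of 1, the decay of the resolvent, and 1/2, that of the
  potential times the resolvent. With 1 + t in place of t one bound holds down to t = 0.\<close>

definition decays :: "real \<Rightarrow> (real \<Rightarrow> 'a :: banach) \<Rightarrow> bool" where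
  "decays K f \<longleftrightarrow> continuous_on {0..} f \<and> (\<forall>t\<ge>0. norm (f t) \<le> K * (1 + t) powr (-3/2))"

lemma decays_nonneg: "decays K f \<Longrightarrow> 0 \<le> K"
proof -
  assume "decays K f"
  then have "norm (f 0) \<le> K * (1 + 0) powr (-3/2)" unfolding decays_def by blast
  from order_trans[OF norm_ge_zero this] show ?thesis by simp
qed

lemma decays_continuous: "decays K f \<Longrightarrow> 0 \<le> a \<Longrightarrow> continuous_on {a..b} f"
  unfolding decays_def by (auto elim: continuous_on_subset)

lemma decays_integrable: "decays K f \<Longrightarrow> 0 \<le> a \<Longrightarrow> f integrable_on {a..b}"
  by (intro integrable_continuous_real decays_continuous)

lemma has_integral_decay:
  fixes a b K :: real
  assumes "0 \<le> a" "a \<le> b"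
  shows "((\<lambda>t. K * (1 + t) powr (-3/2)) has_integral
     (2 * K * (1 + a) powr (-1/2) - 2 * K * (1 + b) powr (-1/2))) {a..b}"
proof -
  have "((\<lambda>t. K * (1 + t) powr (-3/2)) has_integral
     ((- 2 * K * (1 + b) powr (-1/2)) - (- 2 * K * (1 + a) powr (-1/2)))) {a..b}"
    using assms
    by (intro fundamental_theorem_of_calculus)
      (auto intro!: derivative_eq_intros simp: has_real_derivative_iff_has_vector_derivative[symmetric])
  then show ?thesis by simp
qed

text \<open>The majorant has the primitive - 2 K (1 + t)^(-1/2). The bound does not depend on b: for
  large a it gives convergence, for a = 0 the norm estimate.\<close>

lemma norm_integral_decays:
  assumes "decays K f" "0 \<le> a" "a \<le> b"
  shows "norm (integral {a..b} f) \<le> 2 * K * (1 + a) powr (-1/2)"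
proof -
  note hi = has_integral_decay[OF assms(2,3), of K]
  have "norm (integral {a..b} f) \<le> integral {a..b} (\<lambda>t. K * (1 + t) powr (-3/2))"
    using assms by (intro Henstock_Kurzweil_Integration.integral_norm_bound_integral
        decays_integrable[OF assms(1)] has_integral_integrable[OF hi]) (auto simp: decays_def)
  also have "\<dots> = 2 * K * (1 + a) powr (-1/2) - 2 * K * (1 + b) powr (-1/2)"
    using hi by (rule integral_unique)
  also have "\<dots> \<le> 2 * K * (1 + a) powr (-1/2)"
    using decays_nonneg[OF assms(1)] by simp
  finally show ?thesis .
qed

lemma impint_tendsto:
  assumes "decays K f"
  shows "(\<lambda>n. integral {0..real n} f) \<longlonglongrightarrow> impint f"
proof -
  have lim: "(\<lambda>n. 2 * K * (1 + real n) powr (-1/2)) \<longlonglongrightarrow> 0"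
    by (intro tendsto_mult_right_zero tendsto_neg_powr
        filterlim_tendsto_add_at_top[OF tendsto_const filterlim_real_sequentially]) simp
  have "Cauchy (\<lambda>n. integral {0..real n} f)"
  proof (rule metric_CauchyI)
    fix e :: real assume "e > 0"
    then obtain M where M: "\<And>n. n \<ge> M \<Longrightarrow> 2 * K * (1 + real n) powr (-1/2) < e"
      using order_tendstoD(2)[OF lim] unfolding eventually_sequentially by blast
    have *: "dist (integral {0..real m} f) (integral {0..real n} f) < e" if "M \<le> m" "m \<le> n" for m n
    proof -
      have "integral {0..real m} f + integral {real m..real n} f = integral {0..real n} f"
        using that by (intro Henstock_Kurzweil_Integration.integral_combine decays_integrable[OF assms]) auto
      then have "dist (integral {0..real m} f) (integral {0..real n} f) = norm (integral {real m..real n} f)"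
        by (metis add_diff_cancel_left' dist_commute dist_norm)
      also have "\<dots> \<le> 2 * K * (1 + real m) powr (-1/2)"
        using that by (intro norm_integral_decays[OF assms]) auto
      also have "\<dots> < e" using M that by auto
      finally show ?thesis .
    qed
    show "\<exists>M. \<forall>m\<ge>M. \<forall>n\<ge>M. dist (integral {0..real m} f) (integral {0..real n} f) < e"
    proof (intro exI allI impI)
      fix m n assume "M \<le> m" "M \<le> n"
      then show "dist (integral {0..real m} f) (integral {0..real n} f) < e"
        using *[of m n] *[of n m] by (cases "m \<le> n") (auto simp: dist_commute)
    qed
  qed
  then show ?thesis
    unfolding impint_def by (simp add: Cauchy_convergent_iff convergent_LIMSEQ_iff)
qed

lemma impint_eqI: "(\<lambda>n. integral {0..real n} f) \<longlonglongrightarrow> l \<Longrightarrow> impint f = l"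
  unfolding impint_def by (rule limI)

lemma norm_impint:
  assumes "decays K f"
  shows "norm (impint f) \<le> 2 * K"
  using norm_integral_decays[OF assms, of 0]
  by (intro tendsto_upperbound[OF tendsto_norm[OF impint_tendsto[OF assms]]]) auto

lemma impint_cong: "(\<And>t. t \<ge> 0 \<Longrightarrow> f t = g t) \<Longrightarrow> impint f = impint g"
  unfolding impint_def by (intro arg_cong[where f = lim] ext Henstock_Kurzweil_Integration.integral_cong) auto

lemma impint_linear:
  assumes "bounded_linear T" "decays K f"
  shows "impint (\<lambda>t. T (f t)) = T (impint f)"
proof (rule impint_eqI)
  have "(\<lambda>n. T (integral {0..real n} f)) \<longlonglongrightarrow> T (impint f)"
    by (intro bounded_linear.tendsto[OF assms(1)] impint_tendsto[OF assms(2)])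
  then show "(\<lambda>n. integral {0..real n} (\<lambda>t. T (f t))) \<longlonglongrightarrow> T (impint f)"
    using integral_linear[OF decays_integrable[OF assms(2)] assms(1)] by (simp add: o_def)
qed

lemma impint_add:
  assumes "decays K f" "decays K' g"
  shows "impint (\<lambda>t. f t + g t) = impint f + impint g"
proof (rule impint_eqI)
  have "(\<lambda>n. integral {0..real n} f + integral {0..real n} g) \<longlonglongrightarrow> impint f + impint g"
    by (intro tendsto_intros impint_tendsto[OF assms(1)] impint_tendsto[OF assms(2)])
  then show "(\<lambda>n. integral {0..real n} (\<lambda>t. f t + g t)) \<longlonglongrightarrow> impint f + impint g"
    by (simp add: Henstock_Kurzweil_Integration.integral_add decays_integrable[OF assms(1)] decays_integrable[OF assms(2)])
qed

lemma impint_diff: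
  assumes "decays K f" "decays K' g"
  shows "impint (\<lambda>t. f t - g t) = impint f - impint g"
proof (rule impint_eqI)
  have "(\<lambda>n. integral {0..real n} f - integral {0..real n} g) \<longlonglongrightarrow> impint f - impint g"
    by (intro tendsto_intros impint_tendsto[OF assms(1)] impint_tendsto[OF assms(2)])
  then show "(\<lambda>n. integral {0..real n} (\<lambda>t. f t - g t)) \<longlonglongrightarrow> impint f - impint g"
    by (simp add: Henstock_Kurzweil_Integration.integral_diff decays_integrable[OF assms(1)] decays_integrable[OF assms(2)])
qed

lemma decays_linear:
  assumes "bounded_linear T" "decays K f"
  shows "\<exists>K'. decays K' (\<lambda>t. T (f t))"
proof -
  obtain B where B: "B \<ge> 0" "\<And>x. norm (T x) \<le> norm x * B"
    using bounded_linear.nonneg_bounded[OF assms(1)] by blast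
  have "decays (K * B) (\<lambda>t. T (f t))"
    unfolding decays_def
  proof (intro conjI allI impI)
    show "continuous_on {0..} (\<lambda>t. T (f t))"
      using assms by (auto simp: decays_def intro: bounded_linear.continuous_on)
    fix t :: real assume "t \<ge> 0"
    then have "norm (f t) * B \<le> K * (1 + t) powr (-3/2) * B"
      using assms(2) B(1) by (intro mult_right_mono) (auto simp: decays_def)
    then show "norm (T (f t)) \<le> K * B * (1 + t) powr (-3/2)"
      using B(2)[of "f t"] by (simp add: mult_ac)
  qed
  then show ?thesis by blast
qed

lemma inverse_square_decay:
  assumes "t \<ge> (0 :: real)"
  shows "1 / (1 + t\<^sup>2) \<le> 2 * (1 + t) powr (-3/2)"
proof -
  have "(1 + t)\<^sup>2 \<le> 2 * (1 + t\<^sup>2)"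
    using zero_le_power2[of "1 - t"] by (simp add: power2_eq_square algebra_simps)
  then have "1 / (1 + t\<^sup>2) \<le> 2 * (1 / (1 + t)\<^sup>2)"
    using assms by (simp add: divide_simps add_pos_nonneg)
  also have "1 / (1 + t)\<^sup>2 = (1 + t) powr (-2)"
    using assms by (simp add: powr_minus_divide)
  also have "\<dots> \<le> (1 + t) powr (-3/2)"
    using assms by (intro powr_mono) auto
  finally show ?thesis by simp
qed

text \<open>Brings products of two resolvents, which are O(t^(-2)), into the common format.\<close>

lemma decays_inverse_square:
  assumes "continuous_on {0..} f" "\<And>t. t \<ge> 0 \<Longrightarrow> norm (f t) \<le> K / (1 + t\<^sup>2)" "K \<ge> 0"
  shows "decays (2 * K) f"
  unfolding decays_def
proof (intro conjI assms allI impI)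
  fix t :: real assume t: "t \<ge> 0"
  have "norm (f t) \<le> K * (1 / (1 + t\<^sup>2))" using assms(2)[OF t] by simp
  also have "\<dots> \<le> K * (2 * (1 + t) powr (-3/2))"
    by (intro mult_left_mono inverse_square_decay t assms)
  finally show "norm (f t) \<le> 2 * K * (1 + t) powr (-3/2)" by simp
qed

lemma diff_eqI: "x = a + p \<Longrightarrow> x = b + q \<Longrightarrow> a - b = q - (p :: 'a :: ab_group_add)"
  by (simp add: algebra_simps)

section \<open>Resolvents on the imaginary axis\<close>

text \<open>\<open>A\<close> stands for H^(-1) and \<open>R t\<close> for (H - it)^(-1); the first
  two assumptions are the resolvent identity between 0 and it, in both orders. H itself does not
  occur; its role is taken by \<open>inj\<close>, which cancels factors \<open>A\<close> on the
  left.\<close>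

locale axis_resolvent =
  fixes A :: "'a :: complex_banach_algebra_1" and R :: "real \<Rightarrow> 'a" and C :: real
  assumes R_left: "R t = A + (\<i> * t) *\<^sub>C (A * R t)"
    and R_right: "R t = A + (\<i> * t) *\<^sub>C (R t * A)"
    and inj: "A * Y = 0 \<Longrightarrow> Y = 0"
    and norm_R: "norm (R t) \<le> C / sqrt (1 + t\<^sup>2)"
begin

lemma inj_eq: "A * x = A * y \<Longrightarrow> x = y"
  using inj[of "x - y"] by (simp add: algebra_simps)

lemma R_0: "R 0 = A"
  using R_left[of 0] by simp

lemma R_comm_A: "R t * A = A * R t"
proof (cases "t = 0")
  case False
  have "(\<i> * t) *\<^sub>C (R t * A) = (\<i> * t) *\<^sub>C (A * R t)"
    using R_left[of t] R_right[of t] by (metis add_left_cancel)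
  then show ?thesis using False by simp
qed (simp add: R_0)

text \<open>The commutator D satisfies (1 - it A) D = 0, and 1 + it R(t) is a left inverse of 1 - it
  A. Expanding R(t) D in two ways leaves A D = 0.\<close>

lemma commute_R:
  assumes "Y * A = A * Y"
  shows "Y * R t = R t * Y"
proof -
  have "A * (Y * R t - R t * Y) = 0"
  proof -
    define D where "D = Y * R t - R t * Y"
    have "Y * R t = Y * A + (\<i> * t) *\<^sub>C (A * (Y * R t))"
      using arg_cong[OF R_left[of t], of "\<lambda>x. Y * x"] assms by (metis distrib_left mult.assoc scaleC_mult_right)
    moreover have "R t * Y = A * Y + (\<i> * t) *\<^sub>C (A * (R t * Y))"
      using arg_cong[OF R_left[of t], of "\<lambda>x. x * Y"] by (simp add: distrib_right mult.assoc)
    ultimately have "D = (\<i> * t) *\<^sub>C (A * (Y * R t)) - (\<i> * t) *\<^sub>C (A * (R t * Y))"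
      unfolding D_def using assms by (metis add_diff_cancel_left)
    then have "D = (\<i> * t) *\<^sub>C (A * (Y * R t - R t * Y))"
      by (simp only: right_diff_distrib scaleC_diff_right)
    then have D: "D = (\<i> * t) *\<^sub>C (A * D)"
      by (simp only: D_def[symmetric])
    have "R t * D = A * D + (\<i> * t) *\<^sub>C (R t * A * D)"
      using arg_cong[OF R_right[of t], of "\<lambda>x. x * D"] by (simp add: distrib_right)
    moreover have "R t * D = (\<i> * t) *\<^sub>C (R t * A * D)"
      using arg_cong[OF D, of "\<lambda>x. R t * x"] by (simp add: mult.assoc)
    ultimately show "A * D = 0" by simp
  qed
  then have "Y * R t - R t * Y = 0" by (rule inj)
  then show ?thesis by simp
qed

lemma R_comm: "R t * R s = R s * R t"
  by (rule commute_R[OF R_comm_A])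

lemma R_diff: "R t - R s = (\<i> * (t - s)) *\<^sub>C (R t * R s)"
proof (rule inj_eq)
  have "R t * R s = A * R s + (\<i> * t) *\<^sub>C (A * (R t * R s))"
    using arg_cong[OF R_left[of t], of "\<lambda>x. x * R s"] by (simp add: distrib_right mult.assoc)
  moreover have "R t * R s = R t * A + (\<i> * s) *\<^sub>C (R t * A * R s)"
    using arg_cong[OF R_left[of s], of "\<lambda>x. R t * x"] by (simp add: distrib_left mult.assoc)
  then have "R t * R s = A * R t + (\<i> * s) *\<^sub>C (A * (R t * R s))"
    by (simp add: R_comm_A mult.assoc)
  ultimately have "A * R t - A * R s = (\<i> * t) *\<^sub>C (A * (R t * R s)) - (\<i> * s) *\<^sub>C (A * (R t * R s))"
    by (metis diff_eqI)
  then show "A * (R t - R s) = A * (\<i> * (t - s)) *\<^sub>C (R t * R s)"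
    by (simp add: right_diff_distrib scaleC_diff_left)
qed

lemma C_nonneg: "C \<ge> 0"
  using order_trans[OF norm_ge_zero norm_R[of 0]] by simp

lemma norm_R_le: "norm (R t) \<le> C"
proof -
  have "C / sqrt (1 + t\<^sup>2) \<le> C"
    using C_nonneg by (simp add: divide_le_eq mult_le_cancel_left1 add_pos_nonneg)
  then show ?thesis using norm_R[of t] by simp
qed

text \<open>The resolvent identity and the uniform bound C make R Lipschitz with constant
  C^2.\<close>

lemma continuous_R: "continuous_on S R"
proof -
  have "(C * C)-lipschitz_on S R"
  proof (rule lipschitz_onI)
    fix t s
    have "dist (R t) (R s) = \<bar>t - s\<bar> * norm (R t * R s)"
      by (simp add: dist_norm R_diff norm_scaleC norm_mult flip: of_real_diff)
    also have "\<dots> \<le> \<bar>t - s\<bar> * (C * C)"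
      by (intro mult_left_mono order_trans[OF norm_mult_ineq] mult_mono norm_R_le C_nonneg) auto
    finally show "dist (R t) (R s) \<le> C * C * dist t s" by (simp add: dist_real_def mult.commute)
  qed simp
  then show ?thesis by (rule lipschitz_on_continuous_on)
qed

text \<open>This is (H^2 + t^2)^(-1).\<close>

definition G :: "real \<Rightarrow> 'a" where "G t = R t * R (- t)"

lemma G_minus: "G (- t) = G t"
  using R_comm[of "- t" t] by (simp add: G_def)

text \<open>In terms of H: (H - it)^(-1) = (H + it) (H^2 + t^2)^(-1), multiplied by A.\<close>

lemma A_mult_R: "A * R t = G t + (\<i> * t) *\<^sub>C (A * G t)"
proof -
  have "R (- t) * R t = A * R t - (\<i> * t) *\<^sub>C (A * (R (- t) * R t))"
    using arg_cong[OF R_left[of "- t"], of "\<lambda>x. x * R t"] by (simp add: distrib_right left_diff_distrib mult.assoc)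
  then show ?thesis by (simp add: G_def R_comm[of "- t"] algebra_simps)
qed

text \<open>The symmetrised resolvent is 2 H (H^2 + t^2)^(-1), formally the integrand of \<pi> sign
  H; the factor A makes it absolutely integrable.\<close>

lemma A_mult_R_sym: "A * (R t + R (- t)) = 2 *\<^sub>R G t"
  using A_mult_R[of t] A_mult_R[of "- t"] by (simp add: distrib_left G_minus scaleR_2)

lemma commute_G: "Y * A = A * Y \<Longrightarrow> Y * G t = G t * Y"
  unfolding G_def using commute_R[of Y t] commute_R[of Y "- t"]
  by (metis (no_types) mult.assoc)

lemma G_comm_A: "G t * A = A * G t"
  using commute_G[OF refl] by simp

lemma G_comm: "G t * G s = G s * G t"
  using commute_G[OF G_comm_A] by simp

text \<open>The relation (H^2 + t^2) G(t) = 1, multiplied by A^2.\<close>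

lemma G_eq: "G t = A * A - t\<^sup>2 *\<^sub>R (A * A * G t)"
proof -
  have "A * R t = A * (A + (\<i> * t) *\<^sub>C (A * R t))"
    using R_left[of t] by simp
  then have "G t + (\<i> * t) *\<^sub>C (A * G t) = A * A + (\<i> * t) *\<^sub>C (A * (G t + (\<i> * t) *\<^sub>C (A * G t)))"
    unfolding A_mult_R by (metis distrib_left mult.assoc scaleC_mult_right A_mult_R)
  then show ?thesis
    by (simp add: distrib_left scaleC_distribs mult.assoc scaleR_scaleC power2_eq_square)
       (simp add: algebra_simps)
qed

lemma G_diff: "G t - G s = (s\<^sup>2 - t\<^sup>2) *\<^sub>R (G t * G s)"
proof -
  have "G t * G s = A * A * G s - t\<^sup>2 *\<^sub>R (A * A * (G t * G s))"
    using arg_cong[OF G_eq[of t], of "\<lambda>x. x * G s"] by (simp add: left_diff_distrib mult.assoc)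
  moreover have "G t * G s = A * A * G t - s\<^sup>2 *\<^sub>R (A * A * (G t * G s))"
    using arg_cong[OF G_eq[of s], of "\<lambda>x. x * G t"]
    by (simp add: left_diff_distrib mult.assoc G_comm[of s t])
  ultimately have "A * A * G t - A * A * G s =
      s\<^sup>2 *\<^sub>R (A * A * (G t * G s)) - t\<^sup>2 *\<^sub>R (A * A * (G t * G s))"
    using diff_eqI[of "G t * G s" _ "- (s\<^sup>2 *\<^sub>R (A * A * (G t * G s)))" _
        "- (t\<^sup>2 *\<^sub>R (A * A * (G t * G s)))"] by simp
  then have "A * (A * (G t - G s)) = A * (A * ((s\<^sup>2 - t\<^sup>2) *\<^sub>R (G t * G s)))"
    by (simp only: right_diff_distrib scaleR_left_diff_distrib mult.assoc mult_scaleR_right)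
  then show ?thesis by (rule inj_eq[OF inj_eq])
qed

lemma norm_G: "norm (G t) \<le> C\<^sup>2 / (1 + t\<^sup>2)"
proof -
  have "norm (G t) \<le> (C / sqrt (1 + t\<^sup>2)) * (C / sqrt (1 + t\<^sup>2))"
    unfolding G_def using norm_R[of t] norm_R[of "- t"] C_nonneg
    by (intro order_trans[OF norm_mult_ineq] mult_mono) auto
  then show ?thesis by (simp add: power2_eq_square)
qed

lemma continuous_G: "continuous_on S G"
  unfolding G_def
  by (intro continuous_intros continuous_R continuous_on_compose2[OF continuous_R[of UNIV]]) auto

lemma decays_G: "decays (2 * C\<^sup>2) G"
  by (intro decays_inverse_square continuous_G norm_G) auto

text \<open>The classical integral for (H^2)^(-1/2): it is |H|^(-1) for selfadjoint H, and A times
  the sign of H in general.\<close>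

definition L :: 'a where "L = (2 / pi) *\<^sub>R impint G"

lemma commute_impint_G:
  assumes "Y * A = A * Y"
  shows "Y * impint G = impint G * Y"
proof -
  have "Y * impint G = impint (\<lambda>t. Y * G t)"
    by (rule impint_linear[OF bounded_linear_mult_right decays_G, symmetric])
  also have "\<dots> = impint (\<lambda>t. G t * Y)" by (simp add: commute_G[OF assms])
  also have "\<dots> = impint G * Y"
    by (rule impint_linear[OF bounded_linear_mult_left decays_G])
  finally show ?thesis .
qed

lemma commute_L: "Y * A = A * Y \<Longrightarrow> Y * L = L * Y"
  by (simp add: L_def commute_impint_G)

end

section \<open>The square root of the squared inverse\<close>

context axis_resolvent
begin

text \<open>The resolvent (H^2 + \<mu>)^(-1) in the variable \<mu> = t^2, in which the resolvent
  identity yields the differential equation g' = - g^2.\<close>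

definition g :: "real \<Rightarrow> 'a" where "g \<mu> = G (sqrt \<mu>)"

lemma g_diff: "0 \<le> \<mu> \<Longrightarrow> 0 \<le> \<nu> \<Longrightarrow> g \<mu> - g \<nu> = (\<nu> - \<mu>) *\<^sub>R (g \<mu> * g \<nu>)"
  using G_diff[of "sqrt \<mu>" "sqrt \<nu>"] by (simp add: g_def)

lemma g_0: "g 0 = A * A"
  by (simp add: g_def G_def R_0)

lemma g_square: "g (t\<^sup>2) = G t"
  by (cases "t \<ge> 0") (auto simp: g_def G_minus)

lemma norm_g: "0 \<le> \<mu> \<Longrightarrow> norm (g \<mu>) \<le> C\<^sup>2 / (1 + \<mu>)"
  using norm_G[of "sqrt \<mu>"] by (simp add: g_def)

lemma continuous_g: "continuous_on S g"
  unfolding g_def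
  by (intro continuous_intros continuous_on_compose2[OF continuous_G[of UNIV]]) auto

lemma commute_g: "Y * A = A * Y \<Longrightarrow> Y * g \<mu> = g \<mu> * Y"
  by (simp add: g_def commute_G)

lemma g_eq: "0 \<le> \<mu> \<Longrightarrow> A * A = g \<mu> + \<mu> *\<^sub>R (A * A * g \<mu>)"
  using g_diff[of 0 \<mu>] by (simp only: g_0 diff_eq_eq diff_zero) (simp add: add.commute)

text \<open>By the resolvent identity the difference quotient is exactly - g(\<mu>) g(\<nu>), so the
  error is |g(\<mu>) (g(\<mu>) - g(\<nu>))| and continuity of g finishes.\<close>

lemma g_has_derivative:
  assumes "0 \<le> \<mu>"
  shows "(g has_vector_derivative - (g \<mu> * g \<mu>)) (at \<mu> within {0..})"
  unfolding has_vector_derivative_def has_derivative_within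
proof (intro conjI bounded_linear_scaleR_left)
  have "((\<lambda>\<nu>. norm (g \<mu> * (g \<mu> - g \<nu>))) \<longlongrightarrow> norm (g \<mu> * (g \<mu> - g \<mu>))) (at \<mu> within {0..})"
    using continuous_g[of "{0..}"] assms
    by (intro tendsto_intros) (auto simp: continuous_on_def)
  then have lim: "((\<lambda>\<nu>. norm (g \<mu> * (g \<mu> - g \<nu>))) \<longlongrightarrow> 0) (at \<mu> within {0..})" by simp
  have "norm ((1 / norm (\<nu> - \<mu>)) *\<^sub>R (g \<nu> - (g \<mu> + (\<nu> - \<mu>) *\<^sub>R - (g \<mu> * g \<mu>)))) \<le> norm (g \<mu> * (g \<mu> - g \<nu>))"
    if "\<nu> \<in> {0..}" "\<nu> \<noteq> \<mu>" for \<nu>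
  proof -
    have "g \<nu> - g \<mu> = - ((\<nu> - \<mu>) *\<^sub>R (g \<mu> * g \<nu>))"
      using g_diff[of \<mu> \<nu>] that assms by (metis minus_diff_eq atLeast_iff)
    then have "g \<nu> - (g \<mu> + (\<nu> - \<mu>) *\<^sub>R - (g \<mu> * g \<mu>))
        = - ((\<nu> - \<mu>) *\<^sub>R (g \<mu> * g \<nu>)) + (\<nu> - \<mu>) *\<^sub>R (g \<mu> * g \<mu>)"
      by (simp only: diff_diff_add[symmetric]) simp
    also have "\<dots> = (\<nu> - \<mu>) *\<^sub>R (g \<mu> * (g \<mu> - g \<nu>))"
      by (simp add: right_diff_distrib scaleR_diff_right)
    finally show ?thesis using that by simp
  qed
  then show "((\<lambda>\<nu>. (1 / norm (\<nu> - \<mu>)) *\<^sub>R (g \<nu> - (g \<mu> + (\<nu> - \<mu>) *\<^sub>R - (g \<mu> * g \<mu>)))) \<longlongrightarrow> 0) (at \<mu> within {0..})"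
    by (intro Lim_null_comparison[OF _ lim]) (auto simp: eventually_at_filter)
qed

lemma g_compose_derivative:
  assumes "(f has_vector_derivative f') (at x within S)" "\<And>y. y \<in> S \<Longrightarrow> 0 \<le> f y" "x \<in> S"
  shows "((\<lambda>y. g (f y)) has_vector_derivative - (f' *\<^sub>R (g (f x) * g (f x)))) (at x within S)"
proof -
  have "(g has_vector_derivative - (g (f x) * g (f x))) (at (f x) within f ` S)"
    by (rule has_vector_derivative_within_subset[OF g_has_derivative]) (use assms in auto)
  from vector_diff_chain_within[OF assms(1) this] show ?thesis by (simp add: o_def)
qed

text \<open>For n \<rightarrow> \<infinity> this tends to \<pi>/2 times (H^2 + \<kappa>)^(-1/2). The
  truncation at n allows differentiation under the integral on a compact interval.\<close>

definition ell :: "nat \<Rightarrow> real \<Rightarrow> 'a" where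
  "ell n \<kappa> = integral {0..real n} (\<lambda>t. g (\<kappa> + t\<^sup>2))"

lemma continuous_g_shift: "continuous_on S (\<lambda>t. g (\<kappa> + t\<^sup>2))"
  by (intro continuous_on_compose2[OF continuous_g[of UNIV]] continuous_intros) auto

lemma ell_derivative:
  assumes "0 \<le> \<kappa>"
  shows "(ell n has_vector_derivative - integral {0..real n} (\<lambda>t. g (\<kappa> + t\<^sup>2) * g (\<kappa> + t\<^sup>2))) (at \<kappa> within {0..})"
proof -
  have "((\<lambda>\<kappa>. integral (cbox 0 (real n)) (\<lambda>t. g (\<kappa> + t\<^sup>2))) has_vector_derivative
    integral (cbox 0 (real n)) (\<lambda>t. - (g (\<kappa> + t\<^sup>2) * g (\<kappa> + t\<^sup>2)))) (at \<kappa> within {0..})"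
  proof (rule leibniz_rule_vector_derivative)
    fix \<kappa> t :: real assume "\<kappa> \<in> {0..}"
    have "((\<lambda>\<kappa>. \<kappa> + t\<^sup>2) has_vector_derivative 1) (at \<kappa> within {0..})"
      by (auto intro!: derivative_eq_intros simp flip: has_real_derivative_iff_has_vector_derivative)
    from g_compose_derivative[OF this _ \<open>\<kappa> \<in> {0..}\<close>]
    show "((\<lambda>\<kappa>. g (\<kappa> + t\<^sup>2)) has_vector_derivative - (g (\<kappa> + t\<^sup>2) * g (\<kappa> + t\<^sup>2))) (at \<kappa> within {0..})"
      by simp
  next
    show "(\<lambda>t. g (\<kappa> + t\<^sup>2)) integrable_on cbox 0 (real n)" for \<kappa>
      by (simp add: integrable_continuous_real continuous_g_shift)
    show "continuous_on ({0..} \<times> cbox 0 (real n)) (\<lambda>(\<kappa>, t). - (g (\<kappa> + t\<^sup>2) * g (\<kappa> + t\<^sup>2)))"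
      unfolding split_beta
      by (intro continuous_intros continuous_on_compose2[OF continuous_g[of UNIV]]) auto
  qed (use assms in auto)
  then show ?thesis unfolding ell_def[abs_def] by simp
qed

text \<open>Integration by parts in \<open>t\<close>, combined with the resolvent identity, turns the derivative in
  \<open>\<kappa>\<close> of the truncated integral into a multiple of the integral itself.\<close>

lemma ell_parts:
  assumes "0 \<le> \<kappa>"
  shows "2 *\<^sub>R integral {0..real n} (\<lambda>t. g (\<kappa> + t\<^sup>2) * g (\<kappa> + t\<^sup>2))
    = g \<kappa> * ell n \<kappa> + real n *\<^sub>R (g \<kappa> * g (\<kappa> + (real n)\<^sup>2))"
proof -
  let ?g = "\<lambda>t. g (\<kappa> + t\<^sup>2)"
  have der: "((\<lambda>t. t *\<^sub>R ?g t) has_vector_derivative ?g t - (2 * t\<^sup>2) *\<^sub>R (?g t * ?g t)) (at t within {0..real n})"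
    if "t \<in> {0..real n}" for t
  proof -
    have "((\<lambda>t. \<kappa> + t\<^sup>2) has_vector_derivative 2 * t) (at t within {0..real n})"
      by (auto intro!: derivative_eq_intros simp flip: has_real_derivative_iff_has_vector_derivative)
    from g_compose_derivative[OF this _ that] assms
    have "(?g has_vector_derivative - ((2 * t) *\<^sub>R (?g t * ?g t))) (at t within {0..real n})" by simp
    from has_vector_derivative_scaleR[OF DERIV_ident this]
    show ?thesis by (simp add: power2_eq_square mult_ac)
  qed
  have "((\<lambda>t. ?g t - (2 * t\<^sup>2) *\<^sub>R (?g t * ?g t)) has_integral (real n *\<^sub>R ?g (real n) - 0 *\<^sub>R ?g 0)) {0..real n}"
    by (rule fundamental_theorem_of_calculus) (use der in auto)
  from has_integral_mult_right[OF this, of "g \<kappa>"]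
  have "((\<lambda>t. g \<kappa> * (?g t - (2 * t\<^sup>2) *\<^sub>R (?g t * ?g t))) has_integral (real n *\<^sub>R (g \<kappa> * ?g (real n)))) {0..real n}"
    by simp
  \<comment> \<open>The factor g(\<kappa>) turns t^2 g(\<kappa> + t^2) into g(\<kappa>) - g(\<kappa>
    + t^2); this removes the weight t^2 left by the integration by parts.\<close>
  moreover have "g \<kappa> * (?g t - (2 * t\<^sup>2) *\<^sub>R (?g t * ?g t)) = 2 *\<^sub>R (?g t * ?g t) - g \<kappa> * ?g t" for t
  proof -
    have "t\<^sup>2 *\<^sub>R (g \<kappa> * ?g t) = g \<kappa> - ?g t"
      using g_diff[of \<kappa> "\<kappa> + t\<^sup>2"] assms by simp
    then have "t\<^sup>2 *\<^sub>R (g \<kappa> * ?g t) * ?g t = (g \<kappa> - ?g t) * ?g t" by simp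
    then have "t\<^sup>2 *\<^sub>R (g \<kappa> * (?g t * ?g t)) = g \<kappa> * ?g t - ?g t * ?g t"
      by (simp add: left_diff_distrib mult.assoc)
    then have "(2 * t\<^sup>2) *\<^sub>R (g \<kappa> * (?g t * ?g t)) = 2 *\<^sub>R (g \<kappa> * ?g t - ?g t * ?g t)"
      by (metis scaleR_scaleR)
    then show ?thesis
      by (simp add: right_diff_distrib scaleR_diff_right scaleR_2)
  qed
  ultimately have 1: "((\<lambda>t. 2 *\<^sub>R (?g t * ?g t) - g \<kappa> * ?g t) has_integral (real n *\<^sub>R (g \<kappa> * ?g (real n)))) {0..real n}"
    by simp
  have int: "(\<lambda>t. ?g t * ?g t) integrable_on {0..real n}" "?g integrable_on {0..real n}"
    by (intro integrable_continuous_real continuous_intros continuous_g_shift)+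
  have "((\<lambda>t. 2 *\<^sub>R (?g t * ?g t) - g \<kappa> * ?g t) has_integral
     (2 *\<^sub>R integral {0..real n} (\<lambda>t. ?g t * ?g t) - g \<kappa> * ell n \<kappa>)) {0..real n}"
    unfolding ell_def
    by (rule has_integral_diff[OF has_integral_cmul[OF integrable_integral[OF int(1)]]
        has_integral_mult_right[OF integrable_integral[OF int(2)]]])
  from has_integral_unique[OF this 1] show ?thesis by (simp add: diff_eq_eq add.commute)
qed

lemma decays_g: "0 \<le> \<kappa> \<Longrightarrow> decays (2 * C\<^sup>2) (\<lambda>t. g (\<kappa> + t\<^sup>2))"
proof (rule decays_inverse_square)
  fix t :: real assume \<kappa>: "0 \<le> \<kappa>"
  have "norm (g (\<kappa> + t\<^sup>2)) \<le> C\<^sup>2 / (1 + (\<kappa> + t\<^sup>2))"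
    using \<kappa> by (intro norm_g) auto
  also have "\<dots> \<le> C\<^sup>2 / (1 + t\<^sup>2)"
    using \<kappa> by (intro divide_left_mono) (auto intro!: mult_pos_pos add_pos_nonneg)
  finally show "norm (g (\<kappa> + t\<^sup>2)) \<le> C\<^sup>2 / (1 + t\<^sup>2)" .
qed (auto intro: continuous_g_shift)

lemma norm_ell: "0 \<le> \<kappa> \<Longrightarrow> norm (ell n \<kappa>) \<le> 4 * C\<^sup>2"
  unfolding ell_def using norm_integral_decays[OF decays_g, of \<kappa> 0 "real n"] by simp

lemma commute_ell: "Y * A = A * Y \<Longrightarrow> Y * ell n \<kappa> = ell n \<kappa> * Y"
  unfolding ell_def
  using integral_linear[OF integrable_continuous_real[OF continuous_g_shift] bounded_linear_mult_right[of Y], of 0 "real n" \<kappa>]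
    integral_linear[OF integrable_continuous_real[OF continuous_g_shift] bounded_linear_mult_left[of Y], of 0 "real n" \<kappa>]
  by (simp add: o_def commute_g)

text \<open>The function differentiated is A^2 (H^2 + \<kappa>) times the square of
  \<open>ell n \<kappa>\<close>; without truncation it would be the constant (\<pi>/2)^2 A^2. By
  \<open>ell_parts\<close> everything cancels except the boundary term at t = n.\<close>

lemma ell_square_derivative:
  assumes "0 \<le> \<kappa>"
  shows "((\<lambda>\<kappa>. ell n \<kappa> * ell n \<kappa> + \<kappa> *\<^sub>R (A * A * (ell n \<kappa> * ell n \<kappa>)))
    has_vector_derivative - (real n *\<^sub>R (A * A * (ell n \<kappa> * g (\<kappa> + (real n)\<^sup>2))))) (at \<kappa> within {0..})"
proof -
  define D where "D = - integral {0..real n} (\<lambda>t. g (\<kappa> + t\<^sup>2) * g (\<kappa> + t\<^sup>2))"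
  let ?l = "ell n \<kappa>" and ?h = "g (\<kappa> + (real n)\<^sup>2)"
  have comm: "g \<mu> * ?l = ?l * g \<mu>" for \<mu>
    using commute_ell[of "g \<mu>"] commute_g[of A \<mu>] by simp
  have D2: "2 *\<^sub>R D = - (g \<kappa> * ?l + real n *\<^sub>R (g \<kappa> * ?h))"
    using ell_parts[OF assms, of n] by (simp add: D_def)
  have gl: "?l * (g \<kappa> * x) = g \<kappa> * (?l * x)" for x
    by (metis comm mult.assoc)
  have lD: "?l * D = D * ?l"
  proof -
    have "2 *\<^sub>R (?l * D) = ?l * (2 *\<^sub>R D)" by simp
    also have "\<dots> = (2 *\<^sub>R D) * ?l"
      unfolding D2 by (simp add: algebra_simps gl comm)
    finally show ?thesis by simp
  qed
  have E: "((\<lambda>\<kappa>. ell n \<kappa> * ell n \<kappa>) has_vector_derivative (?l * D + D * ?l)) (at \<kappa> within {0..})"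
    using ell_derivative[OF assms, of n] unfolding D_def[symmetric]
    by (intro has_vector_derivative_mult) auto
  have E': "?l * D + D * ?l = - (g \<kappa> * (?l * ?l + real n *\<^sub>R (?l * ?h)))"
  proof -
    have "?l * D + D * ?l = (2 *\<^sub>R D) * ?l" by (simp add: lD scaleR_2 distrib_right)
    also have "\<dots> = - (g \<kappa> * (?l * ?l + real n *\<^sub>R (?l * ?h)))"
      unfolding D2 by (simp add: algebra_simps comm gl[symmetric])
    finally show ?thesis .
  qed
  have "((\<lambda>\<kappa>. ell n \<kappa> * ell n \<kappa> + \<kappa> *\<^sub>R (A * A * (ell n \<kappa> * ell n \<kappa>))) has_vector_derivative
    (?l * D + D * ?l) + (\<kappa> *\<^sub>R (A * A * (?l * D + D * ?l)) + 1 *\<^sub>R (A * A * (?l * ?l)))) (at \<kappa> within {0..})"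
    by (intro has_vector_derivative_add E has_vector_derivative_scaleR DERIV_ident
      has_vector_derivative_mult_right)
  moreover have "(?l * D + D * ?l) + (\<kappa> *\<^sub>R (A * A * (?l * D + D * ?l)) + 1 *\<^sub>R (A * A * (?l * ?l)))
    = - (real n *\<^sub>R (A * A * (?l * ?h)))"
  proof -
    have "(?l * D + D * ?l) + \<kappa> *\<^sub>R (A * A * (?l * D + D * ?l))
      = - ((g \<kappa> + \<kappa> *\<^sub>R (A * A * g \<kappa>)) * (?l * ?l + real n *\<^sub>R (?l * ?h)))"
      unfolding E' distrib_right[of "g \<kappa>"] by (simp add: mult.assoc)
    also have "\<dots> = - (A * A * (?l * ?l + real n *\<^sub>R (?l * ?h)))"
      by (simp only: g_eq[OF assms, symmetric])
    finally show ?thesis by (simp add: distrib_left add.assoc[symmetric])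
  qed
  ultimately show ?thesis by simp
qed

text \<open>The derivative just computed is O(1/n) uniformly in \<kappa>, since g(\<kappa> + n^2) =
  O(n^(-2)) outweighs the factor n. The mean value inequality followed by n \<rightarrow>
  \<infinity> makes the values at \<kappa> and at 0 equal.\<close>

lemma ell_square_const:
  assumes "0 \<le> \<kappa>"
  shows "impint (\<lambda>t. g (\<kappa> + t\<^sup>2)) * impint (\<lambda>t. g (\<kappa> + t\<^sup>2))
      + \<kappa> *\<^sub>R (A * A * (impint (\<lambda>t. g (\<kappa> + t\<^sup>2)) * impint (\<lambda>t. g (\<kappa> + t\<^sup>2))))
    = impint G * impint G"
proof -
  define N where "N n \<kappa> = ell n \<kappa> * ell n \<kappa> + \<kappa> *\<^sub>R (A * A * (ell n \<kappa> * ell n \<kappa>))" for n \<kappa>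
  define I where "I \<kappa> = impint (\<lambda>t. g (\<kappa> + t\<^sup>2))" for \<kappa>
  have ell: "(\<lambda>n. ell n \<kappa>) \<longlonglongrightarrow> I \<kappa>" if "0 \<le> \<kappa>" for \<kappa>
    unfolding ell_def I_def by (rule impint_tendsto[OF decays_g[OF that]])
  have N: "(\<lambda>n. N n \<kappa>) \<longlonglongrightarrow> I \<kappa> * I \<kappa> + \<kappa> *\<^sub>R (A * A * (I \<kappa> * I \<kappa>))" if "0 \<le> \<kappa>" for \<kappa>
    unfolding N_def by (intro tendsto_intros ell[OF that])
  define K where "K = norm (A * A) * (4 * C\<^sup>2 * C\<^sup>2)"
  have K: "norm (N n \<kappa> - N n 0) \<le> (\<kappa> * K) * inverse (real n)" if n: "n > 0" for n
  proof -
    have "norm (N n \<kappa> - N n 0) \<le> (K * inverse (real n)) * norm (\<kappa> - 0)"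
    proof (rule differentiable_bound)
      show "convex {0 :: real..}" by simp
      show "(N n has_derivative (\<lambda>x. x *\<^sub>R - (real n *\<^sub>R (A * A * (ell n \<kappa> * g (\<kappa> + (real n)\<^sup>2)))))) (at \<kappa> within {0..})"
        if "\<kappa> \<in> {0..}" for \<kappa>
        using ell_square_derivative[of \<kappa> n] that unfolding N_def[abs_def] has_vector_derivative_def by simp
      fix \<kappa> :: real assume "\<kappa> \<in> {0..}"
      then have \<kappa>: "0 \<le> \<kappa>" by simp
      have "norm (g (\<kappa> + (real n)\<^sup>2)) \<le> C\<^sup>2 / (1 + (\<kappa> + (real n)\<^sup>2))"
        using \<kappa> by (intro norm_g) auto
      also have "\<dots> \<le> C\<^sup>2 / (real n)\<^sup>2"
        using \<kappa> n by (intro divide_left_mono) (auto intro!: mult_pos_pos add_pos_nonneg)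
      finally have h: "norm (g (\<kappa> + (real n)\<^sup>2)) \<le> C\<^sup>2 / (real n)\<^sup>2" .
      have "norm (- (real n *\<^sub>R (A * A * (ell n \<kappa> * g (\<kappa> + (real n)\<^sup>2)))))
          = real n * norm (A * A * (ell n \<kappa> * g (\<kappa> + (real n)\<^sup>2)))"
        by simp
      also have "\<dots> \<le> real n * (norm (A * A) * (4 * C\<^sup>2 * (C\<^sup>2 / (real n)\<^sup>2)))"
        using norm_ell[OF \<kappa>, of n] h
        by (intro mult_left_mono order_trans[OF norm_mult_ineq]
          order_trans[OF norm_mult_ineq[of "ell n \<kappa>"]] mult_mono) auto
      also have "\<dots> = K * inverse (real n)"
        using n by (simp add: K_def field_simps power2_eq_square)
      finally have "norm (- (real n *\<^sub>R (A * A * (ell n \<kappa> * g (\<kappa> + (real n)\<^sup>2))))) \<le> K * inverse (real n)" .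
      then show "onorm (\<lambda>x. x *\<^sub>R - (real n *\<^sub>R (A * A * (ell n \<kappa> * g (\<kappa> + (real n)\<^sup>2))))) \<le> K * inverse (real n)"
        using onorm_scaleR_left[OF bounded_linear_ident, of "- (real n *\<^sub>R (A * A * (ell n \<kappa> * g (\<kappa> + (real n)\<^sup>2))))"]
        by (simp add: onorm_id)
    qed (use assms in auto)
    then show ?thesis using assms by (simp add: mult_ac)
  qed
  have "(\<lambda>n. N n \<kappa> - N n 0) \<longlonglongrightarrow> 0"
  proof (rule Lim_null_comparison)
    show "\<forall>\<^sub>F n in sequentially. norm (N n \<kappa> - N n 0) \<le> (\<kappa> * K) * inverse (real n)"
      using eventually_gt_at_top[of 0] by eventually_elim (rule K)
    show "(\<lambda>n. (\<kappa> * K) * inverse (real n)) \<longlonglongrightarrow> 0"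
      by (intro tendsto_mult_right_zero lim_inverse_n)
  qed
  moreover have "(\<lambda>n. N n \<kappa> - N n 0) \<longlonglongrightarrow>
    (I \<kappa> * I \<kappa> + \<kappa> *\<^sub>R (A * A * (I \<kappa> * I \<kappa>))) - (I 0 * I 0 + 0 *\<^sub>R (A * A * (I 0 * I 0)))"
    by (intro tendsto_diff N assms) simp
  ultimately have "(I \<kappa> * I \<kappa> + \<kappa> *\<^sub>R (A * A * (I \<kappa> * I \<kappa>))) - (I 0 * I 0 + 0 *\<^sub>R (A * A * (I 0 * I 0))) = 0"
    using LIMSEQ_unique by blast
  then show ?thesis by (simp add: I_def g_square)
qed

end

section \<open>The arctangent integral and the square of L\<close>

lemma arctan_impint:
  assumes "0 < \<kappa>"
  shows "impint (\<lambda>t. 1 / (\<kappa> + t\<^sup>2)) = pi / (2 * sqrt \<kappa>)"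
proof (rule impint_eqI)
  let ?s = "sqrt \<kappa>"
  have s: "?s > 0" "?s\<^sup>2 = \<kappa>" using assms by auto
  have "((\<lambda>t. 1 / (\<kappa> + t\<^sup>2)) has_integral (arctan (real n / ?s) / ?s - arctan (0 / ?s) / ?s)) {0..real n}" for n
  proof (rule fundamental_theorem_of_calculus)
    fix t assume "t \<in> {0..real n}"
    have *: "1 / (1 + (t / ?s)\<^sup>2) * (1 / ?s) / ?s = 1 / (\<kappa> + t\<^sup>2)"
      using s assms by (simp add: power_divide divide_simps add_pos_nonneg)
    have "((\<lambda>t. arctan (t / ?s) / ?s) has_real_derivative 1 / (1 + (t / ?s)\<^sup>2) * (1 / ?s) / ?s) (at t within {0..real n})"
      using s by (auto intro!: derivative_eq_intros simp: field_simps)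
    then show "((\<lambda>t. arctan (t / ?s) / ?s) has_vector_derivative 1 / (\<kappa> + t\<^sup>2)) (at t within {0..real n})"
      unfolding * by (simp add: has_real_derivative_iff_has_vector_derivative)
  qed simp
  then have eq: "integral {0..real n} (\<lambda>t. 1 / (\<kappa> + t\<^sup>2)) = arctan (real n / ?s) / ?s" for n
    by (simp add: integral_unique)
  have "filterlim (\<lambda>n. inverse ?s * real n) at_top sequentially"
    using s by (intro filterlim_tendsto_pos_mult_at_top[OF tendsto_const _ filterlim_real_sequentially]) auto
  then have "(\<lambda>n. arctan (real n / ?s)) \<longlonglongrightarrow> pi / 2"
    by (intro filterlim_compose[OF tendsto_arctan_at_top]) (simp add: divide_inverse mult.commute)
  then have "(\<lambda>n. arctan (real n / ?s) / ?s) \<longlonglongrightarrow> (pi / 2) / ?s"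
    using s by (intro tendsto_divide tendsto_const) auto
  then show "(\<lambda>n. integral {0..real n} (\<lambda>t. 1 / (\<kappa> + t\<^sup>2))) \<longlonglongrightarrow> pi / (2 * sqrt \<kappa>)"
    unfolding eq by simp
qed


context axis_resolvent
begin

text \<open>By \<open>ell_square_const\<close> the square of the integral may be evaluated at any
  shift, and (H^2 + \<kappa>)^(-1/2) behaves like \<kappa>^(-1/2) for \<kappa> \<rightarrow>
  \<infinity>. This asymptotics holds in norm only after multiplication by X = A^2; hence the factor
  X^2, which injectivity removes at the end.\<close>

lemma L_square: "L * L = A * A"
proof -
  define X where "X = A * A"
  define I where "I \<kappa> = impint (\<lambda>t. g (\<kappa> + t\<^sup>2))" for \<kappa>
  define J where "J \<kappa> = impint (\<lambda>t. (1 / (\<kappa> + t\<^sup>2)) *\<^sub>R g (\<kappa> + t\<^sup>2))" for \<kappa>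
  define T where "T \<kappa> = sqrt \<kappa> *\<^sub>R (X * I \<kappa>)" for \<kappa>
  have XI: "T \<kappa> = (pi / 2) *\<^sub>R X - sqrt \<kappa> *\<^sub>R J \<kappa>" and J: "norm (sqrt \<kappa> *\<^sub>R J \<kappa>) \<le> 4 * C\<^sup>2 * inverse (sqrt \<kappa>)"
    if \<kappa>: "1 \<le> \<kappa>" for \<kappa>
  proof -
    have pos: "0 < \<kappa> + t\<^sup>2" for t using \<kappa> by (simp add: add_pos_nonneg)
    have d1: "decays (2 * 1) (\<lambda>t. 1 / (\<kappa> + t\<^sup>2))"
    proof (rule decays_inverse_square)
      show "continuous_on {0..} (\<lambda>t. 1 / (\<kappa> + t\<^sup>2))"
        using pos by (intro continuous_intros) (auto simp: less_imp_neq[symmetric])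
      show "norm (1 / (\<kappa> + t\<^sup>2)) \<le> 1 / (1 + t\<^sup>2)" for t
        using \<kappa> pos[of t] by (auto intro!: divide_left_mono mult_pos_pos add_pos_nonneg)
    qed simp
    have d2: "decays (2 * (C\<^sup>2 / \<kappa>)) (\<lambda>t. (1 / (\<kappa> + t\<^sup>2)) *\<^sub>R g (\<kappa> + t\<^sup>2))"
    proof (rule decays_inverse_square)
      show "continuous_on {0..} (\<lambda>t. (1 / (\<kappa> + t\<^sup>2)) *\<^sub>R g (\<kappa> + t\<^sup>2))"
        using pos by (intro continuous_intros continuous_g_shift) (auto simp: less_imp_neq[symmetric])
      show "norm ((1 / (\<kappa> + t\<^sup>2)) *\<^sub>R g (\<kappa> + t\<^sup>2)) \<le> C\<^sup>2 / \<kappa> / (1 + t\<^sup>2)" for t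
      proof -
        have "norm (g (\<kappa> + t\<^sup>2)) \<le> C\<^sup>2 / (1 + (\<kappa> + t\<^sup>2))"
          using pos[of t] by (intro norm_g) auto
        also have "\<dots> \<le> C\<^sup>2 / (1 + t\<^sup>2)"
          using \<kappa> by (intro divide_left_mono) (auto intro!: mult_pos_pos add_pos_nonneg)
        finally have "(1 / (\<kappa> + t\<^sup>2)) * norm (g (\<kappa> + t\<^sup>2)) \<le> (1 / \<kappa>) * (C\<^sup>2 / (1 + t\<^sup>2))"
          using \<kappa> pos[of t] by (intro mult_mono divide_left_mono mult_pos_pos) auto
        then show ?thesis using pos[of t] by simp
      qed
    qed (use \<kappa> in auto)
    from norm_impint[OF d2] have nJ: "norm (J \<kappa>) \<le> 4 * C\<^sup>2 / \<kappa>" by (simp add: J_def)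
    have "norm (sqrt \<kappa> *\<^sub>R J \<kappa>) \<le> sqrt \<kappa> * (4 * C\<^sup>2 / \<kappa>)"
      using \<kappa> nJ unfolding norm_scaleR by (intro mult_mono) auto
    also have "\<dots> = 4 * C\<^sup>2 * (sqrt \<kappa> / \<kappa>)" by simp
    also have "sqrt \<kappa> / \<kappa> = inverse (sqrt \<kappa>)"
      using \<kappa> by (simp add: real_div_sqrt inverse_eq_divide divide_simps)
    finally show "norm (sqrt \<kappa> *\<^sub>R J \<kappa>) \<le> 4 * C\<^sup>2 * inverse (sqrt \<kappa>)" .
    obtain K where d1': "decays K (\<lambda>t. (1 / (\<kappa> + t\<^sup>2)) *\<^sub>R X)"
      using decays_linear[OF bounded_linear_scaleR_left d1] by blast
    have "X * I \<kappa> = impint (\<lambda>t. X * g (\<kappa> + t\<^sup>2))"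
      unfolding I_def using \<kappa>
      by (intro impint_linear[OF bounded_linear_mult_right decays_g, symmetric]) auto
    \<comment> \<open>The first term integrates to the arctangent, the second one,
      \<open>J \<kappa>\<close>, is O(1/\<kappa>) and remains negligible after scaling by sqrt
      \<kappa>.\<close>
    also have "\<dots> = impint (\<lambda>t. (1 / (\<kappa> + t\<^sup>2)) *\<^sub>R X - (1 / (\<kappa> + t\<^sup>2)) *\<^sub>R g (\<kappa> + t\<^sup>2))"
    proof (rule impint_cong)
      fix t :: real
      have "X = g (\<kappa> + t\<^sup>2) + (\<kappa> + t\<^sup>2) *\<^sub>R (X * g (\<kappa> + t\<^sup>2))"
        unfolding X_def using pos[of t] by (intro g_eq) auto
      then have "X - g (\<kappa> + t\<^sup>2) = (\<kappa> + t\<^sup>2) *\<^sub>R (X * g (\<kappa> + t\<^sup>2))"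
        by (metis add_diff_cancel_left')
      then have "(1 / (\<kappa> + t\<^sup>2)) *\<^sub>R (X - g (\<kappa> + t\<^sup>2)) = X * g (\<kappa> + t\<^sup>2)"
        using pos[of t] by simp
      then show "X * g (\<kappa> + t\<^sup>2) = (1 / (\<kappa> + t\<^sup>2)) *\<^sub>R X - (1 / (\<kappa> + t\<^sup>2)) *\<^sub>R g (\<kappa> + t\<^sup>2)"
        by (simp only: scaleR_diff_right)
    qed
    also have "\<dots> = impint (\<lambda>t. (1 / (\<kappa> + t\<^sup>2)) *\<^sub>R X) - J \<kappa>"
      unfolding J_def by (rule impint_diff[OF d1' d2])
    also have "impint (\<lambda>t. (1 / (\<kappa> + t\<^sup>2)) *\<^sub>R X) = (pi / (2 * sqrt \<kappa>)) *\<^sub>R X"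
      using impint_linear[OF bounded_linear_scaleR_left d1, of X] arctan_impint[of \<kappa>] \<kappa> by simp
    finally show "T \<kappa> = (pi / 2) *\<^sub>R X - sqrt \<kappa> *\<^sub>R J \<kappa>"
      using \<kappa> by (simp add: T_def scaleR_diff_right)
  qed
  have XIc: "X * I \<kappa> = I \<kappa> * X" if "0 \<le> \<kappa>" for \<kappa>
  proof -
    have "X * I \<kappa> = impint (\<lambda>t. X * g (\<kappa> + t\<^sup>2))"
      unfolding I_def by (rule impint_linear[OF bounded_linear_mult_right decays_g[OF that], symmetric])
    also have "\<dots> = impint (\<lambda>t. g (\<kappa> + t\<^sup>2) * X)"
      using commute_g[of X] by (simp add: X_def mult.assoc)
    also have "\<dots> = I \<kappa> * X"
      unfolding I_def by (rule impint_linear[OF bounded_linear_mult_left decays_g[OF that]])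
    finally show ?thesis .
  qed
  define \<kappa> where "\<kappa> n = 1 + real n" for n
  have \<kappa>: "1 \<le> \<kappa> n" for n by (simp add: \<kappa>_def)
  have inv: "(\<lambda>n. inverse (\<kappa> n)) \<longlonglongrightarrow> 0"
    unfolding \<kappa>_def
    by (intro tendsto_inverse_0_at_top filterlim_tendsto_add_at_top[OF tendsto_const filterlim_real_sequentially])
  then have "(\<lambda>n. sqrt (inverse (\<kappa> n))) \<longlonglongrightarrow> sqrt 0"
    by (rule tendsto_real_sqrt)
  then have inv2: "(\<lambda>n. 4 * C\<^sup>2 * inverse (sqrt (\<kappa> n))) \<longlonglongrightarrow> 0"
    by (intro tendsto_mult_right_zero) (simp add: real_sqrt_inverse)
  have "(\<lambda>n. sqrt (\<kappa> n) *\<^sub>R J (\<kappa> n)) \<longlonglongrightarrow> 0"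
    by (rule Lim_null_comparison[OF always_eventually inv2]) (blast intro: J[OF \<kappa>])
  then have "(\<lambda>n. (pi / 2) *\<^sub>R X - sqrt (\<kappa> n) *\<^sub>R J (\<kappa> n)) \<longlonglongrightarrow> (pi / 2) *\<^sub>R X - 0"
    by (intro tendsto_diff tendsto_const)
  then have T: "(\<lambda>n. T (\<kappa> n)) \<longlonglongrightarrow> (pi / 2) *\<^sub>R X"
    by (simp add: XI[OF \<kappa>])
  have eq: "X * X * (impint G * impint G) = inverse (\<kappa> n) *\<^sub>R (T (\<kappa> n) * T (\<kappa> n)) + X * (T (\<kappa> n) * T (\<kappa> n))" for n
  proof -
    let ?k = "\<kappa> n"
    have TT: "T ?k * T ?k = ?k *\<^sub>R (X * X * (I ?k * I ?k))"
    proof -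
      have "sqrt ?k * sqrt ?k = ?k" using \<kappa>[of n] by simp
      then have "T ?k * T ?k = ?k *\<^sub>R (X * I ?k * (X * I ?k))"
        unfolding T_def by simp
      also have "X * I ?k * (X * I ?k) = X * (I ?k * X) * I ?k" by (simp add: mult.assoc)
      also have "\<dots> = X * X * (I ?k * I ?k)"
        using XIc[of ?k, symmetric] \<kappa>[of n] by (simp add: mult.assoc)
      finally show ?thesis .
    qed
    have "X * X * (impint G * impint G) = X * X * (I ?k * I ?k + ?k *\<^sub>R (X * (I ?k * I ?k)))"
      using ell_square_const[of ?k] \<kappa>[of n] unfolding I_def X_def by simp
    also have "\<dots> = X * X * (I ?k * I ?k) + X * (?k *\<^sub>R (X * X * (I ?k * I ?k)))"
      by (simp add: distrib_left mult.assoc)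
    also have "\<dots> = inverse ?k *\<^sub>R (T ?k * T ?k) + X * (T ?k * T ?k)"
      unfolding TT using \<kappa>[of n] by simp
    finally show ?thesis .
  qed
  have "(\<lambda>n. inverse (\<kappa> n) *\<^sub>R (T (\<kappa> n) * T (\<kappa> n)) + X * (T (\<kappa> n) * T (\<kappa> n))) \<longlonglongrightarrow>
    0 *\<^sub>R ((pi / 2) *\<^sub>R X * (pi / 2) *\<^sub>R X) + X * ((pi / 2) *\<^sub>R X * (pi / 2) *\<^sub>R X)"
    by (intro tendsto_intros inv T)
  then have "X * X * (impint G * impint G) = X * ((pi / 2) *\<^sub>R X * (pi / 2) *\<^sub>R X)"
    unfolding eq[symmetric] by (simp add: LIMSEQ_const_iff)
  then have "A * (A * (A * (A * (impint G * impint G)))) = A * (A * (A * (A * ((pi / 2)\<^sup>2 *\<^sub>R X))))"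
    by (simp add: X_def mult.assoc power2_eq_square)
  then have "impint G * impint G = (pi / 2)\<^sup>2 *\<^sub>R X"
    using inj_eq by blast
  then have "L * L = ((2 / pi)\<^sup>2 * (pi / 2)\<^sup>2) *\<^sub>R X"
    by (simp add: L_def power2_eq_square)
  also have "(2 / pi)\<^sup>2 * (pi / 2)\<^sup>2 = 1" by (simp add: power_divide)
  finally show ?thesis by (simp add: X_def)
qed

text \<open>B is H L, the sign of H, and A^2 B^2 = L^2 = A^2.\<close>

lemma sign_square:
  assumes "A * B = L" "B * A = L"
  shows "B * B = 1"
proof -
  have "A * (A * (B * B)) = A * (L * B)" using assms(1) by (simp add: mult.assoc[symmetric])
  also have "L * B = B * L" using assms by (metis mult.assoc)
  also have "A * (B * L) = A * (A * 1)" using assms(1) L_square by (simp add: mult.assoc[symmetric])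
  finally show ?thesis using inj_eq by blast
qed

end

section \<open>Contour integrals over the imaginary axis\<close>

lemma norm_resolvent_scalar:
  assumes "Re z \<noteq> 0"
  shows "\<exists>K\<ge>0. \<forall>t. cmod (1 / (\<i> * of_real t - z)) \<le> K / sqrt (1 + t\<^sup>2)"
proof -
  define a b where "a = Re z" and "b = Im z"
  have a: "a \<noteq> 0" using assms by (simp add: a_def)
  \<comment> \<open>In M (a^2 + (t - b)^2) the summand 2 of M dominates 2 (t - b)^2 and the quotient
    dominates 1 + 2 b^2.\<close>
  define M where "M = 2 + (1 + 2 * b\<^sup>2) / a\<^sup>2"
  have M: "M \<ge> 0" unfolding M_def by simp
  have "cmod (1 / (\<i> * of_real t - z)) \<le> sqrt M / sqrt (1 + t\<^sup>2)" for t
  proof -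
    have "1 + t\<^sup>2 \<le> 1 + 2 * (t - b)\<^sup>2 + 2 * b\<^sup>2"
      using zero_le_power2[of "t - 2 * b"] by (simp add: power2_eq_square algebra_simps)
    also have "\<dots> \<le> M * (a\<^sup>2 + (t - b)\<^sup>2)"
      using a by (simp add: M_def divide_simps) (simp add: algebra_simps)
    finally have le: "1 + t\<^sup>2 \<le> M * (a\<^sup>2 + (t - b)\<^sup>2)" .
    have "cmod (\<i> * of_real t - z) = sqrt (a\<^sup>2 + (t - b)\<^sup>2)"
      by (simp add: cmod_def a_def b_def)
    moreover have "sqrt (1 + t\<^sup>2) \<le> sqrt M * sqrt (a\<^sup>2 + (t - b)\<^sup>2)"
      using le by (simp flip: real_sqrt_mult)
    moreover have "0 < sqrt (a\<^sup>2 + (t - b)\<^sup>2)" "0 < sqrt (1 + t\<^sup>2)"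
      using a by (simp_all add: add_pos_nonneg)
    ultimately show ?thesis by (simp add: norm_divide divide_simps)
  qed
  then show ?thesis using M by (intro exI[of _ "sqrt M"]) auto
qed

text \<open>Each summand alone is O(1/t) and only the sum is integrable. A primitive is a difference
  of principal logarithms, whose arguments stay in the right half plane because Re z < 0.\<close>

lemma impint_resolvent_scalar_neg:
  assumes "Re z < 0"
  shows "(\<lambda>n. integral {0..real n} (\<lambda>t. 1 / (\<i> * of_real t - z) + 1 / (\<i> * of_real (- t) - z)))
    \<longlonglongrightarrow> of_real pi"
proof -
  define F where "F t = - \<i> * Ln (\<i> * of_real t - z) + \<i> * Ln (- (\<i> * of_real t) - z)" for t
  have nz: "\<i> * of_real t - z \<notin> \<real>\<^sub>\<le>\<^sub>0" "- (\<i> * of_real t) - z \<notin> \<real>\<^sub>\<le>\<^sub>0" for t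
    using assms by (auto simp: complex_nonpos_Reals_iff)
  then have nz': "\<i> * of_real t - z \<noteq> 0" "- (\<i> * of_real t) - z \<noteq> 0" for t
    by (metis nonpos_Reals_zero_I)+
  have "((\<lambda>t. 1 / (\<i> * of_real t - z) + 1 / (\<i> * of_real (- t) - z)) has_integral (F (real n) - F 0)) {0..real n}" for n
  proof (rule fundamental_theorem_of_calculus)
    fix t assume "t \<in> {0..real n}"
    have "((\<lambda>w. - \<i> * Ln (\<i> * w - z) + \<i> * Ln (- (\<i> * w) - z)) has_field_derivative
       1 / (\<i> * of_real t - z) + 1 / (\<i> * of_real (- t) - z)) (at (of_real t))"
      using nz[of t] nz'[of t] by (auto intro!: derivative_eq_intros simp: field_simps)
    then have "((\<lambda>w. - \<i> * Ln (\<i> * w - z) + \<i> * Ln (- (\<i> * w) - z)) \<circ> complex_of_real has_vector_derivative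
       1 / (\<i> * of_real t - z) + 1 / (\<i> * of_real (- t) - z)) (at t within {0..real n})"
      using field_vector_diff_chain_within[OF has_vector_derivative_of_real[OF DERIV_ident] has_field_derivative_at_within]
      by fastforce
    then show "(F has_vector_derivative 1 / (\<i> * of_real t - z) + 1 / (\<i> * of_real (- t) - z)) (at t within {0..real n})"
      by (simp add: F_def[abs_def] o_def)
  qed simp
  then have eq: "integral {0..real n} (\<lambda>t. 1 / (\<i> * of_real t - z) + 1 / (\<i> * of_real (- t) - z)) = F (real n)" for n
    by (simp add: integral_unique F_def)
  \<comment> \<open>Taking n out of both arguments adds the same ln n to both logarithms, and the
    rest tends to Ln(i) - Ln(-i) = i \<pi>.\<close>
  have F: "F (real n) = - \<i> * (Ln (\<i> - z / of_nat n) - Ln (- \<i> - z / of_nat n))" if "n > 0" for n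
  proof -
    have n0: "\<i> - z / of_nat n \<noteq> 0" "- \<i> - z / of_nat n \<noteq> 0"
      using nz'[of "real n"] that by (simp_all add: field_simps)
    have "Ln (of_real (real n) * (\<i> - z / of_nat n)) = of_real (ln (real n)) + Ln (\<i> - z / of_nat n)"
      by (subst Ln_times_of_real) (use n0 that in \<open>auto simp: Ln_of_real simp del: of_real_of_nat_eq\<close>)
    moreover have "Ln (of_real (real n) * (- \<i> - z / of_nat n)) = of_real (ln (real n)) + Ln (- \<i> - z / of_nat n)"
      by (subst Ln_times_of_real) (use n0 that in \<open>auto simp: Ln_of_real simp del: of_real_of_nat_eq\<close>)
    moreover have "of_real (real n) * (\<i> - z / of_nat n) = \<i> * of_real (real n) - z"
      "of_real (real n) * (- \<i> - z / of_nat n) = - (\<i> * of_real (real n)) - z"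
      using that by (simp_all add: field_simps)
    ultimately show ?thesis by (simp add: F_def algebra_simps)
  qed
  have lim0: "(\<lambda>n. z / of_nat n) \<longlonglongrightarrow> 0"
    by (intro tendsto_divide_0[OF tendsto_const] filterlim_compose[OF _ filterlim_real_sequentially] tendsto_of_nat)
  have "(\<lambda>n. - \<i> * (Ln (\<i> - z / of_nat n) - Ln (- \<i> - z / of_nat n))) \<longlonglongrightarrow> - \<i> * (Ln (\<i> - 0) - Ln (- \<i> - 0))"
    by (intro tendsto_intros lim0) (auto simp: complex_nonpos_Reals_iff)
  also have "- \<i> * (Ln (\<i> - 0) - Ln (- \<i> - 0)) = of_real pi"
    by (simp add: algebra_simps)
  finally have "(\<lambda>n. F (real n)) \<longlonglongrightarrow> of_real pi"
    by (rule Lim_transform_eventually)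
      (use eventually_gt_at_top[of 0] in eventually_elim, simp add: F)
  then show "(\<lambda>n. integral {0..real n} (\<lambda>t. 1 / (\<i> * of_real t - z) + 1 / (\<i> * of_real (- t) - z))) \<longlonglongrightarrow> of_real pi"
    by (simp only: eq)
qed

text \<open>Replacing z by - z changes the sign of the integrand, which reduces Re z > 0 to the
  previous case.\<close>

lemma impint_resolvent_scalar:
  assumes "Re z \<noteq> 0"
  shows "impint (\<lambda>t. 1 / (\<i> * of_real t - z) + 1 / (\<i> * of_real (- t) - z)) = of_real (- sgn (Re z) * pi)"
proof (cases "Re z < 0")
  case True
  then show ?thesis using impint_eqI[OF impint_resolvent_scalar_neg[OF True]] by simp
next
  case False
  then have z: "Re (- z) < 0" using assms by simp
  have eq: "1 / (\<i> * of_real t - z) + 1 / (\<i> * of_real (- t) - z)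
    = - (1 / (\<i> * of_real t - (- z)) + 1 / (\<i> * of_real (- t) - (- z)))" for t
  proof -
    have 1: "\<i> * of_real t - z = - (\<i> * of_real (- t) - (- z))"
      and 2: "\<i> * of_real (- t) - z = - (\<i> * of_real t - (- z))" by simp_all
    show ?thesis unfolding 1 2 minus_divide_right[symmetric] by simp
  qed
  have "(\<lambda>n. integral {0..real n} (\<lambda>t. 1 / (\<i> * of_real t - z) + 1 / (\<i> * of_real (- t) - z)))
    \<longlonglongrightarrow> - of_real pi"
    unfolding eq Henstock_Kurzweil_Integration.integral_neg
    by (intro tendsto_minus impint_resolvent_scalar_neg z)
  from impint_eqI[OF this] show ?thesis using False assms by simp
qed

context axis_resolvent
begin

text \<open>For \<open>Re z < 0\<close> the contour integral \<open>Q\<close> is the resolvent of the part with spectrum in the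
  right half-plane, where \<open>A = L\<close>; it is a one-sided inverse of \<open>1 - z A\<close> up to the factor
  \<open>(A + L) / 2\<close>.\<close>

lemma half_plane_resolvent:
  assumes "Re z \<noteq> 0"
  obtains Q where "Q - z *\<^sub>C (A * Q) = (1/2) *\<^sub>R (L - sgn (Re z) *\<^sub>R A)"
    and "\<And>Y. Y * A = A * Y \<Longrightarrow> Y * Q = Q * Y"
proof -
  define c where "c t = 1 / (\<i> * of_real t - z)" for t
  obtain K where K: "K \<ge> 0" "\<And>t. cmod (c t) \<le> K / sqrt (1 + t\<^sup>2)"
    using norm_resolvent_scalar[OF assms] by (auto simp: c_def)
  have nz: "\<i> * of_real t - z \<noteq> 0" for t
    using assms by (auto simp: complex_eq_iff)
  have cont_c: "continuous_on S c" for S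
    unfolding c_def using nz by (intro continuous_intros) auto
  have cont_cm: "continuous_on S (\<lambda>t. c (- t))" for S
    by (intro continuous_on_compose2[OF cont_c[of UNIV]] continuous_intros) auto
  have cont_Rm: "continuous_on S (\<lambda>t. R (- t))" for S
    by (intro continuous_on_compose2[OF continuous_R[of UNIV]] continuous_intros) auto
  have sq: "a / sqrt (1 + t\<^sup>2) * (b / sqrt (1 + t\<^sup>2)) = a * b / (1 + t\<^sup>2)" for a b t :: real
    by simp
  have "c t + c (- t) = - 2 * z * (c t * c (- t))" for t
    using nz[of t] nz[of "- t"] by (simp add: c_def divide_simps)
  moreover have "norm (- 2 * z * (c t * c (- t))) \<le> 2 * cmod z * (K * K / (1 + t\<^sup>2))" for t
  proof -
    have "cmod (c t) * cmod (c (- t)) \<le> K / sqrt (1 + t\<^sup>2) * (K / sqrt (1 + t\<^sup>2))"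
      using K(2)[of t] K(2)[of "- t"] K(1) by (intro mult_mono) auto
    then have "2 * cmod z * (cmod (c t) * cmod (c (- t))) \<le> 2 * cmod z * (K * K / (1 + t\<^sup>2))"
      unfolding sq by (intro mult_left_mono) auto
    then show ?thesis by (simp add: norm_mult)
  qed
  ultimately have "norm (c t + c (- t)) \<le> (2 * cmod z * (K * K)) / (1 + t\<^sup>2)" for t
    by simp
  then have dc: "decays (2 * (2 * cmod z * (K * K))) (\<lambda>t. c t + c (- t))"
    using K(1) by (intro decays_inverse_square continuous_intros cont_c cont_cm) auto
  define q where "q t = c t *\<^sub>C R t + c (- t) *\<^sub>C R (- t)" for t
  have "norm (q t) \<le> 2 * (K * C) / (1 + t\<^sup>2)" for t
  proof -
    have "norm (c t *\<^sub>C R t) \<le> K * C / (1 + t\<^sup>2)" for t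
      unfolding norm_scaleC sq[symmetric] using K(1,2) norm_R C_nonneg by (intro mult_mono) auto
    from this[of t] this[of "- t", unfolded power2_minus] norm_triangle_ineq[of "c t *\<^sub>C R t" "c (- t) *\<^sub>C R (- t)"]
    have "norm (q t) \<le> K * C / (1 + t\<^sup>2) + K * C / (1 + t\<^sup>2)"
      unfolding q_def by linarith
    then show ?thesis by (simp add: mult.commute)
  qed
  then have dq: "decays (2 * (2 * (K * C))) q"
    unfolding q_def[abs_def] using K(1) C_nonneg
    by (intro decays_inverse_square continuous_intros cont_c cont_cm cont_Rm continuous_R) auto
  have bl: "bounded_linear (\<lambda>x. x - z *\<^sub>C (A * x))"
    by (intro bounded_linear_sub bounded_linear_ident
        bounded_linear_compose[OF bounded_linear_scaleC] bounded_linear_mult_right)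
  \<comment> \<open>The resolvent identity gives (1 - z A) R(t) = A + (it - z) A R(t), and c(t) is
    chosen to cancel the factor it - z.\<close>
  have piece: "c t *\<^sub>C R t - z *\<^sub>C (A * (c t *\<^sub>C R t)) = c t *\<^sub>C A + A * R t" for t
  proof -
    have "R t - z *\<^sub>C (A * R t) = A + (\<i> * of_real t - z) *\<^sub>C (A * R t)"
      by (subst R_left) (simp add: scaleC_diff_left)
    then have "c t *\<^sub>C (R t - z *\<^sub>C (A * R t)) = c t *\<^sub>C A + (c t * (\<i> * of_real t - z)) *\<^sub>C (A * R t)"
      by (simp only: scaleC_add_right scaleC_scaleC)
    also have "c t * (\<i> * of_real t - z) = 1" using nz[of t] by (simp add: c_def)
    finally show ?thesis by (simp add: scaleC_diff_right scaleC_scaleC scaleC_one mult.commute)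
  qed
  have "impint q - z *\<^sub>C (A * impint q) = impint (\<lambda>t. q t - z *\<^sub>C (A * q t))"
    by (rule impint_linear[OF bl dq, symmetric])
  \<comment> \<open>Pairing t with - t turns c into an integrable scalar function and A R into 2 G;
    this allows the integral to be split.\<close>
  also have "\<dots> = impint (\<lambda>t. (c t + c (- t)) *\<^sub>C A + 2 *\<^sub>R G t)"
  proof (rule impint_cong)
    fix t :: real
    have "q t - z *\<^sub>C (A * q t) = (c t *\<^sub>C R t - z *\<^sub>C (A * (c t *\<^sub>C R t)))
       + (c (- t) *\<^sub>C R (- t) - z *\<^sub>C (A * (c (- t) *\<^sub>C R (- t))))"
      by (simp add: q_def distrib_left scaleC_add_right)
    also have "\<dots> = (c t + c (- t)) *\<^sub>C A + A * (R t + R (- t))"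
      unfolding piece by (simp add: scaleC_add_left distrib_left)
    finally show "q t - z *\<^sub>C (A * q t) = (c t + c (- t)) *\<^sub>C A + 2 *\<^sub>R G t"
      by (simp only: A_mult_R_sym)
  qed
  also have "\<dots> = impint (\<lambda>t. (c t + c (- t)) *\<^sub>C A) + impint (\<lambda>t. 2 *\<^sub>R G t)"
    using decays_linear[OF bounded_bilinear.bounded_linear_left[OF bounded_bilinear_scaleC] dc]
      decays_linear[OF bounded_linear_scaleR_right decays_G] impint_add by blast
  also have "impint (\<lambda>t. 2 *\<^sub>R G t) = pi *\<^sub>R L"
    using impint_linear[OF bounded_linear_scaleR_right decays_G, of 2] by (simp add: L_def)
  also have "impint (\<lambda>t. (c t + c (- t)) *\<^sub>C A) = (- sgn (Re z) * pi) *\<^sub>R A"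
    using impint_linear[OF bounded_bilinear.bounded_linear_left[OF bounded_bilinear_scaleC] dc, of A]
      impint_resolvent_scalar[OF assms] by (simp add: c_def scaleR_scaleC)
  finally have main: "impint q - z *\<^sub>C (A * impint q) = (- sgn (Re z) * pi) *\<^sub>R A + pi *\<^sub>R L" .
  show ?thesis
  proof (rule that[of "(1 / (2 * pi)) *\<^sub>R impint q"])
    have "(1 / (2 * pi)) *\<^sub>R impint q - z *\<^sub>C (A * (1 / (2 * pi)) *\<^sub>R impint q)
      = (1 / (2 * pi)) *\<^sub>R (impint q - z *\<^sub>C (A * impint q))"
      by (simp add: scaleR_diff_right scaleR_scaleC_commute)
    also have "\<dots> = (1/2) *\<^sub>R (L - sgn (Re z) *\<^sub>R A)"
      unfolding main by (simp add: scaleR_add_right scaleR_diff_right)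
    finally show "(1 / (2 * pi)) *\<^sub>R impint q - z *\<^sub>C (A * (1 / (2 * pi)) *\<^sub>R impint q)
      = (1/2) *\<^sub>R (L - sgn (Re z) *\<^sub>R A)" .
    fix Y assume Y: "Y * A = A * Y"
    have "Y * impint q = impint (\<lambda>t. Y * q t)"
      by (rule impint_linear[OF bounded_linear_mult_right dq, symmetric])
    also have "\<dots> = impint (\<lambda>t. q t * Y)"
      by (simp add: q_def distrib_left distrib_right commute_R[OF Y])
    also have "\<dots> = impint q * Y"
      by (rule impint_linear[OF bounded_linear_mult_left dq])
    finally show "Y * (1 / (2 * pi)) *\<^sub>R impint q = (1 / (2 * pi)) *\<^sub>R impint q * Y" by simp
  qed
qed

end

section \<open>Perturbation of the sign operator\<close>

definition invertible_element :: "'a :: monoid_mult \<Rightarrow> bool" where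
  "invertible_element x \<longleftrightarrow> (\<exists>y. x * y = 1 \<and> y * x = 1)"

lemma invertible_element_mult:
  assumes "invertible_element x" "invertible_element y"
  shows "invertible_element (x * y)"
proof -
  obtain x' y' where "x * x' = 1" "x' * x = 1" "y * y' = 1" "y' * y = 1"
    using assms by (auto simp: invertible_element_def)
  then have "(x * y) * (y' * x') = 1" "(y' * x') * (x * y) = 1"
    by (metis mult.assoc mult.right_neutral)+
  then show ?thesis unfolding invertible_element_def by blast
qed

text \<open>The two products give x a right inverse y u and a left inverse v y, which must
  coincide.\<close>

lemma invertible_element_of_products:
  assumes "invertible_element (x * y)" "invertible_element (y * x)"
  shows "invertible_element x"
proof -
  obtain u v where u: "(x * y) * u = 1" and v: "v * (y * x) = 1"
    using assms by (auto simp: invertible_element_def)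
  have "v * y = v * y * (x * (y * u))" using u by (simp add: mult.assoc)
  also have "\<dots> = (v * (y * x)) * (y * u)" by (simp add: mult.assoc)
  also have "\<dots> = y * u" using v by simp
  finally have "v * y = y * u" .
  then show ?thesis
    unfolding invertible_element_def using u v by (metis mult.assoc)
qed

definition neumann :: "'a :: {real_normed_algebra_1, banach} \<Rightarrow> 'a" where
  "neumann x = (\<Sum>n. (- x) ^ n)"

lemma neumann:
  fixes x :: "'a :: {real_normed_algebra_1, banach}"
  assumes "norm x < 1"
  shows "(1 + x) * neumann x = 1" "neumann x * (1 + x) = 1" "norm (neumann x) \<le> 1 / (1 - norm x)"
proof -
  have s: "summable (\<lambda>n. (- x) ^ n)"
    using assms by (intro complete_algebra_summable_geometric) simp
  have split: "neumann x = 1 + (\<Sum>n. (- x) ^ Suc n)"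
    unfolding neumann_def by (subst suminf_split_head[OF s]) simp
  have "(\<Sum>n. (- x) ^ Suc n) = - x * neumann x"
    unfolding neumann_def power_Suc by (rule suminf_mult[OF s])
  with split have "neumann x = 1 + - x * neumann x" by (simp only:)
  then show l: "(1 + x) * neumann x = 1" by (simp add: distrib_right eq_diff_eq)
  have "(\<Sum>n. (- x) ^ Suc n) = neumann x * (- x)"
    unfolding neumann_def power_Suc2 by (rule suminf_mult2[OF s, symmetric])
  with split have "neumann x = 1 + neumann x * (- x)" by (simp only:)
  then show "neumann x * (1 + x) = 1" by (simp add: distrib_left eq_diff_eq)
  \<comment> \<open>The bound follows from the equation neumann x = 1 - x * neumann x, without
    summing norms.\<close>
  have "norm (neumann x) = norm (1 - x * neumann x)"
    using l by (metis add_diff_cancel_right' distrib_right mult_1)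
  also have "\<dots> \<le> 1 + norm x * norm (neumann x)"
    using norm_triangle_ineq4[of 1 "x * neumann x"] norm_mult_ineq[of x "neumann x"] by simp
  finally show "norm (neumann x) \<le> 1 / (1 - norm x)"
    using assms by (simp add: field_simps)
qed

lemma invertible_neumann:
  fixes x :: "'a :: {real_normed_algebra_1, banach}"
  shows "norm x < 1 \<Longrightarrow> invertible_element (1 + x)"
  unfolding invertible_element_def using neumann[of x] by blast

lemma invertible_element_scaleR:
  fixes x :: "'a :: real_normed_algebra_1"
  assumes "invertible_element x" "r \<noteq> 0"
  shows "invertible_element (r *\<^sub>R x)"
proof -
  obtain y where "x * y = 1" "y * x = 1" using assms by (auto simp: invertible_element_def)
  then show ?thesis
    unfolding invertible_element_def using assms(2) by (intro exI[of _ "inverse r *\<^sub>R y"]) simp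
qed

text \<open>Two involutions \<open>a\<close> and \<open>b\<close> are intertwined by \<open>1 + a b\<close>, which is close to \<open>2\<close> if
  \<open>a\<close> is close to \<open>b\<close>.\<close>

lemma intertwine_involutions:
  fixes a b :: "'a :: ring_1"
  assumes "a * a = 1" "b * b = 1"
  shows "(1 + a * b) * b = a * (1 + a * b)"
  using assms by (simp add: distrib_left distrib_right mult.assoc[symmetric])
    (simp add: mult.assoc add.commute)

text \<open>Since a^2 = 1, 1 + a b = 2 (1 + a (b - a) / 2), and the correction has norm below
  1.\<close>

lemma similar_near_involutions:
  fixes a b :: "'a :: {real_normed_algebra_1, banach}"
  assumes "a * a = 1" "b * b = 1" "norm a * norm (b - a) < 2"
  shows "invertible_element (1 + a * b)"
proof -
  have "1 + a * b = 2 *\<^sub>R (1 + (1/2) *\<^sub>R (a * (b - a)))"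
    using assms(1) by (simp add: scaleR_add_right right_diff_distrib scaleR_2)
  moreover have "norm ((1/2) *\<^sub>R (a * (b - a))) < 1"
    using norm_mult_ineq[of a "b - a"] assms(3) by simp
  ultimately show ?thesis
    using invertible_element_scaleR[OF invertible_neumann, of "(1/2) *\<^sub>R (a * (b - a))" 2] by simp
qed

text \<open>The path is cut into pieces so short that consecutive involutions are similar, and the
  intertwiners are multiplied. A Lipschitz path is bounded, so one step length serves
  everywhere.\<close>

lemma similar_path_involutions:
  fixes \<beta> :: "real \<Rightarrow> 'a :: {real_normed_algebra_1, banach}"
  assumes inv: "\<And>t. t \<in> {0..1} \<Longrightarrow> \<beta> t * \<beta> t = 1"
    and lip: "\<And>s t. s \<in> {0..1} \<Longrightarrow> t \<in> {0..1} \<Longrightarrow> norm (\<beta> s - \<beta> t) \<le> M * \<bar>s - t\<bar>"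
  shows "\<exists>S. invertible_element S \<and> S * \<beta> 1 = \<beta> 0 * S"
proof -
  have M: "M \<ge> 0" using lip[of 0 1] order_trans[OF norm_ge_zero] by auto
  define B where "B = norm (\<beta> 0) + M"
  have B: "norm (\<beta> t) \<le> B" if "t \<in> {0..1}" for t
  proof -
    have "norm (\<beta> t) \<le> norm (\<beta> 0) + norm (\<beta> t - \<beta> 0)"
      by (metis add.commute diff_add_cancel norm_triangle_ineq)
    also have "\<dots> \<le> norm (\<beta> 0) + M * \<bar>t - 0\<bar>" using lip[of t 0] that by simp
    also have "\<dots> \<le> B" using that M by (simp add: B_def mult_left_le)
    finally show ?thesis .
  qed
  have B0: "B \<ge> 0" using M by (simp add: B_def)
  \<comment> \<open>With this n every step satisfies |a| |b - a| \<le> B M / n < 1.\<close>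
  obtain n :: nat where n: "B * M < real n" using reals_Archimedean2 by blast
  then have n0: "real n > 0" using B0 M by (smt (verit) mult_nonneg_nonneg)
  have "k \<le> n \<Longrightarrow> \<exists>S. invertible_element S \<and> S * \<beta> (real k / real n) = \<beta> 0 * S" for k
  proof (induction k)
    case 0
    show ?case by (intro exI[of _ 1]) (simp add: invertible_element_def)
  next
    case (Suc k)
    then obtain S where S: "invertible_element S" "S * \<beta> (real k / real n) = \<beta> 0 * S" by auto
    let ?a = "\<beta> (real k / real n)" and ?b = "\<beta> (real (Suc k) / real n)"
    have mem: "real k / real n \<in> {0..1}" "real (Suc k) / real n \<in> {0..1}"
      using Suc.prems n0 by auto
    have "norm (?b - ?a) \<le> M * \<bar>real (Suc k) / real n - real k / real n\<bar>"
      by (rule lip[OF mem(2,1)])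
    also have "\<bar>real (Suc k) / real n - real k / real n\<bar> = 1 / real n"
      using n0 by (simp add: diff_divide_distrib[symmetric])
    finally have "norm ?a * norm (?b - ?a) \<le> B * (M * (1 / real n))"
      using B[OF mem(1)] B0 by (intro mult_mono) auto
    also have "\<dots> < 2" using n n0 by (simp add: divide_less_eq)
    finally have T: "invertible_element (1 + ?a * ?b)"
      by (rule similar_near_involutions[OF inv[OF mem(1)] inv[OF mem(2)]])
    have "S * (1 + ?a * ?b) * ?b = \<beta> 0 * (S * (1 + ?a * ?b))"
      using intertwine_involutions[OF inv[OF mem(1)] inv[OF mem(2)]] S(2) by (metis mult.assoc)
    then show ?case using invertible_element_mult[OF S(1) T] by blast
  qed
  from this[of n] n0 show ?thesis by auto
qed

section \<open>Resolvents and signs along the path H_0 + \<tau> V\<close>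

lemma resolvent_of_perturbation:
  fixes a P u U :: "'a :: complex_banach_algebra_1"
  assumes "(u - s *\<^sub>C a) * P = 1" "P * (u - s *\<^sub>C a) = 1" "u * U = 1" "U * u = 1"
  shows "P = U + s *\<^sub>C (U * a * P)" "P = U + s *\<^sub>C (P * a * U)"
proof -
  have "u * P = 1 + s *\<^sub>C (a * P)" using assms(1) by (simp add: left_diff_distrib diff_eq_eq)
  then have "U * (u * P) = U * (1 + s *\<^sub>C (a * P))" by simp
  then show "P = U + s *\<^sub>C (U * a * P)"
    using assms(4) by (simp add: distrib_left mult.assoc[symmetric])
  have "P * u = 1 + s *\<^sub>C (P * a)" using assms(2) by (simp add: right_diff_distrib diff_eq_eq)
  then have "P * u * U = (1 + s *\<^sub>C (P * a)) * U" by simp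
  then show "P = U + s *\<^sub>C (P * a * U)"
    using assms(3) by (simp add: distrib_right mult.assoc)
qed

text \<open>\<open>W\<close> stands for V H_0^(-1), so that W + it W R(t) is V (H_0 - it)^(-1); the
  potential enters only through these bounded operators. \<open>B\<close> is the sign of H_0,
  characterised by its products with A.\<close>

locale axis_perturbation = axis_resolvent +
  fixes B W :: 'a and q K :: real
  assumes AB: "A * B = L" and BA: "B * A = L"
    and right_inj: "Y * A = 0 \<Longrightarrow> Y = 0"
    and q: "q < 1"
    and W_le_q: "norm (W + (\<i> * t) *\<^sub>C (W * R t)) \<le> q"
    and W_decay: "norm (W + (\<i> * t) *\<^sub>C (W * R t)) \<le> K * (1 + \<bar>t\<bar>) powr (-1/2)"
begin

definition Wt :: "real \<Rightarrow> 'a" where "Wt t = W + (\<i> * t) *\<^sub>C (W * R t)"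

lemma K_nonneg: "K \<ge> 0"
  using order_trans[OF norm_ge_zero W_decay[of 0]] by simp

definition Y :: "real \<Rightarrow> real \<Rightarrow> 'a" where "Y \<tau> t = neumann (\<tau> *\<^sub>R Wt t)"

lemma Y:
  assumes "\<tau> \<in> {0..1}"
  shows "(1 + \<tau> *\<^sub>R Wt t) * Y \<tau> t = 1" "Y \<tau> t * (1 + \<tau> *\<^sub>R Wt t) = 1" "norm (Y \<tau> t) \<le> 1 / (1 - q)"
proof -
  have "norm (\<tau> *\<^sub>R Wt t) \<le> 1 * q"
    using assms W_le_q[of t] unfolding norm_scaleR Wt_def by (intro mult_mono) auto
  then have n: "norm (\<tau> *\<^sub>R Wt t) \<le> q" by simp
  then have "norm (\<tau> *\<^sub>R Wt t) < 1" using q by simp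
  note * = neumann[OF this, folded Y_def]
  show "(1 + \<tau> *\<^sub>R Wt t) * Y \<tau> t = 1" "Y \<tau> t * (1 + \<tau> *\<^sub>R Wt t) = 1" by (rule *)+
  have "1 / (1 - norm (\<tau> *\<^sub>R Wt t)) \<le> 1 / (1 - q)" using n q by (intro divide_left_mono) auto
  with *(3) show "norm (Y \<tau> t) \<le> 1 / (1 - q)" by linarith
qed

text \<open>As \<open>Y \<tau> t\<close> is the inverse of 1 + \<tau> V R(t), this is the resolvent
  of H_0 + \<tau> V at it, and \<open>Ap \<tau>\<close> is the inverse of H_0 + \<tau> V.\<close>

definition Rp :: "real \<Rightarrow> real \<Rightarrow> 'a" where "Rp \<tau> t = R t * Y \<tau> t"
definition Ap :: "real \<Rightarrow> 'a" where "Ap \<tau> = A * Y \<tau> 0"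

text \<open>With s = it, the element u - s A is (H_0 + \<tau> V - s) A. It factors as (1 + \<tau> W
  e) (1 - s A) with e = (1 - s A)^(-1) = 1 + s R(t), so its inverse is e Y and the perturbed
  resolvent is A e Y.\<close>

lemma axis_resolvent_perturbed:
  assumes \<tau>: "\<tau> \<in> {0..1}"
  shows "axis_resolvent (Ap \<tau>) (Rp \<tau>) (C / (1 - q))"
proof
  fix t :: real and Z :: 'a
  define s where "s = \<i> * complex_of_real t"
  define e where "e = 1 + s *\<^sub>C R t"
  define u where "u = 1 + \<tau> *\<^sub>R W"
  note Rl = R_left[of t, folded s_def] and Rr = R_right[of t, folded s_def]
  have sR: "s *\<^sub>C R t = s *\<^sub>C A + s *\<^sub>C s *\<^sub>C (A * R t)" "s *\<^sub>C R t = s *\<^sub>C A + s *\<^sub>C s *\<^sub>C (R t * A)"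
    using arg_cong[OF Rl, of "scaleC s"] arg_cong[OF Rr, of "scaleC s"] unfolding scaleC_add_right .
  have "(1 - s *\<^sub>C A) * e = 1 + (s *\<^sub>C R t - (s *\<^sub>C A + s *\<^sub>C s *\<^sub>C (A * R t)))"
    by (simp add: e_def algebra_simps scaleC_diff_right)
  with sR(1) have fe: "(1 - s *\<^sub>C A) * e = 1" by (metis diff_self add_0_right)
  have "e * (1 - s *\<^sub>C A) = 1 + (s *\<^sub>C R t - (s *\<^sub>C A + s *\<^sub>C s *\<^sub>C (R t * A)))"
    by (simp add: e_def algebra_simps scaleC_diff_right scaleC_add_right)
  with sR(2) have ef: "e * (1 - s *\<^sub>C A) = 1" by (metis diff_self add_0_right)
  have We: "W * e = Wt t" by (simp add: e_def Wt_def distrib_left s_def)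
  have "A * e = A + s *\<^sub>C (A * R t)" by (simp add: e_def distrib_left)
  then have Ae: "A * e = R t" by (rule trans[OF _ Rl[symmetric]])
  let ?P = "e * Y \<tau> t"
  have W0: "Wt 0 = W" by (simp add: Wt_def)
  have uP: "u - s *\<^sub>C A = (1 - s *\<^sub>C A) + \<tau> *\<^sub>R W" by (simp add: u_def)
  have P1: "(u - s *\<^sub>C A) * ?P = 1"
  proof -
    have "(u - s *\<^sub>C A) * ?P = ((1 - s *\<^sub>C A) * e + \<tau> *\<^sub>R (W * e)) * Y \<tau> t"
      unfolding uP by (simp only: distrib_right mult.assoc mult_scaleR_left)
    then show ?thesis unfolding fe We using Y[OF \<tau>] by simp
  qed
  have P2: "?P * (u - s *\<^sub>C A) = 1"
  proof -
    have "u - s *\<^sub>C A = (1 + \<tau> *\<^sub>R (W * e)) * (1 - s *\<^sub>C A)"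
      unfolding uP by (simp only: distrib_right mult_scaleR_left mult.assoc ef mult_1_left mult_1_right)
    then have "?P * (u - s *\<^sub>C A) = e * (Y \<tau> t * (1 + \<tau> *\<^sub>R Wt t)) * (1 - s *\<^sub>C A)"
      unfolding We by (simp add: mult.assoc)
    then show ?thesis using Y[OF \<tau>] ef by simp
  qed
  have U: "u * Y \<tau> 0 = 1" "Y \<tau> 0 * u = 1" using Y[OF \<tau>, of 0] by (simp_all add: u_def W0)
  have RP: "Rp \<tau> t = A * ?P" using Ae by (simp add: Rp_def mult.assoc[symmetric])
  note * = resolvent_of_perturbation[OF P1 P2 U]
  show "Rp \<tau> t = Ap \<tau> + (\<i> * complex_of_real t) *\<^sub>C (Ap \<tau> * Rp \<tau> t)"
    using arg_cong[OF *(1), of "\<lambda>x. A * x"]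
    unfolding RP Ap_def s_def distrib_left scaleC_mult_right mult.assoc .
  show "Rp \<tau> t = Ap \<tau> + (\<i> * complex_of_real t) *\<^sub>C (Rp \<tau> t * Ap \<tau>)"
    using arg_cong[OF *(2), of "\<lambda>x. A * x"]
    unfolding RP Ap_def s_def distrib_left scaleC_mult_right mult.assoc .
  show "Z = 0" if "Ap \<tau> * Z = 0"
  proof -
    have "Y \<tau> 0 * Z = 0" using that inj by (simp add: Ap_def mult.assoc)
    then have "u * (Y \<tau> 0 * Z) = 0" by simp
    then show ?thesis using U by (simp add: mult.assoc[symmetric])
  qed
  have "norm (Rp \<tau> t) \<le> (C / sqrt (1 + t\<^sup>2)) * (1 / (1 - q))"
    unfolding Rp_def using norm_R[of t] Y(3)[OF \<tau>, of t] C_nonneg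
    by (intro order_trans[OF norm_mult_ineq] mult_mono) auto
  then show "norm (Rp \<tau> t) \<le> C / (1 - q) / sqrt (1 + t\<^sup>2)" by (simp add: mult.commute)
qed

text \<open>The integrand of \<pi> times the difference of the signs of H_0 + \<tau> V and of
  H_0.\<close>

definition \<Delta> :: "real \<Rightarrow> real \<Rightarrow> 'a" where
  "\<Delta> \<tau> t = (Rp \<tau> t - R t) + (Rp \<tau> (- t) - R (- t))"

lemma inverse_sqrt_decay:
  assumes "0 \<le> t"
  shows "1 / sqrt (1 + t\<^sup>2) * (1 + t) powr (-1/2) \<le> sqrt 2 * (1 + t) powr (-3/2)"
proof -
  have "(1 + t)\<^sup>2 \<le> 2 * (1 + t\<^sup>2)"
    using zero_le_power2[of "1 - t"] by (simp add: power2_eq_square algebra_simps)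
  then have "1 + t \<le> sqrt 2 * sqrt (1 + t\<^sup>2)"
    using assms by (metis real_le_rsqrt real_sqrt_mult)
  then have "1 / sqrt (1 + t\<^sup>2) \<le> sqrt 2 * (1 / (1 + t))"
    using assms by (simp add: divide_simps add_pos_nonneg)
  then have "1 / sqrt (1 + t\<^sup>2) * (1 + t) powr (-1/2) \<le> sqrt 2 * (1 / (1 + t)) * (1 + t) powr (-1/2)"
    by (rule mult_right_mono) simp
  also have "1 / (1 + t) = (1 + t) powr (-1)"
    using assms by (simp add: powr_minus_divide)
  also have "sqrt 2 * (1 + t) powr (-1) * (1 + t) powr (-1/2) = sqrt 2 * (1 + t) powr (-3/2)"
    by (simp only: mult.assoc powr_add[symmetric]) simp
  finally show ?thesis .
qed

text \<open>The source of the exponent 3/2: R(t) is O(1/t) and V R(t) is O(|t|^(-1/2)). The signs of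
  the two arguments are independent because V R(t) also meets R(-t).\<close>

lemma norm_R_Wt:
  assumes "\<bar>s\<bar> = \<bar>t\<bar>"
  shows "norm (R t) * norm (Wt s) \<le> sqrt 2 * C * K * (1 + \<bar>t\<bar>) powr (-3/2)"
proof -
  have "norm (R t) * norm (Wt s) \<le> (C / sqrt (1 + \<bar>t\<bar>\<^sup>2)) * (K * (1 + \<bar>t\<bar>) powr (-1/2))"
    using norm_R[of t] W_decay[of s] assms K_nonneg C_nonneg unfolding Wt_def by (intro mult_mono) auto
  also have "\<dots> = C * K * (1 / sqrt (1 + \<bar>t\<bar>\<^sup>2) * (1 + \<bar>t\<bar>) powr (-1/2))"
    by simp
  also have "\<dots> \<le> C * K * (sqrt 2 * (1 + \<bar>t\<bar>) powr (-3/2))"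
    using C_nonneg K_nonneg by (intro mult_left_mono inverse_sqrt_decay) auto
  finally show ?thesis by (simp add: mult_ac)
qed

text \<open>The identity Y_\<sigma> - Y_\<tau> = (\<tau> - \<sigma>) Y_\<sigma> (V R) Y_\<tau>
  supplies both the Lipschitz factor and the factor V R with its extra decay.\<close>

lemma norm_Rp_diff:
  assumes "\<sigma> \<in> {0..1}" "\<tau> \<in> {0..1}"
  shows "norm (Rp \<sigma> t - Rp \<tau> t) \<le>
    \<bar>\<sigma> - \<tau>\<bar> * (sqrt 2 * C * K / (1 - q)\<^sup>2) * (1 + \<bar>t\<bar>) powr (-3/2)"
proof -
  have "Y \<sigma> t - Y \<tau> t = Y \<sigma> t * ((1 + \<tau> *\<^sub>R Wt t) * Y \<tau> t) - (Y \<sigma> t * (1 + \<sigma> *\<^sub>R Wt t)) * Y \<tau> t"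
    using Y[OF assms(1)] Y[OF assms(2)] by simp
  also have "\<dots> = (\<tau> - \<sigma>) *\<^sub>R (Y \<sigma> t * Wt t * Y \<tau> t)"
    by (simp add: algebra_simps)
  finally have "Rp \<sigma> t - Rp \<tau> t = (\<tau> - \<sigma>) *\<^sub>R (R t * (Y \<sigma> t * Wt t * Y \<tau> t))"
    by (simp add: Rp_def right_diff_distrib[symmetric])
  also have "norm \<dots> \<le> \<bar>\<sigma> - \<tau>\<bar> * (norm (R t) * (norm (Y \<sigma> t) * norm (Wt t) * norm (Y \<tau> t)))"
    by (auto intro!: mult_mono order_trans[OF norm_mult_ineq] simp: abs_minus_commute)
  also have "\<dots> \<le> \<bar>\<sigma> - \<tau>\<bar> * (norm (R t) * ((1 / (1 - q)) * norm (Wt t) * (1 / (1 - q))))"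
    using Y(3)[OF assms(1)] Y(3)[OF assms(2)] q by (intro mult_left_mono mult_mono) auto
  also have "\<dots> = \<bar>\<sigma> - \<tau>\<bar> * (1 / (1 - q)\<^sup>2) * (norm (R t) * norm (Wt t))"
    by (simp add: power2_eq_square)
  also have "\<dots> \<le> \<bar>\<sigma> - \<tau>\<bar> * (1 / (1 - q)\<^sup>2) * (sqrt 2 * C * K * (1 + \<bar>t\<bar>) powr (-3/2))"
    by (intro mult_left_mono norm_R_Wt) auto
  finally show ?thesis by (simp add: mult_ac)
qed

lemma Rp_0: "Rp 0 t = R t"
  using neumann(1)[of "0 :: 'a"] by (simp add: Rp_def Y_def)

lemma continuous_reflect: "continuous_on S (\<lambda>t. R (- t))"
  by (intro continuous_on_compose2[OF continuous_R[of UNIV]] continuous_intros) auto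

lemma continuous_Rp:
  assumes "\<tau> \<in> {0..1}"
  shows "continuous_on S (Rp \<tau>)" "continuous_on S (\<lambda>t. Rp \<tau> (- t))"
proof -
  interpret P: axis_resolvent "Ap \<tau>" "Rp \<tau>" "C / (1 - q)" by (rule axis_resolvent_perturbed[OF assms])
  show "continuous_on S (Rp \<tau>)" by (rule P.continuous_R)
  show "continuous_on S (\<lambda>t. Rp \<tau> (- t))"
    by (intro continuous_on_compose2[OF P.continuous_R[of UNIV]] continuous_intros) auto
qed

lemma decays_\<Delta>_diff:
  assumes "\<sigma> \<in> {0..1}" "\<tau> \<in> {0..1}"
  shows "decays (\<bar>\<sigma> - \<tau>\<bar> * (2 * (sqrt 2 * C * K / (1 - q)\<^sup>2))) (\<lambda>t. \<Delta> \<sigma> t - \<Delta> \<tau> t)"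
  unfolding decays_def
proof (intro conjI allI impI)
  show "continuous_on {0..} (\<lambda>t. \<Delta> \<sigma> t - \<Delta> \<tau> t)"
    unfolding \<Delta>_def
    by (intro continuous_intros continuous_R continuous_Rp assms continuous_reflect)
  fix t :: real assume t: "0 \<le> t"
  have "\<Delta> \<sigma> t - \<Delta> \<tau> t = (Rp \<sigma> t - Rp \<tau> t) + (Rp \<sigma> (- t) - Rp \<tau> (- t))"
    by (simp add: \<Delta>_def)
  also have "norm \<dots> \<le> norm (Rp \<sigma> t - Rp \<tau> t) + norm (Rp \<sigma> (- t) - Rp \<tau> (- t))"
    by (rule norm_triangle_ineq)
  also have "\<dots> \<le> \<bar>\<sigma> - \<tau>\<bar> * (sqrt 2 * C * K / (1 - q)\<^sup>2) * (1 + \<bar>t\<bar>) powr (-3/2)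
      + \<bar>\<sigma> - \<tau>\<bar> * (sqrt 2 * C * K / (1 - q)\<^sup>2) * (1 + \<bar>- t\<bar>) powr (-3/2)"
    by (intro add_mono norm_Rp_diff assms)
  finally show "norm (\<Delta> \<sigma> t - \<Delta> \<tau> t) \<le> \<bar>\<sigma> - \<tau>\<bar> * (2 * (sqrt 2 * C * K / (1 - q)\<^sup>2)) * (1 + t) powr (-3/2)"
    using t by (simp add: mult_ac)
qed

lemma \<Delta>_0: "\<Delta> 0 t = 0"
  by (simp add: \<Delta>_def Rp_0)

lemma decays_\<Delta>:
  assumes "\<tau> \<in> {0..1}"
  shows "\<exists>K. decays K (\<Delta> \<tau>)"
  using decays_\<Delta>_diff[OF assms, of 0] by (auto simp: \<Delta>_0)

text \<open>The sign of H_0 + \<tau> V, with the part that does not converge in norm collected in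
  B.\<close>

definition Bp :: "real \<Rightarrow> 'a" where "Bp \<tau> = B + (1 / pi) *\<^sub>R impint (\<Delta> \<tau>)"

lemma Bp_0: "Bp 0 = B"
proof -
  have "impint (\<Delta> 0) = impint (\<lambda>_. 0)" by (rule impint_cong) (simp add: \<Delta>_0)
  then show ?thesis by (simp add: Bp_def impint_def)
qed

lemma Bp_lipschitz:
  assumes "\<sigma> \<in> {0..1}" "\<tau> \<in> {0..1}"
  shows "norm (Bp \<sigma> - Bp \<tau>) \<le> (1 / pi * (4 * (sqrt 2 * C * K / (1 - q)\<^sup>2))) * \<bar>\<sigma> - \<tau>\<bar>"
proof -
  obtain K1 K2 where "decays K1 (\<Delta> \<sigma>)" "decays K2 (\<Delta> \<tau>)"
    using decays_\<Delta> assms by blast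
  then have "Bp \<sigma> - Bp \<tau> = (1 / pi) *\<^sub>R impint (\<lambda>t. \<Delta> \<sigma> t - \<Delta> \<tau> t)"
    by (simp add: Bp_def impint_diff scaleR_diff_right)
  then have "norm (Bp \<sigma> - Bp \<tau>) = (1 / pi) * norm (impint (\<lambda>t. \<Delta> \<sigma> t - \<Delta> \<tau> t))"
    by simp
  also have "\<dots> \<le> (1 / pi) * (2 * (\<bar>\<sigma> - \<tau>\<bar> * (2 * (sqrt 2 * C * K / (1 - q)\<^sup>2))))"
    by (intro mult_left_mono norm_impint decays_\<Delta>_diff assms) auto
  finally show ?thesis by (simp add: mult_ac)
qed

text \<open>Writing R(t) as R(-t) + 2 it R(t) R(-t) collects the two resolvents into V R(t) times
  R(-t), which shows the decay of order 3/2.\<close>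

lemma W_sym: "W * (R t + R (- t)) = 2 *\<^sub>R (Wt t * R (- t))"
proof -
  have "Wt t * R (- t) = W * (R (- t) + (\<i> * t) *\<^sub>C (R t * R (- t)))"
    by (simp add: Wt_def distrib_right distrib_left mult.assoc)
  moreover have "R t - R (- t) = 2 *\<^sub>R ((\<i> * t) *\<^sub>C (R t * R (- t)))"
    using R_diff[of t "- t"] by (simp add: scaleR_2 scaleC_add_left[symmetric] algebra_simps)
  then have "R t + R (- t) = 2 *\<^sub>R (R (- t) + (\<i> * t) *\<^sub>C (R t * R (- t)))"
    by (simp add: scaleR_add_right scaleR_2 diff_eq_eq add.assoc add.commute)
  ultimately show ?thesis by simp
qed

lemma decays_W_sym: "decays (2 * (sqrt 2 * C * K)) (\<lambda>t. W * (R t + R (- t)))"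
  unfolding decays_def
proof (intro conjI allI impI)
  show "continuous_on {0..} (\<lambda>t. W * (R t + R (- t)))"
    by (intro continuous_intros continuous_R continuous_reflect)
  fix t :: real assume t: "0 \<le> t"
  have "norm (W * (R t + R (- t))) \<le> 2 * (norm (R (- t)) * norm (Wt t))"
    unfolding W_sym using norm_mult_ineq[of "Wt t" "R (- t)"] by (simp add: mult.commute)
  also have "\<dots> \<le> 2 * (sqrt 2 * C * K * (1 + \<bar>- t\<bar>) powr (-3/2))"
    by (intro mult_left_mono norm_R_Wt) auto
  finally show "norm (W * (R t + R (- t))) \<le> 2 * (sqrt 2 * C * K) * (1 + t) powr (-3/2)"
    using t by simp
qed

text \<open>Multiplied by A on the right the integrand becomes 2 W G, with integral \<pi> W L =
  \<pi> W B A; the factor A is then cancelled on the right, for which \<open>right_inj\<close> is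
  assumed.\<close>

lemma impint_W_sym: "impint (\<lambda>t. W * (R t + R (- t))) = pi *\<^sub>R (W * B)"
proof -
  have "impint (\<lambda>t. W * (R t + R (- t))) * A = impint (\<lambda>t. W * (R t + R (- t)) * A)"
    by (rule impint_linear[OF bounded_linear_mult_left decays_W_sym, symmetric])
  also have "\<dots> = impint (\<lambda>t. (2 *\<^sub>R W) * G t)"
  proof (rule impint_cong)
    fix t
    have "(R t + R (- t)) * A = 2 *\<^sub>R G t"
      using A_mult_R_sym[of t] by (simp add: distrib_left distrib_right R_comm_A)
    then show "W * (R t + R (- t)) * A = (2 *\<^sub>R W) * G t" by (simp add: mult.assoc)
  qed
  also have "\<dots> = (2 *\<^sub>R W) * impint G"
    by (rule impint_linear[OF bounded_linear_mult_right decays_G])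
  also have "\<dots> = pi *\<^sub>R (W * L)" by (simp add: L_def)
  also have "\<dots> = (pi *\<^sub>R (W * B)) * A" by (simp add: BA[symmetric] mult.assoc)
  finally have "(impint (\<lambda>t. W * (R t + R (- t))) - pi *\<^sub>R (W * B)) * A = 0"
    by (simp add: left_diff_distrib)
  then show ?thesis using right_inj by fastforce
qed

text \<open>After multiplication by Ap the parts of \<Delta> can be integrated separately. On the
  right, (R(t) + R(-t)) Ap = 2 G Y; on the left, Ap = A - \<tau> Ap W leaves a term with W that
  \<open>impint_W_sym\<close> evaluates. The terms with the free L cancel against the contribution
  of B.\<close>

lemma Bp:
  assumes \<tau>: "\<tau> \<in> {0..1}"
  shows "Ap \<tau> * Bp \<tau> = axis_resolvent.L (Rp \<tau>)" "Bp \<tau> * Ap \<tau> = axis_resolvent.L (Rp \<tau>)"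
proof -
  interpret P: axis_resolvent "Ap \<tau>" "Rp \<tau>" "C / (1 - q)" by (rule axis_resolvent_perturbed[OF \<tau>])
  obtain K\<Delta> where d\<Delta>: "decays K\<Delta> (\<Delta> \<tau>)" using decays_\<Delta>[OF \<tau>] by blast
  have W0: "Wt 0 = W" by (simp add: Wt_def)
  have Ap: "Ap \<tau> * (1 + \<tau> *\<^sub>R W) = A"
    using Y(2)[OF \<tau>, of 0] by (simp add: Ap_def W0 mult.assoc)
  have G2: "decays (2 * (2 * (C / (1 - q))\<^sup>2)) (\<lambda>t. 2 *\<^sub>R P.G t)" "decays (2 * (2 * C\<^sup>2)) (\<lambda>t. 2 *\<^sub>R G t)"
    using P.decays_G decays_G by (auto simp: decays_def intro!: continuous_intros)
  have i2: "impint (\<lambda>t. 2 *\<^sub>R P.G t) = pi *\<^sub>R P.L" "impint (\<lambda>t. 2 *\<^sub>R G t) = pi *\<^sub>R L"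
    using impint_linear[OF bounded_linear_scaleR_right P.decays_G, of 2]
      impint_linear[OF bounded_linear_scaleR_right decays_G, of 2] by (simp_all add: P.L_def L_def)
  have \<Delta>_sym: "\<Delta> \<tau> t = (Rp \<tau> t + Rp \<tau> (- t)) - (R t + R (- t))" for t
    by (simp add: \<Delta>_def)
  have "impint (\<Delta> \<tau>) * Ap \<tau> = impint (\<lambda>t. \<Delta> \<tau> t * Ap \<tau>)"
    by (rule impint_linear[OF bounded_linear_mult_left d\<Delta>, symmetric])
  also have "\<dots> = impint (\<lambda>t. 2 *\<^sub>R P.G t - (2 *\<^sub>R G t) * Y \<tau> 0)"
  proof (rule impint_cong)
    fix t
    have "(Rp \<tau> t + Rp \<tau> (- t)) * Ap \<tau> = 2 *\<^sub>R P.G t"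
      using P.A_mult_R_sym[of t] by (simp add: distrib_left distrib_right P.R_comm_A)
    moreover have "(R t + R (- t)) * Ap \<tau> = (2 *\<^sub>R G t) * Y \<tau> 0"
      using A_mult_R_sym[of t] unfolding Ap_def mult.assoc[symmetric]
      by (simp add: distrib_left distrib_right R_comm_A)
    ultimately show "\<Delta> \<tau> t * Ap \<tau> = 2 *\<^sub>R P.G t - (2 *\<^sub>R G t) * Y \<tau> 0"
      unfolding \<Delta>_sym left_diff_distrib by simp
  qed
  also have "\<dots> = impint (\<lambda>t. 2 *\<^sub>R P.G t) - impint (\<lambda>t. (2 *\<^sub>R G t) * Y \<tau> 0)"
    using decays_linear[OF bounded_linear_mult_left G2(2)] impint_diff[OF G2(1)] by blast
  also have "\<dots> = pi *\<^sub>R P.L - pi *\<^sub>R (L * Y \<tau> 0)"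
    using impint_linear[OF bounded_linear_mult_left G2(2)] by (simp add: i2)
  finally have "(1 / pi) *\<^sub>R (impint (\<Delta> \<tau>) * Ap \<tau>) = P.L - L * Y \<tau> 0"
    by (simp add: scaleR_diff_right)
  then show "Bp \<tau> * Ap \<tau> = P.L"
    by (simp add: Bp_def distrib_right) (simp add: Ap_def BA mult.assoc[symmetric])
  have "Ap \<tau> * impint (\<Delta> \<tau>) = impint (\<lambda>t. Ap \<tau> * \<Delta> \<tau> t)"
    by (rule impint_linear[OF bounded_linear_mult_right d\<Delta>, symmetric])
  also have "\<dots> = impint (\<lambda>t. (2 *\<^sub>R P.G t - 2 *\<^sub>R G t) + (\<tau> *\<^sub>R Ap \<tau>) * (W * (R t + R (- t))))"
  proof (rule impint_cong)
    fix t
    define S where "S = R t + R (- t)"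
    have "A * S = (Ap \<tau> * (1 + \<tau> *\<^sub>R W)) * S" by (simp only: Ap)
    also have "\<dots> = Ap \<tau> * S + (\<tau> *\<^sub>R Ap \<tau>) * (W * S)"
      by (simp add: distrib_left distrib_right mult.assoc)
    finally have "Ap \<tau> * (R t + R (- t)) = A * (R t + R (- t)) - (\<tau> *\<^sub>R Ap \<tau>) * (W * (R t + R (- t)))"
      by (simp only: S_def eq_diff_eq)
    then show "Ap \<tau> * \<Delta> \<tau> t = (2 *\<^sub>R P.G t - 2 *\<^sub>R G t) + (\<tau> *\<^sub>R Ap \<tau>) * (W * (R t + R (- t)))"
      unfolding \<Delta>_sym right_diff_distrib P.A_mult_R_sym A_mult_R_sym by simp
  qed
  also have "\<dots> = impint (\<lambda>t. 2 *\<^sub>R P.G t - 2 *\<^sub>R G t) + impint (\<lambda>t. (\<tau> *\<^sub>R Ap \<tau>) * (W * (R t + R (- t))))"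
  proof -
    have "decays (2 * (2 * (C / (1 - q))\<^sup>2) + 2 * (2 * C\<^sup>2)) (\<lambda>t. 2 *\<^sub>R P.G t - 2 *\<^sub>R G t)"
      using G2 unfolding decays_def
      by (auto intro!: continuous_intros order_trans[OF norm_triangle_ineq4] simp: distrib_right add_mono)
    then show ?thesis
      using decays_linear[OF bounded_linear_mult_right decays_W_sym] impint_add by blast
  qed
  also have "\<dots> = pi *\<^sub>R P.L - pi *\<^sub>R L + (\<tau> *\<^sub>R Ap \<tau>) * (pi *\<^sub>R (W * B))"
    unfolding impint_diff[OF G2] i2 impint_linear[OF bounded_linear_mult_right decays_W_sym] impint_W_sym ..
  finally have "(1 / pi) *\<^sub>R (Ap \<tau> * impint (\<Delta> \<tau>)) = P.L - L + \<tau> *\<^sub>R (Ap \<tau> * (W * B))"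
    by (simp add: scaleR_diff_right scaleR_add_right)
  then have "Ap \<tau> * Bp \<tau> = P.L - A * B + Ap \<tau> * (1 + \<tau> *\<^sub>R W) * B"
    by (simp add: Bp_def AB algebra_simps)
  then show "Ap \<tau> * Bp \<tau> = P.L" by (simp add: Ap)
qed

lemma perturbed_similar:
  obtains S where "invertible_element S" "S * Bp 1 = B * S"
proof -
  have "Bp \<tau> * Bp \<tau> = 1" if "\<tau> \<in> {0..1}" for \<tau>
    by (rule axis_resolvent.sign_square[OF axis_resolvent_perturbed[OF that] Bp[OF that]])
  from similar_path_involutions[OF this Bp_lipschitz] show ?thesis
    using that by (auto simp: Bp_0)
qed

end

section \<open>Selfadjoint resolvents\<close>

context axis_resolvent
begin

text \<open>The argument of \<open>commute_R\<close> with A^2 in place of A. It serves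
  \<open>\<sigma>\<^sub>3\<close>, which commutes with the square of the free A although not with
  A.\<close>

lemma square_commute_G:
  assumes "Y * (A * A) = (A * A) * Y"
  shows "Y * G t = G t * Y"
proof -
  define D where "D = Y * G t - G t * Y"
  have "A * A * G t = G t * (A * A)"
    using G_comm_A[of t] by (metis mult.assoc)
  with G_eq[of t] have GX: "G t = A * A - t\<^sup>2 *\<^sub>R (G t * (A * A))" by simp
  have "Y * G t = Y * (A * A - t\<^sup>2 *\<^sub>R (A * A * G t))" by (rule arg_cong[OF G_eq])
  also have "\<dots> = A * A * Y - t\<^sup>2 *\<^sub>R (A * A * (Y * G t))"
    using assms by (simp only: right_diff_distrib mult_scaleR_right mult.assoc[symmetric])
  finally have 1: "Y * G t = A * A * Y - t\<^sup>2 *\<^sub>R (A * A * (Y * G t))" .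
  have "G t * Y = (A * A - t\<^sup>2 *\<^sub>R (A * A * G t)) * Y" by (rule arg_cong[OF G_eq])
  also have "\<dots> = A * A * Y - t\<^sup>2 *\<^sub>R (A * A * (G t * Y))"
    by (simp only: left_diff_distrib mult_scaleR_left mult.assoc)
  finally have 2: "G t * Y = A * A * Y - t\<^sup>2 *\<^sub>R (A * A * (G t * Y))" .
  have "D = (A * A * Y - t\<^sup>2 *\<^sub>R (A * A * (Y * G t))) - (A * A * Y - t\<^sup>2 *\<^sub>R (A * A * (G t * Y)))"
    unfolding D_def by (rule arg_cong2[OF 1 2])
  also have "\<dots> = - (t\<^sup>2 *\<^sub>R (A * A * D))"
    by (simp add: D_def right_diff_distrib scaleR_diff_right)
  finally have "D = - (t\<^sup>2 *\<^sub>R (A * A * D))" .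
  then have D: "G t * D = - (t\<^sup>2 *\<^sub>R (G t * (A * A) * D))"
    by (metis mult.assoc mult_minus_right mult_scaleR_right)
  have "G t * D = (A * A - t\<^sup>2 *\<^sub>R (G t * (A * A))) * D" by (rule arg_cong[OF GX])
  also have "\<dots> = A * A * D - t\<^sup>2 *\<^sub>R (G t * (A * A) * D)"
    by (simp only: left_diff_distrib mult_scaleR_left)
  finally have "A * (A * D) = 0" using D by (simp add: mult.assoc)
  then have "D = 0" using inj by blast
  then show ?thesis by (simp add: D_def)
qed

lemma square_commute_L:
  assumes "Y * (A * A) = (A * A) * Y"
  shows "Y * L = L * Y"
proof -
  have "Y * impint G = impint (\<lambda>t. Y * G t)"
    by (rule impint_linear[OF bounded_linear_mult_right decays_G, symmetric])
  also have "\<dots> = impint (\<lambda>t. G t * Y)" by (simp add: square_commute_G[OF assms])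
  also have "\<dots> = impint G * Y"
    by (rule impint_linear[OF bounded_linear_mult_left decays_G])
  finally show ?thesis by (simp add: L_def)
qed

lemma L_comm_A: "L * A = A * L"
  using commute_L[of A] by simp

lemma L_inj: "L * x = 0 \<Longrightarrow> x = 0"
proof -
  assume "L * x = 0"
  then have "L * L * x = 0" by (simp add: mult.assoc)
  then have "A * (A * x) = 0" by (simp add: L_square mult.assoc)
  then show "x = 0" using inj by blast
qed

end

text \<open>For s = 1 / (1 + |T|^2) the element s (1 + T) has distance at most sqrt (1 - s) from 1:
  in the square of |(1 - s) f - s T f| the mixed term is nonpositive by accretivity.\<close>

lemma invertible_one_plus_accretive:
  fixes T :: "'a :: {complex_normed_vector, real_inner, perfect_space, banach} cop"
  assumes "\<And>f. 0 \<le> inner (T \<bullet>\<^sub>o f) f"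
  shows "invertible_element (1 + T)"
proof -
  define M where "M = norm T"
  define s where "s = 1 / (1 + M\<^sup>2)"
  have s: "0 < s" "s \<le> 1" "s * (1 + M\<^sup>2) = 1"
    using add_pos_nonneg[OF zero_less_one zero_le_power2[of M]] by (auto simp: s_def divide_simps)
  have "norm (((1 - s) *\<^sub>R 1 - s *\<^sub>R T) \<bullet>\<^sub>o f) \<le> sqrt (1 - s) * norm f" for f
  proof (rule power2_le_imp_le)
    have "(norm (((1 - s) *\<^sub>R 1 - s *\<^sub>R T) \<bullet>\<^sub>o f))\<^sup>2
        = (1 - s)\<^sup>2 * (norm f)\<^sup>2 - 2 * ((1 - s) * s) * inner (T \<bullet>\<^sub>o f) f + s\<^sup>2 * (norm (T \<bullet>\<^sub>o f))\<^sup>2"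
    proof -
      have *: "(norm (a - b))\<^sup>2 = (norm a)\<^sup>2 - 2 * inner b a + (norm b)\<^sup>2" for a b :: 'a
        by (simp add: power2_norm_eq_inner inner_diff_left inner_diff_right inner_commute)
      have "((1 - s) *\<^sub>R 1 - s *\<^sub>R T) \<bullet>\<^sub>o f = (1 - s) *\<^sub>R f - s *\<^sub>R (T \<bullet>\<^sub>o f)"
        by simp
      then show ?thesis
        by (simp only: * norm_scaleR inner_scaleR_left inner_scaleR_right power_mult_distrib power2_abs)
    qed
    also have "\<dots> \<le> (1 - s)\<^sup>2 * (norm f)\<^sup>2 - 0 + s\<^sup>2 * (M * norm f)\<^sup>2"
      using assms[of f] s norm_cop_apply[of T f] unfolding M_def
      by (intro add_mono diff_mono mult_left_mono power_mono) auto
    also have "\<dots> = (1 - 2 * s + s * (s * (1 + M\<^sup>2))) * (norm f)\<^sup>2"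
      by (simp add: power2_eq_square algebra_simps)
    also have "\<dots> = (sqrt (1 - s) * norm f)\<^sup>2"
      using s by (simp add: power_mult_distrib)
    finally show "(norm (((1 - s) *\<^sub>R 1 - s *\<^sub>R T) \<bullet>\<^sub>o f))\<^sup>2 \<le> (sqrt (1 - s) * norm f)\<^sup>2" .
  qed (use s in auto)
  then have "norm ((1 - s) *\<^sub>R 1 - s *\<^sub>R T) \<le> sqrt (1 - s)"
    by (rule norm_cop_bound[rotated]) (use s in auto)
  also have "\<dots> < 1" using s by simp
  finally have "invertible_element (1 + - ((1 - s) *\<^sub>R 1 - s *\<^sub>R T))"
    by (intro invertible_neumann) (simp only: norm_minus_cancel)
  also have "1 + - ((1 - s) *\<^sub>R 1 - s *\<^sub>R T) = s *\<^sub>R (1 + T)"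
    by (simp add: scaleR_diff_left scaleR_add_right)
  finally have "invertible_element (s *\<^sub>R (1 + T))" .
  from invertible_element_scaleR[OF this, of "inverse s"] s show ?thesis by simp
qed

text \<open>\<open>inner\<close> is a real inner product, in the application the real part of the
  Hermitian one; for complex linear operators it determines the adjoint, so the first assumption
  says that the adjoint of R(t) is R(-t).\<close>

locale selfadjoint_axis = axis_resolvent A R C
  for A :: "'h :: {complex_normed_vector, real_inner, perfect_space, banach} cop" and R C +
  assumes adjoint: "inner (R t \<bullet>\<^sub>o f) h = inner f (R (- t) \<bullet>\<^sub>o h)"
    and vec_inj: "A \<bullet>\<^sub>o f = 0 \<Longrightarrow> f = 0"
begin

lemma G_symmetric: "inner (G t \<bullet>\<^sub>o f) h = inner f (G t \<bullet>\<^sub>o h)"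
  using adjoint[of t "R (- t) \<bullet>\<^sub>o f" h] adjoint[of "- t" f "R (- t) \<bullet>\<^sub>o h"]
  by (simp add: G_def)

lemma G_positive: "0 \<le> inner (G t \<bullet>\<^sub>o f) f"
  using adjoint[of t "R (- t) \<bullet>\<^sub>o f" f] by (simp add: G_def)

lemma A_symmetric: "inner (A \<bullet>\<^sub>o f) h = inner f (A \<bullet>\<^sub>o h)"
  using adjoint[of 0 f h] by (simp add: R_0)

lemma bounded_linear_form: "bounded_linear (\<lambda>T :: 'h cop. inner (T \<bullet>\<^sub>o f) h)"
  by (rule bounded_linear_compose[OF bounded_linear_inner_left bounded_linear_cop_left])

lemma L_form: "inner (L \<bullet>\<^sub>o f) h = 2 / pi * impint (\<lambda>t. inner (G t \<bullet>\<^sub>o f) h)"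
  by (simp add: L_def impint_linear[OF bounded_linear_form decays_G])

lemma L_symmetric: "inner (L \<bullet>\<^sub>o f) h = inner f (L \<bullet>\<^sub>o h)"
proof -
  have "inner (G t \<bullet>\<^sub>o h) f = inner (G t \<bullet>\<^sub>o f) h" for t
    by (metis G_symmetric inner_commute)
  then have "inner (L \<bullet>\<^sub>o h) f = inner (L \<bullet>\<^sub>o f) h" by (simp only: L_form)
  then show ?thesis by (simp only: inner_commute)
qed

lemma L_positive: "0 \<le> inner (L \<bullet>\<^sub>o f) f"
proof -
  obtain K where "decays K (\<lambda>t. inner (G t \<bullet>\<^sub>o f) f)"
    using decays_linear[OF bounded_linear_form decays_G] by blast
  note impint_tendsto[OF this]
  moreover have "0 \<le> integral {0..real n} (\<lambda>t. inner (G t \<bullet>\<^sub>o f) f)" for n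
    using decays_integrable[OF \<open>decays K _\<close>, of 0 "real n"] G_positive
    by (intro Henstock_Kurzweil_Integration.integral_nonneg) auto
  ultimately have "0 \<le> impint (\<lambda>t. inner (G t \<bullet>\<^sub>o f) f)"
    by (intro LIMSEQ_le_const) auto
  then show ?thesis by (simp add: L_form)
qed

lemma norm_L_apply: "norm (L \<bullet>\<^sub>o f) = norm (A \<bullet>\<^sub>o f)"
proof -
  have "inner (L \<bullet>\<^sub>o f) (L \<bullet>\<^sub>o f) = inner f ((L * L) \<bullet>\<^sub>o f)"
    by (simp add: L_symmetric)
  also have "\<dots> = inner (A \<bullet>\<^sub>o f) (A \<bullet>\<^sub>o f)"
    unfolding L_square by (simp add: A_symmetric)
  finally show ?thesis by (simp add: norm_eq_sqrt_inner)
qed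

text \<open>The vectors \<open>f - n (H\<^sup>2 + n)\<^sup>-\<^sup>1 f\<close> decrease in norm, and positivity of the resolvents bounds the
  norm of their increments by the decrease; this replaces an argument with density of the
  domain.\<close>

lemma approximate_identity: "(\<lambda>n. real n *\<^sub>R (g (real n) \<bullet>\<^sub>o f)) \<longlonglongrightarrow> f"
proof -
  define e where "e n = f - real n *\<^sub>R (g (real n) \<bullet>\<^sub>o f)" for n
  have step: "e k - e n = (real n - real k) *\<^sub>R (g (real k) \<bullet>\<^sub>o e n)" for k n
  proof -
    have "(g (real k) - g (real n)) \<bullet>\<^sub>o f = ((real n - real k) *\<^sub>R (g (real k) * g (real n))) \<bullet>\<^sub>o f"
      by (subst g_diff) auto
    then have *: "g (real k) \<bullet>\<^sub>o f - g (real n) \<bullet>\<^sub>o f = (real n - real k) *\<^sub>R (g (real k) \<bullet>\<^sub>o (g (real n) \<bullet>\<^sub>o f))"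
      by simp
    have "(real n - real k) *\<^sub>R (g (real k) \<bullet>\<^sub>o e n) = (real n - real k) *\<^sub>R (g (real k) \<bullet>\<^sub>o f)
        - real n *\<^sub>R ((real n - real k) *\<^sub>R (g (real k) \<bullet>\<^sub>o (g (real n) \<bullet>\<^sub>o f)))"
      by (simp add: e_def cop_diff cop_scaleR scaleR_diff_right)
    also have "\<dots> = real n *\<^sub>R (g (real n) \<bullet>\<^sub>o f) - real k *\<^sub>R (g (real k) \<bullet>\<^sub>o f)"
      unfolding *[symmetric] by (simp add: scaleR_diff_right scaleR_diff_left)
    finally show ?thesis by (simp add: e_def)
  qed
  have pos: "0 \<le> inner (e k - e n) (e n)" if "k \<le> n" for k n
    unfolding step using that G_positive[of "sqrt (real k)" "e n"] by (simp add: g_def)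
  have incr: "(norm (e n - e k))\<^sup>2 \<le> (norm (e k))\<^sup>2 - (norm (e n))\<^sup>2" if "k \<le> n" for k n
  proof -
    have "(norm (e k))\<^sup>2 = (norm (e n))\<^sup>2 + (norm (e n - e k))\<^sup>2 + 2 * inner (e k - e n) (e n)"
      by (simp add: power2_norm_eq_inner inner_diff_left inner_diff_right inner_commute)
    then show ?thesis using pos[OF that] by linarith
  qed
  have "decseq (\<lambda>n. (norm (e n))\<^sup>2)"
    unfolding decseq_def using incr by (metis diff_ge_0_iff_ge order_trans zero_le_power2)
  then have "convergent (\<lambda>n. (norm (e n))\<^sup>2)"
    using decseq_convergent[of "\<lambda>n. (norm (e n))\<^sup>2" 0] by (auto simp: convergent_def)
  then have C: "Cauchy (\<lambda>n. (norm (e n))\<^sup>2)" by (simp add: Cauchy_convergent_iff)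
  have "Cauchy e"
  proof (rule metric_CauchyI)
    fix \<epsilon> :: real assume "\<epsilon> > 0"
    then obtain M where M: "\<And>m n. m \<ge> M \<Longrightarrow> n \<ge> M \<Longrightarrow> dist ((norm (e m))\<^sup>2) ((norm (e n))\<^sup>2) < \<epsilon>\<^sup>2"
      using metric_CauchyD[OF C, of "\<epsilon>\<^sup>2"] by auto
    have *: "dist (e n) (e k) < \<epsilon>" if "M \<le> k" "k \<le> n" for k n
    proof -
      have "(norm (e n - e k))\<^sup>2 < \<epsilon>\<^sup>2"
        using incr[OF that(2)] M[of k n] that by (auto simp: dist_real_def)
      then show ?thesis using \<open>\<epsilon> > 0\<close> by (simp add: dist_norm power2_less_imp_less)
    qed
    show "\<exists>M. \<forall>m\<ge>M. \<forall>n\<ge>M. dist (e m) (e n) < \<epsilon>"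
      using * by (metis dist_commute nle_le)
  qed
  then obtain l where l: "e \<longlonglongrightarrow> l" using Cauchy_convergent_iff convergent_def by blast
  \<comment> \<open>As e_n = H^2 (H^2 + n)^(-1) f, applying A^2 gives (H^2 + n)^(-1) f, which tends
    to 0; so A^2 annihilates the limit.\<close>
  have "(\<lambda>n. A \<bullet>\<^sub>o (A \<bullet>\<^sub>o e n)) \<longlonglongrightarrow> A \<bullet>\<^sub>o (A \<bullet>\<^sub>o l)"
    by (intro bounded_linear.tendsto[OF bounded_linear_cop] l)
  moreover have "A \<bullet>\<^sub>o (A \<bullet>\<^sub>o e n) = g (real n) \<bullet>\<^sub>o f" for n
  proof -
    have "(A * A) \<bullet>\<^sub>o f = (g (real n) + real n *\<^sub>R (A * A * g (real n))) \<bullet>\<^sub>o f"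
      by (rule arg_cong[OF g_eq]) simp
    then show ?thesis by (simp add: e_def cop_diff cop_scaleR)
  qed
  moreover have "(\<lambda>n. g (real n) \<bullet>\<^sub>o f) \<longlonglongrightarrow> 0"
  proof (rule Lim_null_comparison)
    show "\<forall>\<^sub>F n in sequentially. norm (g (real n) \<bullet>\<^sub>o f) \<le> (C\<^sup>2 * norm f) * inverse (1 + real n)"
    proof (rule always_eventually, rule allI)
      fix n
      have "norm (g (real n) \<bullet>\<^sub>o f) \<le> norm (g (real n)) * norm f" by (rule norm_cop_apply)
      also have "\<dots> \<le> C\<^sup>2 / (1 + real n) * norm f" by (intro mult_right_mono norm_g) auto
      finally show "norm (g (real n) \<bullet>\<^sub>o f) \<le> (C\<^sup>2 * norm f) * inverse (1 + real n)"
        by (simp add: field_simps)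
    qed
    show "(\<lambda>n. (C\<^sup>2 * norm f) * inverse (1 + real n)) \<longlonglongrightarrow> 0"
      by (intro tendsto_mult_right_zero tendsto_inverse_0_at_top
        filterlim_tendsto_add_at_top[OF tendsto_const filterlim_real_sequentially])
  qed
  ultimately have "A \<bullet>\<^sub>o (A \<bullet>\<^sub>o l) = 0" using LIMSEQ_unique by fastforce
  then have "l = 0" using vec_inj by blast
  then have "(\<lambda>n. f - e n) \<longlonglongrightarrow> f - 0" using l by (intro tendsto_diff) auto
  then show ?thesis by (simp add: e_def)
qed

text \<open>If Y A = 0 then Y (H^2 + n)^(-1) = 0, while n (H^2 + n)^(-1) tends strongly to 1. This
  takes the place of density of the range of A.\<close>

lemma right_inj:
  assumes "Y * A = 0"
  shows "Y = 0"
proof (rule cop_eqI)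
  fix f
  have Yg: "Y * g \<mu> = 0" if "0 \<le> \<mu>" for \<mu>
  proof -
    have "A * A = g \<mu> + \<mu> *\<^sub>R (A * A * g \<mu>)" using that by (rule g_eq)
    then have "Y * (A * A) = Y * (g \<mu> + \<mu> *\<^sub>R (A * A * g \<mu>))" by (rule arg_cong)
    then show ?thesis using assms by (simp add: distrib_left mult.assoc[symmetric])
  qed
  have "(\<lambda>n. Y \<bullet>\<^sub>o (real n *\<^sub>R (g (real n) \<bullet>\<^sub>o f))) \<longlonglongrightarrow> Y \<bullet>\<^sub>o f"
    by (rule bounded_linear.tendsto[OF bounded_linear_cop approximate_identity])
  moreover have "Y \<bullet>\<^sub>o (real n *\<^sub>R (g (real n) \<bullet>\<^sub>o f)) = 0" for n
    using Yg[of "real n"] by (simp add: cop_scaleR flip: cop_apply_mult)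
  ultimately show "Y \<bullet>\<^sub>o f = 0 \<bullet>\<^sub>o f" by (simp add: LIMSEQ_const_iff)
qed

text \<open>Since \<open>\<parallel>L f\<parallel> = \<parallel>A f\<parallel>\<close>, the operator \<open>L A\<^sup>-\<^sup>1\<close> is isometric on the range of \<open>A\<close>.\<close>

lemma sign_exists:
  obtains B where "A * B = L" "B * A = L"
proof -
  \<comment> \<open>S_n is H (H^2 + n)^(-1), so n L S_n approximates L H, the sign of H.\<close>
  define S where "S n = (1/2) *\<^sub>R (R (sqrt (real n)) + R (- sqrt (real n)))" for n
  have AS: "A * S n = g (real n)" for n
    using A_mult_R_sym[of "sqrt (real n)"] by (simp add: S_def g_def distrib_left scaleR_2 flip: scaleR_add_right)
  have SA: "S n * A = A * S n" for n
    by (simp add: S_def distrib_left distrib_right R_comm_A)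
  define T where "T n = real n *\<^sub>R (L * S n)" for n
  define e where "e n f = real n *\<^sub>R (g (real n) \<bullet>\<^sub>o f)" for n f
  have e: "(\<lambda>n. e n f) \<longlonglongrightarrow> f" for f unfolding e_def by (rule approximate_identity)
  \<comment> \<open>Replacing L by A inside the norm turns T_m f - T_n f into a difference of the
    approximate identity, so T_n f is Cauchy for every f.\<close>
  have normT: "norm (T m \<bullet>\<^sub>o f - T n \<bullet>\<^sub>o f) = norm (e m f - e n f)" for m n f
  proof -
    have "T m \<bullet>\<^sub>o f - T n \<bullet>\<^sub>o f = L \<bullet>\<^sub>o (real m *\<^sub>R (S m \<bullet>\<^sub>o f) - real n *\<^sub>R (S n \<bullet>\<^sub>o f))"
      by (simp add: T_def cop_diff cop_scaleR)
    also have "norm \<dots> = norm (A \<bullet>\<^sub>o (real m *\<^sub>R (S m \<bullet>\<^sub>o f) - real n *\<^sub>R (S n \<bullet>\<^sub>o f)))"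
      by (rule norm_L_apply)
    also have "A \<bullet>\<^sub>o (real m *\<^sub>R (S m \<bullet>\<^sub>o f) - real n *\<^sub>R (S n \<bullet>\<^sub>o f)) = e m f - e n f"
      by (simp add: e_def cop_diff cop_scaleR AS flip: cop_apply_mult)
    finally show ?thesis .
  qed
  have T0: "T 0 \<bullet>\<^sub>o f = 0" and e0: "e 0 f = 0" for f by (simp_all add: T_def e_def)
  have "convergent (\<lambda>n. T n \<bullet>\<^sub>o f)" for f
  proof -
    have "Cauchy (\<lambda>n. e n f)" using e convergent_Cauchy convergent_def by blast
    then have "Cauchy (\<lambda>n. T n \<bullet>\<^sub>o f)"
      unfolding Cauchy_def dist_norm normT .
    then show ?thesis by (simp add: Cauchy_convergent_iff)
  qed
  then have lim: "(\<lambda>n. T n \<bullet>\<^sub>o f) \<longlonglongrightarrow> lim (\<lambda>n. T n \<bullet>\<^sub>o f)" for f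
    by (simp add: convergent_LIMSEQ_iff)
  define b where "b f = lim (\<lambda>n. T n \<bullet>\<^sub>o f)" for f
  have b: "(\<lambda>n. T n \<bullet>\<^sub>o f) \<longlonglongrightarrow> b f" for f unfolding b_def by (rule lim)
  have bI: "b f = l" if "(\<lambda>n. T n \<bullet>\<^sub>o f) \<longlonglongrightarrow> l" for f l
    using LIMSEQ_unique[OF b that] .
  have "bounded_clinear b"
  proof (rule bounded_clinearI[where K = 1])
    show "b (x + y) = b x + b y" for x y
      by (rule bI) (simp add: cop_add tendsto_add b)
    show "b (c *\<^sub>C x) = c *\<^sub>C b x" for c x
      by (rule bI) (simp add: cop_scaleC bounded_linear.tendsto[OF bounded_linear_scaleC] b)
    show "norm (b x) \<le> 1 * norm x" for x
    proof -
      have "norm (T n \<bullet>\<^sub>o x) = norm (e n x)" for n using normT[of n x 0] by (simp add: T0 e0)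
      then have "(\<lambda>n. norm (T n \<bullet>\<^sub>o x)) \<longlonglongrightarrow> norm x" using tendsto_norm[OF e] by simp
      then show ?thesis using LIMSEQ_unique[OF tendsto_norm[OF b]] by simp
    qed
  qed
  then have app: "cop_of b \<bullet>\<^sub>o f = b f" for f by simp
  have Le: "(\<lambda>n. L \<bullet>\<^sub>o e n f) \<longlonglongrightarrow> L \<bullet>\<^sub>o f" for f
    by (rule bounded_linear.tendsto[OF bounded_linear_cop e])
  show ?thesis
  proof (rule that[of "cop_of b"])
    show "A * cop_of b = L"
    proof (rule cop_eqI)
      fix f
      have "A * T n = real n *\<^sub>R (L * g (real n))" for n
        using L_comm_A by (simp add: T_def AS[symmetric] mult.assoc[symmetric])
      then have "A \<bullet>\<^sub>o (T n \<bullet>\<^sub>o f) = L \<bullet>\<^sub>o e n f" for n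
        by (metis cop_apply_mult(1) cop_apply_simps(5) cop_scaleR e_def)
      then have "(\<lambda>n. L \<bullet>\<^sub>o e n f) \<longlonglongrightarrow> A \<bullet>\<^sub>o b f"
        using bounded_linear.tendsto[OF bounded_linear_cop b, of A f] by simp
      then show "(A * cop_of b) \<bullet>\<^sub>o f = L \<bullet>\<^sub>o f"
        using LIMSEQ_unique[OF Le] by (simp add: app)
    qed
    show "cop_of b * A = L"
    proof (rule cop_eqI)
      fix f
      have "T n * A = real n *\<^sub>R (L * g (real n))" for n
        by (simp add: T_def AS[symmetric] mult.assoc SA)
      then have "T n \<bullet>\<^sub>o (A \<bullet>\<^sub>o f) = L \<bullet>\<^sub>o e n f" for n
        by (metis cop_apply_mult(1) cop_apply_simps(5) cop_scaleR e_def)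
      then have "b (A \<bullet>\<^sub>o f) = L \<bullet>\<^sub>o f" using bI Le by simp
      then show "(cop_of b * A) \<bullet>\<^sub>o f = L \<bullet>\<^sub>o f" by (simp add: app)
    qed
  qed
qed

text \<open>The anticommutation relation is that of the Dirac operator with \<open>J = \<sigma>\<^sub>3\<close>, written for the
  inverse: \<open>J H + H J = 2 m\<close>.\<close>

lemma sign_similar:
  assumes B: "A * B = L" "B * A = L" and J: "J * J = 1" and m: "m > 0"
    and anti: "A * J + J * A = (2 * m) *\<^sub>R (A * A)"
  shows "\<exists>S. invertible_element S \<and> S * B = J * S"
proof -
  have BB: "B * B = 1" by (rule sign_square[OF B])
  \<comment> \<open>The anticommutation relation, used twice, moves J past A^2.\<close>
  have "J * (A * A) = (J * A) * A" by (simp add: mult.assoc)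
  also have "J * A = (2 * m) *\<^sub>R (A * A) - A * J" using anti by (simp add: eq_diff_eq add.commute)
  also have "((2 * m) *\<^sub>R (A * A) - A * J) * A = (2 * m) *\<^sub>R (A * A * A) - A * (J * A)"
    by (simp add: left_diff_distrib mult.assoc)
  also have "J * A = (2 * m) *\<^sub>R (A * A) - A * J" using anti by (simp add: eq_diff_eq add.commute)
  also have "(2 * m) *\<^sub>R (A * A * A) - A * ((2 * m) *\<^sub>R (A * A) - A * J) = (A * A) * J"
    by (simp add: right_diff_distrib mult.assoc)
  finally have JL: "J * L = L * J" by (rule square_commute_L)
  have A: "L * B = A"
  proof -
    have "L * B = A * (B * B)" by (simp only: B(1)[symmetric] mult.assoc)
    then show ?thesis by (simp add: BB)
  qed
  have "L * (B * J + J * B) = (L * B) * J + (L * J) * B"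
    by (simp only: distrib_left mult.assoc)
  also have "\<dots> = A * J + J * A"
    by (simp only: JL[symmetric] mult.assoc A)
  also have "\<dots> = L * ((2 * m) *\<^sub>R L)" by (simp add: anti L_square)
  finally have "L * (B * J + J * B - (2 * m) *\<^sub>R L) = 0" by (simp add: right_diff_distrib)
  then have K: "B * J + J * B = (2 * m) *\<^sub>R L"
    using L_inj[of "B * J + J * B - (2 * m) *\<^sub>R L"] by simp
  \<comment> \<open>The intertwiner 1 + J B is inverted through its products with 1 + B J: in both
    orders they are 2 (1 + m L), and L is positive.\<close>
  have "(1 + J * B) * (1 + B * J) = 1 + (B * J + J * B) + J * (B * B) * J"
    by (simp add: distrib_left distrib_right mult.assoc)
  then have p1: "(1 + J * B) * (1 + B * J) = 2 *\<^sub>R (1 + m *\<^sub>R L)"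
    by (simp add: BB J K scaleR_add_right scaleR_2)
  have "(1 + B * J) * (1 + J * B) = 1 + (B * J + J * B) + B * (J * J) * B"
    by (simp add: distrib_left distrib_right mult.assoc)
  then have p2: "(1 + B * J) * (1 + J * B) = 2 *\<^sub>R (1 + m *\<^sub>R L)"
    by (simp add: BB J K scaleR_add_right scaleR_2)
  have "invertible_element (2 *\<^sub>R (1 + m *\<^sub>R L))"
    by (intro invertible_element_scaleR invertible_one_plus_accretive)
      (use m L_positive in auto)
  then have "invertible_element (1 + J * B)"
    using invertible_element_of_products[of "1 + J * B" "1 + B * J"] p1 p2 by simp
  then show ?thesis using intertwine_involutions[OF J BB] by blast
qed

end

section \<open>The space of square-integrable functions\<close>

lemma rep_abs_l2:
  assumes "sq_integrable f"
  shows "AE x in lebesgue. rep_l2 (abs_l2 f) x = f x"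
  using Quotient3_rep_abs[OF Quotient3_l2, of f] assms by (simp add: l2_rel_def)

lemma l2_eqI: "(AE x in lebesgue. rep_l2 f x = rep_l2 g x) \<Longrightarrow> f = g"
  using AE_rep_l2_eq_iff by blast

lemma abs_l2_eqI: "sq_integrable f \<Longrightarrow> (AE x in lebesgue. rep_l2 g x = f x) \<Longrightarrow> abs_l2 f = g"
  by (rule l2_eqI) (use rep_abs_l2[of f] in \<open>auto elim: eventually_elim2\<close>)

lemma measurable_rep_l2 [measurable]: "rep_l2 f \<in> borel_measurable lebesgue"
  using sq_integrable_rep_l2[of f] by (simp add: sq_integrable_def)

lemma sq_integrable_scaleC: "sq_integrable f \<Longrightarrow> sq_integrable (\<lambda>x. c *\<^sub>C f x)"
  by (rule sq_integrable_bounded_linear[OF bounded_linear_scaleC])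

lemma sq_integrable_scaleR: "sq_integrable f \<Longrightarrow> sq_integrable (\<lambda>x. r *\<^sub>R f x)"
  by (rule sq_integrable_bounded_linear[OF bounded_linear_scaleR_right])

lemma sq_integrable_diff:
  fixes f g :: "real \<Rightarrow> 'a :: {real_normed_vector, second_countable_topology}"
  shows "sq_integrable f \<Longrightarrow> sq_integrable g \<Longrightarrow> sq_integrable (\<lambda>x. f x - g x)"
  using sq_integrable_add[of f "\<lambda>x. - g x"]
    sq_integrable_bounded_linear[OF bounded_linear_minus[OF bounded_linear_ident], of g]
  by simp

lemma rep_l2_zero: "AE x in lebesgue. rep_l2 (0 :: 'a :: {complex_normed_vector, euclidean_space} l2) x = 0"
  unfolding zero_l2_def by (rule rep_abs_l2[OF sq_integrable_zero])

lemma rep_l2_add: "AE x in lebesgue. rep_l2 (f + g) x = rep_l2 f x + rep_l2 g x"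
  unfolding plus_l2_def map_fun_apply
  by (rule rep_abs_l2) (intro sq_integrable_add sq_integrable_rep_l2)

lemma rep_l2_scaleR: "AE x in lebesgue. rep_l2 (r *\<^sub>R f) x = r *\<^sub>R rep_l2 f x"
  unfolding scaleR_l2_def map_fun_apply id_apply
  by (rule rep_abs_l2) (intro sq_integrable_scaleR sq_integrable_rep_l2)

lemma rep_l2_scaleC: "AE x in lebesgue. rep_l2 (c *\<^sub>C f) x = c *\<^sub>C rep_l2 f x"
  unfolding scaleC_l2_def map_fun_apply id_apply
  by (rule rep_abs_l2) (intro sq_integrable_scaleC sq_integrable_rep_l2)

lemma rep_l2_diff: "AE x in lebesgue. rep_l2 (f - g) x = rep_l2 f x - rep_l2 g x"
proof -
  have eq: "f - g = f + (-1) *\<^sub>R g" by simp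
  show ?thesis
    unfolding eq using rep_l2_add[of f "(-1) *\<^sub>R g"] rep_l2_scaleR[of "-1" g]
    by eventually_elim simp
qed

lemma norm_l2_rep: "norm f = l2_norm (rep_l2 f)"
  by (simp add: norm_l2_def)

lemma nn_integral_l2:
  "sq_integrable f \<Longrightarrow> (\<integral>\<^sup>+x. ennreal ((norm (f x))\<^sup>2) \<partial>lebesgue) = ennreal ((l2_norm f)\<^sup>2)"
  unfolding l2_norm_sq by (rule nn_integral_eq_integral) (auto simp: sq_integrable_def)

lemma nn_integral_rep_l2: "(\<integral>\<^sup>+x. ennreal ((norm (rep_l2 f x))\<^sup>2) \<partial>lebesgue) = ennreal ((norm f)\<^sup>2)"
  by (simp add: nn_integral_l2 sq_integrable_rep_l2 norm_l2_rep)

text \<open>A single estimate of a nonnegative integral yields membership in L^2 together with the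
  norm bound.\<close>

lemma sq_integrable_nn_bound:
  assumes "f \<in> borel_measurable lebesgue" "(\<integral>\<^sup>+x. ennreal ((norm (f x))\<^sup>2) \<partial>lebesgue) \<le> ennreal (c\<^sup>2)" "0 \<le> c"
  shows "sq_integrable f" "norm (abs_l2 f) \<le> c"
proof -
  have [measurable]: "f \<in> borel_measurable lebesgue" by fact
  show s: "sq_integrable f"
    unfolding sq_integrable_def using assms(2)
    by (auto intro!: integrableI_bounded simp: le_less_trans[OF _ ennreal_less_top])
  have "ennreal ((norm (abs_l2 f))\<^sup>2) = (\<integral>\<^sup>+x. ennreal ((norm (f x))\<^sup>2) \<partial>lebesgue)"
    unfolding nn_integral_rep_l2[symmetric]
    by (rule nn_integral_cong_AE) (use rep_abs_l2[OF s] in eventually_elim, simp)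
  then have "(norm (abs_l2 f))\<^sup>2 \<le> c\<^sup>2" using assms(2) by (metis ennreal_le_iff zero_le_power2)
  then show "norm (abs_l2 f) \<le> c" using assms(3) by (rule power2_le_imp_le)
qed

lemma integrable_inner_sq_integrable:
  fixes f g :: "real \<Rightarrow> 'a :: euclidean_space"
  assumes "sq_integrable f" "sq_integrable g"
  shows "integrable lebesgue (\<lambda>x. inner (f x) (g x))"
proof (rule Bochner_Integration.integrable_bound)
  have [measurable]: "f \<in> borel_measurable lebesgue" "g \<in> borel_measurable lebesgue"
    using assms by (auto simp: sq_integrable_def)
  show "integrable lebesgue (\<lambda>x. (norm (f x))\<^sup>2 + (norm (g x))\<^sup>2)"
    using assms by (simp add: sq_integrable_def)
  show "(\<lambda>x. inner (f x) (g x)) \<in> borel_measurable lebesgue" by measurable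
  show "AE x in lebesgue. norm (inner (f x) (g x)) \<le> norm ((norm (f x))\<^sup>2 + (norm (g x))\<^sup>2)"
  proof (rule AE_I2)
    fix x
    have "\<bar>inner (f x) (g x)\<bar> \<le> norm (f x) * norm (g x)" by (rule Cauchy_Schwarz_ineq2)
    also have "\<dots> \<le> (norm (f x))\<^sup>2 + (norm (g x))\<^sup>2"
    proof -
      have "2 * (norm (f x) * norm (g x)) \<le> (norm (f x))\<^sup>2 + (norm (g x))\<^sup>2"
        using zero_le_power2[of "norm (f x) - norm (g x)"] by (simp add: power2_diff)
      moreover have "0 \<le> norm (f x) * norm (g x)" by simp
      ultimately show ?thesis by linarith
    qed
    finally show "norm (inner (f x) (g x)) \<le> norm ((norm (f x))\<^sup>2 + (norm (g x))\<^sup>2)" by simp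
  qed
qed

section \<open>Inner product, nontriviality and completeness of L^2\<close>

instantiation l2 :: ("{complex_normed_vector, euclidean_space}") real_inner
begin

text \<open>For complex values this is the real part of the Hermitian inner product, because
  \<open>inner\<close> on the values is real.\<close>

definition inner_l2 :: "'a l2 \<Rightarrow> 'a l2 \<Rightarrow> real" where
  "inner_l2 f g = (LINT x|lebesgue. inner (rep_l2 f x) (rep_l2 g x))"

instance
proof
  fix f g h :: "'a l2" and r :: real
  note int = integrable_inner_sq_integrable[OF sq_integrable_rep_l2 sq_integrable_rep_l2]
  show "inner f g = inner g f" by (simp add: inner_l2_def inner_commute)
  have "inner (f + g) h = (LINT x|lebesgue. inner (rep_l2 f x) (rep_l2 h x) + inner (rep_l2 g x) (rep_l2 h x))"
    unfolding inner_l2_def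
    by (rule integral_cong_AE, measurable) (use rep_l2_add[of f g] in eventually_elim, simp add: inner_add_left)
  then show "inner (f + g) h = inner f h + inner g h"
    by (simp add: inner_l2_def int)
  have "inner (r *\<^sub>R f) g = (LINT x|lebesgue. r * inner (rep_l2 f x) (rep_l2 g x))"
    unfolding inner_l2_def
    by (rule integral_cong_AE, measurable) (use rep_l2_scaleR[of r f] in eventually_elim, simp)
  then show "inner (r *\<^sub>R f) g = r * inner f g" by (simp add: inner_l2_def)
  have sq: "inner f f = (norm f)\<^sup>2"
    unfolding norm_l2_rep l2_norm_sq by (simp add: inner_l2_def power2_norm_eq_inner)
  show "0 \<le> inner f f" "(inner f f = 0) = (f = 0)" "norm f = sqrt (inner f f)"
    unfolding sq by auto
qed

end

lemma inner_l2_AE: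
  assumes "AE x in lebesgue. rep_l2 f x = f' x" "AE x in lebesgue. rep_l2 g x = g' x"
    "f' \<in> borel_measurable lebesgue" "g' \<in> borel_measurable lebesgue"
  shows "inner f g = (LINT x|lebesgue. inner (f' x) (g' x))"
  unfolding inner_l2_def
proof (rule integral_cong_AE)
  show "AE x in lebesgue. inner (rep_l2 f x) (rep_l2 g x) = inner (f' x) (g' x)"
    using assms(1,2) by eventually_elim simp
qed (intro borel_measurable_inner measurable_rep_l2 assms(3,4))+

instance l2 :: ("{complex_normed_vector, euclidean_space}") perfect_space
proof
  fix f :: "'a l2"
  define b :: 'a where "b = (SOME i. i \<in> Basis)"
  have b: "norm b = 1" unfolding b_def by (rule norm_Basis[OF SOME_Basis])
  \<comment> \<open>A unit vector supported on [0, 1]: once the space is known to be nonzero, no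
    point is isolated.\<close>
  define u where "u x = indicator {0..1} x *\<^sub>R b" for x :: real
  have u: "(norm (u x))\<^sup>2 = indicator {0..1} x" for x
    by (simp add: u_def b indicator_def)
  have meas: "u \<in> borel_measurable lebesgue"
    unfolding u_def by (intro borel_measurable_scaleR borel_measurable_indicator) auto
  have nn: "(\<integral>\<^sup>+x. ennreal ((norm (u x))\<^sup>2) \<partial>lebesgue) = 1"
    unfolding u by (simp add: ennreal_indicator)
  have s: "sq_integrable u"
    by (rule sq_integrable_nn_bound(1)[where c = 1, OF meas]) (simp_all add: nn)
  define v where "v = abs_l2 u"
  have "ennreal ((norm v)\<^sup>2) = 1"
    unfolding nn[symmetric] nn_integral_rep_l2[symmetric] v_def
    by (rule nn_integral_cong_AE) (use rep_abs_l2[OF s] in eventually_elim, simp)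
  then have v: "v \<noteq> 0" by (metis norm_zero power_zero_numeral ennreal_0 zero_neq_one)
  show "\<not> open {f}"
  proof
    assume "open {f}"
    then obtain e where e: "e > 0" "\<And>y. dist y f < e \<Longrightarrow> y = f"
      unfolding open_dist by auto
    have "dist (f + (e / 2 / norm v) *\<^sub>R v) f < e"
      using e(1) v by (simp add: dist_norm)
    from e(2)[OF this] e(1) v show False by simp
  qed
qed

text \<open>For increments of norm at most 2^(-n) the sum of 2^n |u_(n+1) - u_n|^2 has a finite
  integral. Hence almost everywhere the increments are O(2^(-n/2)) and the sequence converges;
  Fatou's lemma carries the Cauchy estimates over to the limit.\<close>

lemma l2_cauchy_subsequence_converges:
  fixes X :: "nat \<Rightarrow> 'a :: {complex_normed_vector, euclidean_space} l2"
  assumes C: "Cauchy X" and fast: "\<And>n. norm (X (Suc n) - X n) \<le> (1/2) ^ n"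
  shows "\<exists>l. X \<longlonglongrightarrow> l"
proof -
  define u where "u n = rep_l2 (X n)" for n
  have [measurable]: "u n \<in> borel_measurable lebesgue" for n by (simp add: u_def)
  have nn: "(\<integral>\<^sup>+x. ennreal ((norm (u m x - u n x))\<^sup>2) \<partial>lebesgue) = ennreal ((norm (X m - X n))\<^sup>2)" for m n
    unfolding nn_integral_rep_l2[symmetric] u_def
    by (rule nn_integral_cong_AE) (use rep_l2_diff[of "X m" "X n"] in eventually_elim, simp)
  let ?d = "\<lambda>n x. norm (u (Suc n) x - u n x)"
  have "(\<integral>\<^sup>+x. (\<Sum>n. ennreal (2 ^ n * (?d n x)\<^sup>2)) \<partial>lebesgue) = (\<Sum>n. \<integral>\<^sup>+x. ennreal (2 ^ n * (?d n x)\<^sup>2) \<partial>lebesgue)"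
    by (rule nn_integral_suminf) measurable
  also have "\<dots> \<le> (\<Sum>n. ennreal ((1/2) ^ n))"
  proof (rule suminf_le)
    fix n
    have "(\<integral>\<^sup>+x. ennreal (2 ^ n * (?d n x)\<^sup>2) \<partial>lebesgue) = ennreal (2 ^ n) * (\<integral>\<^sup>+x. ennreal ((?d n x)\<^sup>2) \<partial>lebesgue)"
      by (subst nn_integral_cmult[symmetric]) (auto simp: ennreal_mult)
    also have "\<dots> = ennreal (2 ^ n * (norm (X (Suc n) - X n))\<^sup>2)"
      unfolding nn by (simp add: ennreal_mult)
    also have "\<dots> \<le> ennreal (2 ^ n * ((1/2) ^ n)\<^sup>2)"
      by (intro ennreal_leI mult_left_mono power_mono fast) auto
    also have "2 ^ n * ((1/2 :: real) ^ n)\<^sup>2 = (1/2) ^ n"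
      by (simp add: power2_eq_square power_divide)
    finally show "(\<integral>\<^sup>+x. ennreal (2 ^ n * (?d n x)\<^sup>2) \<partial>lebesgue) \<le> ennreal ((1/2) ^ n)" .
  qed auto
  also have "\<dots> = ennreal (\<Sum>n. (1/2) ^ n)"
    by (rule suminf_ennreal2) (auto intro: summable_geometric)
  also have "\<dots> < \<infinity>" by simp
  finally have "AE x in lebesgue. (\<Sum>n. ennreal (2 ^ n * (?d n x)\<^sup>2)) \<noteq> \<infinity>"
    by (intro nn_integral_PInf_AE) auto
  then have conv: "AE x in lebesgue. convergent (\<lambda>n. u n x)"
  proof eventually_elim
    case (elim x)
    then have "summable (\<lambda>n. 2 ^ n * (?d n x)\<^sup>2)"
      by (intro summable_suminf_not_top) auto
    then have "Bseq (\<lambda>n. 2 ^ n * (?d n x)\<^sup>2)" by (rule summable_imp_Bseq)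
    then obtain c where c: "\<And>n. norm (2 ^ n * (?d n x)\<^sup>2) \<le> c"
      unfolding Bseq_def by blast
    have le: "?d n x \<le> sqrt c * (1 / sqrt 2) ^ n" for n
    proof (rule power2_le_imp_le)
      have c0: "c \<ge> 0" using order_trans[OF norm_ge_zero c[of 0]] .
      have "(?d n x)\<^sup>2 \<le> c * (1 / 2) ^ n"
        using c[of n] by (simp add: field_simps power_divide)
      also have "\<dots> = (sqrt c * (1 / sqrt 2) ^ n)\<^sup>2"
      proof -
        have "((1 / sqrt 2) ^ n)\<^sup>2 = (1 / 2) ^ n"
          by (simp only: power2_eq_square power_mult_distrib[symmetric]) simp
        then show ?thesis using c0 by (simp add: power_mult_distrib)
      qed
      finally show "(?d n x)\<^sup>2 \<le> (sqrt c * (1 / sqrt 2) ^ n)\<^sup>2" .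
      show "0 \<le> sqrt c * (1 / sqrt 2) ^ n" using c0 by simp
    qed
    have "summable (\<lambda>n. sqrt c * (1 / sqrt 2) ^ n)"
      by (intro summable_mult summable_geometric) (simp add: divide_less_eq)
    then have "summable (\<lambda>n. u (Suc n) x - u n x)"
      by (rule summable_comparison_test'[where N = 0]) (rule le)
    then have "convergent (\<lambda>n. \<Sum>i<n. u (Suc i) x - u i x)"
      by (simp add: summable_iff_convergent)
    then have "convergent (\<lambda>n. u n x - u 0 x)" 
      using sum_lessThan_telescope[of "\<lambda>n. u n x"] by simp
    then show "convergent (\<lambda>n. u n x)"
      using convergent_diff_const_right_iff[of "\<lambda>n. u n x" "u 0 x"] by simp
  qed
  define v where "v x = lim (\<lambda>n. u n x)" for x
  have [measurable]: "v \<in> borel_measurable lebesgue"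
    unfolding v_def by (rule borel_measurable_lim_metric) auto
  have lim: "AE x in lebesgue. (\<lambda>n. u n x) \<longlonglongrightarrow> v x"
    using conv by eventually_elim (simp add: v_def convergent_LIMSEQ_iff)
  have fatou: "(\<integral>\<^sup>+x. ennreal ((norm (v x - u n x))\<^sup>2) \<partial>lebesgue) \<le> ennreal (e\<^sup>2)"
    if e: "\<And>k. k \<ge> N \<Longrightarrow> norm (X k - X n) \<le> e" for N n e
  proof -
    have "(\<integral>\<^sup>+x. ennreal ((norm (v x - u n x))\<^sup>2) \<partial>lebesgue)
      = (\<integral>\<^sup>+x. liminf (\<lambda>k. ennreal ((norm (u k x - u n x))\<^sup>2)) \<partial>lebesgue)"
    proof (rule nn_integral_cong_AE)
      show "AE x in lebesgue. ennreal ((norm (v x - u n x))\<^sup>2) = liminf (\<lambda>k. ennreal ((norm (u k x - u n x))\<^sup>2))"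
        using lim
      proof eventually_elim
        case (elim x)
        have "(\<lambda>k. ennreal ((norm (u k x - u n x))\<^sup>2)) \<longlonglongrightarrow> ennreal ((norm (v x - u n x))\<^sup>2)"
          by (intro tendsto_ennrealI tendsto_intros elim)
        then show ?case by (rule lim_imp_Liminf[symmetric, rotated]) simp
      qed
    qed
    also have "\<dots> \<le> liminf (\<lambda>k. \<integral>\<^sup>+x. ennreal ((norm (u k x - u n x))\<^sup>2) \<partial>lebesgue)"
      by (rule nn_integral_liminf) measurable
    also have "\<dots> \<le> liminf (\<lambda>k. ennreal (e\<^sup>2))"
      unfolding nn
      by (intro Liminf_mono eventually_sequentiallyI[of N] ennreal_leI power_mono e) auto
    also have "\<dots> = ennreal (e\<^sup>2)" by (simp add: Liminf_const)
    finally show ?thesis .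
  qed
  have close: "\<exists>N. \<forall>n\<ge>N. (\<integral>\<^sup>+x. ennreal ((norm (v x - u n x))\<^sup>2) \<partial>lebesgue) \<le> ennreal (e\<^sup>2)" if e: "e > 0" for e
  proof -
    obtain N where "\<And>k n. k \<ge> N \<Longrightarrow> n \<ge> N \<Longrightarrow> norm (X k - X n) < e"
      using CauchyD[OF C e] by blast
    then show ?thesis by (intro exI[of _ N] allI impI fatou[of N]) (simp add: less_imp_le)
  qed
  obtain n0 where "(\<integral>\<^sup>+x. ennreal ((norm (v x - u n0 x))\<^sup>2) \<partial>lebesgue) \<le> ennreal (1\<^sup>2)"
    using close[of 1] by auto
  then have "sq_integrable (\<lambda>x. v x - u n0 x)"
    by (intro sq_integrable_nn_bound(1)[of _ 1]) auto
  then have "sq_integrable (\<lambda>x. (v x - u n0 x) + u n0 x)"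
    by (intro sq_integrable_add) (auto simp: u_def sq_integrable_rep_l2)
  then have v: "sq_integrable v" by simp
  have "X \<longlonglongrightarrow> abs_l2 v"
  proof (rule LIMSEQ_I)
    fix e :: real assume "e > 0"
    then obtain N where N: "\<And>n. n \<ge> N \<Longrightarrow> (\<integral>\<^sup>+x. ennreal ((norm (v x - u n x))\<^sup>2) \<partial>lebesgue) \<le> ennreal ((e / 2)\<^sup>2)"
      using close[of "e / 2"] by auto
    have "norm (X n - abs_l2 v) < e" if "n \<ge> N" for n
    proof -
      have "abs_l2 (\<lambda>x. v x - u n x) = abs_l2 v - X n"
      proof (rule abs_l2_eqI)
        show "sq_integrable (\<lambda>x. v x - u n x)"
          by (intro sq_integrable_diff v) (simp add: u_def sq_integrable_rep_l2)
        show "AE x in lebesgue. rep_l2 (abs_l2 v - X n) x = v x - u n x"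
          using rep_l2_diff[of "abs_l2 v" "X n"] rep_abs_l2[OF v] by eventually_elim (simp add: u_def)
      qed
      moreover have "norm (abs_l2 (\<lambda>x. v x - u n x)) \<le> e / 2"
        using \<open>e > 0\<close> by (intro sq_integrable_nn_bound(2) N that) auto
      ultimately show ?thesis using \<open>e > 0\<close> by (simp add: norm_minus_commute)
    qed
    then show "\<exists>N. \<forall>n\<ge>N. norm (X n - abs_l2 v) < e" by blast
  qed
  then show ?thesis by blast
qed

instance l2 :: ("{complex_normed_vector, euclidean_space}") banach
proof
  fix X :: "nat \<Rightarrow> 'a l2"
  assume C: "Cauchy X"
  have "\<forall>n. \<exists>N. \<forall>j\<ge>N. \<forall>k\<ge>N. norm (X j - X k) < (1/2) ^ n"
    using CauchyD[OF C] by simp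
  then obtain N where N: "\<And>n j k. j \<ge> N n \<Longrightarrow> k \<ge> N n \<Longrightarrow> norm (X j - X k) < (1/2) ^ n" by metis
  \<comment> \<open>The partial sums dominate each N n, and the added n makes r strictly
    increasing.\<close>
  define r where "r n = (\<Sum>i\<le>n. N i) + n" for n
  have r: "strict_mono r" by (rule strict_monoI_Suc) (simp add: r_def)
  have rN: "r n \<ge> N n" for n
    unfolding r_def by (rule trans_le_add1, rule member_le_sum) auto
  have "\<exists>l. (X \<circ> r) \<longlonglongrightarrow> l"
  proof (rule l2_cauchy_subsequence_converges)
    show "Cauchy (X \<circ> r)" using C r by (rule Cauchy_subseq_Cauchy)
    show "norm ((X \<circ> r) (Suc n) - (X \<circ> r) n) \<le> (1/2) ^ n" for n
    proof -
      have "r (Suc n) \<ge> N n" using rN[of n] strict_monoD[OF r, of n "Suc n"] by simp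
      then show ?thesis using N[of n "r (Suc n)" "r n"] rN[of n] by (simp add: less_imp_le)
    qed
  qed
  then obtain l where "(X \<circ> r) \<longlonglongrightarrow> l" by blast
  then have "X \<longlonglongrightarrow> l" by (rule Cauchy_converges_subseq[OF C r])
  then show "convergent X" by (auto simp: convergent_def)
qed

section \<open>Operators given by functions\<close>

text \<open>All rules hold only almost everywhere, since the representative chosen for a sum is not
  the sum of the representatives. The bound uses the nonnegative integral, so it includes
  square-integrability of the image.\<close>

definition l2_operator ::
    "real \<Rightarrow> ((real \<Rightarrow> 'a) \<Rightarrow> real \<Rightarrow> 'a :: {complex_normed_vector, euclidean_space}) \<Rightarrow> bool" where
  "l2_operator c F \<longleftrightarrow> 0 \<le> c \<and>
     (\<forall>f. sq_integrable f \<longrightarrow> F f \<in> borel_measurable lebesgue \<and>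
        (\<integral>\<^sup>+x. ennreal ((norm (F f x))\<^sup>2) \<partial>lebesgue) \<le> ennreal ((c * l2_norm f)\<^sup>2)) \<and>
     (\<forall>f g. sq_integrable f \<longrightarrow> sq_integrable g \<longrightarrow> (AE x in lebesgue. F (\<lambda>x. f x + g x) x = F f x + F g x)) \<and>
     (\<forall>a f. sq_integrable f \<longrightarrow> (AE x in lebesgue. F (\<lambda>x. a *\<^sub>C f x) x = a *\<^sub>C F f x)) \<and>
     (\<forall>f g. sq_integrable f \<longrightarrow> sq_integrable g \<longrightarrow> (AE x in lebesgue. f x = g x) \<longrightarrow> (AE x in lebesgue. F f x = F g x))"

definition lift_l2 ::
    "((real \<Rightarrow> 'a) \<Rightarrow> real \<Rightarrow> 'a :: {complex_normed_vector, euclidean_space}) \<Rightarrow> 'a l2 cop" where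
  "lift_l2 F = cop_of (\<lambda>f. abs_l2 (F (rep_l2 f)))"

lemma l2_operator_sq_integrable:
  assumes "l2_operator c F" "sq_integrable f"
  shows "sq_integrable (F f)"
  using assms sq_integrable_nn_bound(1)[of "F f" "c * l2_norm f"]
  by (auto simp: l2_operator_def l2_norm_nonneg)

lemma lift_l2_bounded_clinear:
  assumes F: "l2_operator c F"
  shows "bounded_clinear (\<lambda>f. abs_l2 (F (rep_l2 f)))"
    and "norm (abs_l2 (F (rep_l2 f))) \<le> c * norm f"
proof -
  note sq = l2_operator_sq_integrable[OF F]
  note rep = rep_abs_l2[OF sq[OF sq_integrable_rep_l2]]
  have cong: "AE x in lebesgue. F f x = F g x"
    if "sq_integrable f" "sq_integrable g" "AE x in lebesgue. f x = g x" for f g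
    using F that by (auto simp: l2_operator_def)
  show norm: "norm (abs_l2 (F (rep_l2 f))) \<le> c * norm f" for f
    using F sq_integrable_rep_l2[of f] unfolding norm_l2_rep[of f]
    by (intro sq_integrable_nn_bound(2)) (auto simp: l2_operator_def l2_norm_nonneg)
  show "bounded_clinear (\<lambda>f. abs_l2 (F (rep_l2 f)))"
  proof (rule bounded_clinearI[where K = c])
    fix f g :: "'a l2" and a :: complex
    show "abs_l2 (F (rep_l2 (f + g))) = abs_l2 (F (rep_l2 f)) + abs_l2 (F (rep_l2 g))"
    proof (rule abs_l2_eqI[OF sq[OF sq_integrable_rep_l2]])
      have "AE x in lebesgue. F (rep_l2 (f + g)) x = F (\<lambda>x. rep_l2 f x + rep_l2 g x) x"
        by (intro cong sq_integrable_rep_l2 sq_integrable_add rep_l2_add)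
      moreover have "AE x in lebesgue. F (\<lambda>x. rep_l2 f x + rep_l2 g x) x = F (rep_l2 f) x + F (rep_l2 g) x"
        using F sq_integrable_rep_l2 unfolding l2_operator_def by blast
      ultimately show "AE x in lebesgue. rep_l2 (abs_l2 (F (rep_l2 f)) + abs_l2 (F (rep_l2 g))) x = F (rep_l2 (f + g)) x"
        using rep_l2_add[of "abs_l2 (F (rep_l2 f))" "abs_l2 (F (rep_l2 g))"] rep[of f] rep[of g]
        by eventually_elim simp
    qed
    show "abs_l2 (F (rep_l2 (a *\<^sub>C f))) = a *\<^sub>C abs_l2 (F (rep_l2 f))"
    proof (rule abs_l2_eqI[OF sq[OF sq_integrable_rep_l2]])
      have "AE x in lebesgue. F (rep_l2 (a *\<^sub>C f)) x = F (\<lambda>x. a *\<^sub>C rep_l2 f x) x"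
        by (intro cong sq_integrable_rep_l2 sq_integrable_scaleC rep_l2_scaleC)
      moreover have "AE x in lebesgue. F (\<lambda>x. a *\<^sub>C rep_l2 f x) x = a *\<^sub>C F (rep_l2 f) x"
        using F sq_integrable_rep_l2 unfolding l2_operator_def by blast
      ultimately show "AE x in lebesgue. rep_l2 (a *\<^sub>C abs_l2 (F (rep_l2 f))) x = F (rep_l2 (a *\<^sub>C f)) x"
        using rep_l2_scaleC[of a "abs_l2 (F (rep_l2 f))"] rep[of f]
        by eventually_elim simp
    qed
    show "norm (abs_l2 (F (rep_l2 f))) \<le> c * norm f" by (rule norm)
  qed
qed

lemma lift_l2_apply:
  assumes "l2_operator c F"
  shows "lift_l2 F \<bullet>\<^sub>o f = abs_l2 (F (rep_l2 f))"
  unfolding lift_l2_def using lift_l2_bounded_clinear(1)[OF assms] by simp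

lemma rep_lift_l2:
  assumes "l2_operator c F"
  shows "AE x in lebesgue. rep_l2 (lift_l2 F \<bullet>\<^sub>o f) x = F (rep_l2 f) x"
  unfolding lift_l2_apply[OF assms]
  by (intro rep_abs_l2 l2_operator_sq_integrable[OF assms] sq_integrable_rep_l2)

lemma norm_lift_l2:
  assumes "l2_operator c F"
  shows "norm (lift_l2 F) \<le> c"
  using assms lift_l2_bounded_clinear(2)[OF assms]
  by (intro norm_cop_bound) (auto simp: lift_l2_apply[OF assms] l2_operator_def)

section \<open>Convolution with exponentially bounded kernels\<close>

text \<open>Representatives of L^2 elements are only Lebesgue measurable, so Fubini's theorem is
  applied to the product of the completed measure with itself.\<close>

lemma sigma_finite_lebesgue: "sigma_finite_measure (lebesgue :: real measure)"
proof
  show "\<exists>A :: real set set. countable A \<and> A \<subseteq> sets lebesgue \<and> \<Union> A = space lebesgue \<and> (\<forall>a\<in>A. emeasure lebesgue a \<noteq> \<infinity>)"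
  proof (intro exI conjI)
    let ?A = "range (\<lambda>n :: nat. {- real n..real n})"
    show "countable ?A" by simp
    show "?A \<subseteq> sets lebesgue" by auto
    have "\<exists>n. x \<in> {- real n..real n}" for x
    proof -
      obtain n where "\<bar>x\<bar> < real n" using reals_Archimedean2 by blast
      then show ?thesis by (intro exI[of _ n]) auto
    qed
    then show "\<Union> ?A = space lebesgue" by auto
    show "\<forall>a\<in>?A. emeasure lebesgue a \<noteq> \<infinity>" by auto
  qed
qed

interpretation lebesgue: sigma_finite_measure "lebesgue :: real measure"
  by (rule sigma_finite_lebesgue)

interpretation lebesgue_pair: pair_sigma_finite "lebesgue :: real measure" "lebesgue :: real measure" ..

lemma measurable_ident_lebesgue: "(\<lambda>x. x) \<in> borel_measurable (lebesgue :: real measure)"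
  by (rule measurable_completion) simp

lemma measurable_diff_pair [measurable]:
  "(\<lambda>p. fst p - snd p) \<in> borel_measurable (lebesgue \<Otimes>\<^sub>M (lebesgue :: real measure))"
  by (intro borel_measurable_diff measurable_compose[OF measurable_fst measurable_ident_lebesgue]
      measurable_compose[OF measurable_snd measurable_ident_lebesgue])

lemma nn_integral_exp_half_line:
  assumes "c > 0"
  shows "(\<integral>\<^sup>+y. ennreal (exp (- c * y)) * indicator {0..} y \<partial>lebesgue) = ennreal (1 / c)"
proof -
  have "(\<integral>\<^sup>+y. ennreal (exp (- c * y)) * indicator {0..} y \<partial>lborel) = ennreal (0 - (- exp (- c * 0) / c))"
  proof (rule nn_integral_FTC_atLeast)
    have "filterlim (\<lambda>x. c * x) at_top at_top"
      using assms by (intro filterlim_tendsto_pos_mult_at_top[OF tendsto_const _ filterlim_ident])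
    then have "filterlim (\<lambda>x. - (c * x)) at_bot at_top" by (simp add: filterlim_uminus_at_bot)
    then have "((\<lambda>x. exp (- (c * x))) \<longlongrightarrow> 0) at_top"
      by (rule filterlim_compose[OF exp_at_bot])
    then have "((\<lambda>x. - exp (- (c * x)) / c) \<longlongrightarrow> - 0 / c) at_top"
      by (intro tendsto_intros) (use assms in auto)
    then show "((\<lambda>x. - exp (- c * x) / c) \<longlongrightarrow> 0) at_top" by simp
    show "DERIV (\<lambda>x. - exp (- c * x) / c) x :> exp (- c * x)" for x
      using assms by (auto intro!: derivative_eq_intros)
  qed auto
  then show ?thesis by (simp add: nn_integral_completion)
qed

lemma nn_integral_exp_abs:
  assumes "c > 0"
  shows "(\<integral>\<^sup>+y. ennreal (exp (- c * \<bar>x - y\<bar>)) \<partial>lebesgue) = ennreal (2 / c)"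
    and "(\<integral>\<^sup>+x. ennreal (exp (- c * \<bar>x - y\<bar>)) \<partial>lebesgue) = ennreal (2 / c)"
proof -
  have zero: "(\<integral>\<^sup>+y. ennreal (exp (- c * \<bar>y\<bar>)) \<partial>lebesgue) = ennreal (2 / c)"
  proof -
    \<comment> \<open>Both half lines contain 0, so the split holds almost everywhere; the argument
      0 + (-1) * y has the form of an affine substitution.\<close>
    have "(\<integral>\<^sup>+y. ennreal (exp (- c * \<bar>y\<bar>)) \<partial>lebesgue) =
      (\<integral>\<^sup>+y. ennreal (exp (- c * y)) * indicator {0..} y + ennreal (exp (- c * (0 + (-1) * y))) * indicator {0..} (0 + (-1) * y) \<partial>lebesgue)"
    proof (rule nn_integral_cong_AE)
      have "AE y in lebesgue. y \<noteq> (0 :: real)"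
        using AE_lborel_singleton by (rule AE_completion)
      then show "AE y in lebesgue. ennreal (exp (- c * \<bar>y\<bar>)) =
        ennreal (exp (- c * y)) * indicator {0..} y + ennreal (exp (- c * (0 + (-1) * y))) * indicator {0..} (0 + (-1) * y)"
        by eventually_elim (auto simp: indicator_def)
    qed
    also have "\<dots> = (\<integral>\<^sup>+y. ennreal (exp (- c * y)) * indicator {0..} y \<partial>lebesgue)
        + (\<integral>\<^sup>+y. ennreal (exp (- c * (0 + (-1) * y))) * indicator {0..} (0 + (-1) * y) \<partial>lebesgue)"
    proof (rule nn_integral_add)
      have F: "(\<lambda>y. ennreal (exp (- c * y)) * indicator {0..} y) \<in> borel_measurable (borel :: real measure)"
        by measurable
      then show "(\<lambda>y. ennreal (exp (- c * y)) * indicator {0..} y) \<in> borel_measurable lebesgue"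
        by (intro measurable_completion) simp
      have "(\<lambda>y. 0 + (-1) * y) \<in> borel_measurable (borel :: real measure)" by measurable
      from measurable_compose[OF this F]
      show "(\<lambda>y. ennreal (exp (- c * (0 + (-1) * y))) * indicator {0..} (0 + (-1) * y)) \<in> borel_measurable lebesgue"
        by (intro measurable_completion) simp
    qed
    also have "(\<integral>\<^sup>+y. ennreal (exp (- c * (0 + (-1) * y))) * indicator {0..} (0 + (-1) * y) \<partial>lebesgue)
       = (\<integral>\<^sup>+y. ennreal (exp (- c * y)) * indicator {0..} y \<partial>lebesgue)"
      by (subst nn_integral_real_affine_lebesgue[of "\<lambda>y. ennreal (exp (- c * y)) * indicator {0..} y" "-1" 0])
        (auto intro!: measurable_completion)
    finally show ?thesis
      unfolding nn_integral_exp_half_line[OF assms] using assms by (simp flip: ennreal_plus)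
  qed
  have "(\<lambda>y. ennreal (exp (- c * \<bar>y\<bar>))) \<in> borel_measurable (borel :: real measure)" by measurable
  then have meas: "(\<lambda>y. ennreal (exp (- c * \<bar>y\<bar>))) \<in> borel_measurable lebesgue"
    by (intro measurable_completion) simp
  show "(\<integral>\<^sup>+y. ennreal (exp (- c * \<bar>x - y\<bar>)) \<partial>lebesgue) = ennreal (2 / c)"
    using nn_integral_real_affine_lebesgue[OF meas, of "-1" x] zero by simp
  show "(\<integral>\<^sup>+x. ennreal (exp (- c * \<bar>x - y\<bar>)) \<partial>lebesgue) = ennreal (2 / c)"
    using nn_integral_real_affine_lebesgue[OF meas, of 1 "- y"] zero by simp
qed

lemma measurable_exp_abs [measurable]:
  "(\<lambda>y. exp (c * \<bar>x - y\<bar>)) \<in> borel_measurable (lebesgue :: real measure)"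
  "(\<lambda>x. exp (c * \<bar>x - y\<bar>)) \<in> borel_measurable (lebesgue :: real measure)"
  "(\<lambda>p. exp (c * \<bar>fst p - snd p\<bar>)) \<in> borel_measurable (lebesgue \<Otimes>\<^sub>M (lebesgue :: real measure))"
proof -
  have [measurable]: "(\<lambda>u. exp (c * \<bar>u\<bar>)) \<in> borel_measurable (borel :: real measure)"
    by (intro borel_measurable_continuous_onI continuous_intros)
  show "(\<lambda>y. exp (c * \<bar>x - y\<bar>)) \<in> borel_measurable (lebesgue :: real measure)"
    "(\<lambda>x. exp (c * \<bar>x - y\<bar>)) \<in> borel_measurable (lebesgue :: real measure)"
    by (intro measurable_completion, unfold measurable_lborel2,
      intro borel_measurable_continuous_onI continuous_intros)+
  show "(\<lambda>p. exp (c * \<bar>fst p - snd p\<bar>)) \<in> borel_measurable (lebesgue \<Otimes>\<^sub>M (lebesgue :: real measure))"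
    by (rule measurable_compose[OF measurable_diff_pair]) measurable
qed

text \<open>The majorant of all convolutions with kernels bounded by exp (- \<kappa> |x|); extended
  values postpone questions of integrability.\<close>

definition exp_conv :: "real \<Rightarrow> (real \<Rightarrow> 'a :: real_normed_vector) \<Rightarrow> real \<Rightarrow> ennreal" where
  "exp_conv \<kappa> f x = (\<integral>\<^sup>+y. ennreal (exp (- \<kappa> * \<bar>x - y\<bar>) * norm (f y)) \<partial>lebesgue)"

lemma measurable_kernel [measurable]:
  fixes f :: "real \<Rightarrow> 'a :: {real_normed_vector, second_countable_topology}"
  assumes [measurable]: "f \<in> borel_measurable lebesgue"
  shows "(\<lambda>(x, y). ennreal (exp (- \<kappa> * \<bar>x - y\<bar>) * norm (f y))) \<in> borel_measurable (lebesgue \<Otimes>\<^sub>M lebesgue)"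
proof -
  have [measurable]: "(\<lambda>p. f (snd p)) \<in> borel_measurable (lebesgue \<Otimes>\<^sub>M lebesgue)"
    by (rule measurable_compose[OF measurable_snd assms])
  show ?thesis unfolding split_beta by measurable
qed

text \<open>Cauchy-Schwarz with the splitting \<open>e\<^sup>-\<^sup>\<kappa>\<^sup>|\<^sup>x\<^sup>| = e\<^sup>-\<^sup>r\<^sup>\<kappa>\<^sup>|\<^sup>x\<^sup>|\<^sup>/\<^sup>2 e\<^sup>-\<^sup>(\<^sup>2\<^sup>-\<^sup>r\<^sup>)\<^sup>\<kappa>\<^sup>|\<^sup>x\<^sup>|\<^sup>/\<^sup>2\<close> of the kernel, followed by Fubini's theorem.\<close>

lemma weighted_exp_conv_bound:
  fixes f :: "real \<Rightarrow> 'a :: {real_normed_vector, second_countable_topology}" and v :: "real \<Rightarrow> real"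
  assumes f [measurable]: "f \<in> borel_measurable lebesgue" and v [measurable]: "v \<in> borel_measurable lebesgue"
    and \<kappa>: "\<kappa> > 0" and r: "0 < r"
    and M: "\<And>y. (\<integral>\<^sup>+x. ennreal ((v x)\<^sup>2 * exp (- ((2 - r) * \<kappa>) * \<bar>x - y\<bar>)) \<partial>lebesgue) \<le> ennreal M"
  shows "(\<integral>\<^sup>+x. ennreal ((v x)\<^sup>2) * (exp_conv \<kappa> f x)\<^sup>2 \<partial>lebesgue)
    \<le> ennreal (2 / (r * \<kappa>)) * ennreal M * (\<integral>\<^sup>+y. ennreal ((norm (f y))\<^sup>2) \<partial>lebesgue)"
proof -
  let ?k = "\<lambda>x y. exp (- (r * \<kappa> / 2) * \<bar>x - y\<bar>)" and ?l = "\<lambda>x y. exp (- ((2 - r) * \<kappa> / 2) * \<bar>x - y\<bar>)"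
  have [measurable]: "(\<lambda>p. f (snd p)) \<in> borel_measurable (lebesgue \<Otimes>\<^sub>M lebesgue)"
    "(\<lambda>p. v (fst p)) \<in> borel_measurable (lebesgue \<Otimes>\<^sub>M lebesgue)"
    by (rule measurable_compose[OF measurable_snd f] measurable_compose[OF measurable_fst v])+
  have kl: "exp (- \<kappa> * \<bar>x - y\<bar>) = ?k x y * ?l x y" for x y
    unfolding exp_add[symmetric] by (rule arg_cong[of _ _ exp]) (simp add: field_simps)
  have sq: "(?k x y)\<^sup>2 = exp (- (r * \<kappa>) * \<bar>x - y\<bar>)" "(?l x y)\<^sup>2 = exp (- ((2 - r) * \<kappa>) * \<bar>x - y\<bar>)" for x y
    by (simp_all add: exp_double[symmetric])
  have cs: "(exp_conv \<kappa> f x)\<^sup>2 \<le> ennreal (2 / (r * \<kappa>)) *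
      (\<integral>\<^sup>+y. ennreal (exp (- ((2 - r) * \<kappa>) * \<bar>x - y\<bar>) * (norm (f y))\<^sup>2) \<partial>lebesgue)" for x
  proof -
    have 1: "exp_conv \<kappa> f x = (\<integral>\<^sup>+y. ennreal (?k x y) * ennreal (?l x y * norm (f y)) \<partial>lebesgue)"
      unfolding exp_conv_def by (intro nn_integral_cong) (simp only: kl mult.assoc ennreal_mult exp_ge_zero
        mult_nonneg_nonneg norm_ge_zero)
    have 2: "(\<integral>\<^sup>+y. (ennreal (?k x y))\<^sup>2 \<partial>lebesgue) = ennreal (2 / (r * \<kappa>))"
    proof -
      have "(ennreal (?k x y))\<^sup>2 = ennreal (exp (- (r * \<kappa>) * \<bar>x - y\<bar>))" for y
        using sq(1) by (simp only: ennreal_power exp_ge_zero)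
      then show ?thesis using nn_integral_exp_abs(1)[OF mult_pos_pos[OF r \<kappa>]] by simp
    qed
    have 3: "(ennreal (?l x y * norm (f y)))\<^sup>2 = ennreal (exp (- ((2 - r) * \<kappa>) * \<bar>x - y\<bar>) * (norm (f y))\<^sup>2)" for y
      using sq(2) by (simp only: ennreal_power mult_nonneg_nonneg exp_ge_zero norm_ge_zero power_mult_distrib)
    show ?thesis
      using Cauchy_Schwarz_nn_integral[OF measurable_compose[OF measurable_exp_abs(1) measurable_ennreal]
        measurable_compose[OF borel_measurable_times[OF measurable_exp_abs(1) measurable_compose[OF f borel_measurable_norm]] measurable_ennreal],
        of "- (r * \<kappa> / 2)" x "- ((2 - r) * \<kappa> / 2)" x]
      unfolding 1[symmetric] 2 3 .
  qed
  have "(\<integral>\<^sup>+x. ennreal ((v x)\<^sup>2) * (exp_conv \<kappa> f x)\<^sup>2 \<partial>lebesgue) \<le>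
    (\<integral>\<^sup>+x. ennreal (2 / (r * \<kappa>)) *
      (\<integral>\<^sup>+y. ennreal ((v x)\<^sup>2 * exp (- ((2 - r) * \<kappa>) * \<bar>x - y\<bar>)) * ennreal ((norm (f y))\<^sup>2) \<partial>lebesgue) \<partial>lebesgue)"
  proof (rule nn_integral_mono)
    fix x
    have "ennreal ((v x)\<^sup>2) * (exp_conv \<kappa> f x)\<^sup>2 \<le> ennreal ((v x)\<^sup>2) * (ennreal (2 / (r * \<kappa>)) *
      (\<integral>\<^sup>+y. ennreal (exp (- ((2 - r) * \<kappa>) * \<bar>x - y\<bar>) * (norm (f y))\<^sup>2) \<partial>lebesgue))"
      by (intro mult_left_mono cs) simp
    also have "\<dots> = ennreal (2 / (r * \<kappa>)) *
      (ennreal ((v x)\<^sup>2) * (\<integral>\<^sup>+y. ennreal (exp (- ((2 - r) * \<kappa>) * \<bar>x - y\<bar>) * (norm (f y))\<^sup>2) \<partial>lebesgue))"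
      by (simp add: mult_ac)
    also have "ennreal ((v x)\<^sup>2) * (\<integral>\<^sup>+y. ennreal (exp (- ((2 - r) * \<kappa>) * \<bar>x - y\<bar>) * (norm (f y))\<^sup>2) \<partial>lebesgue)
      = (\<integral>\<^sup>+y. ennreal ((v x)\<^sup>2) * ennreal (exp (- ((2 - r) * \<kappa>) * \<bar>x - y\<bar>) * (norm (f y))\<^sup>2) \<partial>lebesgue)"
      by (rule nn_integral_cmult[symmetric]) measurable
    also have "\<dots> = (\<integral>\<^sup>+y. ennreal ((v x)\<^sup>2 * exp (- ((2 - r) * \<kappa>) * \<bar>x - y\<bar>)) * ennreal ((norm (f y))\<^sup>2) \<partial>lebesgue)"
      by (intro nn_integral_cong) (simp add: ennreal_mult mult.assoc)
    finally show "ennreal ((v x)\<^sup>2) * (exp_conv \<kappa> f x)\<^sup>2 \<le> ennreal (2 / (r * \<kappa>)) *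
      (\<integral>\<^sup>+y. ennreal ((v x)\<^sup>2 * exp (- ((2 - r) * \<kappa>) * \<bar>x - y\<bar>)) * ennreal ((norm (f y))\<^sup>2) \<partial>lebesgue)" .
  qed
  also have "\<dots> = ennreal (2 / (r * \<kappa>)) *
    (\<integral>\<^sup>+x. (\<integral>\<^sup>+y. ennreal ((v x)\<^sup>2 * exp (- ((2 - r) * \<kappa>) * \<bar>x - y\<bar>)) * ennreal ((norm (f y))\<^sup>2) \<partial>lebesgue) \<partial>lebesgue)"
    by (rule nn_integral_cmult) (intro lebesgue.borel_measurable_nn_integral, unfold split_beta, measurable)
  also have "(\<integral>\<^sup>+x. (\<integral>\<^sup>+y. ennreal ((v x)\<^sup>2 * exp (- ((2 - r) * \<kappa>) * \<bar>x - y\<bar>)) * ennreal ((norm (f y))\<^sup>2) \<partial>lebesgue) \<partial>lebesgue)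
    = (\<integral>\<^sup>+y. (\<integral>\<^sup>+x. ennreal ((v x)\<^sup>2 * exp (- ((2 - r) * \<kappa>) * \<bar>x - y\<bar>)) * ennreal ((norm (f y))\<^sup>2) \<partial>lebesgue) \<partial>lebesgue)"
    by (rule lebesgue_pair.Fubini'[symmetric]) (unfold split_beta, measurable)
  also have "\<dots> \<le> (\<integral>\<^sup>+y. ennreal M * ennreal ((norm (f y))\<^sup>2) \<partial>lebesgue)"
  proof (rule nn_integral_mono)
    fix y
    have "(\<integral>\<^sup>+x. ennreal ((v x)\<^sup>2 * exp (- ((2 - r) * \<kappa>) * \<bar>x - y\<bar>)) * ennreal ((norm (f y))\<^sup>2) \<partial>lebesgue)
      = (\<integral>\<^sup>+x. ennreal ((v x)\<^sup>2 * exp (- ((2 - r) * \<kappa>) * \<bar>x - y\<bar>)) \<partial>lebesgue) * ennreal ((norm (f y))\<^sup>2)"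
      by (rule nn_integral_multc) measurable
    then show "(\<integral>\<^sup>+x. ennreal ((v x)\<^sup>2 * exp (- ((2 - r) * \<kappa>) * \<bar>x - y\<bar>)) * ennreal ((norm (f y))\<^sup>2) \<partial>lebesgue)
      \<le> ennreal M * ennreal ((norm (f y))\<^sup>2)"
      using M[of y] by (simp add: mult_right_mono)
  qed
  also have "\<dots> = ennreal M * (\<integral>\<^sup>+y. ennreal ((norm (f y))\<^sup>2) \<partial>lebesgue)"
    by (rule nn_integral_cmult) measurable
  finally show ?thesis by (simp add: mult_left_mono mult.assoc)
qed

text \<open>Weight 1 and r = 1 give Schur's bound by the L^1 norm 2 / \<kappa> of the
  kernel.\<close>

lemma exp_conv_bound:
  fixes f :: "real \<Rightarrow> 'a :: {real_normed_vector, second_countable_topology}"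
  assumes "sq_integrable f" "\<kappa> > 0"
  shows "(\<integral>\<^sup>+x. (exp_conv \<kappa> f x)\<^sup>2 \<partial>lebesgue) \<le> ennreal ((2 / \<kappa> * l2_norm f)\<^sup>2)"
proof -
  have "(\<integral>\<^sup>+x. (exp_conv \<kappa> f x)\<^sup>2 \<partial>lebesgue)
    \<le> ennreal (2 / \<kappa>) * ennreal (2 / \<kappa>) * (\<integral>\<^sup>+y. ennreal ((norm (f y))\<^sup>2) \<partial>lebesgue)"
    using weighted_exp_conv_bound[of f "\<lambda>_. 1" \<kappa> 1 "2 / \<kappa>"] assms nn_integral_exp_abs(2)[OF assms(2)]
    by (simp add: sq_integrable_def)
  also have "\<dots> = ennreal ((2 / \<kappa> * l2_norm f)\<^sup>2)"
    unfolding nn_integral_l2[OF assms(1)] using assms(2)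
    by (simp add: ennreal_mult[symmetric] power2_eq_square mult_ac)
  finally show ?thesis .
qed

section \<open>Convolution operators on L^2 and their adjoints\<close>

definition conv :: "(real \<Rightarrow> real) \<Rightarrow> (real \<Rightarrow> 'a) \<Rightarrow> real \<Rightarrow> 'a :: {banach, second_countable_topology}" where
  "conv w f x = (LINT y|lebesgue. w (x - y) *\<^sub>R f y)"

definition exp_bounded :: "real \<Rightarrow> (real \<Rightarrow> real) \<Rightarrow> bool" where
  "exp_bounded \<kappa> w \<longleftrightarrow> 0 < \<kappa> \<and> w \<in> borel_measurable borel \<and> (\<forall>x. \<bar>w x\<bar> \<le> exp (- \<kappa> * \<bar>x\<bar>))"

lemma exp_bounded_measurable_pair:
  assumes "exp_bounded \<kappa> w"
  shows "(\<lambda>p. w (fst p - snd p)) \<in> borel_measurable (lebesgue \<Otimes>\<^sub>M lebesgue)"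
  using assms by (intro measurable_compose[OF measurable_diff_pair]) (auto simp: exp_bounded_def)

lemma exp_bounded_measurable:
  assumes "exp_bounded \<kappa> w"
  shows "(\<lambda>y. w (x - y)) \<in> borel_measurable lebesgue"
  using assms by (intro measurable_completion) (auto simp: exp_bounded_def)

lemma integrable_exp_abs:
  fixes c x :: real
  assumes "c > 0"
  shows "integrable lebesgue (\<lambda>y. exp (- c * \<bar>x - y\<bar>))"
proof (rule integrableI_bounded)
  show "(\<lambda>y. exp (- c * \<bar>x - y\<bar>)) \<in> borel_measurable lebesgue"
    by (rule measurable_exp_abs)
  show "(\<integral>\<^sup>+y. ennreal (norm (exp (- c * \<bar>x - y\<bar>))) \<partial>lebesgue) < \<infinity>"
    using nn_integral_exp_abs(1)[OF assms, of x] by simp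
qed

lemma integrable_conv:
  fixes f :: "real \<Rightarrow> 'a :: {banach, second_countable_topology}"
  assumes w: "exp_bounded \<kappa> w" and f: "sq_integrable f"
  shows "integrable lebesgue (\<lambda>y. w (x - y) *\<^sub>R f y)"
proof (rule Bochner_Integration.integrable_bound)
  have \<kappa>: "\<kappa> > 0" using w by (simp add: exp_bounded_def)
  show "integrable lebesgue (\<lambda>y. exp (- (2 * \<kappa>) * \<bar>x - y\<bar>) + (norm (f y))\<^sup>2)"
    using f \<kappa> by (intro Bochner_Integration.integrable_add integrable_exp_abs) (auto simp: sq_integrable_def)
  show "(\<lambda>y. w (x - y) *\<^sub>R f y) \<in> borel_measurable lebesgue"
    using f by (intro borel_measurable_scaleR exp_bounded_measurable[OF w]) (auto simp: sq_integrable_def)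
  show "AE y in lebesgue. norm (w (x - y) *\<^sub>R f y) \<le> norm (exp (- (2 * \<kappa>) * \<bar>x - y\<bar>) + (norm (f y))\<^sup>2)"
  proof (rule AE_I2)
    fix y
    let ?e = "exp (- \<kappa> * \<bar>x - y\<bar>)"
    have "norm (w (x - y) *\<^sub>R f y) \<le> ?e * norm (f y)"
      using w by (auto simp: exp_bounded_def intro!: mult_right_mono)
    also have "\<dots> \<le> ?e\<^sup>2 + (norm (f y))\<^sup>2"
    proof -
      have "2 * (?e * norm (f y)) \<le> ?e\<^sup>2 + (norm (f y))\<^sup>2"
        using zero_le_power2[of "?e - norm (f y)"] unfolding power2_diff by linarith
      moreover have "0 \<le> ?e * norm (f y)" by simp
      ultimately show ?thesis by linarith
    qed
    also have "?e\<^sup>2 = exp (- (2 * \<kappa>) * \<bar>x - y\<bar>)" by (simp add: exp_double[symmetric])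
    finally show "norm (w (x - y) *\<^sub>R f y) \<le> norm (exp (- (2 * \<kappa>) * \<bar>x - y\<bar>) + (norm (f y))\<^sup>2)"
      by simp
  qed
qed

lemma measurable_conv:
  fixes f :: "real \<Rightarrow> 'a :: {banach, second_countable_topology}"
  assumes w: "exp_bounded \<kappa> w" and f: "f \<in> borel_measurable lebesgue"
  shows "conv w f \<in> borel_measurable lebesgue"
  unfolding conv_def[abs_def]
proof (rule lebesgue.borel_measurable_lebesgue_integral)
  show "(\<lambda>(x, y). w (x - y) *\<^sub>R f y) \<in> borel_measurable (lebesgue \<Otimes>\<^sub>M lebesgue)"
    unfolding split_beta
    by (intro borel_measurable_scaleR exp_bounded_measurable_pair[OF w] measurable_compose[OF measurable_snd f])
qed

lemma norm_conv_le:
  fixes f :: "real \<Rightarrow> 'a :: {banach, second_countable_topology}"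
  assumes w: "exp_bounded \<kappa> w" and f: "sq_integrable f"
  shows "ennreal (norm (conv w f x)) \<le> exp_conv \<kappa> f x"
proof -
  have "ennreal (norm (conv w f x)) \<le> (\<integral>\<^sup>+y. ennreal (norm (w (x - y) *\<^sub>R f y)) \<partial>lebesgue)"
    unfolding conv_def by (rule integral_norm_bound_ennreal[OF integrable_conv[OF w f]])
  also have "\<dots> \<le> exp_conv \<kappa> f x"
    unfolding exp_conv_def using w
    by (intro nn_integral_mono ennreal_leI) (auto simp: exp_bounded_def intro!: mult_right_mono)
  finally show ?thesis .
qed

lemma l2_operator_conv:
  assumes w: "exp_bounded \<kappa> w"
  shows "l2_operator (2 / \<kappa>) (conv w :: (real \<Rightarrow> 'a :: {complex_normed_vector, euclidean_space}) \<Rightarrow> _)"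
proof -
  have \<kappa>: "\<kappa> > 0" using w by (simp add: exp_bounded_def)
  have 1: "conv w f \<in> borel_measurable lebesgue"
    and 2: "(\<integral>\<^sup>+x. ennreal ((norm (conv w f x))\<^sup>2) \<partial>lebesgue) \<le> ennreal ((2 / \<kappa> * l2_norm f)\<^sup>2)"
    and 3: "AE x in lebesgue. conv w (\<lambda>x. a *\<^sub>C f x) x = a *\<^sub>C conv w f x"
    if f: "sq_integrable f" for f :: "real \<Rightarrow> 'a" and a
  proof -
    show "conv w f \<in> borel_measurable lebesgue"
      using f by (intro measurable_conv[OF w]) (simp add: sq_integrable_def)
    have "ennreal ((norm (conv w f x))\<^sup>2) \<le> (exp_conv \<kappa> f x)\<^sup>2" for x
      using power_mono[OF norm_conv_le[OF w f], of x 2] by (simp add: ennreal_power)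
    then have "(\<integral>\<^sup>+x. ennreal ((norm (conv w f x))\<^sup>2) \<partial>lebesgue) \<le> (\<integral>\<^sup>+x. (exp_conv \<kappa> f x)\<^sup>2 \<partial>lebesgue)"
      by (intro nn_integral_mono)
    also have "\<dots> \<le> ennreal ((2 / \<kappa> * l2_norm f)\<^sup>2)" by (rule exp_conv_bound[OF f \<kappa>])
    finally show "(\<integral>\<^sup>+x. ennreal ((norm (conv w f x))\<^sup>2) \<partial>lebesgue) \<le> ennreal ((2 / \<kappa> * l2_norm f)\<^sup>2)" .
    show "AE x in lebesgue. conv w (\<lambda>x. a *\<^sub>C f x) x = a *\<^sub>C conv w f x"
      unfolding conv_def scaleR_scaleC_commute
      by (intro AE_I2 integral_bounded_linear bounded_linear_scaleC integrable_conv[OF w f])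
  qed
  have 4: "AE x in lebesgue. conv w (\<lambda>x. f x + g x) x = conv w f x + conv w g x"
    and 5: "(AE x in lebesgue. f x = g x) \<Longrightarrow> AE x in lebesgue. conv w f x = conv w g x"
    if f: "sq_integrable f" and g: "sq_integrable g" for f g :: "real \<Rightarrow> 'a"
  proof -
    show "AE x in lebesgue. conv w (\<lambda>x. f x + g x) x = conv w f x + conv w g x"
      unfolding conv_def scaleR_add_right
      by (intro AE_I2 Bochner_Integration.integral_add integrable_conv[OF w f] integrable_conv[OF w g])
    assume fg: "AE x in lebesgue. f x = g x"
    have "conv w f x = conv w g x" for x
      unfolding conv_def
    proof (rule integral_cong_AE)
      show "(\<lambda>y. w (x - y) *\<^sub>R f y) \<in> borel_measurable lebesgue" "(\<lambda>y. w (x - y) *\<^sub>R g y) \<in> borel_measurable lebesgue"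
        using integrable_conv[OF w f] integrable_conv[OF w g] by auto
      show "AE y in lebesgue. w (x - y) *\<^sub>R f y = w (x - y) *\<^sub>R g y"
        using fg by eventually_elim simp
    qed
    then show "AE x in lebesgue. conv w f x = conv w g x" by simp
  qed
  show ?thesis
    unfolding l2_operator_def
  proof (intro conjI allI impI)
    show "0 \<le> 2 / \<kappa>" using \<kappa> by simp
  qed (rule 1 2 3 4 5; assumption)+
qed

text \<open>The adjoint of convolution with \<open>w\<close> is convolution with the reflected kernel, with respect to
  any bounded bilinear pairing: the inner product and the pairing with test functions are used.\<close>

lemma conv_adjoint:
  fixes f :: "real \<Rightarrow> 'a :: {banach, second_countable_topology}" and h :: "real \<Rightarrow> 'b :: {banach, second_countable_topology}"
    and pair :: "'a \<Rightarrow> 'b \<Rightarrow> 'c :: {banach, second_countable_topology}"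
  assumes bb: "bounded_bilinear pair" and w: "exp_bounded \<kappa> w" and f: "sq_integrable f" and h: "sq_integrable h"
  shows "(LINT x|lebesgue. pair (conv w f x) (h x)) = (LINT y|lebesgue. pair (f y) (conv (\<lambda>x. w (- x)) h y))"
proof -
  interpret bounded_bilinear pair by (rule bb)
  have \<kappa>: "\<kappa> > 0" using w by (simp add: exp_bounded_def)
  have w': "exp_bounded \<kappa> (\<lambda>x. w (- x))"
    using w by (auto simp: exp_bounded_def dest: spec[of _ "- _"])
  obtain K where K: "0 \<le> K" "\<And>a b. norm (pair a b) \<le> norm a * norm b * K"
    using nonneg_bounded by blast
  have fm: "f \<in> borel_measurable lebesgue" and hm: "h \<in> borel_measurable lebesgue"
    using f h by (auto simp: sq_integrable_def)
  have [measurable]: "(\<lambda>p. f (snd p)) \<in> borel_measurable (lebesgue \<Otimes>\<^sub>M lebesgue)"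
    "(\<lambda>p. h (fst p)) \<in> borel_measurable (lebesgue \<Otimes>\<^sub>M lebesgue)"
    "(\<lambda>p. w (fst p - snd p)) \<in> borel_measurable (lebesgue \<Otimes>\<^sub>M lebesgue)"
    by (rule measurable_compose[OF measurable_snd fm] measurable_compose[OF measurable_fst hm]
        exp_bounded_measurable_pair[OF w])+
  let ?F = "\<lambda>x y. w (x - y) *\<^sub>R pair (f y) (h x)"
  have meas: "(\<lambda>(x, y). ?F x y) \<in> borel_measurable (lebesgue \<Otimes>\<^sub>M lebesgue)"
    unfolding split_beta
  proof (intro borel_measurable_scaleR)
    have "(\<lambda>p. pair (fst p) (snd p)) \<in> borel_measurable borel"
      by (intro borel_measurable_continuous_onI continuous_on continuous_intros)
    then have "(\<lambda>p. pair (fst p) (snd p)) \<in> borel_measurable (borel \<Otimes>\<^sub>M borel)"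
      by (simp add: borel_prod)
    from measurable_compose[OF _ this, of "\<lambda>p. (f (snd p), h (fst p))" "lebesgue \<Otimes>\<^sub>M lebesgue"]
    show "(\<lambda>p. pair (f (snd p)) (h (fst p))) \<in> borel_measurable (lebesgue \<Otimes>\<^sub>M lebesgue)"
      by simp
  qed measurable
  let ?E = "\<lambda>x y. exp (- \<kappa> * \<bar>x - y\<bar>)"
  \<comment> \<open>For Fubini's theorem |f(y)| |h(x)| is bounded by |f(y)|^2 + |h(x)|^2; in each
    term the exponential is integrated over the other variable.\<close>
  have int: "integrable (lebesgue \<Otimes>\<^sub>M lebesgue) (\<lambda>(x, y). ?F x y)"
  proof (rule integrableI_bounded[OF meas])
    have "(\<integral>\<^sup>+p. ennreal (norm (case p of (x, y) \<Rightarrow> ?F x y)) \<partial>(lebesgue \<Otimes>\<^sub>M lebesgue))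
      \<le> (\<integral>\<^sup>+p. ennreal K * (ennreal (?E (fst p) (snd p) * (norm (f (snd p)))\<^sup>2) + ennreal (?E (fst p) (snd p) * (norm (h (fst p)))\<^sup>2)) \<partial>(lebesgue \<Otimes>\<^sub>M lebesgue))"
    proof (rule nn_integral_mono)
      fix p :: "real \<times> real"
      obtain x y where p: "p = (x, y)" by (cases p)
      have "norm (?F x y) \<le> ?E x y * (norm (f y) * norm (h x) * K)"
        using w K(2) unfolding norm_scaleR by (intro mult_mono) (auto simp: exp_bounded_def)
      also have "\<dots> \<le> ?E x y * (((norm (f y))\<^sup>2 + (norm (h x))\<^sup>2) * K)"
      proof (intro mult_left_mono mult_right_mono)
        have "2 * (norm (f y) * norm (h x)) \<le> (norm (f y))\<^sup>2 + (norm (h x))\<^sup>2"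
          using zero_le_power2[of "norm (f y) - norm (h x)"] unfolding power2_diff by linarith
        moreover have "0 \<le> norm (f y) * norm (h x)" by simp
        ultimately show "norm (f y) * norm (h x) \<le> (norm (f y))\<^sup>2 + (norm (h x))\<^sup>2" by linarith
      qed (use K in auto)
      also have "\<dots> = K * (?E x y * (norm (f y))\<^sup>2 + ?E x y * (norm (h x))\<^sup>2)"
        by (simp add: algebra_simps)
      finally have "ennreal (norm (?F x y)) \<le> ennreal (K * (?E x y * (norm (f y))\<^sup>2 + ?E x y * (norm (h x))\<^sup>2))"
        by (rule ennreal_leI)
      also have "\<dots> = ennreal K * (ennreal (?E x y * (norm (f y))\<^sup>2) + ennreal (?E x y * (norm (h x))\<^sup>2))"
        using K by (simp add: ennreal_mult)
      finally show "ennreal (norm (case p of (x, y) \<Rightarrow> ?F x y)) \<le> ennreal K *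
        (ennreal (?E (fst p) (snd p) * (norm (f (snd p)))\<^sup>2) + ennreal (?E (fst p) (snd p) * (norm (h (fst p)))\<^sup>2))"
        by (simp add: p)
    qed
    also have "\<dots> = ennreal K * ((\<integral>\<^sup>+p. ennreal (?E (fst p) (snd p) * (norm (f (snd p)))\<^sup>2) \<partial>(lebesgue \<Otimes>\<^sub>M lebesgue))
       + (\<integral>\<^sup>+p. ennreal (?E (fst p) (snd p) * (norm (h (fst p)))\<^sup>2) \<partial>(lebesgue \<Otimes>\<^sub>M lebesgue)))"
      by (subst nn_integral_cmult, measurable) (subst nn_integral_add, measurable)
    also have "(\<integral>\<^sup>+p. ennreal (?E (fst p) (snd p) * (norm (f (snd p)))\<^sup>2) \<partial>(lebesgue \<Otimes>\<^sub>M lebesgue))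
      = (\<integral>\<^sup>+y. (\<integral>\<^sup>+x. ennreal (?E x y * (norm (f y))\<^sup>2) \<partial>lebesgue) \<partial>lebesgue)"
    proof -
      have "(\<lambda>p. ennreal (?E (fst p) (snd p) * (norm (f (snd p)))\<^sup>2)) \<in> borel_measurable (lebesgue \<Otimes>\<^sub>M lebesgue)"
        by measurable
      from lebesgue_pair.nn_integral_snd[OF this] show ?thesis by simp
    qed
    also have "\<dots> = (\<integral>\<^sup>+y. ennreal (2 / \<kappa>) * ennreal ((norm (f y))\<^sup>2) \<partial>lebesgue)"
    proof (rule nn_integral_cong)
      fix y
      have "(\<integral>\<^sup>+x. ennreal (?E x y * (norm (f y))\<^sup>2) \<partial>lebesgue) = (\<integral>\<^sup>+x. ennreal (?E x y) * ennreal ((norm (f y))\<^sup>2) \<partial>lebesgue)"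
        by (simp add: ennreal_mult)
      also have "\<dots> = (\<integral>\<^sup>+x. ennreal (?E x y) \<partial>lebesgue) * ennreal ((norm (f y))\<^sup>2)"
        by (rule nn_integral_multc) measurable
      finally show "(\<integral>\<^sup>+x. ennreal (?E x y * (norm (f y))\<^sup>2) \<partial>lebesgue) = ennreal (2 / \<kappa>) * ennreal ((norm (f y))\<^sup>2)"
        by (simp only: nn_integral_exp_abs(2)[OF \<kappa>])
    qed
    also have "(\<integral>\<^sup>+p. ennreal (?E (fst p) (snd p) * (norm (h (fst p)))\<^sup>2) \<partial>(lebesgue \<Otimes>\<^sub>M lebesgue))
      = (\<integral>\<^sup>+x. (\<integral>\<^sup>+y. ennreal (?E x y * (norm (h x))\<^sup>2) \<partial>lebesgue) \<partial>lebesgue)"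
    proof -
      have "(\<lambda>p. ennreal (?E (fst p) (snd p) * (norm (h (fst p)))\<^sup>2)) \<in> borel_measurable (lebesgue \<Otimes>\<^sub>M lebesgue)"
        by measurable
      from lebesgue.nn_integral_fst[OF this] show ?thesis by simp
    qed
    also have "\<dots> = (\<integral>\<^sup>+x. ennreal (2 / \<kappa>) * ennreal ((norm (h x))\<^sup>2) \<partial>lebesgue)"
    proof (rule nn_integral_cong)
      fix x
      have "(\<integral>\<^sup>+y. ennreal (?E x y * (norm (h x))\<^sup>2) \<partial>lebesgue) = (\<integral>\<^sup>+y. ennreal (?E x y) * ennreal ((norm (h x))\<^sup>2) \<partial>lebesgue)"
        by (simp add: ennreal_mult)
      also have "\<dots> = (\<integral>\<^sup>+y. ennreal (?E x y) \<partial>lebesgue) * ennreal ((norm (h x))\<^sup>2)"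
        by (rule nn_integral_multc) measurable
      finally show "(\<integral>\<^sup>+y. ennreal (?E x y * (norm (h x))\<^sup>2) \<partial>lebesgue) = ennreal (2 / \<kappa>) * ennreal ((norm (h x))\<^sup>2)"
        by (simp only: nn_integral_exp_abs(1)[OF \<kappa>])
    qed
    also have "ennreal K * ((\<integral>\<^sup>+y. ennreal (2 / \<kappa>) * ennreal ((norm (f y))\<^sup>2) \<partial>lebesgue)
       + (\<integral>\<^sup>+x. ennreal (2 / \<kappa>) * ennreal ((norm (h x))\<^sup>2) \<partial>lebesgue))
      = ennreal K * (ennreal (2 / \<kappa>) * ennreal ((l2_norm f)\<^sup>2) + ennreal (2 / \<kappa>) * ennreal ((l2_norm h)\<^sup>2))"
      using fm hm by (simp add: nn_integral_cmult nn_integral_l2[OF f] nn_integral_l2[OF h])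
    also have "\<dots> < \<infinity>" by (simp add: ennreal_mult_less_top)
    finally show "(\<integral>\<^sup>+p. ennreal (norm (case p of (x, y) \<Rightarrow> ?F x y)) \<partial>(lebesgue \<Otimes>\<^sub>M lebesgue)) < \<infinity>" .
  qed
  have "(LINT x|lebesgue. pair (conv w f x) (h x)) = (LINT x|lebesgue. LINT y|lebesgue. ?F x y)"
  proof (rule Bochner_Integration.integral_cong)
    fix x
    have "(LINT y|lebesgue. pair (w (x - y) *\<^sub>R f y) (h x)) = pair (conv w f x) (h x)"
      unfolding conv_def
      by (rule integral_bounded_linear[OF bounded_linear_left integrable_conv[OF w f]])
    then show "pair (conv w f x) (h x) = (LINT y|lebesgue. ?F x y)" by (simp add: scaleR_left)
  qed simp
  also have "\<dots> = (LINT y|lebesgue. LINT x|lebesgue. ?F x y)"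
    by (rule lebesgue_pair.Fubini_integral[OF int, symmetric])
  also have "\<dots> = (LINT y|lebesgue. pair (f y) (conv (\<lambda>x. w (- x)) h y))"
  proof (rule Bochner_Integration.integral_cong)
    fix y
    have "(LINT x|lebesgue. pair (f y) (w (- (y - x)) *\<^sub>R h x)) = pair (f y) (conv (\<lambda>x. w (- x)) h y)"
      unfolding conv_def
      by (rule integral_bounded_linear[OF bounded_linear_right integrable_conv[OF w' h]])
    then show "(LINT x|lebesgue. ?F x y) = pair (f y) (conv (\<lambda>x. w (- x)) h y)" by (simp add: scaleR_right)
  qed simp
  finally show ?thesis .
qed

section \<open>Matrix multipliers\<close>

lemma matrix_vector_mult_scaleC: "M *v (c *\<^sub>C v) = c *\<^sub>C (M *v (v :: complex ^ 2))" for M :: "complex ^ 2 ^ 2"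
  by (simp add: vec_eq_iff matrix_vector_mult_def scaleC_vec_def scaleC_complex_def sum_distrib_left mult_ac)

lemma scaleC_matrix_vector_mult: "(c *\<^sub>C M) *v v = c *\<^sub>C (M *v (v :: complex ^ 2))" for M :: "complex ^ 2 ^ 2"
  by (simp add: vec_eq_iff matrix_vector_mult_def scaleC_vec_def scaleC_complex_def sum_distrib_left mult_ac)

lemma norm_matrix_vector_mult: "norm (M *v v) \<le> onorm ((*v) M) * norm (v :: complex ^ 2)" for M :: "complex ^ 2 ^ 2"
  by (rule onorm[OF matrix_vector_mul_bounded_linear])

lemma l2_operator_matrix: "l2_operator (onorm ((*v) M)) (\<lambda>f x. M *v (f x))" for M :: "complex ^ 2 ^ 2"
proof -
  let ?c = "onorm ((*v) M)"
  have c: "0 \<le> ?c" by (rule onorm_pos_le[OF matrix_vector_mul_bounded_linear])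
  have 1: "(\<lambda>x. M *v f x) \<in> borel_measurable lebesgue"
    and 2: "(\<integral>\<^sup>+x. ennreal ((norm (M *v f x))\<^sup>2) \<partial>lebesgue) \<le> ennreal ((?c * l2_norm f)\<^sup>2)"
    if f: "sq_integrable f" for f :: "real \<Rightarrow> complex ^ 2"
  proof -
    show "(\<lambda>x. M *v f x) \<in> borel_measurable lebesgue"
      using sq_integrable_bounded_linear[OF matrix_vector_mul_bounded_linear f, of M] by (simp add: sq_integrable_def)
    have [measurable]: "f \<in> borel_measurable lebesgue" using f by (simp add: sq_integrable_def)
    have "(\<integral>\<^sup>+x. ennreal ((norm (M *v f x))\<^sup>2) \<partial>lebesgue) \<le> (\<integral>\<^sup>+x. ennreal (?c\<^sup>2) * ennreal ((norm (f x))\<^sup>2) \<partial>lebesgue)"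
    proof (rule nn_integral_mono)
      fix x
      have "(norm (M *v f x))\<^sup>2 \<le> (?c * norm (f x))\<^sup>2"
        by (intro power_mono norm_matrix_vector_mult) simp
      then show "ennreal ((norm (M *v f x))\<^sup>2) \<le> ennreal (?c\<^sup>2) * ennreal ((norm (f x))\<^sup>2)"
        by (simp add: power_mult_distrib flip: ennreal_mult)
    qed
    also have "\<dots> = ennreal (?c\<^sup>2) * ennreal ((l2_norm f)\<^sup>2)"
      by (subst nn_integral_cmult) (simp_all add: nn_integral_l2[OF f])
    also have "\<dots> = ennreal ((?c * l2_norm f)\<^sup>2)"
      by (simp add: power_mult_distrib ennreal_mult)
    finally show "(\<integral>\<^sup>+x. ennreal ((norm (M *v f x))\<^sup>2) \<partial>lebesgue) \<le> ennreal ((?c * l2_norm f)\<^sup>2)" .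
  qed
  show ?thesis
    unfolding l2_operator_def
    using c 1 2 by (auto simp: matrix_vector_right_distrib matrix_vector_mult_scaleC elim: eventually_mono)
qed

definition matop :: "complex ^ 2 ^ 2 \<Rightarrow> (complex ^ 2) l2 cop" where
  "matop M = lift_l2 (\<lambda>f x. M *v f x)"

lemma rep_matop: "AE x in lebesgue. rep_l2 (matop M \<bullet>\<^sub>o f) x = M *v rep_l2 f x"
  unfolding matop_def by (rule rep_lift_l2[OF l2_operator_matrix])

lemma norm_matop: "norm (matop M) \<le> onorm ((*v) M)"
  unfolding matop_def by (rule norm_lift_l2[OF l2_operator_matrix])

lemma matop_mult: "matop M * matop N = matop (M ** N)"
proof (rule cop_eqI, rule l2_eqI)
  fix f
  show "AE x in lebesgue. rep_l2 ((matop M * matop N) \<bullet>\<^sub>o f) x = rep_l2 (matop (M ** N) \<bullet>\<^sub>o f) x"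
    unfolding cop_apply_mult
    using rep_matop[of M "matop N \<bullet>\<^sub>o f"] rep_matop[of N f] rep_matop[of "M ** N" f]
    by eventually_elim (simp add: matrix_vector_mul_assoc)
qed

lemma matop_add: "matop M + matop N = matop (M + N)"
proof (rule cop_eqI, rule l2_eqI)
  fix f
  show "AE x in lebesgue. rep_l2 ((matop M + matop N) \<bullet>\<^sub>o f) x = rep_l2 (matop (M + N) \<bullet>\<^sub>o f) x"
    unfolding cop_apply_simps
    using rep_l2_add[of "matop M \<bullet>\<^sub>o f" "matop N \<bullet>\<^sub>o f"] rep_matop[of M f] rep_matop[of N f] rep_matop[of "M + N" f]
    by eventually_elim (simp add: matrix_vector_mult_add_rdistrib)
qed

lemma matop_scaleC: "c *\<^sub>C matop M = matop (c *\<^sub>C M)"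
proof (rule cop_eqI, rule l2_eqI)
  fix f
  show "AE x in lebesgue. rep_l2 (c *\<^sub>C matop M \<bullet>\<^sub>o f) x = rep_l2 (matop (c *\<^sub>C M) \<bullet>\<^sub>o f) x"
    unfolding cop_apply_scaleC
    using rep_l2_scaleC[of c "matop M \<bullet>\<^sub>o f"] rep_matop[of M f] rep_matop[of "c *\<^sub>C M" f]
    by eventually_elim (simp add: scaleC_matrix_vector_mult)
qed

lemma matop_one: "matop (mat 1) = 1"
proof (rule cop_eqI, rule l2_eqI)
  fix f
  show "AE x in lebesgue. rep_l2 (matop (mat 1) \<bullet>\<^sub>o f) x = rep_l2 (1 \<bullet>\<^sub>o f) x"
    using rep_matop[of "mat 1" f] by eventually_elim simp
qed

lemma matop_adjoint:
  assumes "\<And>u v. inner (M *v u) v = inner u (N *v v)"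
  shows "inner (matop M \<bullet>\<^sub>o f) g = inner f (matop N \<bullet>\<^sub>o g)"
  unfolding inner_l2_def
proof (rule integral_cong_AE)
  show "AE x in lebesgue. inner (rep_l2 (matop M \<bullet>\<^sub>o f) x) (rep_l2 g x) = inner (rep_l2 f x) (rep_l2 (matop N \<bullet>\<^sub>o g) x)"
    using rep_matop[of M f] rep_matop[of N g] by eventually_elim (simp add: assms)
qed (intro borel_measurable_inner measurable_rep_l2)+

section \<open>One-sided exponential convolutions\<close>

text \<open>The strict inequality makes the kernel vanish at 0, so that its sum with the reflected
  kernel stays below exp (- \<kappa> |x|) at every point.\<close>

definition half_exp :: "real \<Rightarrow> real \<Rightarrow> real" where
  "half_exp \<kappa> x = (if x > 0 then exp (- \<kappa> * x) else 0)"

lemma exp_bounded_half_exp: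
  assumes "\<kappa> > 0"
  shows "exp_bounded \<kappa> (half_exp \<kappa>)" "exp_bounded \<kappa> (\<lambda>x. half_exp \<kappa> (- x))"
proof -
  have [measurable]: "half_exp \<kappa> \<in> borel_measurable borel"
    unfolding half_exp_def[abs_def] by measurable
  show "exp_bounded \<kappa> (half_exp \<kappa>)" "exp_bounded \<kappa> (\<lambda>x. half_exp \<kappa> (- x))"
    using assms unfolding exp_bounded_def by (auto simp: half_exp_def)
qed

text \<open>\<open>forward \<kappa>\<close> is (d/dx + \<kappa>)^(-1) and
  \<open>backward \<kappa>\<close> is (- d/dx + \<kappa>)^(-1).\<close>

definition forward :: "real \<Rightarrow> (complex ^ 2) l2 cop" where
  "forward \<kappa> = lift_l2 (conv (half_exp \<kappa>))"

definition backward :: "real \<Rightarrow> (complex ^ 2) l2 cop" where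
  "backward \<kappa> = lift_l2 (conv (\<lambda>x. half_exp \<kappa> (- x)))"

lemma rep_forward: "\<kappa> > 0 \<Longrightarrow> AE x in lebesgue. rep_l2 (forward \<kappa> \<bullet>\<^sub>o f) x = conv (half_exp \<kappa>) (rep_l2 f) x"
  unfolding forward_def by (rule rep_lift_l2[OF l2_operator_conv[OF exp_bounded_half_exp(1)]])

lemma rep_backward: "\<kappa> > 0 \<Longrightarrow> AE x in lebesgue. rep_l2 (backward \<kappa> \<bullet>\<^sub>o f) x = conv (\<lambda>x. half_exp \<kappa> (- x)) (rep_l2 f) x"
  unfolding backward_def by (rule rep_lift_l2[OF l2_operator_conv[OF exp_bounded_half_exp(2)]])

lemma norm_forward_backward: "\<kappa> > 0 \<Longrightarrow> norm (forward \<kappa>) \<le> 2 / \<kappa>" "\<kappa> > 0 \<Longrightarrow> norm (backward \<kappa>) \<le> 2 / \<kappa>"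
  unfolding forward_def backward_def
  by (rule norm_lift_l2[OF l2_operator_conv[OF exp_bounded_half_exp(1)]], assumption)
    (rule norm_lift_l2[OF l2_operator_conv[OF exp_bounded_half_exp(2)]])

lemma l2_operator_cong:
  assumes "l2_operator c F" "sq_integrable f" "sq_integrable g" "AE x in lebesgue. f x = g x"
  shows "AE x in lebesgue. F f x = F g x"
  using assms by (simp add: l2_operator_def)

lemma lift_conv_matop:
  assumes w: "exp_bounded \<kappa> w"
  shows "lift_l2 (conv w) * matop M = matop M * lift_l2 (conv w)"
proof (rule cop_eqI, rule l2_eqI)
  fix f
  note op = l2_operator_conv[OF w, where ?'a = "complex ^ 2"]
  have 1: "AE x in lebesgue. conv w (rep_l2 (matop M \<bullet>\<^sub>o f)) x = conv w (\<lambda>y. M *v rep_l2 f y) x"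
    by (rule l2_operator_cong[OF op sq_integrable_rep_l2
          sq_integrable_bounded_linear[OF matrix_vector_mul_bounded_linear sq_integrable_rep_l2] rep_matop])
  have 2: "conv w (\<lambda>y. M *v rep_l2 f y) x = M *v conv w (rep_l2 f) x" for x
    unfolding conv_def
    using integral_bounded_linear[OF matrix_vector_mul_bounded_linear integrable_conv[OF w sq_integrable_rep_l2], of M x f]
    by (simp add: linear_scale[OF bounded_linear.linear[OF matrix_vector_mul_bounded_linear]])
  show "AE x in lebesgue. rep_l2 ((lift_l2 (conv w) * matop M) \<bullet>\<^sub>o f) x = rep_l2 ((matop M * lift_l2 (conv w)) \<bullet>\<^sub>o f) x"
    unfolding cop_apply_mult
    using 1 rep_lift_l2[OF op, of "matop M \<bullet>\<^sub>o f"] rep_matop[of M "lift_l2 (conv w) \<bullet>\<^sub>o f"] rep_lift_l2[OF op, of f]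
    by eventually_elim (simp add: 2)
qed

lemma forward_matop: "\<kappa> > 0 \<Longrightarrow> forward \<kappa> * matop M = matop M * forward \<kappa>"
  unfolding forward_def by (rule lift_conv_matop[OF exp_bounded_half_exp(1)])

lemma backward_matop: "\<kappa> > 0 \<Longrightarrow> backward \<kappa> * matop M = matop M * backward \<kappa>"
  unfolding backward_def by (rule lift_conv_matop[OF exp_bounded_half_exp(2)])

lemma inner_forward:
  assumes \<kappa>: "\<kappa> > 0"
  shows "inner (forward \<kappa> \<bullet>\<^sub>o f) h = inner f (backward \<kappa> \<bullet>\<^sub>o h)"
proof -
  have m: "rep_l2 f \<in> borel_measurable lebesgue" for f :: "(complex ^ 2) l2" by simp
  note w = exp_bounded_half_exp[OF \<kappa>]
  have "inner (forward \<kappa> \<bullet>\<^sub>o f) h = (LINT x|lebesgue. inner (conv (half_exp \<kappa>) (rep_l2 f) x) (rep_l2 h x))"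
    by (rule inner_l2_AE[OF rep_forward[OF \<kappa>] _ measurable_conv[OF w(1) m] m]) simp
  also have "\<dots> = (LINT x|lebesgue. inner (rep_l2 f x) (conv (\<lambda>x. half_exp \<kappa> (- x)) (rep_l2 h) x))"
    by (rule conv_adjoint[OF bounded_bilinear_inner w(1) sq_integrable_rep_l2 sq_integrable_rep_l2])
  also have "\<dots> = inner f (backward \<kappa> \<bullet>\<^sub>o h)"
    by (rule inner_l2_AE[OF _ rep_backward[OF \<kappa>] m measurable_conv[OF w(2) m], symmetric]) simp
  finally show ?thesis .
qed

lemma inner_backward: "\<kappa> > 0 \<Longrightarrow> inner (backward \<kappa> \<bullet>\<^sub>o f) h = inner f (forward \<kappa> \<bullet>\<^sub>o h)"
  by (metis inner_commute inner_forward)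

section \<open>Weak derivatives\<close>

definition test_function :: "(real \<Rightarrow> real) \<Rightarrow> (real \<Rightarrow> real) \<Rightarrow> bool" where
  "test_function \<phi> \<phi>' \<longleftrightarrow> (\<forall>x. (\<phi> has_real_derivative \<phi>' x) (at x)) \<and> continuous_on UNIV \<phi>' \<and>
     compact (closure {x. \<phi> x \<noteq> 0})"

lemma weak_derivative_iff:
  "weak_derivative f g \<longleftrightarrow> (\<forall>\<phi> \<phi>'. test_function \<phi> \<phi>' \<longrightarrow>
     (LINT x|lebesgue. \<phi>' x *\<^sub>R rep_l2 f x) = - (LINT x|lebesgue. \<phi> x *\<^sub>R rep_l2 g x))"
  unfolding weak_derivative_def test_function_def by blast

lemma sq_integrable_compact_support:
  fixes \<psi> :: "real \<Rightarrow> real"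
  assumes "continuous_on UNIV \<psi>" "\<And>x. \<bar>x\<bar> \<ge> N \<Longrightarrow> \<psi> x = 0"
  shows "sq_integrable \<psi>"
  unfolding sq_integrable_def
proof
  have m: "\<psi> \<in> borel_measurable borel" using assms(1) by (rule borel_measurable_continuous_onI)
  then show "\<psi> \<in> borel_measurable lebesgue" by (intro measurable_completion) simp
  have "integrable lborel (\<lambda>x. indicator {- N..N} x *\<^sub>R (norm (\<psi> x))\<^sup>2)"
    by (intro borel_integrable_compact continuous_intros continuous_on_subset[OF assms(1)]) auto
  also have "(\<lambda>x. indicator {- N..N} x *\<^sub>R (norm (\<psi> x))\<^sup>2) = (\<lambda>x. (norm (\<psi> x))\<^sup>2)"
  proof
    fix x
    show "indicator {- N..N} x *\<^sub>R (norm (\<psi> x))\<^sup>2 = (norm (\<psi> x))\<^sup>2"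
      using assms(2)[of x] by (cases "\<bar>x\<bar> \<ge> N") (auto simp: indicator_def)
  qed
  finally show "integrable lebesgue (\<lambda>x. (norm (\<psi> x))\<^sup>2)"
    using m by (subst integrable_completion) auto
qed

lemma test_function_support:
  assumes "test_function \<phi> \<phi>'"
  obtains N where "N > 0" "\<And>x. \<bar>x\<bar> \<ge> N \<Longrightarrow> \<phi> x = 0" "\<And>x. \<bar>x\<bar> \<ge> N \<Longrightarrow> \<phi>' x = 0"
    "continuous_on UNIV \<phi>" "continuous_on UNIV \<phi>'" "sq_integrable \<phi>" "sq_integrable \<phi>'"
proof -
  have der: "(\<phi> has_real_derivative \<phi>' x) (at x)" for x using assms by (simp add: test_function_def)
  have "bounded (closure {x. \<phi> x \<noteq> 0})"
    using assms by (simp add: test_function_def compact_imp_bounded)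
  then obtain B where B': "\<And>x. x \<in> closure {x. \<phi> x \<noteq> 0} \<Longrightarrow> norm x \<le> B"
    unfolding bounded_iff by blast
  have B: "\<bar>x\<bar> \<le> B" if "\<phi> x \<noteq> 0" for x
    using B'[of x] subsetD[OF closure_subset, of x "{x. \<phi> x \<noteq> 0}"] that by simp
  define N where "N = \<bar>B\<bar> + 1"
  have z: "\<phi> x = 0" if "\<bar>x\<bar> > \<bar>B\<bar>" for x using B[of x] that by (cases "\<phi> x = 0") auto
  have 1: "\<phi> x = 0" if "\<bar>x\<bar> \<ge> N" for x using z[of x] that by (simp add: N_def)
  have 2: "\<phi>' x = 0" if "\<bar>x\<bar> \<ge> N" for x
  proof -
    have "((\<lambda>x. 0) has_real_derivative \<phi>' x) (at x)"
    proof (rule has_field_derivative_transform_within_open[OF der])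
      show "open (- {- \<bar>B\<bar>..\<bar>B\<bar>})" by (simp add: open_Compl)
      show "x \<in> - {- \<bar>B\<bar>..\<bar>B\<bar>}" using that by (auto simp: N_def)
      show "\<phi> y = 0" if "y \<in> - {- \<bar>B\<bar>..\<bar>B\<bar>}" for y using z[of y] that by auto
    qed
    from DERIV_unique[OF this DERIV_const] show ?thesis .
  qed
  have c: "continuous_on UNIV \<phi>" 
    by (rule DERIV_continuous_on[OF has_field_derivative_at_within[OF der]])
  have c': "continuous_on UNIV \<phi>'" using assms by (simp add: test_function_def)
  show ?thesis
    by (rule that[of N, OF _ 1 2 c c' sq_integrable_compact_support[OF c 1] sq_integrable_compact_support[OF c' 2]])
      (simp add: N_def)
qed

lemma integrable_scaleR_sq_integrable:
  fixes f :: "real \<Rightarrow> 'a :: {banach, second_countable_topology}"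
  assumes "sq_integrable \<phi>" "sq_integrable f"
  shows "integrable lebesgue (\<lambda>x. \<phi> x *\<^sub>R f x)"
proof (rule Bochner_Integration.integrable_bound)
  show "integrable lebesgue (\<lambda>x. (norm (\<phi> x))\<^sup>2 + (norm (f x))\<^sup>2)"
    using assms by (simp add: sq_integrable_def)
  show "(\<lambda>x. \<phi> x *\<^sub>R f x) \<in> borel_measurable lebesgue"
    using assms by (intro borel_measurable_scaleR) (auto simp: sq_integrable_def)
  show "AE x in lebesgue. norm (\<phi> x *\<^sub>R f x) \<le> norm ((norm (\<phi> x))\<^sup>2 + (norm (f x))\<^sup>2)"
  proof (rule AE_I2)
    fix x
    have "2 * (norm (\<phi> x) * norm (f x)) \<le> (norm (\<phi> x))\<^sup>2 + (norm (f x))\<^sup>2"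
      using zero_le_power2[of "norm (\<phi> x) - norm (f x)"] unfolding power2_diff by linarith
    moreover have "0 \<le> norm (\<phi> x) * norm (f x)" by simp
    ultimately have "norm (\<phi> x) * norm (f x) \<le> (norm (\<phi> x))\<^sup>2 + (norm (f x))\<^sup>2" by linarith
    then show "norm (\<phi> x *\<^sub>R f x) \<le> norm ((norm (\<phi> x))\<^sup>2 + (norm (f x))\<^sup>2)" by simp
  qed
qed

lemma sq_integrable_conv:
  fixes f :: "real \<Rightarrow> 'a :: {banach, second_countable_topology}"
  assumes w: "exp_bounded \<kappa> w" and f: "sq_integrable f"
  shows "sq_integrable (conv w f)"
proof -
  have \<kappa>: "\<kappa> > 0" using w by (simp add: exp_bounded_def)
  have m [measurable]: "conv w f \<in> borel_measurable lebesgue"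
    using f by (intro measurable_conv[OF w]) (simp add: sq_integrable_def)
  have "ennreal ((norm (conv w f x))\<^sup>2) \<le> (exp_conv \<kappa> f x)\<^sup>2" for x
    using power_mono[OF norm_conv_le[OF w f], of x 2] by (simp add: ennreal_power)
  then have "(\<integral>\<^sup>+x. ennreal ((norm (conv w f x))\<^sup>2) \<partial>lebesgue) \<le> (\<integral>\<^sup>+x. (exp_conv \<kappa> f x)\<^sup>2 \<partial>lebesgue)"
    by (intro nn_integral_mono)
  also have "\<dots> \<le> ennreal ((2 / \<kappa> * l2_norm f)\<^sup>2)" by (rule exp_conv_bound[OF f \<kappa>])
  also have "\<dots> < \<infinity>" by simp
  finally have "integrable lebesgue (\<lambda>x. (norm (conv w f x))\<^sup>2)"
    by (intro integrableI_bounded) auto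
  then show ?thesis using m by (simp add: sq_integrable_def)
qed

text \<open>The left endpoint is exempt from the condition on \<open>g\<close> because one-sided
  kernels jump there.\<close>

lemma lebesgue_integral_FTC:
  fixes F F' g :: "real \<Rightarrow> real"
  assumes "a \<le> b" "\<And>x. (F has_real_derivative F' x) (at x)" "continuous_on UNIV F'"
    and g: "\<And>x. x \<noteq> a \<Longrightarrow> g x = indicator {a..b} x * F' x"
    and meas: "g \<in> borel_measurable lebesgue"
  shows "(LINT x|lebesgue. g x) = F b - F a"
proof -
  have hb: "has_bochner_integral lborel (\<lambda>x. indicator {a..b} x *\<^sub>R F' x) (F b - F a)"
    using assms(1-3) by (intro has_bochner_integral_FTC_Icc)
      (auto intro: has_field_derivative_at_within continuous_on_subset
        simp flip: has_real_derivative_iff_has_vector_derivative)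
  then have m: "(\<lambda>x. indicator {a..b} x *\<^sub>R F' x) \<in> borel_measurable lborel"
    using borel_measurable_has_bochner_integral by blast
  have "(LINT x|lebesgue. g x) = (LINT x|lebesgue. indicator {a..b} x *\<^sub>R F' x)"
  proof (rule integral_cong_AE[OF meas])
    show "(\<lambda>x. indicator {a..b} x *\<^sub>R F' x) \<in> borel_measurable lebesgue"
      using m by (rule measurable_completion)
    have "AE x in lebesgue. x \<noteq> a" using AE_lborel_singleton by (rule AE_completion)
    then show "AE x in lebesgue. g x = indicator {a..b} x *\<^sub>R F' x"
      by eventually_elim (simp add: g)
  qed
  also have "\<dots> = (LINT x|lborel. indicator {a..b} x *\<^sub>R F' x)"
    by (rule integral_completion[OF m])
  also have "\<dots> = F b - F a" by (rule has_bochner_integral_integral_eq[OF hb])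
  finally show ?thesis .
qed

text \<open>Integration by parts against a one-sided exponential: its jump contributes \<phi>(y),
  and \<phi> vanishes at the far end.\<close>

lemma conv_test_function:
  assumes \<kappa>: "\<kappa> > 0" and \<phi>: "test_function \<phi> \<phi>'"
  shows "conv (\<lambda>x. half_exp \<kappa> (- x)) \<phi>' y = \<kappa> * conv (\<lambda>x. half_exp \<kappa> (- x)) \<phi> y - \<phi> y"
    and "conv (half_exp \<kappa>) \<phi>' y = \<phi> y - \<kappa> * conv (half_exp \<kappa>) \<phi> y"
proof -
  note w = exp_bounded_half_exp[OF \<kappa>]
  obtain N where N: "N > 0" "\<And>x. \<bar>x\<bar> \<ge> N \<Longrightarrow> \<phi> x = 0" "\<And>x. \<bar>x\<bar> \<ge> N \<Longrightarrow> \<phi>' x = 0"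
    and c: "continuous_on UNIV \<phi>" "continuous_on UNIV \<phi>'" and sq: "sq_integrable \<phi>" "sq_integrable \<phi>'"
    using test_function_support[OF \<phi>] by blast
  have der: "(\<phi> has_real_derivative \<phi>' x) (at x)" for x using \<phi> by (simp add: test_function_def)
  note i = integrable_conv[OF w(2) sq(1), of y] integrable_conv[OF w(2) sq(2), of y]
    integrable_conv[OF w(1) sq(1), of y] integrable_conv[OF w(1) sq(2), of y]
  \<comment> \<open>The far endpoints b and a lie where \<phi> vanishes, and on the correct side of
    y even if y is outside the support.\<close>
  define b where "b = max N y"
  define a where "a = min (- N) y"
  have "(LINT x|lebesgue. half_exp \<kappa> (- (y - x)) *\<^sub>R \<phi>' x - \<kappa> * (half_exp \<kappa> (- (y - x)) *\<^sub>R \<phi> x))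
    = exp (- \<kappa> * (b - y)) * \<phi> b - exp (- \<kappa> * (y - y)) * \<phi> y"
  proof (rule lebesgue_integral_FTC[where F = "\<lambda>x. exp (- \<kappa> * (x - y)) * \<phi> x" and F' = "\<lambda>x. exp (- \<kappa> * (x - y)) * (\<phi>' x - \<kappa> * \<phi> x)"])
    show "y \<le> b" by (simp add: b_def)
    show "((\<lambda>x. exp (- \<kappa> * (x - y)) * \<phi> x) has_real_derivative exp (- \<kappa> * (x - y)) * (\<phi>' x - \<kappa> * \<phi> x)) (at x)" for x
      by (auto intro!: derivative_eq_intros der simp: algebra_simps)
    show "continuous_on UNIV (\<lambda>x. exp (- \<kappa> * (x - y)) * (\<phi>' x - \<kappa> * \<phi> x))"
      by (intro continuous_intros c)
    show "half_exp \<kappa> (- (y - x)) *\<^sub>R \<phi>' x - \<kappa> * (half_exp \<kappa> (- (y - x)) *\<^sub>R \<phi> x)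
      = indicator {y..b} x * (exp (- \<kappa> * (x - y)) * (\<phi>' x - \<kappa> * \<phi> x))" if "x \<noteq> y" for x
      using that N(2,3)[of x] by (auto simp: half_exp_def indicator_def b_def algebra_simps)
    show "(\<lambda>x. half_exp \<kappa> (- (y - x)) *\<^sub>R \<phi>' x - \<kappa> * (half_exp \<kappa> (- (y - x)) *\<^sub>R \<phi> x)) \<in> borel_measurable lebesgue"
      using i by auto
  qed
  also have "\<dots> = - \<phi> y" using N(1) N(2)[of b] by (auto simp: b_def)
  finally show "conv (\<lambda>x. half_exp \<kappa> (- x)) \<phi>' y = \<kappa> * conv (\<lambda>x. half_exp \<kappa> (- x)) \<phi> y - \<phi> y"
    using i(1,2) by (simp add: conv_def)
  have "(LINT x|lebesgue. half_exp \<kappa> (y - x) *\<^sub>R \<phi>' x + \<kappa> * (half_exp \<kappa> (y - x) *\<^sub>R \<phi> x))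
    = exp (\<kappa> * (y - y)) * \<phi> y - exp (\<kappa> * (a - y)) * \<phi> a"
  proof -
    let ?g = "\<lambda>x. half_exp \<kappa> (y - x) *\<^sub>R \<phi>' x + \<kappa> * (half_exp \<kappa> (y - x) *\<^sub>R \<phi> x)"
    let ?F' = "\<lambda>x. exp (\<kappa> * (x - y)) * (\<phi>' x + \<kappa> * \<phi> x)"
    \<comment> \<open>This kernel jumps at the right endpoint y, whereas
      \<open>lebesgue_integral_FTC\<close> exempts only the left one; the integrand is therefore
      corrected at the single point y.\<close>
    have "(LINT x|lebesgue. ?g x) = (LINT x|lebesgue. (if x = y then indicator {a..y} x * ?F' x else ?g x))"
    proof (rule integral_cong_AE)
      have "AE x in lebesgue. x \<noteq> y" using AE_lborel_singleton by (rule AE_completion)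
      then show "AE x in lebesgue. ?g x = (if x = y then indicator {a..y} x * ?F' x else ?g x)"
        by eventually_elim simp
      show "?g \<in> borel_measurable lebesgue" using i by auto
      then show "(\<lambda>x. if x = y then indicator {a..y} x * ?F' x else ?g x) \<in> borel_measurable lebesgue"
        by (intro measurable_If) (auto intro!: measurable_completion borel_measurable_times borel_measurable_indicator
          borel_measurable_continuous_onI continuous_intros c)
    qed
    also have "\<dots> = exp (\<kappa> * (y - y)) * \<phi> y - exp (\<kappa> * (a - y)) * \<phi> a"
    proof (rule lebesgue_integral_FTC[where F = "\<lambda>x. exp (\<kappa> * (x - y)) * \<phi> x" and F' = ?F'])
      show "a \<le> y" by (simp add: a_def)
      show "((\<lambda>x. exp (\<kappa> * (x - y)) * \<phi> x) has_real_derivative ?F' x) (at x)" for x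
        by (auto intro!: derivative_eq_intros der simp: algebra_simps)
      show "continuous_on UNIV ?F'" by (intro continuous_intros c)
      show "(if x = y then indicator {a..y} x * ?F' x else ?g x) = indicator {a..y} x * ?F' x" for x
        using N(2,3)[of x] by (auto simp: half_exp_def indicator_def a_def algebra_simps)
      have "?g \<in> borel_measurable lebesgue" using i by auto
      then show "(\<lambda>x. if x = y then indicator {a..y} x * ?F' x else ?g x) \<in> borel_measurable lebesgue"
        by (intro measurable_If) (auto intro!: measurable_completion borel_measurable_times borel_measurable_indicator
          borel_measurable_continuous_onI continuous_intros c)
    qed
    finally show ?thesis .
  qed
  also have "\<dots> = \<phi> y" using N(1) N(2)[of a] by (auto simp: a_def)
  finally show "conv (half_exp \<kappa>) \<phi>' y = \<phi> y - \<kappa> * conv (half_exp \<kappa>) \<phi> y"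
    using i(3,4) by (simp add: conv_def)
qed

lemma pair_scaleR: "bounded_bilinear (\<lambda>(v :: 'a :: real_normed_vector) r. r *\<^sub>R v)"
  using bounded_bilinear.flip[OF bounded_bilinear_scaleR] .

lemma integral_rep_cong:
  assumes "AE x in lebesgue. rep_l2 f x = g x" "g \<in> borel_measurable lebesgue" "sq_integrable \<phi>"
  shows "(LINT x|lebesgue. \<phi> x *\<^sub>R rep_l2 f x) = (LINT x|lebesgue. \<phi> x *\<^sub>R g x)"
  using assms
  by (intro integral_cong_AE borel_measurable_scaleR measurable_rep_l2)
    (auto simp: sq_integrable_def elim: eventually_mono)

text \<open>The adjoint moves the convolution onto the test function, where the classical identity
  \<open>conv_test_function\<close> applies.\<close>

lemma weak_derivative_forward:
  assumes \<kappa>: "\<kappa> > 0"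
  shows "weak_derivative (forward \<kappa> \<bullet>\<^sub>o f) (f - \<kappa> *\<^sub>R (forward \<kappa> \<bullet>\<^sub>o f))"
  unfolding weak_derivative_iff
proof (intro allI impI)
  fix \<phi> \<phi>' assume \<phi>: "test_function \<phi> \<phi>'"
  note w = exp_bounded_half_exp[OF \<kappa>] and sq_f = sq_integrable_rep_l2[of f]
  obtain N where sq: "sq_integrable \<phi>" "sq_integrable \<phi>'" using test_function_support[OF \<phi>] by blast
  let ?u = "rep_l2 f" and ?w = "\<lambda>x. half_exp \<kappa> (- x)"
  note cf = sq_integrable_conv[OF w(1) sq_f]
  have mcf: "conv (half_exp \<kappa>) ?u \<in> borel_measurable lebesgue" using cf by (simp add: sq_integrable_def)
  have adj: "(LINT x|lebesgue. \<psi> x *\<^sub>R conv (half_exp \<kappa>) ?u x) = (LINT y|lebesgue. conv ?w \<psi> y *\<^sub>R ?u y)"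
    if "sq_integrable \<psi>" for \<psi>
    using conv_adjoint[OF pair_scaleR w(1) sq_f that] .
  have "(LINT x|lebesgue. \<phi>' x *\<^sub>R rep_l2 (forward \<kappa> \<bullet>\<^sub>o f) x) = (LINT x|lebesgue. \<phi>' x *\<^sub>R conv (half_exp \<kappa>) ?u x)"
    by (rule integral_rep_cong[OF rep_forward[OF \<kappa>] mcf sq(2)])
  also have "\<dots> = (LINT y|lebesgue. \<kappa> *\<^sub>R (conv ?w \<phi> y *\<^sub>R ?u y) - \<phi> y *\<^sub>R ?u y)"
    unfolding adj[OF sq(2)] conv_test_function(1)[OF \<kappa> \<phi>] by (simp add: scaleR_diff_left)
  also have "\<dots> = \<kappa> *\<^sub>R (LINT y|lebesgue. conv ?w \<phi> y *\<^sub>R ?u y) - (LINT y|lebesgue. \<phi> y *\<^sub>R ?u y)"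
    by (subst Bochner_Integration.integral_diff)
      (simp_all only: integral_scaleR_right integrable_scaleR_right
        integrable_scaleR_sq_integrable[OF sq_integrable_conv[OF w(2) sq(1)] sq_f]
        integrable_scaleR_sq_integrable[OF sq(1) sq_f])
  also have "\<dots> = - (LINT y|lebesgue. \<phi> y *\<^sub>R (?u y - \<kappa> *\<^sub>R conv (half_exp \<kappa>) ?u y))"
  proof -
    have "\<phi> y *\<^sub>R (?u y - \<kappa> *\<^sub>R conv (half_exp \<kappa>) ?u y) = \<phi> y *\<^sub>R ?u y - \<kappa> *\<^sub>R (\<phi> y *\<^sub>R conv (half_exp \<kappa>) ?u y)" for y
      by (simp add: scaleR_diff_right)
    moreover have "(LINT y|lebesgue. \<phi> y *\<^sub>R ?u y - \<kappa> *\<^sub>R (\<phi> y *\<^sub>R conv (half_exp \<kappa>) ?u y))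
      = (LINT y|lebesgue. \<phi> y *\<^sub>R ?u y) - \<kappa> *\<^sub>R (LINT y|lebesgue. \<phi> y *\<^sub>R conv (half_exp \<kappa>) ?u y)"
      by (subst Bochner_Integration.integral_diff)
        (simp_all only: integral_scaleR_right integrable_scaleR_right
          integrable_scaleR_sq_integrable[OF sq(1) sq_f] integrable_scaleR_sq_integrable[OF sq(1) cf])
    ultimately show ?thesis by (simp only: adj[OF sq(1), symmetric] minus_diff_eq)
  qed
  also have "(LINT y|lebesgue. \<phi> y *\<^sub>R (?u y - \<kappa> *\<^sub>R conv (half_exp \<kappa>) ?u y))
    = (LINT x|lebesgue. \<phi> x *\<^sub>R rep_l2 (f - \<kappa> *\<^sub>R (forward \<kappa> \<bullet>\<^sub>o f)) x)"
  proof (rule integral_rep_cong[symmetric, OF _ _ sq(1)])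
    show "AE x in lebesgue. rep_l2 (f - \<kappa> *\<^sub>R (forward \<kappa> \<bullet>\<^sub>o f)) x = ?u x - \<kappa> *\<^sub>R conv (half_exp \<kappa>) ?u x"
      using rep_l2_diff[of f "\<kappa> *\<^sub>R (forward \<kappa> \<bullet>\<^sub>o f)"] rep_l2_scaleR[of \<kappa> "forward \<kappa> \<bullet>\<^sub>o f"] rep_forward[OF \<kappa>, of f]
      by eventually_elim simp
    show "(\<lambda>x. ?u x - \<kappa> *\<^sub>R conv (half_exp \<kappa>) ?u x) \<in> borel_measurable lebesgue"
      using mcf by measurable
  qed
  finally show "(LINT x|lebesgue. \<phi>' x *\<^sub>R rep_l2 (forward \<kappa> \<bullet>\<^sub>o f) x) =
    - (LINT x|lebesgue. \<phi> x *\<^sub>R rep_l2 (f - \<kappa> *\<^sub>R (forward \<kappa> \<bullet>\<^sub>o f)) x)" .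
qed

lemma weak_derivative_backward:
  assumes \<kappa>: "\<kappa> > 0"
  shows "weak_derivative (backward \<kappa> \<bullet>\<^sub>o f) (\<kappa> *\<^sub>R (backward \<kappa> \<bullet>\<^sub>o f) - f)"
  unfolding weak_derivative_iff
proof (intro allI impI)
  fix \<phi> \<phi>' assume \<phi>: "test_function \<phi> \<phi>'"
  note w = exp_bounded_half_exp[OF \<kappa>] and sq_f = sq_integrable_rep_l2[of f]
  obtain N where sq: "sq_integrable \<phi>" "sq_integrable \<phi>'" using test_function_support[OF \<phi>] by blast
  let ?u = "rep_l2 f" and ?w = "\<lambda>x. half_exp \<kappa> (- x)"
  note cf = sq_integrable_conv[OF w(2) sq_f]
  have mcf: "conv ?w ?u \<in> borel_measurable lebesgue" using cf by (simp add: sq_integrable_def)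
  have adj: "(LINT x|lebesgue. \<psi> x *\<^sub>R conv ?w ?u x) = (LINT y|lebesgue. conv (half_exp \<kappa>) \<psi> y *\<^sub>R ?u y)"
    if "sq_integrable \<psi>" for \<psi>
    using conv_adjoint[OF pair_scaleR w(2) sq_f that] by simp
  have "(LINT x|lebesgue. \<phi>' x *\<^sub>R rep_l2 (backward \<kappa> \<bullet>\<^sub>o f) x) = (LINT x|lebesgue. \<phi>' x *\<^sub>R conv ?w ?u x)"
    by (rule integral_rep_cong[OF rep_backward[OF \<kappa>] mcf sq(2)])
  also have "\<dots> = (LINT y|lebesgue. \<phi> y *\<^sub>R ?u y - \<kappa> *\<^sub>R (conv (half_exp \<kappa>) \<phi> y *\<^sub>R ?u y))"
    unfolding adj[OF sq(2)] conv_test_function(2)[OF \<kappa> \<phi>] by (simp add: scaleR_diff_left)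
  also have "\<dots> = (LINT y|lebesgue. \<phi> y *\<^sub>R ?u y) - \<kappa> *\<^sub>R (LINT y|lebesgue. conv (half_exp \<kappa>) \<phi> y *\<^sub>R ?u y)"
    by (subst Bochner_Integration.integral_diff)
      (simp_all only: integral_scaleR_right integrable_scaleR_right
        integrable_scaleR_sq_integrable[OF sq_integrable_conv[OF w(1) sq(1)] sq_f]
        integrable_scaleR_sq_integrable[OF sq(1) sq_f])
  also have "\<dots> = - (LINT y|lebesgue. \<phi> y *\<^sub>R (\<kappa> *\<^sub>R conv ?w ?u y - ?u y))"
  proof -
    have "\<phi> y *\<^sub>R (\<kappa> *\<^sub>R conv ?w ?u y - ?u y) = \<kappa> *\<^sub>R (\<phi> y *\<^sub>R conv ?w ?u y) - \<phi> y *\<^sub>R ?u y" for y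
      by (simp add: scaleR_diff_right)
    moreover have "(LINT y|lebesgue. \<kappa> *\<^sub>R (\<phi> y *\<^sub>R conv ?w ?u y) - \<phi> y *\<^sub>R ?u y)
      = \<kappa> *\<^sub>R (LINT y|lebesgue. \<phi> y *\<^sub>R conv ?w ?u y) - (LINT y|lebesgue. \<phi> y *\<^sub>R ?u y)"
      by (subst Bochner_Integration.integral_diff)
        (simp_all only: integral_scaleR_right integrable_scaleR_right
          integrable_scaleR_sq_integrable[OF sq(1) sq_f] integrable_scaleR_sq_integrable[OF sq(1) cf])
    ultimately show ?thesis by (simp only: adj[OF sq(1), symmetric] minus_diff_eq)
  qed
  also have "(LINT y|lebesgue. \<phi> y *\<^sub>R (\<kappa> *\<^sub>R conv ?w ?u y - ?u y))
    = (LINT x|lebesgue. \<phi> x *\<^sub>R rep_l2 (\<kappa> *\<^sub>R (backward \<kappa> \<bullet>\<^sub>o f) - f) x)"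
  proof (rule integral_rep_cong[symmetric, OF _ _ sq(1)])
    show "AE x in lebesgue. rep_l2 (\<kappa> *\<^sub>R (backward \<kappa> \<bullet>\<^sub>o f) - f) x = \<kappa> *\<^sub>R conv ?w ?u x - ?u x"
      using rep_l2_diff[of "\<kappa> *\<^sub>R (backward \<kappa> \<bullet>\<^sub>o f)" f] rep_l2_scaleR[of \<kappa> "backward \<kappa> \<bullet>\<^sub>o f"] rep_backward[OF \<kappa>, of f]
      by eventually_elim simp
    show "(\<lambda>x. \<kappa> *\<^sub>R conv ?w ?u x - ?u x) \<in> borel_measurable lebesgue"
      using mcf by measurable
  qed
  finally show "(LINT x|lebesgue. \<phi>' x *\<^sub>R rep_l2 (backward \<kappa> \<bullet>\<^sub>o f) x) =
    - (LINT x|lebesgue. \<phi> x *\<^sub>R rep_l2 (\<kappa> *\<^sub>R (backward \<kappa> \<bullet>\<^sub>o f) - f) x)" .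
qed

lemma weak_derivative_add:
  assumes "weak_derivative f f'" "weak_derivative g g'"
  shows "weak_derivative (f + g) (f' + g')"
  unfolding weak_derivative_iff
proof (intro allI impI)
  fix \<phi> \<phi>' assume \<phi>: "test_function \<phi> \<phi>'"
  obtain N where sq: "sq_integrable \<phi>" "sq_integrable \<phi>'" using test_function_support[OF \<phi>] by blast
  have *: "(LINT x|lebesgue. \<psi> x *\<^sub>R rep_l2 (f + g) x) =
      (LINT x|lebesgue. \<psi> x *\<^sub>R rep_l2 f x) + (LINT x|lebesgue. \<psi> x *\<^sub>R rep_l2 g x)"
    if "sq_integrable \<psi>" for \<psi> and f g :: "'a l2"
  proof -
    have "(LINT x|lebesgue. \<psi> x *\<^sub>R rep_l2 (f + g) x) = (LINT x|lebesgue. \<psi> x *\<^sub>R (rep_l2 f x + rep_l2 g x))"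
      by (rule integral_rep_cong[OF rep_l2_add _ that]) measurable
    then show ?thesis
      unfolding scaleR_add_right Bochner_Integration.integral_add[OF
        integrable_scaleR_sq_integrable[OF that sq_integrable_rep_l2]
        integrable_scaleR_sq_integrable[OF that sq_integrable_rep_l2]] .
  qed
  show "(LINT x|lebesgue. \<phi>' x *\<^sub>R rep_l2 (f + g) x) = - (LINT x|lebesgue. \<phi> x *\<^sub>R rep_l2 (f' + g') x)"
    using assms \<phi> unfolding *[OF sq(1)] *[OF sq(2)] weak_derivative_iff by simp
qed

lemma weak_derivative_matop:
  assumes "weak_derivative f f'"
  shows "weak_derivative (matop M \<bullet>\<^sub>o f) (matop M \<bullet>\<^sub>o f')"
  unfolding weak_derivative_iff
proof (intro allI impI)
  fix \<phi> \<phi>' assume \<phi>: "test_function \<phi> \<phi>'"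
  obtain N where sq: "sq_integrable \<phi>" "sq_integrable \<phi>'" using test_function_support[OF \<phi>] by blast
  have *: "(LINT x|lebesgue. \<psi> x *\<^sub>R rep_l2 (matop M \<bullet>\<^sub>o f) x) = M *v (LINT x|lebesgue. \<psi> x *\<^sub>R rep_l2 f x)"
    if s: "sq_integrable \<psi>" for \<psi> f
  proof -
    have "(LINT x|lebesgue. \<psi> x *\<^sub>R rep_l2 (matop M \<bullet>\<^sub>o f) x) = (LINT x|lebesgue. \<psi> x *\<^sub>R (M *v rep_l2 f x))"
      using sq_integrable_bounded_linear[OF matrix_vector_mul_bounded_linear sq_integrable_rep_l2, of M f]
      by (intro integral_rep_cong[OF rep_matop _ s]) (simp add: sq_integrable_def)
    also have "\<dots> = (LINT x|lebesgue. M *v (\<psi> x *\<^sub>R rep_l2 f x))"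
      by (simp add: linear_scale[OF bounded_linear.linear[OF matrix_vector_mul_bounded_linear]])
    also have "\<dots> = M *v (LINT x|lebesgue. \<psi> x *\<^sub>R rep_l2 f x)"
      by (rule integral_bounded_linear[OF matrix_vector_mul_bounded_linear
        integrable_scaleR_sq_integrable[OF s sq_integrable_rep_l2]])
    finally show ?thesis .
  qed
  have "(LINT x|lebesgue. \<phi>' x *\<^sub>R rep_l2 f x) = - (LINT x|lebesgue. \<phi> x *\<^sub>R rep_l2 f' x)"
    using assms \<phi> unfolding weak_derivative_iff by blast
  then show "(LINT x|lebesgue. \<phi>' x *\<^sub>R rep_l2 (matop M \<bullet>\<^sub>o f) x) = - (LINT x|lebesgue. \<phi> x *\<^sub>R rep_l2 (matop M \<bullet>\<^sub>o f') x)"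
    unfolding *[OF sq(1)] *[OF sq(2)]
    by (simp add: linear_neg[OF bounded_linear.linear[OF matrix_vector_mul_bounded_linear]])
qed

section \<open>Uniqueness of weak solutions\<close>

text \<open>For each combination of signs the remainder is at most (v - u)^2. Squaring the positive
  part is what makes the test functions below continuously differentiable.\<close>

lemma DERIV_positive_part_square: "((\<lambda>u :: real. (max 0 u)\<^sup>2) has_real_derivative 2 * max 0 u) (at u)"
proof -
  have bound: "\<bar>(max 0 v)\<^sup>2 - (max 0 u)\<^sup>2 - 2 * max 0 u * (v - u)\<bar> \<le> (v - u)\<^sup>2" for v
  proof -
    consider "u \<ge> 0" "v \<ge> 0" | "u \<ge> 0" "v < 0" | "u < 0" "v \<ge> 0" | "u < 0" "v < 0" by linarith
    then show ?thesis
    proof cases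
      case 1
      then have "(max 0 v)\<^sup>2 - (max 0 u)\<^sup>2 - 2 * max 0 u * (v - u) = (v - u)\<^sup>2"
        by (simp add: power2_eq_square algebra_simps)
      then show ?thesis by simp
    next
      case 2
      then have "(max 0 v)\<^sup>2 - (max 0 u)\<^sup>2 - 2 * max 0 u * (v - u) = u\<^sup>2 - 2 * (u * v)"
        by (simp add: power2_eq_square algebra_simps)
      moreover have "u * v \<le> 0" using 2 by (simp add: mult_nonneg_nonpos)
      moreover have "(v - u)\<^sup>2 = v\<^sup>2 + u\<^sup>2 - 2 * (u * v)" by (simp add: power2_eq_square algebra_simps)
      ultimately show ?thesis using zero_le_power2[of u] zero_le_power2[of v] by linarith
    next
      case 3
      then have "v\<^sup>2 \<le> (v - u)\<^sup>2" by (intro power_mono) auto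
      then show ?thesis using 3 by simp
    qed simp
  qed
  have "((\<lambda>v. ((max 0 v)\<^sup>2 - (max 0 u)\<^sup>2) / (v - u) - 2 * max 0 u) \<longlongrightarrow> 0) (at u)"
  proof (rule Lim_null_comparison)
    show "\<forall>\<^sub>F v in at u. norm (((max 0 v)\<^sup>2 - (max 0 u)\<^sup>2) / (v - u) - 2 * max 0 u) \<le> \<bar>v - u\<bar>"
      unfolding eventually_at_filter
    proof (rule always_eventually, intro allI impI)
      fix v :: real assume v: "v \<noteq> u"
      have "((max 0 v)\<^sup>2 - (max 0 u)\<^sup>2) / (v - u) - 2 * max 0 u
        = ((max 0 v)\<^sup>2 - (max 0 u)\<^sup>2 - 2 * max 0 u * (v - u)) / (v - u)"
        using v by (simp add: diff_divide_distrib)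
      then have "norm (((max 0 v)\<^sup>2 - (max 0 u)\<^sup>2) / (v - u) - 2 * max 0 u)
        = \<bar>(max 0 v)\<^sup>2 - (max 0 u)\<^sup>2 - 2 * max 0 u * (v - u)\<bar> / \<bar>v - u\<bar>"
        by (simp only: real_norm_def abs_divide)
      also have "\<dots> \<le> (v - u)\<^sup>2 / \<bar>v - u\<bar>" by (intro divide_right_mono bound) simp
      also have "(v - u)\<^sup>2 / \<bar>v - u\<bar> = \<bar>v - u\<bar>"
        using v power2_abs[of "v - u"] by (simp add: power2_eq_square divide_simps)
      finally show "norm (((max 0 v)\<^sup>2 - (max 0 u)\<^sup>2) / (v - u) - 2 * max 0 u) \<le> \<bar>v - u\<bar>" .
    qed
    have "((\<lambda>v. \<bar>v - u\<bar>) \<longlongrightarrow> \<bar>u - u\<bar>) (at u)" by (intro tendsto_intros)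
    then show "((\<lambda>v. \<bar>v - u\<bar>) \<longlongrightarrow> 0) (at u)" by simp
  qed
  then show ?thesis unfolding has_field_derivative_iff by (rule LIM_zero_cancel)
qed

section \<open>Test functions approximating intervals, and vanishing of weak null functions\<close>

definition bump_base :: "real \<Rightarrow> real \<Rightarrow> real \<Rightarrow> real" where
  "bump_base a b x = (max 0 ((x - a) * (b - x)))\<^sup>2"

text \<open>With s = n \<open>bump_base a b x\<close> this is s / (1 + s): for a < b it increases
  with n to the indicator of the open interval, on which the base is positive.\<close>

definition bump :: "real \<Rightarrow> real \<Rightarrow> nat \<Rightarrow> real \<Rightarrow> real" where
  "bump a b n x = real n * bump_base a b x / (1 + real n * bump_base a b x)"

lemma bump_base_nonneg: "0 \<le> bump_base a b x"
  by (simp add: bump_base_def)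

lemma bump_base_pos: "a < x \<Longrightarrow> x < b \<Longrightarrow> 0 < bump_base a b x"
  by (simp add: bump_base_def)

lemma bump_base_zero: "x \<notin> {a<..<b} \<Longrightarrow> a < b \<Longrightarrow> bump_base a b x = 0"
  by (auto simp: bump_base_def max_def mult_le_0_iff not_less zero_le_mult_iff)

lemma test_function_supportI:
  assumes "\<And>x. (\<phi> has_real_derivative \<phi>' x) (at x)" "continuous_on UNIV \<phi>'"
    "\<And>x. \<phi> x \<noteq> 0 \<Longrightarrow> x \<in> {a..b}"
  shows "test_function \<phi> \<phi>'"
proof -
  have sub: "closure {x. \<phi> x \<noteq> 0} \<subseteq> {a..b}"
    using assms(3) by (intro closure_minimal) auto
  have "bounded (closure {x. \<phi> x \<noteq> 0})" using sub bounded_subset bounded_closed_interval by blast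
  then show ?thesis using assms by (simp add: test_function_def compact_eq_bounded_closed)
qed

lemma test_function_bump:
  assumes "a < b"
  shows "\<exists>\<phi>'. test_function (bump a b n) \<phi>'"
proof -
  define H' where "H' x = 2 * max 0 ((x - a) * (b - x)) * (a + b - 2 * x)" for x
  have H: "(bump_base a b has_real_derivative H' x) (at x)" for x
  proof -
    have "((\<lambda>x. (x - a) * (b - x)) has_real_derivative (a + b - 2 * x)) (at x)"
      by (auto intro!: derivative_eq_intros)
    from DERIV_chain2[OF DERIV_positive_part_square this]
    show ?thesis unfolding bump_base_def[abs_def] H'_def .
  qed
  have cH: "continuous_on UNIV (bump_base a b)"
    unfolding bump_base_def[abs_def] by (intro continuous_intros)
  have nz: "1 + real n * bump_base a b x \<noteq> 0" for x
    using mult_nonneg_nonneg[OF of_nat_0_le_iff bump_base_nonneg, of n a b x] by linarith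
  have "test_function (bump a b n) (\<lambda>x. real n * H' x / (1 + real n * bump_base a b x)\<^sup>2)"
  proof (rule test_function_supportI[of _ _ a b])
    show "(bump a b n has_real_derivative real n * H' x / (1 + real n * bump_base a b x)\<^sup>2) (at x)" for x
      unfolding bump_def[abs_def]
      using nz[of x] by (auto intro!: derivative_eq_intros H simp: power2_eq_square divide_simps) (simp add: algebra_simps)
    show "continuous_on UNIV (\<lambda>x. real n * H' x / (1 + real n * bump_base a b x)\<^sup>2)"
      unfolding H'_def using nz by (intro continuous_intros cH) auto
    show "x \<in> {a..b}" if "bump a b n x \<noteq> 0" for x
      using that bump_base_zero[OF _ assms, of x] by (cases "x \<in> {a<..<b}") (auto simp: bump_def)
  qed
  then show ?thesis by blast
qed

lemma bump_bounds: "0 \<le> bump a b n x" "a < b \<Longrightarrow> bump a b n x \<le> indicator {a<..<b} x"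
proof -
  have nn: "0 \<le> real n * bump_base a b x" by (simp add: bump_base_nonneg)
  then show "0 \<le> bump a b n x" by (simp add: bump_def)
  have "bump a b n x \<le> 1" using nn by (simp add: bump_def divide_le_eq)
  then show "bump a b n x \<le> indicator {a<..<b} x" if "a < b"
    using bump_base_zero[OF _ that, of x] by (auto simp: indicator_def bump_def)
qed

lemma bump_limit:
  assumes "a < b"
  shows "(\<lambda>n. bump a b n x) \<longlonglongrightarrow> indicator {a<..<b} x"
proof (cases "x \<in> {a<..<b}")
  case True
  then have pos: "0 < bump_base a b x" by (intro bump_base_pos) auto
  have "filterlim (\<lambda>n. 1 + real n * bump_base a b x) at_top sequentially"
    by (intro filterlim_tendsto_add_at_top[OF tendsto_const]
      filterlim_at_top_mult_tendsto_pos[OF tendsto_const pos filterlim_real_sequentially])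
  then have "(\<lambda>n. 1 - inverse (1 + real n * bump_base a b x)) \<longlonglongrightarrow> 1 - 0"
    by (intro tendsto_diff tendsto_const tendsto_inverse_0_at_top)
  moreover have "1 - inverse (1 + real n * bump_base a b x) = bump a b n x" for n
  proof -
    have "1 + real n * bump_base a b x > 0" using pos by (simp add: add_pos_nonneg)
    then show ?thesis by (simp add: bump_def field_simps)
  qed
  ultimately show ?thesis using True by simp
next
  case False
  then show ?thesis using bump_base_zero[OF False assms] by (simp add: bump_def)
qed

lemma sq_integrable_indicator: "sq_integrable (indicator {a<..<b} :: real \<Rightarrow> real)"
  unfolding sq_integrable_def
proof
  have "(\<lambda>x. (norm (indicator {a<..<b} x :: real))\<^sup>2) = indicator {a<..<b}"
    by (auto simp: indicator_def)
  then show "integrable lebesgue (\<lambda>x. (norm (indicator {a<..<b} x :: real))\<^sup>2)"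
    by (auto intro!: integrable_real_indicator emeasure_bounded_finite[unfolded infinity_ennreal_def]
      bounded_subset[OF bounded_closed_interval[of a b]])
  show "(indicator {a<..<b} :: real \<Rightarrow> real) \<in> borel_measurable lebesgue"
    by (rule borel_measurable_indicator) simp
qed

text \<open>Truncation to (- N, N) makes g integrable; then integrals over Borel sets vanish by the
  \<pi>-\<lambda> argument starting from half lines, and a Lebesgue set differs from its Borel main
  part by a null set only.\<close>

lemma AE_zero_of_intervals:
  fixes g :: "real \<Rightarrow> 'a :: {banach, second_countable_topology}"
  assumes g: "sq_integrable g"
    and zero: "\<And>a b. a < b \<Longrightarrow> (LINT x|lebesgue. indicator {a<..<b} x *\<^sub>R g x) = 0"
  shows "AE x in lebesgue. g x = 0"
proof -
  have "AE x in lebesgue. indicator {- real N<..<real N} x *\<^sub>R g x = 0" for N :: nat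
  proof -
    define h where "h x = indicator {- real N<..<real N} x *\<^sub>R g x" for x
    have int: "integrable lebesgue h"
      unfolding h_def by (rule integrable_scaleR_sq_integrable[OF sq_integrable_indicator g])
    have intA: "integrable lebesgue (\<lambda>x. indicator A x *\<^sub>R h x)" if "A \<in> sets lebesgue" for A
      using that int by (rule integrable_mult_indicator)
    have borel: "(LINT x|lebesgue. indicator A x *\<^sub>R h x) = 0" if "A \<in> sets borel" for A
    proof -
      have borel_sigma: "sets borel = sigma_sets UNIV (range (\<lambda>a. {..a :: real}))"
        unfolding borel_eq_atMost by simp
      then have A: "A \<in> sigma_sets UNIV (range (\<lambda>a. {..a :: real}))" using that by simp
      have total: "(LINT x|lebesgue. h x) = 0"
        using zero[of "- real N" "real N"] by (cases "N = 0") (auto simp: h_def)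
      have sb: "B \<in> sets lebesgue" if "B \<in> sigma_sets UNIV (range (\<lambda>a. {..a :: real}))" for B
        using that unfolding borel_sigma[symmetric] by (simp add: sets_completionI_sets)
      have stable: "Int_stable (range (\<lambda>a. {..a :: real}))"
        by (auto simp: Int_stable_def)
      show ?thesis
      proof (rule sigma_sets_induct_disjoint[OF stable _ A])
        show "range (\<lambda>a. {..a :: real}) \<subseteq> Pow UNIV" by simp
        show "(LINT x|lebesgue. indicator {} x *\<^sub>R h x) = 0" by simp
      next
        fix A assume "A \<in> range (\<lambda>a. {..a :: real})"
        then obtain a where a: "A = {..a}" by auto
        have AE: "AE x in lebesgue. x \<noteq> a" using AE_lborel_singleton by (rule AE_completion)
        have "(LINT x|lebesgue. indicator A x *\<^sub>R h x) = (LINT x|lebesgue. indicator {- real N<..<min a (real N)} x *\<^sub>R g x)"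
        proof (rule integral_cong_AE)
          show "AE x in lebesgue. indicator A x *\<^sub>R h x = indicator {- real N<..<min a (real N)} x *\<^sub>R g x"
            using AE by eventually_elim (auto simp: a h_def indicator_def)
        qed (use intA[of A] a integrable_scaleR_sq_integrable[OF sq_integrable_indicator g] in auto)
        also have "\<dots> = 0"
          using zero[of "- real N" "min a (real N)"]
          by (cases "- real N < min a (real N)") auto
        finally show "(LINT x|lebesgue. indicator A x *\<^sub>R h x) = 0" .
      next
        fix A assume compl: "A \<in> sigma_sets UNIV (range (\<lambda>a. {..a :: real}))"
          "(LINT x|lebesgue. indicator A x *\<^sub>R h x) = 0"
        have "(LINT x|lebesgue. indicator (UNIV - A) x *\<^sub>R h x) = (LINT x|lebesgue. h x - indicator A x *\<^sub>R h x)"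
          by (rule Bochner_Integration.integral_cong) (auto simp: indicator_def)
        also have "\<dots> = 0"
          by (subst Bochner_Integration.integral_diff[OF int intA[OF sb[OF compl(1)]]]) (simp only: total compl(2) diff_self)
        finally show "(LINT x|lebesgue. indicator (UNIV - A) x *\<^sub>R h x) = 0" .
      next
        fix A :: "nat \<Rightarrow> real set" assume union: "disjoint_family A"
          "range A \<subseteq> sigma_sets UNIV (range (\<lambda>a. {..a :: real}))"
          "\<And>i. (LINT x|lebesgue. indicator (A i) x *\<^sub>R h x) = 0"
        have sets: "A i \<in> sets lebesgue" for i using union(2) sb by blast
        have "set_lebesgue_integral lebesgue (\<Union>i. A i) h = (\<Sum>i. set_lebesgue_integral lebesgue (A i) h)"
        proof (rule lebesgue_integral_countable_add)
          show "set_integrable lebesgue (\<Union>i. A i) h"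
            unfolding set_integrable_def by (rule intA) (use sets in auto)
          show "A i \<inter> A j = {}" if "i \<noteq> j" for i j
            using union(1) that by (auto simp: disjoint_family_on_def)
        qed (rule sets)
        then show "(LINT x|lebesgue. indicator (\<Union>i. A i) x *\<^sub>R h x) = 0"
          by (simp add: set_lebesgue_integral_def union(3))
      qed
    qed
    have "AE x in lebesgue. h x = 0"
    proof (rule lebesgue.density_zero[OF int])
      fix A :: "real set" assume A: "A \<in> sets lebesgue"
      obtain Z where Z: "Z \<in> null_sets lborel" "null_part lborel A \<subseteq> Z" using null_part[OF A] by blast
      have AE: "AE x in lebesgue. x \<notin> Z"
        using Z(1) by (intro AE_completion AE_not_in)
      have "set_lebesgue_integral lebesgue A h = (LINT x|lebesgue. indicator (main_part lborel A) x *\<^sub>R h x)"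
        unfolding set_lebesgue_integral_def
      proof (rule integral_cong_AE)
        show "AE x in lebesgue. indicator A x *\<^sub>R h x = indicator (main_part lborel A) x *\<^sub>R h x"
          using AE
        proof eventually_elim
          case (elim x)
          then have "x \<in> A \<longleftrightarrow> x \<in> main_part lborel A"
            using main_part_null_part_Un[OF A] Z(2) by blast
          then show ?case by (simp add: indicator_def)
        qed
        show "(\<lambda>x. indicator A x *\<^sub>R h x) \<in> borel_measurable lebesgue" using intA[OF A] by auto
        show "(\<lambda>x. indicator (main_part lborel A) x *\<^sub>R h x) \<in> borel_measurable lebesgue"
          using intA[of "main_part lborel A"] main_part_sets[OF A] by auto
      qed
      also have "\<dots> = 0" using borel main_part_sets[OF A] by simp
      finally show "set_lebesgue_integral lebesgue A h = 0" .
    qed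
    then show ?thesis by (simp add: h_def)
  qed
  then have "AE x in lebesgue. \<forall>N :: nat. indicator {- real N<..<real N} x *\<^sub>R g x = 0"
    unfolding AE_all_countable by blast
  then show ?thesis
  proof eventually_elim
    case (elim x)
    obtain N where "\<bar>x\<bar> < real N" using reals_Archimedean2 by blast
    then have "x \<in> {- real N<..<real N}" by auto
    then show ?case using elim[rule_format, of N] by simp
  qed
qed

text \<open>Bump functions converge to indicators of intervals under a common majorant, so dominated
  convergence reduces the claim to \<open>AE_zero_of_intervals\<close>.\<close>

lemma l2_zero_of_test_functions:
  fixes w :: "'a :: {complex_normed_vector, euclidean_space} l2"
  assumes "\<And>\<phi> \<phi>'. test_function \<phi> \<phi>' \<Longrightarrow> (LINT x|lebesgue. \<phi> x *\<^sub>R rep_l2 w x) = 0"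
  shows "w = 0"
proof (rule l2_eqI)
  have "AE x in lebesgue. rep_l2 w x = 0"
  proof (rule AE_zero_of_intervals[OF sq_integrable_rep_l2])
    fix a b :: real assume ab: "a < b"
    have "(\<lambda>n. LINT x|lebesgue. bump a b n x *\<^sub>R rep_l2 w x) \<longlonglongrightarrow> (LINT x|lebesgue. indicator {a<..<b} x *\<^sub>R rep_l2 w x)"
    proof (rule integral_dominated_convergence[where w = "\<lambda>x. norm (indicator {a<..<b} x *\<^sub>R rep_l2 w x)"])
      show "integrable lebesgue (\<lambda>x. norm (indicator {a<..<b} x *\<^sub>R rep_l2 w x))"
        by (intro integrable_norm integrable_scaleR_sq_integrable sq_integrable_indicator sq_integrable_rep_l2)
      show "(\<lambda>x. indicator {a<..<b} x *\<^sub>R rep_l2 w x) \<in> borel_measurable lebesgue"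
        by (intro borel_measurable_integrable integrable_scaleR_sq_integrable sq_integrable_indicator sq_integrable_rep_l2)
      show "(\<lambda>x. bump a b n x *\<^sub>R rep_l2 w x) \<in> borel_measurable lebesgue" for n
      proof -
        obtain \<phi>' where "test_function (bump a b n) \<phi>'" using test_function_bump[OF ab] by blast
        then obtain N where "sq_integrable (bump a b n)" using test_function_support by blast
        then show ?thesis
          by (intro borel_measurable_integrable integrable_scaleR_sq_integrable sq_integrable_rep_l2)
      qed
      show "AE x in lebesgue. (\<lambda>n. bump a b n x *\<^sub>R rep_l2 w x) \<longlonglongrightarrow> indicator {a<..<b} x *\<^sub>R rep_l2 w x"
        by (intro AE_I2 tendsto_scaleR bump_limit ab tendsto_const)
      show "AE x in lebesgue. norm (bump a b n x *\<^sub>R rep_l2 w x) \<le> norm (indicator {a<..<b} x *\<^sub>R rep_l2 w x)" for n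
      proof (rule AE_I2)
        fix x
        show "norm (bump a b n x *\<^sub>R rep_l2 w x) \<le> norm (indicator {a<..<b} x *\<^sub>R rep_l2 w x)"
          unfolding norm_scaleR real_norm_def
          using bump_bounds(1)[of a b n x] bump_bounds(2)[OF ab, of n x] by (intro mult_right_mono norm_ge_zero) auto
      qed
    qed
    moreover have "(LINT x|lebesgue. bump a b n x *\<^sub>R rep_l2 w x) = 0" for n
      using test_function_bump[OF ab, of n] assms by blast
    ultimately show "(LINT x|lebesgue. indicator {a<..<b} x *\<^sub>R rep_l2 w x) = 0"
      by (simp add: LIMSEQ_const_iff)
  qed
  from this rep_l2_zero show "AE x in lebesgue. rep_l2 w x = rep_l2 0 x"
    by eventually_elim simp
qed

lemma weak_derivative_zero:
  fixes g :: "'a :: {complex_normed_vector, euclidean_space} l2"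
  assumes "weak_derivative 0 g"
  shows "g = 0"
proof (rule l2_zero_of_test_functions)
  fix \<phi> \<phi>' assume \<phi>: "test_function \<phi> \<phi>'"
  obtain N where sq: "sq_integrable \<phi>" "sq_integrable \<phi>'" using test_function_support[OF \<phi>] by blast
  have 1: "(LINT x|lebesgue. \<phi>' x *\<^sub>R rep_l2 (0 :: 'a l2) x) = (LINT x|lebesgue. \<phi>' x *\<^sub>R (0 :: 'a))"
    by (rule integral_rep_cong[OF rep_l2_zero _ sq(2)]) simp
  have "(LINT x|lebesgue. \<phi>' x *\<^sub>R rep_l2 (0 :: 'a l2) x) = - (LINT x|lebesgue. \<phi> x *\<^sub>R rep_l2 g x)"
    using assms \<phi> unfolding weak_derivative_iff by blast
  then show "(LINT x|lebesgue. \<phi> x *\<^sub>R rep_l2 g x) = 0"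
    unfolding 1 by simp
qed

text \<open>The weak equation \<open>w' = \<kappa> w\<close> makes the integral of \<open>e\<^sup>-\<^sup>\<kappa>\<^sup>x w\<close> against \<open>\<beta>\<close> invariant under
  translations of \<open>\<beta>\<close>; square-integrability makes it vanish in the limit.\<close>

lemma weak_exponential_zero:
  fixes w :: "'a :: {complex_normed_vector, euclidean_space} l2"
  assumes w: "weak_derivative w (\<kappa> *\<^sub>R w)" and \<kappa>: "\<kappa> \<noteq> 0"
  shows "w = 0"
proof (rule l2_zero_of_test_functions)
  fix \<psi> \<psi>' assume \<psi>: "test_function \<psi> \<psi>'"
  obtain N where N: "N > 0" "\<And>x. \<bar>x\<bar> \<ge> N \<Longrightarrow> \<psi> x = 0" and c: "continuous_on UNIV \<psi>" and sq: "sq_integrable \<psi>"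
    by (rule test_function_support[OF \<psi>]) (rule that, assumption+)
  define \<beta> where "\<beta> x = exp (\<kappa> * x) * \<psi> x" for x
  have c\<beta>: "continuous_on UNIV \<beta>" unfolding \<beta>_def[abs_def] by (intro continuous_intros c)
  have "\<exists>\<Gamma>. \<forall>x :: real. - \<infinity> < ereal x \<longrightarrow> ereal x < \<infinity> \<longrightarrow> (\<Gamma> has_vector_derivative \<beta> x) (at x)"
    using c\<beta> by (intro einterval_antiderivative) (auto simp: continuous_on_eq_continuous_at)
  then obtain \<Gamma> where \<Gamma>: "\<And>x. (\<Gamma> has_real_derivative \<beta> x) (at x)"
    by (auto simp: has_real_derivative_iff_has_vector_derivative)
  have \<beta>0: "\<beta> x = 0" if "\<bar>x\<bar> \<ge> N" for x using N(2)[OF that] by (simp add: \<beta>_def)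
  have \<Gamma>0: "(\<Gamma> has_real_derivative 0) (at x within A)" if "\<bar>x\<bar> \<ge> N" for x A
    using has_field_derivative_at_within[OF \<Gamma>, of x A] \<beta>0[OF that] by simp
  have "\<exists>c. \<forall>x\<in>{N..}. \<Gamma> x = c"
    by (rule has_field_derivative_zero_constant) (use N(1) in \<open>auto intro!: \<Gamma>0\<close>)
  then obtain c1 where c1: "\<And>x. x \<ge> N \<Longrightarrow> \<Gamma> x = c1" by auto
  have "\<exists>c. \<forall>x\<in>{..- N}. \<Gamma> x = c"
    by (rule has_field_derivative_zero_constant) (use N(1) in \<open>auto intro!: \<Gamma>0\<close>)
  then obtain c2 where c2: "\<And>x. x \<le> - N \<Longrightarrow> \<Gamma> x = c2" by auto
  have sq_shift: "sq_integrable (\<lambda>x. \<psi> (x - h))" for h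
  proof (rule sq_integrable_compact_support[where N = "N + \<bar>h\<bar>"])
    show "continuous_on UNIV (\<lambda>x. \<psi> (x - h))"
      by (intro continuous_on_compose2[OF c] continuous_intros) auto
    show "\<psi> (x - h) = 0" if "N + \<bar>h\<bar> \<le> \<bar>x\<bar>" for x using N(2)[of "x - h"] that by linarith
  qed
  have eq: "(LINT x|lebesgue. \<psi> x *\<^sub>R rep_l2 w x) = exp (- \<kappa> * h) *\<^sub>R (LINT x|lebesgue. \<psi> (x - h) *\<^sub>R rep_l2 w x)" for h
  proof -
    \<comment> \<open>\<Gamma> need not have compact support, but it is constant beyond N on either
      side, so its difference with a translate has. The construction gives \<phi>' + \<kappa> \<phi>
      = \<psi>(x) - exp (- \<kappa> h) \<psi>(x - h).\<close>
    define \<phi> where "\<phi> x = exp (- \<kappa> * x) * (\<Gamma> x - \<Gamma> (x - h))" for x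
    define \<phi>' where "\<phi>' x = (\<psi> x - exp (- \<kappa> * h) * \<psi> (x - h)) - \<kappa> * \<phi> x" for x
    have test: "test_function \<phi> \<phi>'"
    proof (rule test_function_supportI[of _ _ "- (N + \<bar>h\<bar>)" "N + \<bar>h\<bar>"])
      have shift: "((\<lambda>x. \<Gamma> (x - h)) has_real_derivative \<beta> (x - h)) (at x)" for x
      proof -
        have "((\<lambda>x. x - h) has_real_derivative 1) (at x)" by (auto intro!: derivative_eq_intros)
        from DERIV_chain2[OF \<Gamma> this] show ?thesis by simp
      qed
      have e: "exp (- \<kappa> * x) * \<beta> x = \<psi> x" "exp (- \<kappa> * x) * \<beta> (x - h) = exp (- \<kappa> * h) * \<psi> (x - h)" for x
      proof -
        have "exp (- \<kappa> * x) * exp (\<kappa> * (x - k)) = exp (- \<kappa> * k)" for k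
          unfolding exp_add[symmetric] by (simp add: right_diff_distrib)
        from this[of 0] this[of h] show "exp (- \<kappa> * x) * \<beta> x = \<psi> x"
          "exp (- \<kappa> * x) * \<beta> (x - h) = exp (- \<kappa> * h) * \<psi> (x - h)"
          unfolding \<beta>_def mult.assoc[symmetric] by simp_all
      qed
      have "(\<phi> has_real_derivative exp (- \<kappa> * x) * (\<beta> x - \<beta> (x - h)) - \<kappa> * \<phi> x) (at x)" for x
        unfolding \<phi>_def[abs_def] by (auto intro!: derivative_eq_intros \<Gamma> shift simp: algebra_simps)
      then show d: "(\<phi> has_real_derivative \<phi>' x) (at x)" for x
        unfolding \<phi>'_def using e by (simp add: right_diff_distrib)
      have "continuous_on UNIV \<phi>" by (rule DERIV_continuous_on[OF has_field_derivative_at_within[OF d]])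
      then show "continuous_on UNIV \<phi>'"
        unfolding \<phi>'_def[abs_def]
        by (intro continuous_intros c continuous_on_compose2[OF c]) auto
      show "x \<in> {- (N + \<bar>h\<bar>)..N + \<bar>h\<bar>}" if nz: "\<phi> x \<noteq> 0" for x
      proof (rule ccontr)
        assume "x \<notin> {- (N + \<bar>h\<bar>)..N + \<bar>h\<bar>}"
        then consider "x > N + \<bar>h\<bar>" | "x < - (N + \<bar>h\<bar>)" by fastforce
        then have "\<Gamma> x = \<Gamma> (x - h)"
        proof cases
          case 1
          then have "x \<ge> N" "x - h \<ge> N" by linarith+
          then show ?thesis using c1 by simp
        next
          case 2
          then have "x \<le> - N" "x - h \<le> - N" by linarith+
          then show ?thesis using c2 by simp
        qed
        then show False using nz by (simp add: \<phi>_def)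
      qed
    qed
    obtain N' where sq\<phi>: "sq_integrable \<phi>" "sq_integrable \<phi>'" using test_function_support[OF test] by blast
    have "(LINT x|lebesgue. \<phi>' x *\<^sub>R rep_l2 w x) = - (LINT x|lebesgue. \<phi> x *\<^sub>R rep_l2 (\<kappa> *\<^sub>R w) x)"
      using w test unfolding weak_derivative_iff by blast
    also have "(LINT x|lebesgue. \<phi> x *\<^sub>R rep_l2 (\<kappa> *\<^sub>R w) x) = (LINT x|lebesgue. \<phi> x *\<^sub>R (\<kappa> *\<^sub>R rep_l2 w x))"
      by (rule integral_rep_cong[OF rep_l2_scaleR _ sq\<phi>(1)]) measurable
    also have "\<dots> = (LINT x|lebesgue. \<kappa> *\<^sub>R (\<phi> x *\<^sub>R rep_l2 w x))" by (simp add: mult.commute)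
    finally have 1: "(LINT x|lebesgue. \<phi>' x *\<^sub>R rep_l2 w x) + (LINT x|lebesgue. \<kappa> *\<^sub>R (\<phi> x *\<^sub>R rep_l2 w x)) = 0"
      by simp
    note i1 = integrable_scaleR_sq_integrable[OF sq\<phi>(1) sq_integrable_rep_l2[of w]]
      and i2 = integrable_scaleR_sq_integrable[OF sq\<phi>(2) sq_integrable_rep_l2[of w]]
      and i3 = integrable_scaleR_sq_integrable[OF sq sq_integrable_rep_l2[of w]]
      and i4 = integrable_scaleR_sq_integrable[OF sq_shift[of h] sq_integrable_rep_l2[of w]]
    have "(LINT x|lebesgue. \<psi> x *\<^sub>R rep_l2 w x) - exp (- \<kappa> * h) *\<^sub>R (LINT x|lebesgue. \<psi> (x - h) *\<^sub>R rep_l2 w x)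
      = (LINT x|lebesgue. \<psi> x *\<^sub>R rep_l2 w x - exp (- \<kappa> * h) *\<^sub>R (\<psi> (x - h) *\<^sub>R rep_l2 w x))"
      by (subst Bochner_Integration.integral_diff) (simp_all only: integral_scaleR_right integrable_scaleR_right i3 i4)
    also have "\<dots> = (LINT x|lebesgue. \<phi>' x *\<^sub>R rep_l2 w x + \<kappa> *\<^sub>R (\<phi> x *\<^sub>R rep_l2 w x))"
      by (rule Bochner_Integration.integral_cong) (simp_all add: \<phi>'_def scaleR_diff_left)
    also have "\<dots> = (LINT x|lebesgue. \<phi>' x *\<^sub>R rep_l2 w x) + (LINT x|lebesgue. \<kappa> *\<^sub>R (\<phi> x *\<^sub>R rep_l2 w x))"
      by (subst Bochner_Integration.integral_add) (simp_all only: integrable_scaleR_right i1 i2)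
    finally show ?thesis using 1 by simp
  qed
  define B where "B = (LINT x|lebesgue. (norm (\<psi> x))\<^sup>2) + (LINT x|lebesgue. (norm (rep_l2 w x))\<^sup>2)"
  have bound: "norm (LINT x|lebesgue. \<psi> (x - h) *\<^sub>R rep_l2 w x) \<le> B" for h
  proof -
    have "norm (LINT x|lebesgue. \<psi> (x - h) *\<^sub>R rep_l2 w x) \<le> (LINT x|lebesgue. norm (\<psi> (x - h) *\<^sub>R rep_l2 w x))"
      by (rule integral_norm_bound)
    also have "\<dots> \<le> (LINT x|lebesgue. (norm (\<psi> (x - h)))\<^sup>2 + (norm (rep_l2 w x))\<^sup>2)"
    proof (rule integral_mono)
      show "integrable lebesgue (\<lambda>x. norm (\<psi> (x - h) *\<^sub>R rep_l2 w x))"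
        by (intro integrable_norm integrable_scaleR_sq_integrable sq_shift sq_integrable_rep_l2)
      show "integrable lebesgue (\<lambda>x. (norm (\<psi> (x - h)))\<^sup>2 + (norm (rep_l2 w x))\<^sup>2)"
        using sq_shift[of h] sq_integrable_rep_l2[of w] by (simp add: sq_integrable_def)
      show "norm (\<psi> (x - h) *\<^sub>R rep_l2 w x) \<le> (norm (\<psi> (x - h)))\<^sup>2 + (norm (rep_l2 w x))\<^sup>2" for x
      proof -
        have "2 * (norm (\<psi> (x - h)) * norm (rep_l2 w x)) \<le> (norm (\<psi> (x - h)))\<^sup>2 + (norm (rep_l2 w x))\<^sup>2"
          using zero_le_power2[of "norm (\<psi> (x - h)) - norm (rep_l2 w x)"] unfolding power2_diff by linarith
        moreover have "0 \<le> norm (\<psi> (x - h)) * norm (rep_l2 w x)" by simp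
        ultimately have "norm (\<psi> (x - h)) * norm (rep_l2 w x) \<le> (norm (\<psi> (x - h)))\<^sup>2 + (norm (rep_l2 w x))\<^sup>2"
          by linarith
        then show ?thesis by simp
      qed
    qed
    also have "\<dots> = (LINT x|lebesgue. (norm (\<psi> (x - h)))\<^sup>2) + (LINT x|lebesgue. (norm (rep_l2 w x))\<^sup>2)"
      using sq_shift[of h] sq_integrable_rep_l2[of w] by (simp add: sq_integrable_def)
    also have "(LINT x|lebesgue. (norm (\<psi> (x - h)))\<^sup>2) = (LINT x|lebesgue. (norm (\<psi> x))\<^sup>2)"
      using lebesgue_integral_real_affine[of 1 "\<lambda>x. (norm (\<psi> x))\<^sup>2" "- h"] by simp
    finally show ?thesis by (simp add: B_def)
  qed
  \<comment> \<open>The shift h = n / \<kappa> gives the factor exp (- n) for either sign of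
    \<kappa>, while the integrals against translates stay below B.\<close>
  have "(\<lambda>n. norm (LINT x|lebesgue. \<psi> x *\<^sub>R rep_l2 w x)) \<longlonglongrightarrow> 0"
  proof (rule Lim_null_comparison[where g = "\<lambda>n. exp (- real n) * B"])
    show "\<forall>\<^sub>F n in sequentially. norm (norm (LINT x|lebesgue. \<psi> x *\<^sub>R rep_l2 w x)) \<le> exp (- real n) * B"
    proof (rule always_eventually, rule allI)
      fix n
      have "norm (LINT x|lebesgue. \<psi> x *\<^sub>R rep_l2 w x) = exp (- real n) * norm (LINT x|lebesgue. \<psi> (x - real n / \<kappa>) *\<^sub>R rep_l2 w x)"
        using eq[of "real n / \<kappa>"] \<kappa> by simp
      also have "\<dots> \<le> exp (- real n) * B" by (intro mult_left_mono bound) simp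
      finally show "norm (norm (LINT x|lebesgue. \<psi> x *\<^sub>R rep_l2 w x)) \<le> exp (- real n) * B" by simp
    qed
    have "filterlim (\<lambda>n. - real n) at_bot sequentially"
      using filterlim_real_sequentially by (simp add: filterlim_uminus_at_bot)
    then show "(\<lambda>n. exp (- real n) * B) \<longlonglongrightarrow> 0"
      by (intro tendsto_mult_left_zero filterlim_compose[OF exp_at_bot])
  qed
  then show "(LINT x|lebesgue. \<psi> x *\<^sub>R rep_l2 w x) = 0" by (simp add: LIMSEQ_const_iff)
qed

section \<open>Block diagonalization\<close>

lemma l2_component_rep: "AE x in lebesgue. rep_l2 (l2_component i u) x = rep_l2 u x $ i"
  unfolding l2_component_def map_fun_apply id_apply
  by (rule rep_abs_l2) (rule sq_integrable_bounded_linear[OF bounded_linear_vec_nth sq_integrable_rep_l2])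

lift_definition l2_embed :: "2 \<Rightarrow> complex l2 \<Rightarrow> (complex ^ 2) l2" is "\<lambda>i f x. f x *\<^sub>C axis i 1"
  by (auto simp: l2_rel_def sq_integrable_bounded_linear[OF bounded_bilinear.bounded_linear_left[OF bounded_bilinear_scaleC]])

lemma l2_embed_rep: "AE x in lebesgue. rep_l2 (l2_embed i f) x = rep_l2 f x *\<^sub>C axis i 1"
  unfolding l2_embed_def map_fun_apply id_apply
  by (rule rep_abs_l2)
    (rule sq_integrable_bounded_linear[OF bounded_bilinear.bounded_linear_left[OF bounded_bilinear_scaleC] sq_integrable_rep_l2])

lemma l2_component_add: "l2_component i (u + v) = l2_component i u + l2_component i v"
proof (rule l2_eqI)
  show "AE x in lebesgue. rep_l2 (l2_component i (u + v)) x = rep_l2 (l2_component i u + l2_component i v) x"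
    using l2_component_rep[of i "u + v"] l2_component_rep[of i u] l2_component_rep[of i v]
      rep_l2_add[of u v] rep_l2_add[of "l2_component i u" "l2_component i v"]
    by eventually_elim simp
qed

lemma l2_component_scaleC: "l2_component i (c *\<^sub>C u) = c *\<^sub>C l2_component i u"
proof (rule l2_eqI)
  show "AE x in lebesgue. rep_l2 (l2_component i (c *\<^sub>C u)) x = rep_l2 (c *\<^sub>C l2_component i u) x"
    using l2_component_rep[of i "c *\<^sub>C u"] l2_component_rep[of i u]
      rep_l2_scaleC[of c u] rep_l2_scaleC[of c "l2_component i u"]
    by eventually_elim (simp add: scaleC_vec_def)
qed

lemma l2_embed_add: "l2_embed i (f + g) = l2_embed i f + l2_embed i g"
proof (rule l2_eqI)
  show "AE x in lebesgue. rep_l2 (l2_embed i (f + g)) x = rep_l2 (l2_embed i f + l2_embed i g) x"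
    using l2_embed_rep[of i "f + g"] l2_embed_rep[of i f] l2_embed_rep[of i g]
      rep_l2_add[of f g] rep_l2_add[of "l2_embed i f" "l2_embed i g"]
    by eventually_elim (simp add: scaleC_add_left)
qed

lemma l2_embed_scaleC: "l2_embed i (c *\<^sub>C f) = c *\<^sub>C l2_embed i f"
proof (rule l2_eqI)
  show "AE x in lebesgue. rep_l2 (l2_embed i (c *\<^sub>C f)) x = rep_l2 (c *\<^sub>C l2_embed i f) x"
    using l2_embed_rep[of i "c *\<^sub>C f"] l2_embed_rep[of i f]
      rep_l2_scaleC[of c f] rep_l2_scaleC[of c "l2_embed i f"]
    by eventually_elim (simp add: scaleC_scaleC scaleC_complex_def)
qed

lemma l2_component_embed: "l2_component i (l2_embed j f) = (if i = j then f else 0)"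
proof (rule l2_eqI)
  show "AE x in lebesgue. rep_l2 (l2_component i (l2_embed j f)) x = rep_l2 (if i = j then f else 0) x"
    using l2_component_rep[of i "l2_embed j f"] l2_embed_rep[of j f] rep_l2_zero[where ?'a = complex]
    by eventually_elim (simp add: scaleC_vec_def axis_def scaleC_complex_def)
qed

lemma l2_component_zero [simp]: "l2_component i 0 = 0"
  using l2_component_scaleC[of i 0 0] by simp

lemma l2_embed_zero [simp]: "l2_embed i 0 = 0"
  using l2_embed_scaleC[of i 0 0] by simp

lemma l2_component_eqI:
  assumes "l2_component 1 u = l2_component 1 v" "l2_component 2 u = l2_component 2 v"
  shows "u = v"
proof (rule l2_eqI)
  show "AE x in lebesgue. rep_l2 u x = rep_l2 v x"
    using l2_component_rep[of 1 u] l2_component_rep[of 1 v] l2_component_rep[of 2 u] l2_component_rep[of 2 v]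
    unfolding assms by eventually_elim (simp add: vec_eq_iff forall_2)
qed

lemma l2_decompose: "u = l2_embed 1 (l2_component 1 u) + l2_embed 2 (l2_component 2 u)"
  by (rule l2_component_eqI) (simp_all add: l2_component_add l2_component_embed)

lemma l2_norm_mono:
  assumes "AE x in lebesgue. norm (rep_l2 f x) \<le> norm (rep_l2 g x)"
  shows "norm f \<le> norm g"
proof -
  have "ennreal ((norm f)\<^sup>2) \<le> ennreal ((norm g)\<^sup>2)"
    unfolding nn_integral_rep_l2[symmetric]
    by (rule nn_integral_mono_AE) (use assms in eventually_elim, auto intro!: ennreal_leI power_mono)
  then have "(norm f)\<^sup>2 \<le> (norm g)\<^sup>2" by simp
  then show ?thesis by (rule power2_le_imp_le) simp
qed

lemma norm_l2_component: "norm (l2_component i u) \<le> norm u"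
  by (rule l2_norm_mono) (use l2_component_rep[of i u] in eventually_elim, simp add: component_le_norm_cart Finite_Cartesian_Product.norm_nth_le)

lemma norm_l2_embed: "norm (l2_embed i f) \<le> norm f"
proof (rule l2_norm_mono)
  have "norm (axis i 1 :: complex ^ 2) = 1"
    using exhaust_2[of i] by (auto simp: norm_vec_def L2_set_def sum_2 axis_def)
  then show "AE x in lebesgue. norm (rep_l2 (l2_embed i f) x) \<le> norm (rep_l2 f x)"
    using l2_embed_rep[of i f] by (auto simp: norm_scaleC elim: eventually_mono)
qed

lemma bounded_linear_l2_component: "bounded_linear (l2_component i)"
  by (rule bounded_linear_intro[where K = 1])
    (simp_all add: l2_component_add l2_component_scaleC scaleR_scaleC norm_l2_component)

lemmas l2_component_neg = linear_neg[OF bounded_linear.linear[OF bounded_linear_l2_component]]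
  and l2_component_diff = linear_diff[OF bounded_linear.linear[OF bounded_linear_l2_component]]

definition block :: "2 \<Rightarrow> (complex ^ 2) l2 cop \<Rightarrow> complex l2 cop" where
  "block i X = cop_of (\<lambda>f. l2_component i (X \<bullet>\<^sub>o l2_embed i f))"

lemma block_apply: "block i X \<bullet>\<^sub>o f = l2_component i (X \<bullet>\<^sub>o l2_embed i f)"
  unfolding block_def
proof (rule cop_of_apply, rule bounded_clinearI)
  fix f
  have "norm (l2_component i (X \<bullet>\<^sub>o l2_embed i f)) \<le> norm X * norm (l2_embed i f)"
    by (rule order_trans[OF norm_l2_component norm_cop_apply])
  also have "\<dots> \<le> norm X * norm f" by (intro mult_left_mono norm_l2_embed) simp
  finally show "norm (l2_component i (X \<bullet>\<^sub>o l2_embed i f)) \<le> norm X * norm f" .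
qed (simp_all add: l2_embed_add l2_embed_scaleC l2_component_add l2_component_scaleC cop_add cop_scaleC)

lemma component_sigma3: "l2_component 1 (matop \<sigma>\<^sub>3 \<bullet>\<^sub>o u) = l2_component 1 u"
    "l2_component 2 (matop \<sigma>\<^sub>3 \<bullet>\<^sub>o u) = - l2_component 2 u"
proof -
  have s: "(\<sigma>\<^sub>3 *v v) $ 1 = v $ 1" "(\<sigma>\<^sub>3 *v v) $ 2 = - v $ 2" for v
    by (simp_all add: \<sigma>\<^sub>3_def matrix_vector_mult_def sum_2)
  show "l2_component 1 (matop \<sigma>\<^sub>3 \<bullet>\<^sub>o u) = l2_component 1 u"
  proof (rule l2_eqI)
    show "AE x in lebesgue. rep_l2 (l2_component 1 (matop \<sigma>\<^sub>3 \<bullet>\<^sub>o u)) x = rep_l2 (l2_component 1 u) x"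
      using l2_component_rep[of 1 "matop \<sigma>\<^sub>3 \<bullet>\<^sub>o u"] l2_component_rep[of 1 u] rep_matop[of \<sigma>\<^sub>3 u]
      by eventually_elim (simp add: s)
  qed
  have "l2_component 2 (matop \<sigma>\<^sub>3 \<bullet>\<^sub>o u) = (-1) *\<^sub>C l2_component 2 u"
  proof (rule l2_eqI)
    show "AE x in lebesgue. rep_l2 (l2_component 2 (matop \<sigma>\<^sub>3 \<bullet>\<^sub>o u)) x = rep_l2 ((-1) *\<^sub>C l2_component 2 u) x"
      using l2_component_rep[of 2 "matop \<sigma>\<^sub>3 \<bullet>\<^sub>o u"] l2_component_rep[of 2 u] rep_matop[of \<sigma>\<^sub>3 u]
        rep_l2_scaleC[of "-1" "l2_component 2 u"]
      by eventually_elim (simp add: s scaleC_complex_def)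
  qed
  then show "l2_component 2 (matop \<sigma>\<^sub>3 \<bullet>\<^sub>o u) = - l2_component 2 u" by (simp add: scaleC_one)
qed

lemma two_neq_neg: "x = - x \<Longrightarrow> x = (0 :: 'a :: real_vector)"
  by (metis (no_types) add.right_inverse scaleR_2 scaleR_eq_0_iff zero_neq_numeral)

text \<open>Commuting with \<open>\<sigma>\<^sub>3\<close> means preserving its two eigenspaces, the
  components: an off-diagonal entry would equal its own negative.\<close>

locale even_operator =
  fixes X :: "(complex ^ 2) l2 cop"
  assumes even: "X * matop \<sigma>\<^sub>3 = matop \<sigma>\<^sub>3 * X"
begin

lemma even_apply: "X \<bullet>\<^sub>o (matop \<sigma>\<^sub>3 \<bullet>\<^sub>o u) = matop \<sigma>\<^sub>3 \<bullet>\<^sub>o (X \<bullet>\<^sub>o u)"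
  unfolding cop_apply_mult(1)[symmetric] even ..

lemma embed_1: "X \<bullet>\<^sub>o l2_embed 1 f = l2_embed 1 (block 1 X \<bullet>\<^sub>o f)"
proof (rule l2_component_eqI)
  have "matop \<sigma>\<^sub>3 \<bullet>\<^sub>o l2_embed 1 f = l2_embed 1 f"
    by (rule l2_component_eqI) (simp_all add: component_sigma3 l2_component_embed)
  then have "X \<bullet>\<^sub>o l2_embed 1 f = matop \<sigma>\<^sub>3 \<bullet>\<^sub>o (X \<bullet>\<^sub>o l2_embed 1 f)" using even_apply[of "l2_embed 1 f"] by simp
  then have "l2_component 2 (X \<bullet>\<^sub>o l2_embed 1 f) = - l2_component 2 (X \<bullet>\<^sub>o l2_embed 1 f)"
    using component_sigma3(2)[of "X \<bullet>\<^sub>o l2_embed 1 f"] by simp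
  then have "l2_component 2 (X \<bullet>\<^sub>o l2_embed 1 f) = 0" by (rule two_neq_neg)
  then show "l2_component 2 (X \<bullet>\<^sub>o l2_embed 1 f) = l2_component 2 (l2_embed 1 (block 1 X \<bullet>\<^sub>o f))"
    by (simp add: l2_component_embed)
qed (simp add: l2_component_embed block_apply)

lemma embed_2: "X \<bullet>\<^sub>o l2_embed 2 f = l2_embed 2 (block 2 X \<bullet>\<^sub>o f)"
proof (rule l2_component_eqI)
  have "matop \<sigma>\<^sub>3 \<bullet>\<^sub>o l2_embed 2 f = - l2_embed 2 f"
    by (rule l2_component_eqI) (simp_all add: component_sigma3 l2_component_embed l2_component_neg)
  then have "- (X \<bullet>\<^sub>o l2_embed 2 f) = matop \<sigma>\<^sub>3 \<bullet>\<^sub>o (X \<bullet>\<^sub>o l2_embed 2 f)"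
    using even_apply[of "l2_embed 2 f"] by (simp add: cop_neg)
  then have "l2_component 1 (- (X \<bullet>\<^sub>o l2_embed 2 f)) = l2_component 1 (X \<bullet>\<^sub>o l2_embed 2 f)"
    unfolding component_sigma3(1)[of "X \<bullet>\<^sub>o l2_embed 2 f", symmetric] by (rule arg_cong)
  then have "l2_component 1 (X \<bullet>\<^sub>o l2_embed 2 f) = 0"
    unfolding l2_component_neg by (rule two_neq_neg[OF sym])
  then show "l2_component 1 (X \<bullet>\<^sub>o l2_embed 2 f) = l2_component 1 (l2_embed 2 (block 2 X \<bullet>\<^sub>o f))"
    by (simp add: l2_component_embed)
qed (simp add: l2_component_embed block_apply)

lemma embed: "X \<bullet>\<^sub>o l2_embed i f = l2_embed i (block i X \<bullet>\<^sub>o f)"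
  using exhaust_2[of i] embed_1 embed_2 by auto

lemma component: "l2_component i (X \<bullet>\<^sub>o u) = block i X \<bullet>\<^sub>o l2_component i u"
proof -
  have "X \<bullet>\<^sub>o u = l2_embed 1 (block 1 X \<bullet>\<^sub>o l2_component 1 u) + l2_embed 2 (block 2 X \<bullet>\<^sub>o l2_component 2 u)"
    by (subst l2_decompose[of u]) (simp only: cop_add embed)
  then show ?thesis using exhaust_2[of i] by (auto simp: l2_component_add l2_component_embed)
qed

text \<open>Taking a diagonal entry is multiplicative here because the left factor has no
  off-diagonal entries.\<close>

lemma block_mult: "block i (X * Z) = block i X * block i Z"
  by (rule cop_eqI) (simp add: block_apply[of i "X * Z"] block_apply[of i Z] component)

end

lemma block_linear: "block i (X + Z) = block i X + block i Z" "block i (X - Z) = block i X - block i Z"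
    "block i (c *\<^sub>C X) = c *\<^sub>C block i X" "block i (r *\<^sub>R X) = r *\<^sub>R block i X"
  by (rule cop_eqI; simp add: block_apply l2_component_add l2_component_diff l2_component_scaleC scaleR_scaleC)+

lemma block_sigma3: "block 1 (matop \<sigma>\<^sub>3) = 1" "block 2 (matop \<sigma>\<^sub>3) = -1"
  by (rule cop_eqI; simp add: block_apply component_sigma3 l2_component_embed)+

section \<open>Graphs of inverses and their resolvent sets\<close>

definition graph_inv :: "'a :: complex_normed_vector cop \<Rightarrow> ('a \<times> 'a) set" where
  "graph_inv T = {(T \<bullet>\<^sub>o f, f) | f. True}"

text \<open>The inverse of T^(-1) - z is characterised by the resolvent identity with T in both
  orders. This makes the resolvent set an algebraic notion, which can be carried to the blocks and
  back.\<close>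

lemma resolvent_set_graph_inv:
  fixes T :: "'a :: {complex_normed_vector, perfect_space, banach} cop"
  shows "z \<in> resolvent_set (graph_inv T) \<longleftrightarrow> (\<exists>R. R = T + z *\<^sub>C (T * R) \<and> R = T + z *\<^sub>C (R * T))"
proof -
  have conv: "(operator_shift (graph_inv T) z)\<inverse> = {(f - z *\<^sub>C (T \<bullet>\<^sub>o f), T \<bullet>\<^sub>o f) | f. True}"
    unfolding operator_shift_def graph_inv_def by auto
  have iff: "{(f - z *\<^sub>C (T \<bullet>\<^sub>o f), T \<bullet>\<^sub>o f) | f. True} = {(h, R \<bullet>\<^sub>o h) | h. True}
      \<longleftrightarrow> R = T + z *\<^sub>C (T * R) \<and> R = T + z *\<^sub>C (R * T)" for R :: "'a cop"
  proof (intro iffI conjI)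
    assume eq: "{(f - z *\<^sub>C (T \<bullet>\<^sub>o f), T \<bullet>\<^sub>o f) | f. True} = {(h, R \<bullet>\<^sub>o h) | h. True}"
    show "R = T + z *\<^sub>C (T * R)"
    proof (rule cop_eqI)
      fix h
      have "(h, R \<bullet>\<^sub>o h) \<in> {(f - z *\<^sub>C (T \<bullet>\<^sub>o f), T \<bullet>\<^sub>o f) | f. True}" unfolding eq by blast
      then obtain f where f: "h = f - z *\<^sub>C (T \<bullet>\<^sub>o f)" "R \<bullet>\<^sub>o h = T \<bullet>\<^sub>o f" by blast
      have "f = h + z *\<^sub>C (R \<bullet>\<^sub>o h)" using f by simp
      then have "R \<bullet>\<^sub>o h = T \<bullet>\<^sub>o (h + z *\<^sub>C (R \<bullet>\<^sub>o h))" using f(2) by simp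
      then show "R \<bullet>\<^sub>o h = (T + z *\<^sub>C (T * R)) \<bullet>\<^sub>o h" by (simp add: cop_add cop_scaleC)
    qed
    show "R = T + z *\<^sub>C (R * T)"
    proof (rule cop_eqI)
      fix f
      have "(f - z *\<^sub>C (T \<bullet>\<^sub>o f), T \<bullet>\<^sub>o f) \<in> {(h, R \<bullet>\<^sub>o h) | h. True}" unfolding eq[symmetric] by blast
      then have "R \<bullet>\<^sub>o (f - z *\<^sub>C (T \<bullet>\<^sub>o f)) = T \<bullet>\<^sub>o f" by auto
      then show "R \<bullet>\<^sub>o f = (T + z *\<^sub>C (R * T)) \<bullet>\<^sub>o f" by (simp add: cop_diff cop_scaleC algebra_simps)
    qed
  next
    assume R: "R = T + z *\<^sub>C (T * R) \<and> R = T + z *\<^sub>C (R * T)"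
    have R1: "R \<bullet>\<^sub>o h = T \<bullet>\<^sub>o (h + z *\<^sub>C (R \<bullet>\<^sub>o h))" for h
      using arg_cong[OF conjunct1[OF R], of "\<lambda>X. X \<bullet>\<^sub>o h"] by (simp add: cop_add cop_scaleC)
    have R2: "T \<bullet>\<^sub>o f = R \<bullet>\<^sub>o (f - z *\<^sub>C (T \<bullet>\<^sub>o f))" for f
      using arg_cong[OF conjunct2[OF R], of "\<lambda>X. X \<bullet>\<^sub>o f"] by (simp add: cop_diff cop_scaleC)
    show "{(f - z *\<^sub>C (T \<bullet>\<^sub>o f), T \<bullet>\<^sub>o f) | f. True} = {(h, R \<bullet>\<^sub>o h) | h. True}"
    proof (intro equalityI subsetI)
      fix p assume "p \<in> {(f - z *\<^sub>C (T \<bullet>\<^sub>o f), T \<bullet>\<^sub>o f) | f. True}"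
      then obtain f where "p = (f - z *\<^sub>C (T \<bullet>\<^sub>o f), T \<bullet>\<^sub>o f)" by blast
      then show "p \<in> {(h, R \<bullet>\<^sub>o h) | h. True}" using R2[of f] by blast
    next
      fix p assume "p \<in> {(h, R \<bullet>\<^sub>o h) | h. True}"
      then obtain h where p: "p = (h, R \<bullet>\<^sub>o h)" by blast
      have "p = ((h + z *\<^sub>C (R \<bullet>\<^sub>o h)) - z *\<^sub>C (T \<bullet>\<^sub>o (h + z *\<^sub>C (R \<bullet>\<^sub>o h))), T \<bullet>\<^sub>o (h + z *\<^sub>C (R \<bullet>\<^sub>o h)))"
        unfolding p R1[symmetric] by simp
      then show "p \<in> {(f - z *\<^sub>C (T \<bullet>\<^sub>o f), T \<bullet>\<^sub>o f) | f. True}" by blast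
    qed
  qed
  show ?thesis
  proof
    assume "z \<in> resolvent_set (graph_inv T)"
    then obtain R where "bounded_clinear R" "(operator_shift (graph_inv T) z)\<inverse> = {(h, R h) | h. True}"
      unfolding resolvent_set_def by blast
    then show "\<exists>R. R = T + z *\<^sub>C (T * R) \<and> R = T + z *\<^sub>C (R * T)"
      using iff[of "cop_of R"] unfolding conv by auto
  next
    assume "\<exists>R. R = T + z *\<^sub>C (T * R) \<and> R = T + z *\<^sub>C (R * T)"
    then obtain R where "(operator_shift (graph_inv T) z)\<inverse> = {(h, R \<bullet>\<^sub>o h) | h. True}"
      unfolding conv iff[symmetric] by blast
    then show "z \<in> resolvent_set (graph_inv T)"
      unfolding resolvent_set_def using bounded_clinear_cop by blast
  qed
qed

lemma linear_operator_graph_inv: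
  assumes "\<And>f. T \<bullet>\<^sub>o f = 0 \<Longrightarrow> f = 0"
  shows "linear_operator (graph_inv T)"
  unfolding linear_operator_def
proof (intro conjI allI impI)
  show "single_valued (graph_inv T)"
  proof (rule single_valuedI)
    fix x y z assume "(x, y) \<in> graph_inv T" "(x, z) \<in> graph_inv T"
    then have "T \<bullet>\<^sub>o (y - z) = 0" by (auto simp: graph_inv_def cop_diff)
    then show "y = z" using assms by fastforce
  qed
qed (auto simp: graph_inv_def cop_zero cop_add cop_scaleC)

lemma resolvent_commute:
  fixes A B R :: "'a :: complex_banach_algebra_1"
  assumes R: "R = A + z *\<^sub>C (A * R)" "R = A + z *\<^sub>C (R * A)" and AB: "A * B = B * A"
  shows "R * B = B * R"
proof -
  have "R * B = A * B + z *\<^sub>C (R * (A * B))" using arg_cong[OF R(2), of "\<lambda>X. X * B"] by (simp add: distrib_right mult.assoc)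
  then have 1: "R * B - z *\<^sub>C (R * (B * A)) = A * B" unfolding AB by simp
  have "B * R = B * A + z *\<^sub>C (B * (A * R))" using arg_cong[OF R(1), of "\<lambda>X. B * X"] by (simp add: distrib_left)
  then have 2: "B * R = A * B + z *\<^sub>C (A * (B * R))" unfolding AB[symmetric] mult.assoc[symmetric] .
  have "B * R = (R * B - z *\<^sub>C (R * (B * A))) + z *\<^sub>C ((R * B - z *\<^sub>C (R * (B * A))) * R)"
    using 2 unfolding 1 by (simp add: mult.assoc)
  also have "\<dots> = R * B - z *\<^sub>C (R * (B * A)) + z *\<^sub>C (R * (B * (R - z *\<^sub>C (A * R))))"
    by (simp add: left_diff_distrib right_diff_distrib mult.assoc)
  also have "R - z *\<^sub>C (A * R) = A" using R(1) by (metis add_diff_cancel_right')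
  finally show ?thesis by simp
qed

lemma cop_inverse:
  fixes S :: "'a :: {complex_normed_vector, perfect_space, banach} cop"
  assumes "S * S' = 1" "S' * S = 1"
  shows "bij ((\<bullet>\<^sub>o) S)" "inv ((\<bullet>\<^sub>o) S) = (\<bullet>\<^sub>o) S'"
proof -
  have S: "S' \<bullet>\<^sub>o (S \<bullet>\<^sub>o x) = x" "S \<bullet>\<^sub>o (S' \<bullet>\<^sub>o x) = x" for x
    unfolding cop_apply_mult(1)[symmetric] assms by simp_all
  show "bij ((\<bullet>\<^sub>o) S)" by (rule o_bij[of "(\<bullet>\<^sub>o) S'"]) (simp_all add: fun_eq_iff S)
  show "inv ((\<bullet>\<^sub>o) S) = (\<bullet>\<^sub>o) S'" by (rule inv_equality) (rule S)+
qed

text \<open>Conjugation by S turns B into \<open>\<sigma>\<^sub>3\<close>, hence everything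
  commuting with B into a block-diagonal operator. In each block A B = L reads L = \<plusminus> A,
  so there the contour integral is, up to a sign, a true resolvent for z in one of the half
  planes.\<close>

lemma block_diagonalization:
  assumes A: "axis_resolvent A R C"
    and AB: "A * B = axis_resolvent.L R" "B * A = axis_resolvent.L R"
    and S: "S * S' = 1" "S' * S = 1" "S * B = matop \<sigma>\<^sub>3 * S"
    and vec_inj: "\<And>f. A \<bullet>\<^sub>o f = 0 \<Longrightarrow> f = 0"
  shows "\<exists>H_plus H_minus. linear_operator H_plus \<and> linear_operator H_minus \<and>
     operator_conj ((\<bullet>\<^sub>o) S) (graph_inv A) = block_diag H_plus H_minus \<and>
     spectrum H_plus = spectrum (graph_inv A) \<inter> {z. Re z > 0} \<and>
     spectrum H_minus = spectrum (graph_inv A) \<inter> {z. Re z < 0}"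
proof -
  interpret axis_resolvent A R C by (rule A)
  define c where "c X = S * X * S'" for X
  have c_mult: "c (X * Z) = c X * c Z" for X Z
  proof -
    have "c X * c Z = S * X * ((S' * S) * (Z * S'))" unfolding c_def by (simp only: mult.assoc)
    also have "\<dots> = c (X * Z)" unfolding S c_def by (simp only: mult.assoc mult_1_left)
    finally show ?thesis ..
  qed
  have c_linear: "c (X + Z) = c X + c Z" "c (X - Z) = c X - c Z" "c (a *\<^sub>C X) = a *\<^sub>C c X" "c (r *\<^sub>R X) = r *\<^sub>R c X" for X Z a r
    unfolding c_def by (simp_all add: distrib_left distrib_right left_diff_distrib right_diff_distrib)
  have c_B: "c B = matop \<sigma>\<^sub>3" unfolding c_def S(3) mult.assoc S(1) by simp
  have comm: "A * B = B * A" using AB by simp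
  have even: "even_operator (c X)" if "X * B = B * X" for X
  proof
    show "c X * matop \<sigma>\<^sub>3 = matop \<sigma>\<^sub>3 * c X" unfolding c_B[symmetric] c_mult[symmetric] that ..
  qed
  interpret A: even_operator "c A" by (rule even[OF comm])
  let ?T = "\<lambda>i. block i (c A)"
  have blockI: "block i (c (X * Z)) = block i (c X) * block i (c Z)" if "X * B = B * X" for X Z i
    unfolding c_mult by (rule even_operator.block_mult[OF even[OF that]])
  have cA_inj: "f = 0" if "c A \<bullet>\<^sub>o f = 0" for f
  proof -
    have "S' \<bullet>\<^sub>o (c A \<bullet>\<^sub>o f) = A \<bullet>\<^sub>o (S' \<bullet>\<^sub>o f)"
      unfolding cop_apply_mult(1)[symmetric] c_def by (simp only: mult.assoc[symmetric] S mult_1_left)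
    then have "A \<bullet>\<^sub>o (S' \<bullet>\<^sub>o f) = 0" unfolding that cop_zero by (rule sym)
    then have "S' \<bullet>\<^sub>o f = 0" by (rule vec_inj)
    then have "S \<bullet>\<^sub>o (S' \<bullet>\<^sub>o f) = 0" by (simp add: cop_zero)
    then show ?thesis unfolding cop_apply_mult(1)[symmetric] S by simp
  qed
  have T_inj: "f = 0" if "?T i \<bullet>\<^sub>o f = 0" for i f
  proof -
    have "c A \<bullet>\<^sub>o l2_embed i f = 0" unfolding A.embed that by simp
    from cA_inj[OF this] have "l2_component i (l2_embed i f) = 0" by simp
    then show ?thesis by (simp add: l2_component_embed)
  qed
  have inv_S: "inv ((\<bullet>\<^sub>o) S) = (\<bullet>\<^sub>o) S'" by (rule cop_inverse(2)[OF S(1,2)])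
  have conj: "operator_conj ((\<bullet>\<^sub>o) S) (graph_inv A) = block_diag (graph_inv (?T 1)) (graph_inv (?T 2))"
  proof (intro equalityI subsetI)
    fix p assume "p \<in> operator_conj ((\<bullet>\<^sub>o) S) (graph_inv A)"
    then obtain u f where p: "p = (u, S \<bullet>\<^sub>o f)" and u: "S' \<bullet>\<^sub>o u = A \<bullet>\<^sub>o f"
      unfolding operator_conj_def inv_S graph_inv_def by blast
    have "c A \<bullet>\<^sub>o (S \<bullet>\<^sub>o f) = S \<bullet>\<^sub>o (A \<bullet>\<^sub>o ((S' * S) \<bullet>\<^sub>o f))" by (simp add: c_def)
    also have "\<dots> = (S * S') \<bullet>\<^sub>o u" unfolding S(2) by (simp add: u[symmetric])
    finally have "u = c A \<bullet>\<^sub>o (S \<bullet>\<^sub>o f)" unfolding S(1) by simp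
    then show "p \<in> block_diag (graph_inv (?T 1)) (graph_inv (?T 2))"
      unfolding p block_diag_def graph_inv_def by (simp add: A.component)
  next
    fix p assume "p \<in> block_diag (graph_inv (?T 1)) (graph_inv (?T 2))"
    then obtain u h where p: "p = (u, h)" and "l2_component 1 u = ?T 1 \<bullet>\<^sub>o l2_component 1 h" "l2_component 2 u = ?T 2 \<bullet>\<^sub>o l2_component 2 h"
      unfolding block_diag_def graph_inv_def by auto
    then have u: "u = c A \<bullet>\<^sub>o h" by (intro l2_component_eqI) (simp_all add: A.component)
    have "S' \<bullet>\<^sub>o u = (S' * S) \<bullet>\<^sub>o (A \<bullet>\<^sub>o (S' \<bullet>\<^sub>o h))" unfolding u c_def by simp
    moreover have "h = S \<bullet>\<^sub>o (S' \<bullet>\<^sub>o h)" unfolding cop_apply_mult(1)[symmetric] S by simp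
    ultimately show "p \<in> operator_conj ((\<bullet>\<^sub>o) S) (graph_inv A)"
      unfolding p operator_conj_def inv_S graph_inv_def S by auto
  qed
  have to_blocks: "z \<in> resolvent_set (graph_inv (?T i))" if z: "z \<in> resolvent_set (graph_inv A)" for z i
  proof -
    obtain X where X: "X = A + z *\<^sub>C (A * X)" "X = A + z *\<^sub>C (X * A)"
      using z unfolding resolvent_set_graph_inv by blast
    have XB: "X * B = B * X" by (rule resolvent_commute[OF X comm])
    have "block i (c X) = ?T i + z *\<^sub>C (?T i * block i (c X))"
      using arg_cong[OF X(1), of "\<lambda>X. block i (c X)"] unfolding c_linear block_linear blockI[OF comm] .
    moreover have "block i (c X) = ?T i + z *\<^sub>C (block i (c X) * ?T i)"
      using arg_cong[OF X(2), of "\<lambda>X. block i (c X)"] unfolding c_linear block_linear blockI[OF XB] .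
    ultimately show ?thesis unfolding resolvent_set_graph_inv by blast
  qed
  have from_blocks: "z \<in> resolvent_set (graph_inv A)"
    if z: "z \<in> resolvent_set (graph_inv (?T 1))" "z \<in> resolvent_set (graph_inv (?T 2))" for z
  proof -
    obtain R1 where R1: "R1 = ?T 1 + z *\<^sub>C (?T 1 * R1)" "R1 = ?T 1 + z *\<^sub>C (R1 * ?T 1)"
      using z(1) unfolding resolvent_set_graph_inv by blast
    obtain R2 where R2: "R2 = ?T 2 + z *\<^sub>C (?T 2 * R2)" "R2 = ?T 2 + z *\<^sub>C (R2 * ?T 2)"
      using z(2) unfolding resolvent_set_graph_inv by blast
    \<comment> \<open>The resolvents of the two blocks, put together componentwise, form the
      resolvent of the conjugated operator.\<close>
    define F where "F u = l2_embed 1 (R1 \<bullet>\<^sub>o l2_component 1 u) + l2_embed 2 (R2 \<bullet>\<^sub>o l2_component 2 u)" for u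
    have "bounded_clinear F"
    proof (rule bounded_clinearI)
      fix u
      have part: "norm (l2_embed i (X \<bullet>\<^sub>o l2_component i u)) \<le> norm X * norm u" for X i
      proof -
        have "norm (l2_embed i (X \<bullet>\<^sub>o l2_component i u)) \<le> norm X * norm (l2_component i u)"
          by (rule order_trans[OF norm_l2_embed norm_cop_apply])
        also have "\<dots> \<le> norm X * norm u" by (intro mult_left_mono norm_l2_component) simp
        finally show ?thesis .
      qed
      show "norm (F u) \<le> (norm R1 + norm R2) * norm u"
        unfolding F_def distrib_right by (intro norm_triangle_le add_mono part)
    qed (simp_all add: F_def l2_component_add l2_component_scaleC cop_add cop_scaleC l2_embed_add l2_embed_scaleC scaleC_add_right)
    then have F: "cop_of F \<bullet>\<^sub>o u = F u" for u by simp
    have F_comp: "l2_component 1 (F u) = R1 \<bullet>\<^sub>o l2_component 1 u" "l2_component 2 (F u) = R2 \<bullet>\<^sub>o l2_component 2 u" for u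
      by (simp_all add: F_def l2_component_add l2_component_embed)
    note apply_eq = arg_cong[of _ _ "\<lambda>X. X \<bullet>\<^sub>o _"]
    have 1: "cop_of F = c A + z *\<^sub>C (c A * cop_of F)"
    proof (rule cop_eqI)
      fix u
      show "cop_of F \<bullet>\<^sub>o u = (c A + z *\<^sub>C (c A * cop_of F)) \<bullet>\<^sub>o u"
        using arg_cong[OF R1(1), of "\<lambda>X. X \<bullet>\<^sub>o l2_component 1 u"] arg_cong[OF R2(1), of "\<lambda>X. X \<bullet>\<^sub>o l2_component 2 u"]
        by (intro l2_component_eqI) (simp_all only: F F_comp l2_component_add l2_component_scaleC A.component cop_apply_simps cop_apply_scaleC cop_apply_mult)
    qed
    have 2: "cop_of F = c A + z *\<^sub>C (cop_of F * c A)"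
    proof (rule cop_eqI)
      fix u
      show "cop_of F \<bullet>\<^sub>o u = (c A + z *\<^sub>C (cop_of F * c A)) \<bullet>\<^sub>o u"
        using arg_cong[OF R1(2), of "\<lambda>X. X \<bullet>\<^sub>o l2_component 1 u"] arg_cong[OF R2(2), of "\<lambda>X. X \<bullet>\<^sub>o l2_component 2 u"]
        by (intro l2_component_eqI) (simp_all only: F F_comp l2_component_add l2_component_scaleC A.component cop_apply_simps cop_apply_scaleC cop_apply_mult)
    qed
    define d where "d X = S' * X * S" for X
    have d_mult: "d (X * Z) = d X * d Z" for X Z
    proof -
      have "d X * d Z = S' * X * ((S * S') * (Z * S))" unfolding d_def by (simp only: mult.assoc)
      also have "\<dots> = d (X * Z)" unfolding S d_def by (simp only: mult.assoc mult_1_left)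
      finally show ?thesis ..
    qed
    have d_linear: "d (X + Z) = d X + d Z" "d (a *\<^sub>C X) = a *\<^sub>C d X" for X Z a
      unfolding d_def by (simp_all add: distrib_left distrib_right)
    have d_A: "d (c A) = A"
    proof -
      have "d (c A) = (S' * S) * A * (S' * S)" unfolding d_def c_def by (simp only: mult.assoc)
      then show ?thesis unfolding S by simp
    qed
    have "d (cop_of F) = A + z *\<^sub>C (A * d (cop_of F))"
      using arg_cong[OF 1, of d] unfolding d_linear d_mult d_A .
    moreover have "d (cop_of F) = A + z *\<^sub>C (d (cop_of F) * A)"
      using arg_cong[OF 2, of d] unfolding d_linear d_mult d_A .
    ultimately show ?thesis unfolding resolvent_set_graph_inv by blast
  qed
  have axis: "z \<in> resolvent_set (graph_inv A)" if "Re z = 0" for z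
  proof -
    have "z = \<i> * Im z" using that by (simp add: complex_eq_iff)
    then show ?thesis unfolding resolvent_set_graph_inv using R_left[of "Im z"] R_right[of "Im z"] by metis
  qed
  \<comment> \<open>In a block where \<open>\<sigma>\<^sub>3\<close> acts as - sgn (Re z), L equals
    - sgn (Re z) A, so the two terms of the contour identity add up to - sgn (Re z) A;
    \<open>X\<close> absorbs this sign.\<close>
  have half: "z \<in> resolvent_set (graph_inv (?T i))"
    if z: "Re z \<noteq> 0" and s: "block i (matop \<sigma>\<^sub>3) = - sgn (Re z) *\<^sub>R 1" for z i
  proof -
    obtain Q where Q: "Q - z *\<^sub>C (A * Q) = (1/2) *\<^sub>R (L - sgn (Re z) *\<^sub>R A)"
      and Q_comm: "\<And>Y. Y * A = A * Y \<Longrightarrow> Y * Q = Q * Y"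
      using half_plane_resolvent[OF z] by blast
    have QA: "Q * A = A * Q" and QB: "Q * B = B * Q" using Q_comm[of A] Q_comm[of B] comm by simp_all
    define X where "X = (- sgn (Re z)) *\<^sub>R block i (c Q)"
    have sg: "sgn (Re z) * sgn (Re z) = 1" using z by (simp add: sgn_if)
    have BL: "block i (c L) = - sgn (Re z) *\<^sub>R ?T i"
      unfolding AB(1)[symmetric] blockI[OF comm] c_B s by simp
    have "block i (c Q) - z *\<^sub>C (?T i * block i (c Q)) = (1/2) *\<^sub>R (- sgn (Re z) *\<^sub>R ?T i - sgn (Re z) *\<^sub>R ?T i)"
      using arg_cong[OF Q, of "\<lambda>X. block i (c X)"] unfolding c_linear block_linear blockI[OF comm] BL .
    also have "\<dots> = - sgn (Re z) *\<^sub>R ?T i"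
    proof -
      have "(1/2) *\<^sub>R (y + y) = y" for y :: "complex l2 cop" unfolding scaleR_2[symmetric] by simp
      from this[of "- sgn (Re z) *\<^sub>R ?T i"] show ?thesis by simp
    qed
    finally have eq: "block i (c Q) - z *\<^sub>C (?T i * block i (c Q)) = - sgn (Re z) *\<^sub>R ?T i" .
    have "X - z *\<^sub>C (?T i * X) = (- sgn (Re z)) *\<^sub>R (block i (c Q) - z *\<^sub>C (?T i * block i (c Q)))"
    proof -
      have "s *\<^sub>R Y - z *\<^sub>C (T * (s *\<^sub>R Y)) = s *\<^sub>R (Y - z *\<^sub>C (T * Y))" for s and Y T :: "complex l2 cop"
        by (simp add: scaleR_right_diff_distrib scaleR_scaleC_commute)
      then show ?thesis unfolding X_def .
    qed
    also have "\<dots> = ?T i" unfolding eq using z by (simp add: sg)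
    finally have 1: "X = ?T i + z *\<^sub>C (?T i * X)" by (simp only: diff_eq_eq)
    have "block i (c Q) * ?T i = ?T i * block i (c Q)"
      unfolding blockI[OF comm, symmetric] blockI[OF QB, symmetric] QA ..
    then have "X * ?T i = ?T i * X" unfolding X_def by simp
    with 1 show ?thesis unfolding resolvent_set_graph_inv by metis
  qed
  have neg: "z \<in> resolvent_set (graph_inv (?T 1))" if "Re z < 0" for z
    using that by (intro half) (simp_all add: block_sigma3)
  have pos: "z \<in> resolvent_set (graph_inv (?T 2))" if "Re z > 0" for z
    using that by (intro half) (simp_all add: block_sigma3)
  have block_1: "z \<notin> resolvent_set (graph_inv (?T 1)) \<longleftrightarrow> z \<notin> resolvent_set (graph_inv A) \<and> Re z > 0" for z
  proof (cases "Re z > 0")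
    case True
    then show ?thesis using to_blocks[of z 1] from_blocks[of z] pos[OF True] by blast
  next
    case False
    then have "Re z < 0 \<or> Re z = 0" by linarith
    then have "z \<in> resolvent_set (graph_inv (?T 1))" using neg[of z] axis[of z] to_blocks[of z 1] by blast
    then show ?thesis using False by blast
  qed
  have block_2: "z \<notin> resolvent_set (graph_inv (?T 2)) \<longleftrightarrow> z \<notin> resolvent_set (graph_inv A) \<and> Re z < 0" for z
  proof (cases "Re z < 0")
    case True
    then show ?thesis using to_blocks[of z 2] from_blocks[of z] neg[OF True] by blast
  next
    case False
    then have "Re z > 0 \<or> Re z = 0" by linarith
    then have "z \<in> resolvent_set (graph_inv (?T 2))" using pos[of z] axis[of z] to_blocks[of z 2] by blast
    then show ?thesis using False by blast
  qed
  have lin: "linear_operator (graph_inv (?T i))" for i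
    by (rule linear_operator_graph_inv) (rule T_inj)
  have spec_1: "spectrum (graph_inv (?T 1)) = spectrum (graph_inv A) \<inter> {z. Re z > 0}"
    unfolding spectrum_def using block_1 by blast
  have spec_2: "spectrum (graph_inv (?T 2)) = spectrum (graph_inv A) \<inter> {z. Re z < 0}"
    unfolding spectrum_def using block_2 by blast
  show ?thesis
    by (intro exI[of _ "graph_inv (?T 1)"] exI[of _ "graph_inv (?T 2)"] conjI lin conj spec_1 spec_2)
qed

section \<open>The resolvent of the free Dirac operator on the imaginary axis\<close>

definition mat2 :: "complex \<Rightarrow> complex \<Rightarrow> complex \<Rightarrow> complex \<Rightarrow> complex ^ 2 ^ 2" where
  "mat2 a b c d = vector [vector [a, b], vector [c, d]]"

lemma mat2_nth [simp]: "mat2 a b c d $ 1 $ 1 = a" "mat2 a b c d $ 1 $ 2 = b"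
    "mat2 a b c d $ 2 $ 1 = c" "mat2 a b c d $ 2 $ 2 = d"
  by (simp_all add: mat2_def)

lemma mat2_mult: "mat2 a b c d ** mat2 a' b' c' d' = mat2 (a * a' + b * c') (a * b' + b * d') (c * a' + d * c') (c * b' + d * d')"
  by (simp add: vec_eq_iff forall_2 matrix_matrix_mult_def sum_2)

lemma mat2_add: "mat2 a b c d + mat2 a' b' c' d' = mat2 (a + a') (b + b') (c + c') (d + d')"
  by (simp add: vec_eq_iff forall_2)

lemma mat2_scaleC: "z *\<^sub>C mat2 a b c d = mat2 (z * a) (z * b) (z * c) (z * d)"
  by (simp add: vec_eq_iff forall_2 scaleC_vec_def scaleC_complex_def)

lemma mat2_one: "mat 1 = mat2 1 0 0 1"
  by (simp add: vec_eq_iff forall_2 mat_def)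

lemma mat2_apply: "(mat2 a b c d *v v) $ 1 = a * v $ 1 + b * v $ 2" "(mat2 a b c d *v v) $ 2 = c * v $ 1 + d * v $ 2"
  by (simp_all add: matrix_vector_mult_def sum_2)

lemma mat2_eq_iff: "mat2 a b c d = mat2 a' b' c' d' \<longleftrightarrow> a = a' \<and> b = b' \<and> c = c' \<and> d = d'"
  by (auto simp: vec_eq_iff forall_2)

lemma mat2_sigma: "\<sigma>\<^sub>1 = mat2 0 1 1 0" "\<sigma>\<^sub>3 = mat2 1 0 0 (-1)"
  by (simp_all add: \<sigma>\<^sub>1_def \<sigma>\<^sub>3_def mat2_def)

lemma inner_mat2: "inner (mat2 a b c d *v u) v = inner u (mat2 (cnj a) (cnj c) (cnj b) (cnj d) *v v)"
  by (simp add: inner_vec_def sum_2 mat2_apply inner_complex_def algebra_simps)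

text \<open>Each component of the image is at most (|v_1| + |v_2|) / 2. The entries of the Green
  matrix have modulus exactly 1/2; this is why its norm is bounded by the exponential with constant
  1.\<close>

lemma norm_mat2_half:
  assumes "cmod a \<le> 1/2" "cmod b \<le> 1/2" "cmod c \<le> 1/2" "cmod d \<le> 1/2"
  shows "norm (mat2 a b c d *v v) \<le> norm v"
proof -
  let ?s = "cmod (v $ 1) + cmod (v $ 2)"
  have half: "cmod (x * v $ 1 + y * v $ 2) \<le> ?s / 2" if "cmod x \<le> 1/2" "cmod y \<le> 1/2" for x y
  proof -
    have "cmod (x * v $ 1 + y * v $ 2) \<le> cmod x * cmod (v $ 1) + cmod y * cmod (v $ 2)"
      by (metis norm_mult norm_triangle_ineq)
    also have "\<dots> \<le> 1/2 * cmod (v $ 1) + 1/2 * cmod (v $ 2)"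
      using that by (intro add_mono mult_right_mono) auto
    finally show ?thesis by simp
  qed
  have "(cmod (a * v $ 1 + b * v $ 2))\<^sup>2 + (cmod (c * v $ 1 + d * v $ 2))\<^sup>2 \<le> (?s / 2)\<^sup>2 + (?s / 2)\<^sup>2"
    using half assms by (intro add_mono power_mono) auto
  moreover have "(?s / 2)\<^sup>2 + (?s / 2)\<^sup>2 \<le> (cmod (v $ 1))\<^sup>2 + (cmod (v $ 2))\<^sup>2"
    using zero_le_power2[of "cmod (v $ 1) - cmod (v $ 2)"]
    by (simp add: power2_eq_square field_simps)
  ultimately show ?thesis
    by (simp add: norm_vec_def L2_set_def sum_2 mat2_apply)
qed

definition kap :: "real \<Rightarrow> real \<Rightarrow> real" where
  "kap m t = sqrt (m\<^sup>2 + t\<^sup>2)"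

definition mat_fw :: "real \<Rightarrow> real \<Rightarrow> complex ^ 2 ^ 2" where
  "mat_fw m t = mat2 ((of_real m + \<i> * of_real t) / (2 * of_real (kap m t))) (\<i> / 2) (\<i> / 2)
     ((- of_real m + \<i> * of_real t) / (2 * of_real (kap m t)))"

definition mat_bw :: "real \<Rightarrow> real \<Rightarrow> complex ^ 2 ^ 2" where
  "mat_bw m t = mat2 ((of_real m + \<i> * of_real t) / (2 * of_real (kap m t))) (- \<i> / 2) (- \<i> / 2)
     ((- of_real m + \<i> * of_real t) / (2 * of_real (kap m t)))"

text \<open>The Green matrix of \<open>H\<^sub>0 - \<i>t\<close> is \<open>e\<^sup>-\<^sup>\<kappa>\<^sup>|\<^sup>x\<^sup>|\<close> times a constant matrix on each of the half lines
  \<open>x > 0\<close> and \<open>x < 0\<close>, where \<open>\<kappa>\<^sup>2 = m\<^sup>2 + t\<^sup>2\<close>.\<close>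

definition free_resolvent :: "real \<Rightarrow> real \<Rightarrow> (complex ^ 2) l2 cop" where
  "free_resolvent m t = matop (mat_fw m t) * forward (kap m t) + matop (mat_bw m t) * backward (kap m t)"

lemma kap_pos: "m > 0 \<Longrightarrow> kap m t > 0"
  by (simp add: kap_def add_pos_nonneg)

lemma kap_ge: "m > 0 \<Longrightarrow> m \<le> kap m t"
  unfolding kap_def by (rule real_le_rsqrt) simp

lemma kap_square: "of_real (kap m t) * of_real (kap m t) = (of_real m * of_real m + of_real t * of_real t :: complex)"
proof -
  have "kap m t * kap m t = m * m + t * t"
    by (simp add: kap_def power2_eq_square)
  then show ?thesis by (metis of_real_add of_real_mult)
qed

lemma norm_mat_fw_bw:
  assumes "m > 0"
  shows "norm (mat_fw m t *v v) \<le> norm v" "norm (mat_bw m t *v v) \<le> norm v"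
proof -
  have mod: "cmod (of_real m + \<i> * of_real t) = kap m t" "cmod (- of_real m + \<i> * of_real t) = kap m t"
    by (simp_all add: cmod_def kap_def)
  have half: "cmod ((of_real m + \<i> * of_real t) / (2 * of_real (kap m t))) \<le> 1/2"
    "cmod ((- of_real m + \<i> * of_real t) / (2 * of_real (kap m t))) \<le> 1/2"
    unfolding norm_divide norm_mult norm_of_real mod using kap_pos[OF assms, of t] by simp_all
  show "norm (mat_fw m t *v v) \<le> norm v" "norm (mat_bw m t *v v) \<le> norm v"
    unfolding mat_fw_def mat_bw_def by (rule norm_mat2_half; (rule half)?; simp add: norm_divide)+
qed

lemma norm_matop_le_one:
  assumes "\<And>v. norm (M *v v) \<le> norm v"
  shows "norm (matop M) \<le> 1"
  by (rule order_trans[OF norm_matop onorm_bound]) (use assms in auto)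

text \<open>Each half line is estimated separately by 2 / \<kappa>. Only the decay in t counts here;
  the sharp constant is needed for V times the resolvent.\<close>

lemma norm_free_resolvent:
  assumes "m > 0"
  shows "norm (free_resolvent m t) \<le> 4 / min 1 m / sqrt (1 + t\<^sup>2)"
proof -
  note \<kappa> = kap_pos[OF assms, of t]
  have n: "norm (matop (mat_fw m t)) \<le> 1" "norm (matop (mat_bw m t)) \<le> 1"
    by (intro norm_matop_le_one norm_mat_fw_bw assms)+
  have "norm (free_resolvent m t) \<le> norm (matop (mat_fw m t)) * norm (forward (kap m t))
      + norm (matop (mat_bw m t)) * norm (backward (kap m t))"
    unfolding free_resolvent_def by (intro norm_triangle_le add_mono norm_mult_ineq)
  also have "\<dots> \<le> 1 * (2 / kap m t) + 1 * (2 / kap m t)"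
    using \<kappa> by (intro add_mono mult_mono n norm_forward_backward) auto
  finally have 1: "norm (free_resolvent m t) \<le> 4 / kap m t" by simp
  have "(min 1 m * sqrt (1 + t\<^sup>2))\<^sup>2 \<le> m\<^sup>2 + t\<^sup>2"
  proof -
    have a: "(min 1 m)\<^sup>2 \<le> m\<^sup>2" "(min 1 m)\<^sup>2 \<le> 1\<^sup>2" using assms by (intro power_mono; simp)+
    have "(min 1 m)\<^sup>2 * t\<^sup>2 \<le> 1 * t\<^sup>2" using a(2) by (intro mult_right_mono) auto
    then show ?thesis using a(1) by (simp add: power_mult_distrib distrib_left)
  qed
  then have "min 1 m * sqrt (1 + t\<^sup>2) \<le> kap m t" unfolding kap_def by (rule real_le_rsqrt)
  moreover have "0 < min 1 m * sqrt (1 + t\<^sup>2)" using assms by (simp add: add_pos_nonneg)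
  ultimately have "4 / kap m t \<le> 4 / (min 1 m * sqrt (1 + t\<^sup>2))" using \<kappa> by (intro divide_left_mono mult_pos_pos) (use assms in \<open>auto simp: add_pos_nonneg\<close>)
  then show ?thesis using 1 by simp
qed

lemma free_resolvent_adjoint:
  assumes "m > 0"
  shows "inner (free_resolvent m t \<bullet>\<^sub>o f) h = inner f (free_resolvent m (- t) \<bullet>\<^sub>o h)"
proof -
  note \<kappa> = kap_pos[OF assms, of t]
  have k: "kap m (- t) = kap m t" by (simp add: kap_def)
  have fw: "inner (mat_fw m t *v u) v = inner u (mat_bw m (- t) *v v)" for u v
    unfolding mat_fw_def mat_bw_def inner_mat2 k by (simp add: minus_diff_commute)
  have bw: "inner (mat_bw m t *v u) v = inner u (mat_fw m (- t) *v v)" for u v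
    unfolding mat_fw_def mat_bw_def inner_mat2 k by (simp add: minus_diff_commute)
  have cf: "forward (kap m t) \<bullet>\<^sub>o (matop M \<bullet>\<^sub>o h) = matop M \<bullet>\<^sub>o (forward (kap m t) \<bullet>\<^sub>o h)"
    and cb: "backward (kap m t) \<bullet>\<^sub>o (matop M \<bullet>\<^sub>o h) = matop M \<bullet>\<^sub>o (backward (kap m t) \<bullet>\<^sub>o h)" for M
    unfolding cop_apply_mult(1)[symmetric] forward_matop[OF \<kappa>] backward_matop[OF \<kappa>] by (rule refl)+
  have "inner (free_resolvent m t \<bullet>\<^sub>o f) h
    = inner (matop (mat_fw m t) \<bullet>\<^sub>o (forward (kap m t) \<bullet>\<^sub>o f)) h + inner (matop (mat_bw m t) \<bullet>\<^sub>o (backward (kap m t) \<bullet>\<^sub>o f)) h"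
    by (simp add: free_resolvent_def inner_add_left)
  also have "\<dots> = inner f (backward (kap m t) \<bullet>\<^sub>o (matop (mat_bw m (- t)) \<bullet>\<^sub>o h)) + inner f (forward (kap m t) \<bullet>\<^sub>o (matop (mat_fw m (- t)) \<bullet>\<^sub>o h))"
    unfolding matop_adjoint[OF fw] matop_adjoint[OF bw] inner_forward[OF \<kappa>] inner_backward[OF \<kappa>] ..
  also have "\<dots> = inner f (free_resolvent m (- t) \<bullet>\<^sub>o h)"
    unfolding cf cb by (simp add: free_resolvent_def k inner_add_right)
  finally show ?thesis .
qed

section \<open>The free Dirac equation on the imaginary axis\<close>

definition kinetic :: "(complex ^ 2) l2 cop" where
  "kinetic = matop (mat2 0 (- \<i>) (- \<i>) 0)"

definition mass :: "real \<Rightarrow> (complex ^ 2) l2 cop" where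
  "mass m = matop (mat2 (of_real m) 0 0 (- of_real m))"

text \<open>\<open>kinetic\<close> is - i \<open>\<sigma>\<^sub>1\<close>, the coefficient of the
  derivative without the derivative, and \<open>mass m\<close> is m \<open>\<sigma>\<^sub>3\<close>;
  the equation almost everywhere becomes one in L^2.\<close>

lemma free_dirac_iff: "(f, g) \<in> free_dirac m \<longleftrightarrow> (\<exists>f'. weak_derivative f f' \<and> g = kinetic \<bullet>\<^sub>o f' + mass m \<bullet>\<^sub>o f)"
proof -
  have "(AE x in lebesgue. rep_l2 g x = - \<i> *\<^sub>C (\<sigma>\<^sub>1 *v rep_l2 f' x) + complex_of_real m *\<^sub>C (\<sigma>\<^sub>3 *v rep_l2 f x))
    \<longleftrightarrow> g = kinetic \<bullet>\<^sub>o f' + mass m \<bullet>\<^sub>o f" for f'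
  proof -
    have "AE x in lebesgue. rep_l2 (kinetic \<bullet>\<^sub>o f' + mass m \<bullet>\<^sub>o f) x
      = - \<i> *\<^sub>C (\<sigma>\<^sub>1 *v rep_l2 f' x) + complex_of_real m *\<^sub>C (\<sigma>\<^sub>3 *v rep_l2 f x)"
      using rep_l2_add[of "kinetic \<bullet>\<^sub>o f'" "mass m \<bullet>\<^sub>o f"] rep_matop[of "mat2 0 (- \<i>) (- \<i>) 0" f']
        rep_matop[of "mat2 (of_real m) 0 0 (- of_real m)" f]
      unfolding kinetic_def mass_def
    proof eventually_elim
      case (elim x)
      show ?case unfolding elim
        by (simp add: mat2_sigma vec_eq_iff forall_2 mat2_apply scaleC_vec_def scaleC_complex_def)
    qed
    note AE = this
    show ?thesis
    proof
      assume "AE x in lebesgue. rep_l2 g x = - \<i> *\<^sub>C (\<sigma>\<^sub>1 *v rep_l2 f' x) + complex_of_real m *\<^sub>C (\<sigma>\<^sub>3 *v rep_l2 f x)"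
      from this AE have "AE x in lebesgue. rep_l2 g x = rep_l2 (kinetic \<bullet>\<^sub>o f' + mass m \<bullet>\<^sub>o f) x"
        by eventually_elim simp
      then show "g = kinetic \<bullet>\<^sub>o f' + mass m \<bullet>\<^sub>o f" by (rule l2_eqI)
    qed (use AE in simp)
  qed
  then show ?thesis by (simp add: free_dirac_def)
qed

lemma matop_apply_mult: "matop M \<bullet>\<^sub>o (matop N \<bullet>\<^sub>o x) = matop (M ** N) \<bullet>\<^sub>o x"
  unfolding matop_mult[symmetric] by simp

lemma matop_apply_add: "matop M \<bullet>\<^sub>o x + matop N \<bullet>\<^sub>o x = matop (M + N) \<bullet>\<^sub>o x"
  unfolding matop_add[symmetric] by simp

lemma matop_apply_scaleC: "c *\<^sub>C (matop M \<bullet>\<^sub>o x) = matop (c *\<^sub>C M) \<bullet>\<^sub>o x"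
  unfolding matop_scaleC[symmetric] by simp

lemma matop_apply_one: "x = matop (mat2 1 0 0 1) \<bullet>\<^sub>o x"
  unfolding mat2_one[symmetric] matop_one by simp

lemmas matop_calc = matop_apply_mult matop_apply_add matop_apply_scaleC mat2_mult mat2_add mat2_scaleC

lemma matop_cong: "M = N \<Longrightarrow> matop M \<bullet>\<^sub>o x = matop N \<bullet>\<^sub>o x"
  by simp

text \<open>These are the conditions on a Green matrix: the unit jump at 0, and the homogeneous
  equation for exp (- \<kappa> x) on x > 0 and for exp (\<kappa> x) on x < 0.\<close>

lemma green_identities:
  assumes "m > 0"
  shows "kinetic \<bullet>\<^sub>o (matop (mat_fw m t) \<bullet>\<^sub>o x) = kinetic \<bullet>\<^sub>o (matop (mat_bw m t) \<bullet>\<^sub>o x) + x"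
    and "mass m \<bullet>\<^sub>o (matop (mat_fw m t) \<bullet>\<^sub>o x)
      = kap m t *\<^sub>R (kinetic \<bullet>\<^sub>o (matop (mat_fw m t) \<bullet>\<^sub>o x)) + (\<i> * t) *\<^sub>C (matop (mat_fw m t) \<bullet>\<^sub>o x)"
    and "mass m \<bullet>\<^sub>o (matop (mat_bw m t) \<bullet>\<^sub>o x) + kap m t *\<^sub>R (kinetic \<bullet>\<^sub>o (matop (mat_bw m t) \<bullet>\<^sub>o x))
      = (\<i> * t) *\<^sub>C (matop (mat_bw m t) \<bullet>\<^sub>o x)"
proof -
  have nz: "complex_of_real (kap m t) \<noteq> 0" using kap_pos[OF assms, of t] by simp
  show "kinetic \<bullet>\<^sub>o (matop (mat_fw m t) \<bullet>\<^sub>o x) = kinetic \<bullet>\<^sub>o (matop (mat_bw m t) \<bullet>\<^sub>o x) + x"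
  proof -
    have "kinetic \<bullet>\<^sub>o (matop (mat_fw m t) \<bullet>\<^sub>o x) = kinetic \<bullet>\<^sub>o (matop (mat_bw m t) \<bullet>\<^sub>o x) + matop (mat2 1 0 0 1) \<bullet>\<^sub>o x"
      unfolding kinetic_def mat_fw_def mat_bw_def matop_calc
      by (rule matop_cong) (simp add: mat2_eq_iff)
    then show ?thesis unfolding matop_apply_one[symmetric] .
  qed
  show "mass m \<bullet>\<^sub>o (matop (mat_fw m t) \<bullet>\<^sub>o x)
      = kap m t *\<^sub>R (kinetic \<bullet>\<^sub>o (matop (mat_fw m t) \<bullet>\<^sub>o x)) + (\<i> * t) *\<^sub>C (matop (mat_fw m t) \<bullet>\<^sub>o x)"
    unfolding kinetic_def mass_def mat_fw_def scaleR_scaleC matop_calc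
    by (rule matop_cong) (use nz kap_square[of m t] in \<open>simp add: mat2_eq_iff divide_simps; simp add: algebra_simps\<close>)
  show "mass m \<bullet>\<^sub>o (matop (mat_bw m t) \<bullet>\<^sub>o x) + kap m t *\<^sub>R (kinetic \<bullet>\<^sub>o (matop (mat_bw m t) \<bullet>\<^sub>o x))
      = (\<i> * t) *\<^sub>C (matop (mat_bw m t) \<bullet>\<^sub>o x)"
    unfolding kinetic_def mass_def mat_bw_def scaleR_scaleC matop_calc
    by (rule matop_cong) (use nz kap_square[of m t] in \<open>simp add: mat2_eq_iff divide_simps; simp add: algebra_simps\<close>)
qed

lemma free_dirac_resolvent:
  assumes "m > 0"
  shows "(free_resolvent m t \<bullet>\<^sub>o f, f + (\<i> * t) *\<^sub>C (free_resolvent m t \<bullet>\<^sub>o f)) \<in> free_dirac m"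
proof -
  note \<kappa> = kap_pos[OF assms, of t]
  note id = green_identities[OF assms, of t]
  let ?F = "forward (kap m t) \<bullet>\<^sub>o f" and ?B = "backward (kap m t) \<bullet>\<^sub>o f"
    and ?P = "matop (mat_fw m t)" and ?M = "matop (mat_bw m t)"
  have "weak_derivative (?P \<bullet>\<^sub>o ?F + ?M \<bullet>\<^sub>o ?B)
      (?P \<bullet>\<^sub>o (f - kap m t *\<^sub>R ?F) + ?M \<bullet>\<^sub>o (kap m t *\<^sub>R ?B - f))"
    by (intro weak_derivative_add weak_derivative_matop weak_derivative_forward weak_derivative_backward \<kappa>)
  moreover have "f + (\<i> * t) *\<^sub>C (?P \<bullet>\<^sub>o ?F + ?M \<bullet>\<^sub>o ?B)
    = kinetic \<bullet>\<^sub>o (?P \<bullet>\<^sub>o (f - kap m t *\<^sub>R ?F) + ?M \<bullet>\<^sub>o (kap m t *\<^sub>R ?B - f)) + mass m \<bullet>\<^sub>o (?P \<bullet>\<^sub>o ?F + ?M \<bullet>\<^sub>o ?B)"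
    using id(1)[of f] id(2)[of ?F] id(3)[of ?B]
    unfolding cop_add cop_diff cop_scaleR scaleC_add_right
    by (simp add: algebra_simps)
  ultimately show ?thesis
    unfolding free_dirac_iff by (auto simp: free_resolvent_def)
qed

text \<open>With \<open>N\<^sup>2 = \<kappa>\<^sup>2\<close>, the homogeneous equation \<open>u' = N u\<close> decouples into \<open>w' = \<plusminus>\<kappa> w\<close> for
  \<open>w = \<kappa> u \<plusminus> N u\<close>.\<close>

lemma free_dirac_homogeneous:
  fixes t :: real
  assumes m: "m > 0" and u: "(u, (\<i> * t) *\<^sub>C u) \<in> free_dirac m"
  shows "u = 0"
proof -
  obtain u' where u': "weak_derivative u u'" and eq: "(\<i> * t) *\<^sub>C u = kinetic \<bullet>\<^sub>o u' + mass m \<bullet>\<^sub>o u"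
    using u unfolding free_dirac_iff by blast
  \<comment> \<open>As \<open>kinetic\<close> squares to -1, solving for the derivative gives u' =
    kinetic (mass - it) u, and N is this matrix.\<close>
  define N where "N = matop (mat2 0 (- of_real t + \<i> * of_real m) (- of_real t - \<i> * of_real m) 0)"
  have kk: "kinetic \<bullet>\<^sub>o (kinetic \<bullet>\<^sub>o x) = - x" for x
  proof -
    have "kinetic \<bullet>\<^sub>o (kinetic \<bullet>\<^sub>o x) = matop (mat2 (-1) 0 0 (-1)) \<bullet>\<^sub>o x"
      unfolding kinetic_def matop_calc by (rule matop_cong) (simp add: mat2_eq_iff)
    also have "\<dots> = (-1) *\<^sub>C (matop (mat2 1 0 0 1) \<bullet>\<^sub>o x)"
      unfolding matop_calc by (rule matop_cong) (simp add: mat2_eq_iff)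
    finally show ?thesis unfolding matop_apply_one[symmetric] by (simp add: scaleC_one)
  qed
  have N: "N \<bullet>\<^sub>o x = kinetic \<bullet>\<^sub>o (mass m \<bullet>\<^sub>o x) + (- (\<i> * t)) *\<^sub>C (kinetic \<bullet>\<^sub>o x)" for x
    unfolding kinetic_def mass_def N_def matop_calc by (rule matop_cong) (simp add: mat2_eq_iff algebra_simps)
  have "kinetic \<bullet>\<^sub>o ((\<i> * t) *\<^sub>C u) = - u' + kinetic \<bullet>\<^sub>o (mass m \<bullet>\<^sub>o u)"
    unfolding eq cop_add kk ..
  then have u'_eq: "u' = N \<bullet>\<^sub>o u" unfolding N cop_scaleC by (simp add: algebra_simps)
  have NN: "N \<bullet>\<^sub>o (N \<bullet>\<^sub>o x) = (kap m t)\<^sup>2 *\<^sub>R x" for x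
  proof -
    have "N \<bullet>\<^sub>o (N \<bullet>\<^sub>o x) = (of_real (kap m t) * of_real (kap m t)) *\<^sub>C (matop (mat2 1 0 0 1) \<bullet>\<^sub>o x)"
      unfolding N_def matop_calc kap_square by (rule matop_cong) (simp add: mat2_eq_iff algebra_simps)
    then show ?thesis unfolding matop_apply_one[symmetric] by (simp add: scaleR_scaleC power2_eq_square)
  qed
  have zero: "s *\<^sub>R u + N \<bullet>\<^sub>o u = 0" if s: "s\<^sup>2 = (kap m t)\<^sup>2" for s
  proof -
    define M where "M = mat2 (of_real s) (- of_real t + \<i> * of_real m) (- of_real t - \<i> * of_real m) (of_real s)"
    have M: "matop M \<bullet>\<^sub>o x = s *\<^sub>R x + N \<bullet>\<^sub>o x" for x
    proof -
      have "matop M \<bullet>\<^sub>o x = of_real s *\<^sub>C (matop (mat2 1 0 0 1) \<bullet>\<^sub>o x) + N \<bullet>\<^sub>o x"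
        unfolding M_def N_def matop_calc by (rule matop_cong) (simp add: mat2_eq_iff)
      then show ?thesis unfolding matop_apply_one[symmetric] by (simp add: scaleR_scaleC)
    qed
    have "weak_derivative (matop M \<bullet>\<^sub>o u) (matop M \<bullet>\<^sub>o (N \<bullet>\<^sub>o u))"
      using weak_derivative_matop[OF u'] unfolding u'_eq .
    moreover have "matop M \<bullet>\<^sub>o (N \<bullet>\<^sub>o u) = s *\<^sub>R (matop M \<bullet>\<^sub>o u)"
      unfolding M NN s[symmetric] by (simp add: scaleR_add_right power2_eq_square add.commute)
    ultimately have "weak_derivative (matop M \<bullet>\<^sub>o u) (s *\<^sub>R (matop M \<bullet>\<^sub>o u))" by simp
    then have "matop M \<bullet>\<^sub>o u = 0"
      using s kap_pos[OF m, of t] by (intro weak_exponential_zero) auto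
    then show ?thesis unfolding M .
  qed
  \<comment> \<open>Both roots s = \<plusminus> \<kappa> are admissible, and subtracting the two
    relations isolates 2 \<kappa> u.\<close>
  have "kap m t *\<^sub>R u + N \<bullet>\<^sub>o u = 0" "(- kap m t) *\<^sub>R u + N \<bullet>\<^sub>o u = 0"
    by (rule zero; simp)+
  then have "(2 * kap m t) *\<^sub>R u = 0" by (simp add: scaleR_2[symmetric] scaleR_left_distrib algebra_simps add_eq_0_iff)
  then show "u = 0" using kap_pos[OF m, of t] by simp
qed

lemma free_dirac_diff:
  assumes "(u, g) \<in> free_dirac m" "(v, h) \<in> free_dirac m"
  shows "(u - v, g - h) \<in> free_dirac m"
proof -
  obtain u' v' where d: "weak_derivative u u'" "g = kinetic \<bullet>\<^sub>o u' + mass m \<bullet>\<^sub>o u"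
      "weak_derivative v v'" "h = kinetic \<bullet>\<^sub>o v' + mass m \<bullet>\<^sub>o v"
    using assms unfolding free_dirac_iff by blast
  have minus: "matop ((-1) *\<^sub>C mat 1) \<bullet>\<^sub>o x = - x" for x
    unfolding matop_scaleC[symmetric] matop_one by (simp add: scaleC_one)
  have "weak_derivative (u + - v) (u' + - v')"
    using weak_derivative_add[OF d(1) weak_derivative_matop[OF d(3), of "(-1) *\<^sub>C mat 1"]] unfolding minus .
  moreover have "g - h = kinetic \<bullet>\<^sub>o (u' + - v') + mass m \<bullet>\<^sub>o (u + - v)"
    unfolding d(2,4) by (simp add: cop_diff)
  ultimately show ?thesis unfolding free_dirac_iff by (metis diff_conv_add_uminus)
qed

text \<open>A given solution and the one from the Green matrix differ by a homogeneous solution.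
  With \<open>free_dirac_resolvent\<close> this makes H_0 the graph of the inverse of
  \<open>free_resolvent m 0\<close>.\<close>

lemma free_dirac_unique:
  fixes t :: real
  assumes m: "m > 0" and u: "(u, g) \<in> free_dirac m"
  shows "u = free_resolvent m t \<bullet>\<^sub>o (g - (\<i> * t) *\<^sub>C u)"
proof -
  define v where "v = free_resolvent m t \<bullet>\<^sub>o (g - (\<i> * t) *\<^sub>C u)"
  have v: "(v, (g - (\<i> * t) *\<^sub>C u) + (\<i> * t) *\<^sub>C v) \<in> free_dirac m"
    unfolding v_def by (rule free_dirac_resolvent[OF m])
  have "g - ((g - (\<i> * t) *\<^sub>C u) + (\<i> * t) *\<^sub>C v) = (\<i> * t) *\<^sub>C (u - v)"
    by (simp add: scaleC_diff_right)
  with free_dirac_diff[OF u v] have "(u - v, (\<i> * t) *\<^sub>C (u - v)) \<in> free_dirac m" by simp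
  then have "u - v = 0" by (rule free_dirac_homogeneous[OF m])
  then show ?thesis by (simp add: v_def)
qed

lemma free_resolvent_zero: "m > 0 \<Longrightarrow> (free_resolvent m 0 \<bullet>\<^sub>o f, f) \<in> free_dirac m"
  using free_dirac_resolvent[of m 0 f] by simp

lemma free_dirac_unique_zero: "m > 0 \<Longrightarrow> (u, g) \<in> free_dirac m \<Longrightarrow> u = free_resolvent m 0 \<bullet>\<^sub>o g"
  using free_dirac_unique[of m u g 0] by simp

lemma free_resolvent_vec_inj:
  assumes "m > 0" "free_resolvent m 0 \<bullet>\<^sub>o f = 0"
  shows "f = 0"
proof -
  have "(0, f) \<in> free_dirac m" using free_resolvent_zero[OF assms(1), of f] assms(2) by simp
  then obtain f' where f': "weak_derivative 0 f'" "f = kinetic \<bullet>\<^sub>o f' + mass m \<bullet>\<^sub>o 0"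
    unfolding free_dirac_iff by blast
  then show ?thesis using weak_derivative_zero[OF f'(1)] by (simp add: cop_zero)
qed

lemma selfadjoint_axis_free:
  assumes m: "m > 0"
  shows "selfadjoint_axis (free_resolvent m 0) (free_resolvent m) (4 / min 1 m)"
proof
  fix t :: real and Y f h
  show "free_resolvent m t = free_resolvent m 0 + (\<i> * t) *\<^sub>C (free_resolvent m 0 * free_resolvent m t)"
  proof (rule cop_eqI)
    fix x
    show "free_resolvent m t \<bullet>\<^sub>o x = (free_resolvent m 0 + (\<i> * t) *\<^sub>C (free_resolvent m 0 * free_resolvent m t)) \<bullet>\<^sub>o x"
      using free_dirac_unique_zero[OF m free_dirac_resolvent[OF m, of t x]] by (simp add: cop_add cop_scaleC)
  qed
  show "free_resolvent m t = free_resolvent m 0 + (\<i> * t) *\<^sub>C (free_resolvent m t * free_resolvent m 0)"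
  proof (rule cop_eqI)
    fix x
    show "free_resolvent m t \<bullet>\<^sub>o x = (free_resolvent m 0 + (\<i> * t) *\<^sub>C (free_resolvent m t * free_resolvent m 0)) \<bullet>\<^sub>o x"
      using free_dirac_unique[OF m free_resolvent_zero[OF m, of x], of t] by (simp add: cop_diff cop_scaleC algebra_simps)
  qed
  show "Y = 0" if "free_resolvent m 0 * Y = 0"
  proof (rule cop_eqI)
    fix x
    have "free_resolvent m 0 \<bullet>\<^sub>o (Y \<bullet>\<^sub>o x) = 0" unfolding cop_apply_mult(1)[symmetric] that by simp
    then show "Y \<bullet>\<^sub>o x = 0 \<bullet>\<^sub>o x" using free_resolvent_vec_inj[OF m] by simp
  qed
  show "norm (free_resolvent m t) \<le> 4 / min 1 m / sqrt (1 + t\<^sup>2)" by (rule norm_free_resolvent[OF m])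
  show "inner (free_resolvent m t \<bullet>\<^sub>o f) h = inner f (free_resolvent m (- t) \<bullet>\<^sub>o h)"
    by (rule free_resolvent_adjoint[OF m])
  show "f = 0" if "free_resolvent m 0 \<bullet>\<^sub>o f = 0" using free_resolvent_vec_inj[OF m that] .
qed

lemma sigma3_square: "matop \<sigma>\<^sub>3 * matop \<sigma>\<^sub>3 = 1"
  unfolding matop_mult mat2_sigma mat2_mult matop_one[symmetric] mat2_one by simp

text \<open>The kinetic part anticommutes with \<open>\<sigma>\<^sub>3\<close> and the mass part
  commutes with it, which leaves 2 m; the relation is applied to vectors A x and then multiplied by
  A.\<close>

lemma free_resolvent_anticommutator:
  assumes m: "m > 0"
  shows "free_resolvent m 0 * matop \<sigma>\<^sub>3 + matop \<sigma>\<^sub>3 * free_resolvent m 0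
    = (2 * m) *\<^sub>R (free_resolvent m 0 * free_resolvent m 0)"
proof (rule cop_eqI)
  fix x
  let ?A = "free_resolvent m 0" and ?J = "matop \<sigma>\<^sub>3"
  obtain u' where u': "weak_derivative (?A \<bullet>\<^sub>o x) u'" and eq: "x = kinetic \<bullet>\<^sub>o u' + mass m \<bullet>\<^sub>o (?A \<bullet>\<^sub>o x)"
    using free_resolvent_zero[OF m, of x] unfolding free_dirac_iff by blast
  have anti: "kinetic \<bullet>\<^sub>o (?J \<bullet>\<^sub>o y) = (-1) *\<^sub>C (?J \<bullet>\<^sub>o (kinetic \<bullet>\<^sub>o y))"
    "mass m \<bullet>\<^sub>o (?J \<bullet>\<^sub>o y) = (2 * of_real m) *\<^sub>C (matop (mat2 1 0 0 1) \<bullet>\<^sub>o y) + (-1) *\<^sub>C (?J \<bullet>\<^sub>o (mass m \<bullet>\<^sub>o y))" for y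
    unfolding kinetic_def mass_def mat2_sigma matop_calc by (rule matop_cong, simp add: mat2_eq_iff)+
  have "?J \<bullet>\<^sub>o x = ?J \<bullet>\<^sub>o (kinetic \<bullet>\<^sub>o u') + ?J \<bullet>\<^sub>o (mass m \<bullet>\<^sub>o (?A \<bullet>\<^sub>o x))"
    using arg_cong[OF eq, of "\<lambda>y. ?J \<bullet>\<^sub>o y"] unfolding cop_add .
  then have "kinetic \<bullet>\<^sub>o (?J \<bullet>\<^sub>o u') + mass m \<bullet>\<^sub>o (?J \<bullet>\<^sub>o (?A \<bullet>\<^sub>o x)) = (2 * m) *\<^sub>R (?A \<bullet>\<^sub>o x) - ?J \<bullet>\<^sub>o x"
    unfolding anti matop_apply_one[symmetric] by (simp add: scaleR_scaleC scaleC_one)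
  then have "(?J \<bullet>\<^sub>o (?A \<bullet>\<^sub>o x), (2 * m) *\<^sub>R (?A \<bullet>\<^sub>o x) - ?J \<bullet>\<^sub>o x) \<in> free_dirac m"
    unfolding free_dirac_iff using weak_derivative_matop[OF u', of \<sigma>\<^sub>3] by metis
  from free_dirac_unique_zero[OF m this]
  have "?J \<bullet>\<^sub>o (?A \<bullet>\<^sub>o x) = (2 * m) *\<^sub>R (?A \<bullet>\<^sub>o (?A \<bullet>\<^sub>o x)) - ?A \<bullet>\<^sub>o (?J \<bullet>\<^sub>o x)"
    unfolding cop_diff cop_scaleR .
  then show "(?A * ?J + ?J * ?A) \<bullet>\<^sub>o x = ((2 * m) *\<^sub>R (?A * ?A)) \<bullet>\<^sub>o x" by simp
qed

section \<open>Potentials in \<open>L\<^sup>p\<close>\<close>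

lemma norm_matrix_vector_le_entries: "norm (M *v v) \<le> (\<Sum>i\<in>UNIV. \<Sum>j\<in>UNIV. cmod (M $ i $ j)) * norm v"
  for M :: "complex ^ 2 ^ 2" and v :: "complex ^ 2"
proof -
  have "norm (M *v v) \<le> (\<Sum>i\<in>UNIV. norm ((M *v v) $ i))"
    unfolding norm_vec_def[of "M *v v"] by (rule L2_set_le_sum) simp
  also have "\<dots> \<le> (\<Sum>i\<in>UNIV. (\<Sum>j\<in>UNIV. cmod (M $ i $ j)) * norm v)"
  proof (rule sum_mono)
    fix i
    have "norm ((M *v v) $ i) \<le> (\<Sum>j\<in>UNIV. norm (M $ i $ j * v $ j))"
      unfolding matrix_vector_mult_def by (simp add: sum_norm_le)
    also have "\<dots> \<le> (\<Sum>j\<in>UNIV. cmod (M $ i $ j) * norm v)"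
      unfolding norm_mult by (intro sum_mono mult_left_mono Finite_Cartesian_Product.norm_nth_le norm_ge_zero)
    finally show "norm ((M *v v) $ i) \<le> (\<Sum>j\<in>UNIV. cmod (M $ i $ j)) * norm v" by (simp add: sum_distrib_right)
  qed
  finally show ?thesis by (simp add: sum_distrib_right)
qed

lemma onorm_matrix_le_entries: "onorm ((*v) M) \<le> (\<Sum>i\<in>UNIV. \<Sum>j\<in>UNIV. cmod (M $ i $ j))"
  for M :: "complex ^ 2 ^ 2"
  by (rule onorm_bound[OF _ norm_matrix_vector_le_entries]) (intro sum_nonneg norm_ge_zero)

text \<open>Serves the measurability of the pointwise norm of V; the constant 4 counts matrix
  entries.\<close>

lemma onorm_matrix_lipschitz: "\<bar>onorm ((*v) M) - onorm ((*v) N)\<bar> \<le> 4 * norm (M - N)"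
  for M N :: "complex ^ 2 ^ 2"
proof -
  have bound: "onorm ((*v) M) \<le> 4 * norm M" for M :: "complex ^ 2 ^ 2"
  proof (rule order_trans[OF onorm_matrix_le_entries])
    have "(\<Sum>i\<in>UNIV. \<Sum>j\<in>UNIV. cmod (M $ i $ j)) \<le> (\<Sum>i\<in>(UNIV :: 2 set). \<Sum>j\<in>(UNIV :: 2 set). norm M)"
      by (intro sum_mono order_trans[OF Finite_Cartesian_Product.norm_nth_le Finite_Cartesian_Product.norm_nth_le])
    then show "(\<Sum>i\<in>UNIV. \<Sum>j\<in>UNIV. cmod (M $ i $ j)) \<le> 4 * norm M" by simp
  qed
  have half: "onorm ((*v) M) - onorm ((*v) N) \<le> 4 * norm (M - N)" for M N :: "complex ^ 2 ^ 2"
  proof -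
    have "(\<lambda>v. M *v v) = (\<lambda>v. N *v v + (M - N) *v v)"
      by (simp add: matrix_vector_mult_add_rdistrib[symmetric])
    then have "onorm ((*v) M) \<le> onorm ((*v) N) + onorm ((*v) (M - N))"
      using onorm_triangle[OF matrix_vector_mul_bounded_linear[of N] matrix_vector_mul_bounded_linear[of "M - N"]] by simp
    then show ?thesis using bound[of "M - N"] by linarith
  qed
  show ?thesis using half[of M N] half[of N M] by (simp add: norm_minus_commute abs_le_iff)
qed

lemma measurable_onorm_matrix:
  assumes "\<And>i j. (\<lambda>x. V x $ i $ j) \<in> borel_measurable M"
  shows "(\<lambda>x. onorm ((*v) (V x :: complex ^ 2 ^ 2))) \<in> borel_measurable M"
    and "V \<in> borel_measurable M"
proof -
  have "continuous_on UNIV (\<lambda>M :: complex ^ 2 ^ 2. onorm ((*v) M))"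
  proof (rule lipschitz_on_continuous_on)
    show "4-lipschitz_on UNIV (\<lambda>M :: complex ^ 2 ^ 2. onorm ((*v) M))"
      by (rule lipschitz_onI) (simp_all add: dist_real_def dist_norm onorm_matrix_lipschitz)
  qed
  note cont = this
  have scale: "(\<lambda>x. f x *\<^sub>C N) \<in> borel_measurable M" if "f \<in> borel_measurable M" for f and N :: "complex ^ 2 ^ 2"
    by (rule borel_measurable_continuous_on[OF _ that])
      (rule bounded_linear.continuous_on[OF bounded_bilinear.bounded_linear_left[OF bounded_bilinear_scaleC] continuous_on_id])
  have V: "V = (\<lambda>x. V x $ 1 $ 1 *\<^sub>C mat2 1 0 0 0 + V x $ 1 $ 2 *\<^sub>C mat2 0 1 0 0
      + V x $ 2 $ 1 *\<^sub>C mat2 0 0 1 0 + V x $ 2 $ 2 *\<^sub>C mat2 0 0 0 1)"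
    by (simp add: fun_eq_iff vec_eq_iff forall_2 mat2_scaleC)
  show V_meas: "V \<in> borel_measurable M"
    by (subst V) (intro borel_measurable_add scale assms)
  show "(\<lambda>x. onorm ((*v) (V x))) \<in> borel_measurable M"
    by (rule borel_measurable_continuous_on[OF cont V_meas])
qed

lemma powr_sum_four_le:
  fixes a b c d p :: real
  assumes "0 \<le> a" "0 \<le> b" "0 \<le> c" "0 \<le> d" "0 \<le> p"
  shows "(a + b + c + d) powr p \<le> 4 powr p * (a powr p + b powr p + c powr p + d powr p)"
proof -
  define M where "M = Max {a, b, c, d}"
  have le: "a \<le> M" "b \<le> M" "c \<le> M" "d \<le> M" by (simp_all add: M_def)
  have "M \<in> {a, b, c, d}" unfolding M_def by (rule Max_in) auto
  then have Mp: "M powr p \<le> a powr p + b powr p + c powr p + d powr p" by auto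
  have "(a + b + c + d) powr p \<le> (4 * M) powr p" using le assms by (intro powr_mono2) auto
  also have "\<dots> = 4 powr p * M powr p" using le assms by (simp add: powr_mult)
  also have "\<dots> \<le> 4 powr p * (a powr p + b powr p + c powr p + d powr p)" by (intro mult_left_mono Mp) simp
  finally show ?thesis .
qed

text \<open>The two kernels have disjoint supports, so their sum obeys the same exponential bound.
  Separate estimates would lose a factor 2 and with it the constant of the theorem.\<close>

lemma sum_half_line_convolutions_le:
  fixes f :: "real \<Rightarrow> complex ^ 2"
  assumes \<kappa>: "\<kappa> > 0" and f: "sq_integrable f"
  shows "ennreal (norm (conv (half_exp \<kappa>) f x) + norm (conv (\<lambda>x. half_exp \<kappa> (- x)) f x)) \<le> exp_conv \<kappa> f x"
proof -
  let ?w1 = "half_exp \<kappa>" and ?w2 = "\<lambda>x. half_exp \<kappa> (- x)"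
  let ?w = "\<lambda>x. ?w1 x + ?w2 x" and ?n = "\<lambda>y. norm (f y)"
  note w = exp_bounded_half_exp[OF \<kappa>]
  have n: "sq_integrable ?n" using f unfolding sq_integrable_def by (auto intro: borel_measurable_norm)
  have w12: "exp_bounded \<kappa> ?w"
    unfolding exp_bounded_def
  proof (intro conjI allI \<kappa>)
    show "?w \<in> borel_measurable borel" using w by (intro borel_measurable_add) (auto simp: exp_bounded_def)
    show "\<bar>?w x\<bar> \<le> exp (- \<kappa> * \<bar>x\<bar>)" for x by (auto simp: half_exp_def)
  qed
  have half: "norm (conv v f x) \<le> conv v ?n x" if "exp_bounded \<kappa> v" "\<And>x. 0 \<le> v x" for v
  proof -
    have "norm (conv v f x) \<le> (LINT y|lebesgue. norm (v (x - y) *\<^sub>R f y))"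
      unfolding conv_def by (rule integral_norm_bound)
    then show ?thesis using that(2) by (simp add: conv_def)
  qed
  have nn: "0 \<le> half_exp \<kappa> y" for y by (simp add: half_exp_def)
  have "norm (conv ?w1 f x) + norm (conv ?w2 f x) \<le> conv ?w1 ?n x + conv ?w2 ?n x"
    by (intro add_mono half w nn)
  also have "\<dots> = conv ?w ?n x"
    using Bochner_Integration.integral_add[OF integrable_conv[OF w(1) n, of x] integrable_conv[OF w(2) n, of x]]
    by (simp add: conv_def distrib_right)
  also have "\<dots> \<le> norm (conv ?w ?n x)" by simp
  finally have "ennreal (norm (conv ?w1 f x) + norm (conv ?w2 f x)) \<le> ennreal (norm (conv ?w ?n x))"
    by (rule ennreal_leI)
  also have "\<dots> \<le> exp_conv \<kappa> ?n x" by (rule norm_conv_le[OF w12 n])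
  finally show ?thesis by (simp add: exp_conv_def)
qed

lemma norm_free_resolvent_pointwise:
  assumes m: "m > 0"
  shows "AE x in lebesgue. ennreal (norm (rep_l2 (free_resolvent m t \<bullet>\<^sub>o f) x)) \<le> exp_conv (kap m t) (rep_l2 f) x"
proof -
  note \<kappa> = kap_pos[OF m, of t]
  let ?F = "forward (kap m t) \<bullet>\<^sub>o f" and ?B = "backward (kap m t) \<bullet>\<^sub>o f"
  have "AE x in lebesgue. rep_l2 (free_resolvent m t \<bullet>\<^sub>o f) x = rep_l2 (matop (mat_fw m t) \<bullet>\<^sub>o ?F) x + rep_l2 (matop (mat_bw m t) \<bullet>\<^sub>o ?B) x"
    using rep_l2_add[of "matop (mat_fw m t) \<bullet>\<^sub>o ?F" "matop (mat_bw m t) \<bullet>\<^sub>o ?B"] by (simp add: free_resolvent_def)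
  then show ?thesis
    using rep_matop[of "mat_fw m t" ?F] rep_matop[of "mat_bw m t" ?B] rep_forward[OF \<kappa>, of f] rep_backward[OF \<kappa>, of f]
  proof eventually_elim
    case (elim x)
    have "norm (rep_l2 (free_resolvent m t \<bullet>\<^sub>o f) x) \<le> norm (rep_l2 ?F x) + norm (rep_l2 ?B x)"
      unfolding elim(1-3) by (intro norm_triangle_le add_mono norm_mat_fw_bw m)
    then have "ennreal (norm (rep_l2 (free_resolvent m t \<bullet>\<^sub>o f) x)) \<le> ennreal (norm (rep_l2 ?F x) + norm (rep_l2 ?B x))"
      by (rule ennreal_leI)
    also have "\<dots> \<le> exp_conv (kap m t) (rep_l2 f) x"
      unfolding elim(4,5) by (rule sum_half_line_convolutions_le[OF \<kappa> sq_integrable_rep_l2])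
    finally show ?case .
  qed
qed

text \<open>A number \<open>N\<close> strictly between the norm of V and the threshold is positive
  even for V = 0, so that it can be divided by.\<close>

locale Lp_potential =
  fixes m p N :: real and V :: "real \<Rightarrow> complex ^ 2 ^ 2"
  assumes m: "m > 0" and p: "p \<ge> 2"
    and Lp: "\<And>i j. Lp_function p (\<lambda>x. V x $ i $ j)"
    and N: "Lp_matrix_norm p V < N" and N_less: "N < (m * p / (2 * (p - 1))) powr ((p - 1) / p)"
begin

definition v :: "real \<Rightarrow> real" where "v x = onorm ((*v) (V x))"

text \<open>The conjugate exponent of p. For p > 2 it satisfies (2 - r) p / (p - 2) = r, so that
  Hoelder's inequality with exponent p / 2 reproduces the exponential of the other Cauchy-Schwarz
  factor.\<close>

abbreviation r :: real where "r \<equiv> p / (p - 1)"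

text \<open>The integral of exp (- r \<kappa> |x|); its power (p - 1) / p = 1 / r is the L^r norm of
  exp (- \<kappa> |x|).\<close>

definition I :: "real \<Rightarrow> real" where "I \<kappa> = 2 / (r * \<kappa>)"

lemma measurable_V: "V \<in> borel_measurable lebesgue" and measurable_v [measurable]: "v \<in> borel_measurable lebesgue"
  using measurable_onorm_matrix[of V lebesgue] Lp unfolding v_def[abs_def] Lp_function_def by blast+

lemma v_nonneg: "0 \<le> v x"
  unfolding v_def by (rule onorm_pos_le[OF matrix_vector_mul_bounded_linear])

lemma N_pos: "0 < N"
  using N by (rule le_less_trans[rotated]) (simp add: Lp_matrix_norm_def)

lemma r_pos: "0 < r"
  using p by simp

lemma I_pos: "0 < \<kappa> \<Longrightarrow> 0 < I \<kappa>"
  using p by (simp add: I_def)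

lemma integrable_v_powr: "integrable lebesgue (\<lambda>x. v x powr p)"
proof (rule Bochner_Integration.integrable_bound)
  let ?g = "\<lambda>x. 4 powr p * (norm (V x $ 1 $ 1) powr p + norm (V x $ 1 $ 2) powr p + norm (V x $ 2 $ 1) powr p + norm (V x $ 2 $ 2) powr p)"
  show "integrable lebesgue ?g"
    using Lp unfolding Lp_function_def by (intro integrable_mult_right Bochner_Integration.integrable_add) blast+
  show "AE x in lebesgue. norm (v x powr p) \<le> norm (?g x)"
  proof (rule AE_I2)
    fix x
    have "v x \<le> norm (V x $ 1 $ 1) + norm (V x $ 1 $ 2) + norm (V x $ 2 $ 1) + norm (V x $ 2 $ 2)"
      using onorm_matrix_le_entries[of "V x"] by (simp add: v_def sum_2)
    then have "v x powr p \<le> (norm (V x $ 1 $ 1) + norm (V x $ 1 $ 2) + norm (V x $ 2 $ 1) + norm (V x $ 2 $ 2)) powr p"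
      using p v_nonneg by (intro powr_mono2) auto
    also have "\<dots> \<le> ?g x" using p by (intro powr_sum_four_le) auto
    finally show "norm (v x powr p) \<le> norm (?g x)" by simp
  qed
qed measurable

lemma integral_v_powr: "(LINT x|lebesgue. v x powr p) \<le> N powr p"
proof -
  have nn: "0 \<le> (LINT x|lebesgue. v x powr p)" by simp
  have "(LINT x|lebesgue. v x powr p) = ((LINT x|lebesgue. v x powr p) powr (1 / p)) powr p"
    using p nn by (simp add: powr_powr)
  also have "\<dots> \<le> N powr p"
    using N p by (intro powr_mono2) (auto simp: Lp_matrix_norm_def v_def)
  finally show ?thesis .
qed

text \<open>Young's inequality with exponents \<open>p/2\<close> and \<open>p/(p-2)\<close>, scaled so that both terms have
  integral one; it holds also for \<open>p = 2\<close>.\<close>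

lemma weighted_young:
  assumes \<kappa>: "0 < \<kappa>"
  shows "(v x)\<^sup>2 * exp (- ((2 - r) * \<kappa>) * s)
    \<le> N\<^sup>2 * I \<kappa> powr (1 - 2 / p) * (2 / p * (v x powr p / N powr p) + (1 - 2 / p) * (exp (- (r * \<kappa>) * s) / I \<kappa>))"
proof (cases "v x = 0")
  case True
  have "0 \<le> N\<^sup>2 * I \<kappa> powr (1 - 2 / p) * (2 / p * (v x powr p / N powr p) + (1 - 2 / p) * (exp (- (r * \<kappa>) * s) / I \<kappa>))"
    using p I_pos[OF \<kappa>] N_pos by (intro mult_nonneg_nonneg add_nonneg_nonneg divide_nonneg_pos) auto
  then show ?thesis using True by simp
next
  case False
  then have v: "0 < v x" using v_nonneg[of x] by linarith
  define a where "a = v x powr p / N powr p"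
  define b where "b = exp (- (r * \<kappa>) * s) / I \<kappa>"
  have pos: "0 < a" "0 < b" using v N_pos I_pos[OF \<kappa>] by (auto simp: a_def b_def)
  have "a powr (2 / p) * b powr (1 - 2 / p) \<le> 2 / p * a + (1 - 2 / p) * b"
    using p pos by (intro Youngs_inequality_0) auto
  then have "N\<^sup>2 * I \<kappa> powr (1 - 2 / p) * (a powr (2 / p) * b powr (1 - 2 / p))
      \<le> N\<^sup>2 * I \<kappa> powr (1 - 2 / p) * (2 / p * a + (1 - 2 / p) * b)"
    by (intro mult_left_mono) auto
  moreover have "a powr (2 / p) = (v x)\<^sup>2 / N\<^sup>2"
    using v N_pos p by (simp add: a_def powr_divide powr_powr)
  moreover have "b powr (1 - 2 / p) = exp (- ((2 - r) * \<kappa>) * s) / I \<kappa> powr (1 - 2 / p)"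
  proof -
    have e: "- (r * \<kappa>) * s * (1 - 2 / p) = - ((2 - r) * \<kappa>) * s" using p by (simp add: field_simps)
    have "exp (- (r * \<kappa>) * s) powr (1 - 2 / p) = exp (- ((2 - r) * \<kappa>) * s)"
      unfolding exp_powr_real e ..
    then show ?thesis unfolding b_def using I_pos[OF \<kappa>] by (simp add: powr_divide)
  qed
  moreover have "N\<^sup>2 \<noteq> 0" "I \<kappa> powr (1 - 2 / p) \<noteq> 0" using N_pos I_pos[OF \<kappa>] by auto
  ultimately show ?thesis unfolding a_def[symmetric] b_def[symmetric] by simp
qed

text \<open>In the integrated Young inequality the two terms contribute at most 2 / p and 1 - 2 / p,
  which add up to 1.\<close>

lemma weighted_integral:
  assumes \<kappa>: "0 < \<kappa>"
  shows "(\<integral>\<^sup>+x. ennreal ((v x)\<^sup>2 * exp (- ((2 - r) * \<kappa>) * \<bar>x - y\<bar>)) \<partial>lebesgue) \<le> ennreal (N\<^sup>2 * I \<kappa> powr (1 - 2 / p))"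
proof -
  let ?M = "N\<^sup>2 * I \<kappa> powr (1 - 2 / p)"
  let ?h = "\<lambda>x. ?M * (2 / p / N powr p * v x powr p + (1 - 2 / p) / I \<kappa> * exp (- (r * \<kappa>) * \<bar>x - y\<bar>))"
  have rk: "0 < r * \<kappa>" by (rule mult_pos_pos[OF r_pos \<kappa>])
  have ie: "integrable lebesgue (\<lambda>x. exp (- (r * \<kappa>) * \<bar>x - y\<bar>))"
    using integrable_exp_abs[OF rk, of y] by (simp add: abs_minus_commute)
  have int: "integrable lebesgue ?h"
    by (intro integrable_mult_right Bochner_Integration.integrable_add integrable_v_powr ie)
  have nn: "0 \<le> (v x)\<^sup>2 * exp (- ((2 - r) * \<kappa>) * \<bar>x - y\<bar>)" for x by simp
  have le: "(v x)\<^sup>2 * exp (- ((2 - r) * \<kappa>) * \<bar>x - y\<bar>) \<le> ?h x" for x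
    using weighted_young[OF \<kappa>, of x "\<bar>x - y\<bar>"] by simp
  have "(\<integral>\<^sup>+x. ennreal ((v x)\<^sup>2 * exp (- ((2 - r) * \<kappa>) * \<bar>x - y\<bar>)) \<partial>lebesgue) \<le> (\<integral>\<^sup>+x. ennreal (?h x) \<partial>lebesgue)"
    by (intro nn_integral_mono ennreal_leI le)
  also have "\<dots> = ennreal (LINT x|lebesgue. ?h x)"
    by (rule nn_integral_eq_integral[OF int]) (intro AE_I2 order_trans[OF nn le])
  also have "(LINT x|lebesgue. ?h x) \<le> ?M"
  proof -
    have e: "(LINT x|lebesgue. exp (- (r * \<kappa>) * \<bar>x - y\<bar>)) = I \<kappa>"
    proof -
      have "ennreal (LINT x|lebesgue. exp (- (r * \<kappa>) * \<bar>x - y\<bar>)) = ennreal (2 / (r * \<kappa>))"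
        using nn_integral_eq_integral[OF ie] nn_integral_exp_abs(2)[OF rk, of y] by simp
      moreover have "0 \<le> (LINT x|lebesgue. exp (- (r * \<kappa>) * \<bar>x - y\<bar>))" by simp
      moreover have "0 \<le> 2 / (r * \<kappa>)" using rk by (intro divide_nonneg_pos) auto
      ultimately show ?thesis unfolding I_def by (metis ennreal_inj)
    qed
    have "(LINT x|lebesgue. ?h x) = ?M * (2 / p / N powr p * (LINT x|lebesgue. v x powr p)
        + (1 - 2 / p) / I \<kappa> * (LINT x|lebesgue. exp (- (r * \<kappa>) * \<bar>x - y\<bar>)))"
      unfolding integral_mult_right_zero
      by (subst Bochner_Integration.integral_add)
        (simp_all only: integral_mult_right_zero integrable_mult_right integrable_v_powr ie)
    also have "\<dots> \<le> ?M * (2 / p / N powr p * N powr p + (1 - 2 / p) / I \<kappa> * I \<kappa>)"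
      unfolding e using p N_pos I_pos[OF \<kappa>]
      by (intro mult_left_mono add_mono integral_v_powr) auto
    also have "\<dots> = ?M" using N_pos I_pos[OF \<kappa>] by simp
    finally show ?thesis .
  qed
  finally show ?thesis by (simp add: ennreal_leI)
qed

section \<open>Norm bounds for V times the free resolvent\<close>

definition bound :: "real \<Rightarrow> real" where "bound \<kappa> = N * I \<kappa> powr ((p - 1) / p)"

lemma bound_nonneg: "0 \<le> bound \<kappa>"
  using N_pos by (simp add: bound_def)

text \<open>Pointwise |V R(t) f| is at most v times \<open>exp_conv\<close>, and the weighted Schur
  estimate applies; \<open>bound\<close> is N times the L^r norm of the exponential.\<close>

lemma potential_resolvent:
  shows "sq_integrable (\<lambda>x. V x *v rep_l2 (free_resolvent m t \<bullet>\<^sub>o f) x)"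
    and "norm (abs_l2 (\<lambda>x. V x *v rep_l2 (free_resolvent m t \<bullet>\<^sub>o f) x)) \<le> bound (kap m t) * norm f"
proof -
  note \<kappa> = kap_pos[OF m, of t]
  let ?u = "rep_l2 (free_resolvent m t \<bullet>\<^sub>o f)"
  have "(\<lambda>(M, w). M *v w) \<in> borel_measurable (borel :: ((complex ^ 2 ^ 2) \<times> (complex ^ 2)) measure)"
    by (intro borel_measurable_continuous_onI) (auto simp: case_prod_unfold matrix_vector_mult_def intro!: continuous_intros)
  from measurable_compose[OF borel_measurable_Pair[OF measurable_V measurable_rep_l2] this]
  have meas: "(\<lambda>x. V x *v ?u x) \<in> borel_measurable lebesgue" by simp
  \<comment> \<open>The two factors of the Schur estimate combine because 2 (p - 1) / p = 1 + (1 - 2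
    / p).\<close>
  have sq: "(bound (kap m t))\<^sup>2 = I (kap m t) * (N\<^sup>2 * I (kap m t) powr (1 - 2 / p))"
  proof -
    have "(I (kap m t) powr ((p - 1) / p))\<^sup>2 = I (kap m t) powr ((p - 1) / p + (p - 1) / p)"
      unfolding power2_eq_square powr_add ..
    also have "(p - 1) / p + (p - 1) / p = 1 + (1 - 2 / p)" using p by (simp add: field_simps)
    finally show ?thesis unfolding powr_add using I_pos[OF \<kappa>] by (simp add: bound_def power_mult_distrib)
  qed
  have "(\<integral>\<^sup>+x. ennreal ((norm (V x *v ?u x))\<^sup>2) \<partial>lebesgue)
      \<le> (\<integral>\<^sup>+x. ennreal ((v x)\<^sup>2) * (exp_conv (kap m t) (rep_l2 f) x)\<^sup>2 \<partial>lebesgue)"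
  proof (rule nn_integral_mono_AE)
    show "AE x in lebesgue. ennreal ((norm (V x *v ?u x))\<^sup>2) \<le> ennreal ((v x)\<^sup>2) * (exp_conv (kap m t) (rep_l2 f) x)\<^sup>2"
      using norm_free_resolvent_pointwise[OF m, of t f]
    proof eventually_elim
      case (elim x)
      have "(norm (V x *v ?u x))\<^sup>2 \<le> (v x * norm (?u x))\<^sup>2"
        unfolding v_def by (intro power_mono norm_matrix_vector_mult norm_ge_zero)
      then have "ennreal ((norm (V x *v ?u x))\<^sup>2) \<le> ennreal ((v x)\<^sup>2) * (ennreal (norm (?u x)))\<^sup>2"
        by (simp add: power_mult_distrib ennreal_mult[symmetric] ennreal_power ennreal_leI)
      also have "\<dots> \<le> ennreal ((v x)\<^sup>2) * (exp_conv (kap m t) (rep_l2 f) x)\<^sup>2"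
        by (intro mult_left_mono power_mono elim) auto
      finally show ?case .
    qed
  qed
  also have "\<dots> \<le> ennreal (2 / (r * kap m t)) * ennreal (N\<^sup>2 * I (kap m t) powr (1 - 2 / p)) * (\<integral>\<^sup>+y. ennreal ((norm (rep_l2 f y))\<^sup>2) \<partial>lebesgue)"
    by (rule weighted_exp_conv_bound[OF measurable_rep_l2 measurable_v \<kappa> r_pos weighted_integral[OF \<kappa>]])
  also have "\<dots> = ennreal ((bound (kap m t) * norm f)\<^sup>2)"
    unfolding nn_integral_rep_l2 power_mult_distrib sq I_def[symmetric]
    using I_pos[OF \<kappa>] N_pos by (simp add: ennreal_mult)
  finally have le: "(\<integral>\<^sup>+x. ennreal ((norm (V x *v ?u x))\<^sup>2) \<partial>lebesgue) \<le> ennreal ((bound (kap m t) * norm f)\<^sup>2)" .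
  show "sq_integrable (\<lambda>x. V x *v ?u x)" "norm (abs_l2 (\<lambda>x. V x *v ?u x)) \<le> bound (kap m t) * norm f"
    by (rule sq_integrable_nn_bound[OF meas le mult_nonneg_nonneg[OF bound_nonneg norm_ge_zero]])+
qed

text \<open>V (H_0 - it)^(-1), bounded and everywhere defined although V is only a maximal
  multiplication operator.\<close>

definition VR :: "real \<Rightarrow> (complex ^ 2) l2 cop" where
  "VR t = cop_of (\<lambda>f. abs_l2 (\<lambda>x. V x *v rep_l2 (free_resolvent m t \<bullet>\<^sub>o f) x))"

lemma bounded_clinear_VR: "bounded_clinear (\<lambda>f. abs_l2 (\<lambda>x. V x *v rep_l2 (free_resolvent m t \<bullet>\<^sub>o f) x))"
proof (rule bounded_clinearI[OF _ _ potential_resolvent(2)])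
  fix f g and c :: complex
  let ?F = "\<lambda>f x. V x *v rep_l2 (free_resolvent m t \<bullet>\<^sub>o f) x"
  note AE = rep_abs_l2[OF potential_resolvent(1)[of t]]
  show "abs_l2 (?F (f + g)) = abs_l2 (?F f) + abs_l2 (?F g)"
  proof (rule l2_eqI)
    show "AE x in lebesgue. rep_l2 (abs_l2 (?F (f + g))) x = rep_l2 (abs_l2 (?F f) + abs_l2 (?F g)) x"
      using AE[of "f + g"] AE[of f] AE[of g] rep_l2_add[of "abs_l2 (?F f)" "abs_l2 (?F g)"]
        rep_l2_add[of "free_resolvent m t \<bullet>\<^sub>o f" "free_resolvent m t \<bullet>\<^sub>o g"]
      by eventually_elim (simp add: cop_add matrix_vector_right_distrib)
  qed
  show "abs_l2 (?F (c *\<^sub>C f)) = c *\<^sub>C abs_l2 (?F f)"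
  proof (rule l2_eqI)
    show "AE x in lebesgue. rep_l2 (abs_l2 (?F (c *\<^sub>C f))) x = rep_l2 (c *\<^sub>C abs_l2 (?F f)) x"
      using AE[of "c *\<^sub>C f"] AE[of f] rep_l2_scaleC[of c "abs_l2 (?F f)"]
        rep_l2_scaleC[of c "free_resolvent m t \<bullet>\<^sub>o f"]
      by eventually_elim (simp add: cop_scaleC matrix_vector_mult_scaleC)
  qed
qed

lemma VR_apply: "VR t \<bullet>\<^sub>o f = abs_l2 (\<lambda>x. V x *v rep_l2 (free_resolvent m t \<bullet>\<^sub>o f) x)"
  unfolding VR_def by (rule cop_of_apply[OF bounded_clinear_VR])

lemma rep_VR: "AE x in lebesgue. rep_l2 (VR t \<bullet>\<^sub>o f) x = V x *v rep_l2 (free_resolvent m t \<bullet>\<^sub>o f) x"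
  unfolding VR_apply by (rule rep_abs_l2[OF potential_resolvent(1)])

lemma norm_VR: "norm (VR t) \<le> bound (kap m t)"
  by (rule norm_cop_bound[OF bound_nonneg]) (simp add: VR_apply potential_resolvent(2))

sublocale free: selfadjoint_axis "free_resolvent m 0" "free_resolvent m" "4 / min 1 m"
  by (rule selfadjoint_axis_free[OF m])

text \<open>Identifies \<open>VR t\<close> with the combination for which
  \<open>axis_perturbation\<close> assumes its bounds.\<close>

lemma VR_resolvent: "VR 0 + (\<i> * t) *\<^sub>C (VR 0 * free_resolvent m t) = VR t"
proof (rule cop_eqI)
  fix f
  have "free_resolvent m 0 \<bullet>\<^sub>o (f + (\<i> * t) *\<^sub>C (free_resolvent m t \<bullet>\<^sub>o f)) = free_resolvent m t \<bullet>\<^sub>o f"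
    using free_dirac_unique_zero[OF m free_dirac_resolvent[OF m, of t f]] by (rule sym)
  then have "VR 0 \<bullet>\<^sub>o (f + (\<i> * t) *\<^sub>C (free_resolvent m t \<bullet>\<^sub>o f)) = VR t \<bullet>\<^sub>o f"
    unfolding VR_apply by (rule arg_cong)
  then show "(VR 0 + (\<i> * t) *\<^sub>C (VR 0 * free_resolvent m t)) \<bullet>\<^sub>o f = VR t \<bullet>\<^sub>o f"
    by (simp add: cop_add cop_scaleC)
qed

definition q :: real where "q = bound m"

text \<open>I(m) is the reciprocal of m p / (2 (p - 1)), so this is the hypothesis on V.\<close>

lemma q_less: "q < 1"
proof -
  have I: "I m = 1 / (m * p / (2 * (p - 1)))" by (simp add: I_def)
  have inv: "(1 / T) powr e = 1 / T powr e" if "T > 0" for T e :: real using that powr_divide[of 1 T e] by simp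
  have pos: "0 < m * p / (2 * (p - 1))" using m p by simp
  have "q = N / (m * p / (2 * (p - 1))) powr ((p - 1) / p)"
    unfolding q_def bound_def I inv[OF pos] by simp
  also have "\<dots> < 1"
  proof -
    have "0 < (m * p / (2 * (p - 1))) powr ((p - 1) / p)" using N_less N_pos by linarith
    from divide_less_eq_1_pos[OF this] show ?thesis using N_less by blast
  qed
  finally show ?thesis .
qed

text \<open>Since I(\<kappa>) = I(m) m / \<kappa>, the decay has the exponent (p - 1) / p, which is
  at least 1/2 by p \<ge> 2; and m / \<kappa> \<le> 1.\<close>

lemma bound_decay:
  assumes "m \<le> \<kappa>"
  shows "bound \<kappa> \<le> q * (m / \<kappa>) powr (1/2)"
proof -
  have "I \<kappa> = I m * (m / \<kappa>)" using m by (simp add: I_def)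
  then have "I \<kappa> powr ((p - 1) / p) = I m powr ((p - 1) / p) * (m / \<kappa>) powr ((p - 1) / p)"
    using m assms I_pos[OF m] by (subst powr_mult[symmetric]) auto
  then have "bound \<kappa> = q * (m / \<kappa>) powr ((p - 1) / p)"
    by (simp only: bound_def q_def mult.assoc)
  also have "\<dots> \<le> q * (m / \<kappa>) powr (1/2)"
  proof (rule mult_left_mono)
    show "(m / \<kappa>) powr ((p - 1) / p) \<le> (m / \<kappa>) powr (1/2)"
      using m assms p by (intro powr_mono') (auto simp: field_simps)
    show "0 \<le> q" unfolding q_def by (rule bound_nonneg)
  qed
  finally show ?thesis .
qed

lemma norm_VR_le: "norm (VR t) \<le> q"
proof -
  have "(m / kap m t) powr (1/2) \<le> 1 powr (1/2)"
    using m kap_ge[OF m, of t] by (intro powr_mono2) auto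
  then have "q * (m / kap m t) powr (1/2) \<le> q * 1"
    using bound_nonneg by (intro mult_left_mono) (auto simp: q_def)
  then show ?thesis using norm_VR[of t] bound_decay[OF kap_ge[OF m, of t]] by linarith
qed

text \<open>The constant 2 m / min 1 m comes from min 1 m (1 + |t|) \<le> m + |t| \<le> 2
  \<kappa>.\<close>

lemma norm_VR_decay: "norm (VR t) \<le> q * (2 * m / min 1 m) powr (1/2) * (1 + \<bar>t\<bar>) powr (-1/2)"
proof -
  have c: "0 < min 1 m" using m by simp
  have "min 1 m * (1 + \<bar>t\<bar>) \<le> 2 * kap m t"
  proof -
    have "min 1 m * (1 + \<bar>t\<bar>) \<le> m + \<bar>t\<bar>"
    proof -
      have "min 1 m * \<bar>t\<bar> \<le> 1 * \<bar>t\<bar>" by (rule mult_right_mono) auto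
      moreover have "min 1 m \<le> m" by simp
      ultimately show ?thesis unfolding distrib_left mult_1_right by linarith
    qed
    moreover have "m \<le> kap m t" by (rule kap_ge[OF m])
    moreover have "\<bar>t\<bar> \<le> kap m t" unfolding kap_def by (rule real_le_rsqrt) simp
    ultimately show ?thesis by linarith
  qed
  moreover have "0 < min 1 m * (1 + \<bar>t\<bar>)" using c by (intro mult_pos_pos) auto
  ultimately have "2 * m / (2 * kap m t) \<le> 2 * m / (min 1 m * (1 + \<bar>t\<bar>))"
    using m kap_pos[OF m, of t] by (intro divide_left_mono mult_pos_pos) auto
  then have "m / kap m t \<le> 2 * m / min 1 m / (1 + \<bar>t\<bar>)" by simp
  then have "(m / kap m t) powr (1/2) \<le> (2 * m / min 1 m / (1 + \<bar>t\<bar>)) powr (1/2)"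
    using m kap_pos[OF m, of t] by (intro powr_mono2) auto
  also have "\<dots> = (2 * m / min 1 m) powr (1/2) * (1 + \<bar>t\<bar>) powr (-1/2)"
    using m c powr_mult[of "min 1 m" "1 + \<bar>t\<bar>" "1/2"] by (simp add: powr_divide powr_minus_divide)
  finally have "q * (m / kap m t) powr (1/2) \<le> q * ((2 * m / min 1 m) powr (1/2) * (1 + \<bar>t\<bar>) powr (-1/2))"
    using bound_nonneg by (intro mult_left_mono) (auto simp: q_def)
  then show ?thesis using norm_VR[of t] bound_decay[OF kap_ge[OF m, of t]] by (simp add: mult.assoc)
qed

lemma axis_perturbation_VR:
  assumes "free_resolvent m 0 * B = free.L" "B * free_resolvent m 0 = free.L"
  shows "axis_perturbation (free_resolvent m 0) (free_resolvent m) (4 / min 1 m) B (VR 0) q (q * (2 * m / min 1 m) powr (1/2))"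
proof
  show "free_resolvent m 0 * B = free.L" "B * free_resolvent m 0 = free.L" by (rule assms)+
  show "Y = 0" if "Y * free_resolvent m 0 = 0" for Y by (rule free.right_inj[OF that])
  show "q < 1" by (rule q_less)
  show "norm (VR 0 + (\<i> * t) *\<^sub>C (VR 0 * free_resolvent m t)) \<le> q" for t :: real
    unfolding VR_resolvent by (rule norm_VR_le)
  show "norm (VR 0 + (\<i> * t) *\<^sub>C (VR 0 * free_resolvent m t)) \<le> q * (2 * m / min 1 m) powr (1/2) * (1 + \<bar>t\<bar>) powr (-1/2)" for t :: real
    unfolding VR_resolvent by (rule norm_VR_decay)
qed

text \<open>On u = A_0 g the operator H acts as (1 + V A_0) g. Boundedness of V A_0 places the whole
  domain of H_0 inside that of V, so the sum is defined on all of it.\<close>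

lemma dirac_graph:
  assumes Y: "(1 + VR 0) * Y = 1" "Y * (1 + VR 0) = 1"
  shows "dirac m V = {((free_resolvent m 0 * Y) \<bullet>\<^sub>o f, f) | f. True}"
proof (intro equalityI subsetI)
  fix w assume "w \<in> dirac m V"
  then obtain u g h where w: "w = (u, g + h)" and u: "(u, g) \<in> free_dirac m" and h: "(u, h) \<in> multiplication_operator V"
    unfolding dirac_def operator_sum_def by blast
  have ug: "u = free_resolvent m 0 \<bullet>\<^sub>o g" by (rule free_dirac_unique_zero[OF m u])
  have "AE x in lebesgue. rep_l2 h x = V x *v rep_l2 (free_resolvent m 0 \<bullet>\<^sub>o g) x"
    using h unfolding multiplication_operator_def ug by simp
  from this rep_VR[of 0 g] have "AE x in lebesgue. rep_l2 h x = rep_l2 (VR 0 \<bullet>\<^sub>o g) x"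
    by eventually_elim simp
  then have "h = VR 0 \<bullet>\<^sub>o g" by (rule l2_eqI)
  then have gh: "g + h = (1 + VR 0) \<bullet>\<^sub>o g" by simp
  have "Y \<bullet>\<^sub>o (g + h) = (Y * (1 + VR 0)) \<bullet>\<^sub>o g" unfolding gh by (simp only: cop_apply_mult)
  then have "g = Y \<bullet>\<^sub>o (g + h)" unfolding Y by simp
  then have "u = (free_resolvent m 0 * Y) \<bullet>\<^sub>o (g + h)" using ug by simp
  then show "w \<in> {((free_resolvent m 0 * Y) \<bullet>\<^sub>o f, f) | f. True}" unfolding w by blast
next
  fix w assume "w \<in> {((free_resolvent m 0 * Y) \<bullet>\<^sub>o f, f) | f. True}"
  then obtain f where w: "w = ((free_resolvent m 0 * Y) \<bullet>\<^sub>o f, f)" by blast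
  define g where "g = Y \<bullet>\<^sub>o f"
  have "f = ((1 + VR 0) * Y) \<bullet>\<^sub>o f" unfolding Y by simp
  then have f: "f = g + VR 0 \<bullet>\<^sub>o g" by (simp add: g_def)
  have "(free_resolvent m 0 \<bullet>\<^sub>o g, VR 0 \<bullet>\<^sub>o g) \<in> multiplication_operator V"
    unfolding multiplication_operator_def using rep_VR[of 0 g] by simp
  with free_resolvent_zero[OF m, of g]
  have "(free_resolvent m 0 \<bullet>\<^sub>o g, g + VR 0 \<bullet>\<^sub>o g) \<in> dirac m V"
    unfolding dirac_def operator_sum_def by blast
  then show "w \<in> dirac m V" unfolding w f[symmetric] by (simp add: g_def)
qed

end

theorem theorem4p8:
  fixes m p :: real and V :: "real \<Rightarrow> complex ^ 2 ^ 2"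
  assumes "m > 0" and "p \<ge> 2"
    and "\<And>i j. Lp_function p (\<lambda>x. V x $ i $ j)"
    and "Lp_matrix_norm p V < (m * p / (2 * (p - 1))) powr ((p - 1) / p)"
  shows "\<exists>(S :: (complex ^ 2) l2 \<Rightarrow> (complex ^ 2) l2)
            (H_plus :: (complex l2 \<times> complex l2) set)
            (H_minus :: (complex l2 \<times> complex l2) set).
           bounded_clinear S \<and> boundedly_invertible S \<and>
           linear_operator H_plus \<and> linear_operator H_minus \<and>
           operator_conj S (dirac m V) = block_diag H_plus H_minus \<and>
           spectrum H_plus = spectrum (dirac m V) \<inter> {z. Re z > 0} \<and>
           spectrum H_minus = spectrum (dirac m V) \<inter> {z. Re z < 0}"
proof -
  \<comment> \<open>The strict hypothesis leaves room for a positive \<open>N\<close>.\<close>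
  obtain N where N: "Lp_matrix_norm p V < N" "N < (m * p / (2 * (p - 1))) powr ((p - 1) / p)"
    using dense[OF assms(4)] by blast
  interpret Lp_potential m p N V
    by unfold_locales (rule assms N)+
  let ?A0 = "free_resolvent m 0"
  obtain B where B: "?A0 * B = free.L" "B * ?A0 = free.L" by (rule free.sign_exists)
  interpret P: axis_perturbation ?A0 "free_resolvent m" "4 / min 1 m" B "VR 0" q "q * (2 * m / min 1 m) powr (1/2)"
    by (rule axis_perturbation_VR[OF B])
  obtain S1 where S1: "invertible_element S1" "S1 * P.Bp 1 = B * S1" by (rule P.perturbed_similar)
  obtain S2 where S2: "invertible_element S2" "S2 * B = matop \<sigma>\<^sub>3 * S2"
    using free.sign_similar[OF B sigma3_square m free_resolvent_anticommutator[OF m]] by blast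
  \<comment> \<open>\<open>S1\<close> carries the sign of H to that of H_0, and \<open>S2\<close>
    carries the latter to \<open>\<sigma>\<^sub>3\<close>.\<close>
  define S where "S = S2 * S1"
  obtain S' where S': "S * S' = 1" "S' * S = 1"
    using invertible_element_mult[OF S2(1) S1(1)] unfolding S_def invertible_element_def by blast
  have SB: "S * P.Bp 1 = matop \<sigma>\<^sub>3 * S"
    unfolding S_def mult.assoc S1(2) unfolding mult.assoc[symmetric] S2(2) ..
  have one: "1 \<in> {0..1 :: real}" by simp
  have "P.Wt 0 = VR 0" by (simp add: P.Wt_def)
  then have Y: "(1 + VR 0) * P.Y 1 0 = 1" "P.Y 1 0 * (1 + VR 0) = 1"
    using P.Y(1,2)[OF one, of 0] by simp_all
  \<comment> \<open>At \<tau> = 1 the abstract perturbed inverse is the inverse of H itself.\<close>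
  have graph: "dirac m V = graph_inv (P.Ap 1)"
    unfolding dirac_graph[OF Y] graph_inv_def P.Ap_def ..
  have vec_inj: "f = 0" if "P.Ap 1 \<bullet>\<^sub>o f = 0" for f
  proof -
    have "?A0 \<bullet>\<^sub>o (P.Y 1 0 \<bullet>\<^sub>o f) = 0" using that by (simp add: P.Ap_def)
    then have "P.Y 1 0 \<bullet>\<^sub>o f = 0" by (rule free_resolvent_vec_inj[OF m])
    then have "((1 + VR 0) * P.Y 1 0) \<bullet>\<^sub>o f = 0" by (simp add: cop_zero)
    then show ?thesis unfolding Y by simp
  qed
  have "bounded_clinear ((\<bullet>\<^sub>o) S)" "boundedly_invertible ((\<bullet>\<^sub>o) S)"
    unfolding boundedly_invertible_def cop_inverse(2)[OF S'] using cop_inverse(1)[OF S'] by (simp_all add: bounded_clinear_cop)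
  then show ?thesis
    using block_diagonalization[OF P.axis_resolvent_perturbed[OF one] P.Bp[OF one] S' SB vec_inj]
    unfolding graph by blast
qed

end
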